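(* Let $N\ge 3$, $\Omega=\{x\in\mathbb{R}^N : 1<|x|<3\}$, $\Psi_\alpha(x)=\big||x|-2\big|^\alpha$, and for $p>2$, $u\in H^1_0(\Omega)\setminus\{0\}$, $$R_{\alpha,p}(u)=\frac{\int_\Omega|\nabla u|^2\,dx}{\left(\int_\Omega \Psi_\alpha |u|^p\,dx\right)^{2/p}}.$$ Let $\alpha>0$. Then for all $p<2^*=2N/(N-2)$ sufficiently close to $2^*$, the functional $R_{\alpha,p}$ has at least two non-radial local minima in $H^1_0(\Omega)\setminus\{0\}$. *)

theory Defs
  imports "HOL-Analysis.Analysis"
begin

coinductive smooth_fun :: "('a::euclidean_space \<Rightarrow> real) \<Rightarrow> bool" where
  "(\<forall>x. f differentiable (at x)) \<Longrightarrow>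
   (\<forall>b\<in>Basis. smooth_fun (\<lambda>x. frechet_derivative f (at x) b)) \<Longrightarrow> smooth_fun f"

definition test_funs :: "'a::euclidean_space set \<Rightarrow> ('a \<Rightarrow> real) set" where
  "test_funs U = {\<phi>. smooth_fun \<phi> \<and> compact (closure {x. \<phi> x \<noteq> 0})
                      \<and> closure {x. \<phi> x \<noteq> 0} \<subseteq> U}"

definition cgrad :: "('a::euclidean_space \<Rightarrow> real) \<Rightarrow> 'a \<Rightarrow> 'a" where
  "cgrad \<phi> x = (\<Sum>b\<in>Basis. frechet_derivative \<phi> (at x) b *\<^sub>R b)"

definition L2_on :: "'a::euclidean_space set \<Rightarrow> ('a \<Rightarrow> real) \<Rightarrow> bool" where
  "L2_on U u \<longleftrightarrow> u \<in> borel_measurable lebesgue \<and> set_integrable lebesgue U (\<lambda>x. (u x)\<^sup>2)"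

definition is_weak_grad :: "'a::euclidean_space set \<Rightarrow> ('a \<Rightarrow> real) \<Rightarrow> ('a \<Rightarrow> 'a) \<Rightarrow> bool" where
  "is_weak_grad U u g \<longleftrightarrow>
     L2_on U u \<and> g \<in> borel_measurable lebesgue \<and>
     set_integrable lebesgue U (\<lambda>x. (norm (g x))\<^sup>2) \<and>
     (\<forall>\<phi>\<in>test_funs U. \<forall>b\<in>Basis.
        (LINT x:U|lebesgue. u x * frechet_derivative \<phi> (at x) b)
        = - (LINT x:U|lebesgue. (g x \<bullet> b) * \<phi> x))"

definition H10 :: "'a::euclidean_space set \<Rightarrow> ('a \<Rightarrow> real) set" where
  "H10 U = {u. \<exists>g. is_weak_grad U u g \<and>
      (\<exists>\<phi>::nat \<Rightarrow> 'a \<Rightarrow> real. (\<forall>k. \<phi> k \<in> test_funs U) \<and>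
         ((\<lambda>k. (LINT x:U|lebesgue. (\<phi> k x - u x)\<^sup>2)
              + (LINT x:U|lebesgue. (norm (cgrad (\<phi> k) x - g x))\<^sup>2)) \<longlonglongrightarrow> 0))}"

text \<open>The (a.e. unique) weak gradient.\<close>
definition wgrad :: "'a::euclidean_space set \<Rightarrow> ('a \<Rightarrow> real) \<Rightarrow> 'a \<Rightarrow> 'a" where
  "wgrad U u = (SOME g. is_weak_grad U u g)"

definition H1norm :: "'a::euclidean_space set \<Rightarrow> ('a \<Rightarrow> real) \<Rightarrow> real" where
  "H1norm U u = sqrt ((LINT x:U|lebesgue. (u x)\<^sup>2) + (LINT x:U|lebesgue. (norm (wgrad U u x))\<^sup>2))"

text \<open>u is the zero element of H^1_0(U), i.e. vanishes a.e. on U.\<close>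
definition ae_zero_on :: "'a::euclidean_space set \<Rightarrow> ('a \<Rightarrow> real) \<Rightarrow> bool" where
  "ae_zero_on U u \<longleftrightarrow> (AE x in lebesgue. x \<in> U \<longrightarrow> u x = 0)"

definition annulus :: "'a::euclidean_space set" where
  "annulus = {x. 1 < norm x \<and> norm x < 3}"

definition Psi :: "real \<Rightarrow> 'a::euclidean_space \<Rightarrow> real" where
  "Psi \<alpha> x = \<bar>norm x - 2\<bar> powr \<alpha>"

definition R :: "real \<Rightarrow> real \<Rightarrow> ('a::euclidean_space \<Rightarrow> real) \<Rightarrow> real" where
  "R \<alpha> p u = (LINT x:annulus|lebesgue. (norm (wgrad annulus u x))\<^sup>2)
             / (LINT x:annulus|lebesgue. Psi \<alpha> x * \<bar>u x\<bar> powr p) powr (2 / p)"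

definition is_local_min_R :: "real \<Rightarrow> real \<Rightarrow> ('a::euclidean_space \<Rightarrow> real) \<Rightarrow> bool" where
  "is_local_min_R \<alpha> p u \<longleftrightarrow> u \<in> H10 annulus \<and> \<not> ae_zero_on annulus u \<and>
     (\<exists>\<epsilon>>0. \<forall>v. v \<in> H10 annulus \<and> \<not> ae_zero_on annulus v \<and>
          H1norm annulus (\<lambda>x. v x - u x) < \<epsilon> \<longrightarrow> R \<alpha> p u \<le> R \<alpha> p v)"

text \<open>Radial (as an element of L^2(U)): a.e. equal on U to a function of |x|.\<close>
definition radial_on :: "'a::euclidean_space set \<Rightarrow> ('a \<Rightarrow> real) \<Rightarrow> bool" where
  "radial_on U u \<longleftrightarrow> (\<exists>f::real \<Rightarrow> real. AE x in lebesgue. x \<in> U \<longrightarrow> u x = f (norm x))"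

end

theory Submission
  imports Defs "HOL-Library.Diagonal_Subsequence"
begin

text \<open>
  The weight is 1 on the boundary spheres and smaller than 1 inside, so the infimum of the quotient
  tends to the Sobolev constant S as p tends to the critical exponent, and functions of almost
  minimal quotient have small L2 norm. For such a function a smooth partition of unity costs almost
  no Dirichlet energy, and since t^(2/p) is strictly subadditive, almost all of the mass must lie in
  one of any two separated regions. Hence an almost minimal function is neither even (in particular
  not radial) nor has it comparable masses near both boundary spheres. Almost optimal Sobolev functions
  rescaled to a point of either sphere are admissible competitors, so minimising over the functions
  with most of their mass in the inner (outer) half of the annulus gives a minimum in the interior
  of that class, which is a local minimum. Compactness of minimising sequences for subcritical p is
  Rellich's theorem together with the parallelogram law; the Sobolev inequality itself is proved by
  truncation and ball averages.
\<close>

section \<open>Smooth functions\<close>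

text \<open>Write \<open>q\<close> for the critical exponent. The class "more than half of the mass
  on one side" is open, so neither limits nor midpoints of a minimising sequence need stay in it.
  The gap cures this: near-minimal normalised functions have less than 1/4 or more than 3/4 of their
  mass inside, so a minimising sequence sits above 3/4, and the remaining quarter absorbs limits,
  midpoints and small perturbations. Strict subadditivity must be uniform as \<open>p\<close> tends
  to \<open>q\<close>; hence \<open>p\<close> is kept above \<open>p1\<close>, midway between 2 and
  \<open>q\<close>, so that \<open>2/p\<close> stays away from 1. Evenness needs more than a
  partition: where the two cutoffs are equal, each carries the fraction \<open>2 powr (-p/2)\<close>
  of the mass, and two such pieces together have exactly the original value of
  \<open>t powr (2/p)\<close>. The gain comes from a fraction at least 1/N of the mass lying where
  one cutoff is 1. All inequalities are proved for test functions and reach \<open>H10\<close>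
  through approximating sequences. The two minima are told apart by the ratio of inner to outer
  mass, which orthogonal maps and scalar multiples preserve.\<close>

abbreviation pd :: "'a::euclidean_space \<Rightarrow> ('a \<Rightarrow> real) \<Rightarrow> 'a \<Rightarrow> real" where
  "pd b f x \<equiv> frechet_derivative f (at x) b"

text \<open>Finite stages of the coinductive \<open>smooth_fun\<close>: closure under sums, products
  and compositions can be proved by induction on the order, and smoothness is recovered as
  membership in all stages.\<close>

primrec Ck :: "nat \<Rightarrow> ('a::euclidean_space \<Rightarrow> real) \<Rightarrow> bool" where
  "Ck 0 f = True"
| "Ck (Suc n) f = ((\<forall>x. f differentiable (at x)) \<and> (\<forall>b\<in>Basis. Ck n (\<lambda>x. pd b f x)))"

lemma smooth_fun_differentiable: "smooth_fun f \<Longrightarrow> f differentiable (at x)"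
  by (auto elim: smooth_fun.cases)

lemma smooth_fun_pd: "smooth_fun f \<Longrightarrow> b \<in> Basis \<Longrightarrow> smooth_fun (\<lambda>x. pd b f x)"
  by (auto elim: smooth_fun.cases)

lemma smooth_fun_imp_Ck: "smooth_fun f \<Longrightarrow> Ck n f"
  by (induction n arbitrary: f) (auto intro: smooth_fun_differentiable smooth_fun_pd)

lemma Ck_imp_smooth_fun:
  assumes "\<forall>n. Ck n f" shows "smooth_fun f"
  using assms
proof (coinduction arbitrary: f)
  case (smooth_fun f)
  have "\<forall>x. f differentiable (at x)" using spec[OF smooth_fun, of "Suc 0"] by simp
  moreover have "Ck n (\<lambda>x. pd b f x)" if "b \<in> Basis" for b n
    using spec[OF smooth_fun, of "Suc n"] that by simp
  ultimately show ?case by auto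
qed

lemma smooth_fun_iff_Ck: "smooth_fun f \<longleftrightarrow> (\<forall>n. Ck n f)"
  using smooth_fun_imp_Ck Ck_imp_smooth_fun by blast

lemma Ck_SucD: "Ck (Suc n) f \<Longrightarrow> Ck n f"
  by (induction n arbitrary: f) auto

lemma pd_eqI: "(f has_derivative f') (at x) \<Longrightarrow> pd b f x = f' b"
  using frechet_derivative_at by fastforce

lemma pd_const: "pd b (\<lambda>x. c) x = 0"
  by (rule pd_eqI[where f'="\<lambda>_. 0"]) (auto intro!: derivative_eq_intros)

lemma pd_add:
  "f differentiable (at x) \<Longrightarrow> g differentiable (at x) \<Longrightarrow> pd b (\<lambda>x. f x + g x) x = pd b f x + pd b g x"
  by (rule pd_eqI[where f'="\<lambda>b. pd b f x + pd b g x"])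
     (auto simp: frechet_derivative_works intro!: has_derivative_add)

lemma pd_mult:
  "f differentiable (at x) \<Longrightarrow> g differentiable (at x) \<Longrightarrow>
    pd b (\<lambda>x. f x * g x) x = f x * pd b g x + pd b f x * g x"
  by (rule pd_eqI[where f'="\<lambda>b. f x * pd b g x + pd b f x * g x"])
     (auto simp: frechet_derivative_works intro!: has_derivative_mult)

lemma pd_cmult:
  "f differentiable (at x) \<Longrightarrow> pd b (\<lambda>x. c * f x) x = c * pd b f x"
  by (subst pd_mult) (auto simp: pd_const)

lemma pd_comp_real:
  fixes f :: "'a::euclidean_space \<Rightarrow> real"
  assumes "f differentiable (at x)" "(h has_real_derivative h') (at (f x))"
  shows "pd b (\<lambda>x. h (f x)) x = h' * pd b f x" "(\<lambda>x. h (f x)) differentiable (at x)"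
proof -
  have "((\<lambda>x. h (f x)) has_derivative (\<lambda>b. h' * pd b f x)) (at x)"
    using assms has_derivative_compose[of f "\<lambda>b. pd b f x" x UNIV h "(*) h'"]
    by (auto simp: frechet_derivative_works has_field_derivative_def)
  then show "pd b (\<lambda>x. h (f x)) x = h' * pd b f x" "(\<lambda>x. h (f x)) differentiable (at x)"
    by (auto intro: pd_eqI differentiableI)
qed

lemma pd_affine:
  fixes f :: "'a::euclidean_space \<Rightarrow> real"
  assumes "\<forall>x. f differentiable (at x)"
  shows "pd b (\<lambda>x. f (v + c *\<^sub>R x)) x = c * pd b f (v + c *\<^sub>R x)" "(\<lambda>x. f (v + c *\<^sub>R x)) differentiable (at x)"
proof -
  have lin: "linear (\<lambda>b. pd b f y)" for y
    using assms frechet_derivative_works has_derivative_linear by blast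
  have "((\<lambda>x. f (v + c *\<^sub>R x)) has_derivative (\<lambda>b. pd (c *\<^sub>R b) f (v + c *\<^sub>R x))) (at x)"
    by (rule has_derivative_compose[of "\<lambda>x. v + c *\<^sub>R x" "\<lambda>b. c *\<^sub>R b" x UNIV f "\<lambda>b. pd b f (v + c *\<^sub>R x)"])
       (use assms in \<open>auto simp: frechet_derivative_works intro!: derivative_eq_intros\<close>)
  then show "pd b (\<lambda>x. f (v + c *\<^sub>R x)) x = c * pd b f (v + c *\<^sub>R x)" "(\<lambda>x. f (v + c *\<^sub>R x)) differentiable (at x)"
    using linear_scale[OF lin] by (auto simp: intro: pd_eqI differentiableI)
qed

lemma Ck_const: "Ck n (\<lambda>x. c)"
  by (induction n arbitrary: c) (auto simp: pd_const)

lemma Ck_add: "Ck n f \<Longrightarrow> Ck n g \<Longrightarrow> Ck n (\<lambda>x. f x + g x)"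
  by (induction n arbitrary: f g) (auto simp: pd_add)

lemma Ck_mult: "Ck n f \<Longrightarrow> Ck n g \<Longrightarrow> Ck n (\<lambda>x. f x * g x)"
proof (induction n arbitrary: f g)
  case (Suc n)
  \<comment> \<open>The product rule keeps each factor undifferentiated once, so the induction
    hypothesis also needs the factors themselves at order \<open>n\<close>.\<close>
  have "Ck n f" "Ck n g" using Suc.prems Ck_SucD by blast+
  then show ?case using Suc by (auto simp: pd_mult intro!: Ck_add)
qed simp

lemma Ck_affine:
  fixes f :: "'a::euclidean_space \<Rightarrow> real"
  shows "Ck n f \<Longrightarrow> Ck n (\<lambda>x. f (v + c *\<^sub>R x))"
proof (induction n arbitrary: f)
  case (Suc n)
  show ?case using Suc by (auto simp: pd_affine intro!: Ck_mult Ck_const)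
qed simp

text \<open>The witness is the whole chain of iterated derivatives, which suits functions whose
  derivatives are known in closed form: phase shifts for sine and cosine, the family
  \<open>flat\<close> for exp(-1/t).\<close>

definition smooth1 :: "(real \<Rightarrow> real) \<Rightarrow> bool" where
  "smooth1 h \<longleftrightarrow> (\<exists>H. H 0 = h \<and> (\<forall>n x. (H n has_real_derivative H (Suc n) x) (at x)))"

lemma smooth1_deriv:
  assumes "smooth1 h"
  obtains h' where "smooth1 h'" "\<And>x. (h has_real_derivative h' x) (at x)"
proof -
  obtain H where H: "H 0 = h" "\<forall>n x. (H n has_real_derivative H (Suc n) x) (at x)"
    using assms unfolding smooth1_def by blast
  have "smooth1 (H 1)"
    unfolding smooth1_def by (rule exI[of _ "\<lambda>n. H (Suc n)"]) (use H in auto)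
  then show thesis using H that[of "H 1"] by auto
qed

lemma smooth1_antideriv:
  assumes "smooth1 h'" "\<And>x. (h has_real_derivative h' x) (at x)"
  shows "smooth1 h"
proof -
  obtain H where H: "H 0 = h'" "\<forall>n x. (H n has_real_derivative H (Suc n) x) (at x)"
    using assms unfolding smooth1_def by blast
  show ?thesis unfolding smooth1_def
  proof (intro exI[of _ "\<lambda>n. case n of 0 \<Rightarrow> h | Suc m \<Rightarrow> H m"] conjI allI)
    fix n x show "((case n of 0 \<Rightarrow> h | Suc m \<Rightarrow> H m) has_real_derivative (case Suc n of 0 \<Rightarrow> h | Suc m \<Rightarrow> H m) x) (at x)"
      using H assms(2) by (cases n) auto
  qed simp
qed

lemma Ck_comp: "Ck n f \<Longrightarrow> smooth1 h \<Longrightarrow> Ck n (\<lambda>x. h (f x))"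
proof (induction n arbitrary: f h)
  case (Suc n)
  obtain h' where h': "smooth1 h'" "\<And>x. (h has_real_derivative h' x) (at x)"
    using smooth1_deriv Suc.prems by blast
  have "Ck n f" using Suc.prems Ck_SucD by blast
  then show ?case using Suc h' by (auto simp: pd_comp_real[OF _ h'(2)] intro!: Ck_mult)
qed simp

lemma smooth_fun_const: "smooth_fun (\<lambda>x. c)"
  by (simp add: smooth_fun_iff_Ck Ck_const)
lemma smooth_fun_add: "smooth_fun f \<Longrightarrow> smooth_fun g \<Longrightarrow> smooth_fun (\<lambda>x. f x + g x)"
  by (simp add: smooth_fun_iff_Ck Ck_add)
lemma smooth_fun_mult: "smooth_fun f \<Longrightarrow> smooth_fun g \<Longrightarrow> smooth_fun (\<lambda>x. f x * g x)"
  by (simp add: smooth_fun_iff_Ck Ck_mult)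
lemma smooth_fun_affine: "smooth_fun f \<Longrightarrow> smooth_fun (\<lambda>x. f (v + c *\<^sub>R x))"
  by (simp add: smooth_fun_iff_Ck Ck_affine)
lemma smooth_fun_comp: "smooth1 h \<Longrightarrow> smooth_fun f \<Longrightarrow> smooth_fun (\<lambda>x. h (f x))"
  by (simp add: smooth_fun_iff_Ck Ck_comp)
lemma smooth_fun_diff: "smooth_fun f \<Longrightarrow> smooth_fun g \<Longrightarrow> smooth_fun (\<lambda>x. f x - g x)"
  using smooth_fun_add[of f "\<lambda>x. (-1) * g x"] smooth_fun_mult[OF smooth_fun_const, of g "-1"] by simp

lemma smooth_fun_prod:
  "finite A \<Longrightarrow> (\<And>a. a \<in> A \<Longrightarrow> smooth_fun (f a)) \<Longrightarrow> smooth_fun (\<lambda>x. \<Prod>a\<in>A. f a x)"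
  by (induction A rule: finite_induct) (auto intro: smooth_fun_const smooth_fun_mult)

lemma pd_inner: "pd b (\<lambda>x. x \<bullet> v) x = b \<bullet> v"
  by (rule pd_eqI[where f'="\<lambda>b. b \<bullet> v"]) (auto intro!: derivative_eq_intros)

lemma smooth_fun_inner: "smooth_fun (\<lambda>x. x \<bullet> v)"
  by (rule smooth_fun.intros) (auto simp: pd_inner intro: smooth_fun_const)

lemma pd_inner_self: "pd b (\<lambda>x. x \<bullet> x) x = 2 * (x \<bullet> b)"
  by (rule pd_eqI[where f'="\<lambda>b. 2 * (x \<bullet> b)"]) (auto intro!: derivative_eq_intros simp: inner_commute)

lemma smooth_fun_inner_self: "smooth_fun (\<lambda>x::'a::euclidean_space. x \<bullet> x)"
  by (rule smooth_fun.intros) (auto simp: pd_inner_self intro: smooth_fun_const smooth_fun_mult smooth_fun_inner)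

lemma pd_1_has_real_derivative:
  fixes f :: "real \<Rightarrow> real"
  assumes "f differentiable (at x)" shows "(f has_real_derivative pd 1 f x) (at x)"
proof -
  have d: "(f has_derivative (\<lambda>b. pd b f x)) (at x)"
    using assms by (simp add: frechet_derivative_works)
  have "pd b f x = pd 1 f x * b" for b
    using linear_scale[OF has_derivative_linear[OF d], of b 1]
    unfolding real_scaleR_def mult_1_right by (simp only: mult.commute)
  then have "(\<lambda>b. pd b f x) = (*) (pd 1 f x)" by (intro ext)
  then show ?thesis unfolding has_field_derivative_def by (rule has_derivative_eq_rhs[OF d])
qed

lemma smooth_fun_imp_smooth1:
  fixes h :: "real \<Rightarrow> real"
  assumes "smooth_fun h" shows "smooth1 h"
proof -
  define H where "H = (\<lambda>n. ((\<lambda>f x. pd 1 f x) ^^ n) h)"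
  have "smooth_fun (H n)" for n
    by (induction n) (use assms in \<open>auto simp: H_def intro: smooth_fun_pd\<close>)
  then have "(H n has_real_derivative H (Suc n) x) (at x)" for n x
    using pd_1_has_real_derivative[OF smooth_fun_differentiable, of "H n" x] by (simp add: H_def)
  then show ?thesis unfolding smooth1_def by (intro exI[of _ H]) (auto simp: H_def)
qed

text \<open>Differentiation shifts the phase by \<open>pi/2\<close>, so the n-th derivative is the
  shift by n quarter turns.\<close>

lemma smooth1_sin_cos: "smooth1 sin" "smooth1 cos"
proof -
  have 1: "((\<lambda>x. sin (x + real n * (pi/2))) has_real_derivative sin (x + real (Suc n) * (pi/2))) (at x)"
    and 2: "((\<lambda>x. cos (x + real n * (pi/2))) has_real_derivative cos (x + real (Suc n) * (pi/2))) (at x)" for n x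
  proof -
    have "x + real (Suc n) * (pi/2) = (x + real n * (pi/2)) + pi/2" by (simp add: algebra_simps)
    then have e: "sin (x + real (Suc n) * (pi/2)) = cos (x + real n * (pi/2))"
        "cos (x + real (Suc n) * (pi/2)) = - sin (x + real n * (pi/2))"
      by (simp_all only: sin_add cos_add sin_pi_half cos_pi_half) simp_all
    show "((\<lambda>x. sin (x + real n * (pi/2))) has_real_derivative sin (x + real (Suc n) * (pi/2))) (at x)"
      unfolding e by (rule derivative_eq_intros refl)+ simp
    show "((\<lambda>x. cos (x + real n * (pi/2))) has_real_derivative cos (x + real (Suc n) * (pi/2))) (at x)"
      unfolding e by (rule derivative_eq_intros refl)+ simp
  qed
  show "smooth1 sin" unfolding smooth1_def
    by (rule exI[of _ "\<lambda>n x. sin (x + real n * (pi/2))"]) (use 1 in auto)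
  show "smooth1 cos" unfolding smooth1_def
    by (rule exI[of _ "\<lambda>n x. cos (x + real n * (pi/2))"]) (use 2 in auto)
qed

lemma tendsto_poly_times_exp: "((\<lambda>x. poly P x * exp (- x)) \<longlongrightarrow> (0::real)) at_top"
proof -
  have "((\<lambda>x. \<Sum>i\<le>degree P. coeff P i * (x ^ i / exp x)) \<longlongrightarrow> (\<Sum>i\<le>degree P. coeff P i * 0)) at_top"
    by (intro tendsto_intros tendsto_power_div_exp_0)
  then show ?thesis by (simp add: poly_altdef sum_distrib_right sum_distrib_left exp_minus divide_inverse ac_simps)
qed

text \<open>For \<open>P = 1\<close> this is the standard smooth function exp(-1/t) that is flat at
  0; the polynomial factor is carried along because differentiation produces it.\<close>

definition flat :: "real poly \<Rightarrow> real \<Rightarrow> real" where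
  "flat P t = (if t > 0 then poly P (1 / t) * exp (- (1 / t)) else 0)"

text \<open>With x = 1/t, differentiation in \<open>t\<close> is -x^2 times differentiation in
  \<open>x\<close>, which sends P(x) exp(-x) to x^2 (P - P')(x) exp(-x). At 0 both one-sided
  difference quotients tend to 0, the right one because the exponential beats every polynomial in
  1/t.\<close>

lemma flat_deriv: "(flat P has_real_derivative flat ([:0,0,1:] * (P - pderiv P)) t) (at t)"
proof -
  consider "t > 0" | "t < 0" | "t = 0" by linarith
  then show ?thesis
  proof cases
    case 1
    have "((\<lambda>t. poly P (1 / t) * exp (- (1 / t))) has_real_derivative
       flat ([:0,0,1:] * (P - pderiv P)) t) (at t)"
      using 1 by (auto intro!: derivative_eq_intros simp: flat_def field_simps power2_eq_square)
    then show ?thesis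
      by (rule has_field_derivative_transform_within_open[where S="{0<..}"]) (use 1 in \<open>auto simp: flat_def\<close>)
  next
    case 2
    have "((\<lambda>t::real. 0::real) has_real_derivative flat ([:0,0,1:] * (P - pderiv P)) t) (at t)"
      using 2 by (auto simp: flat_def)
    then show ?thesis
      by (rule has_field_derivative_transform_within_open[where S="{..<0}"]) (use 2 in \<open>auto simp: flat_def\<close>)
  next
    case 3
    have "((\<lambda>h. poly ([:0,1:] * P) (inverse h) * exp (- inverse h)) \<longlongrightarrow> 0) (at_right (0::real))"
      by (rule filterlim_compose[OF tendsto_poly_times_exp filterlim_inverse_at_top_right])
    then have r: "((\<lambda>h. (flat P (0 + h) - flat P 0) / h) \<longlongrightarrow> 0) (at_right (0::real))"
      by (rule Lim_transform_eventually)
         (auto simp: eventually_at_right_less flat_def field_simps intro!: eventually_mono[OF eventually_at_right_less])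
    have l: "((\<lambda>h. (flat P (0 + h) - flat P 0) / h) \<longlongrightarrow> 0) (at_left (0::real))"
      by (rule Lim_transform_eventually[of "\<lambda>_. 0"]) (auto simp: flat_def eventually_at_left_field intro!: exI[of _ "-1"])
    show ?thesis using 3 r l by (auto simp: DERIV_def filterlim_split_at_real flat_def)
  qed
qed

lemma smooth1_flat: "smooth1 (flat P)"
proof -
  define Q where "Q = (\<lambda>n. ((\<lambda>P. [:0,0,1:] * (P - pderiv P)) ^^ n) P)"
  show ?thesis unfolding smooth1_def
    by (intro exI[of _ "\<lambda>n. flat (Q n)"]) (use flat_deriv in \<open>auto simp: Q_def\<close>)
qed

lemma flat_pos: "t > 0 \<Longrightarrow> flat 1 t > 0" and flat_zero: "t \<le> 0 \<Longrightarrow> flat 1 t = 0"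
  and flat_nonneg: "flat 1 t \<ge> 0" and flat_le_1: "flat 1 t \<le> 1"
  by (auto simp: flat_def)

lemma smooth1_imp_smooth_fun: "smooth1 h \<Longrightarrow> smooth_fun h"
  using smooth_fun_comp[OF _ smooth_fun_inner[of "1::real"], of h] by simp

lemma smooth1_mult: "smooth1 f \<Longrightarrow> smooth1 g \<Longrightarrow> smooth1 (\<lambda>x. f x * g x)"
  by (rule smooth_fun_imp_smooth1, rule smooth_fun_mult) (simp_all add: smooth1_imp_smooth_fun)

lemma smooth1_continuous: "smooth1 h \<Longrightarrow> continuous_on A h"
  by (erule smooth1_deriv, rule continuous_at_imp_continuous_on) (blast intro: DERIV_isCont)

lemma smooth1_affine: "smooth1 f \<Longrightarrow> smooth1 (\<lambda>x. f (v + c * x))"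
  using smooth_fun_imp_smooth1[OF smooth_fun_affine[OF smooth1_imp_smooth_fun, of f v c]] by simp

text \<open>The normalised antiderivative of an even bump function supported in \<open>[-1, 1]\<close>.\<close>

lemma smooth_step:
  obtains \<sigma> where "smooth1 \<sigma>" "\<And>t. t \<le> -1 \<Longrightarrow> \<sigma> t = (0::real)" "\<And>t. t \<ge> 1 \<Longrightarrow> \<sigma> t = 1"
    "\<And>t. 0 \<le> \<sigma> t" "\<And>t. \<sigma> t \<le> 1" "\<And>t. \<sigma> (- t) = 1 - \<sigma> t"
proof -
  define \<beta> where "\<beta> = (\<lambda>t. flat 1 (1 + 1 * t) * flat 1 (1 + (-1) * t))"
  have sb: "smooth1 \<beta>" unfolding \<beta>_def by (intro smooth1_mult smooth1_affine smooth1_flat)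
  have cb: "continuous_on A \<beta>" for A using smooth1_continuous sb by blast
  have b0: "\<beta> t \<ge> 0" for t by (auto simp: \<beta>_def flat_nonneg)
  have even: "\<beta> (-t) = \<beta> t" for t by (simp add: \<beta>_def)
  have out: "\<beta> t = 0" if "\<bar>t\<bar> \<ge> 1" for t using that by (auto simp: \<beta>_def flat_zero abs_if split: if_splits)
  define B where "B = (\<lambda>t. integral {-2..t} \<beta> - 0)"
  have dB0: "((\<lambda>t. integral {-c..t} \<beta>) has_real_derivative \<beta> t) (at t)" if "t > -c" for t c
  proof -
    have "((\<lambda>t. integral {-c..t} \<beta>) has_real_derivative \<beta> t) (at t within {-c..t+1})"
      by (rule integral_has_real_derivative) (use that cb in auto)
    then show ?thesis using at_within_interior[of t "{-c..t+1}"] that by (simp add: interior_atLeastAtMost_real)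
  qed
  have lowB: "integral {-c..t} \<beta> = 0" if "t \<le> -1" for t c
  proof -
    have "integral {-c..t} \<beta> = integral {-c..t} (\<lambda>_. 0)"
      by (rule integral_cong) (use that out in auto)
    then show ?thesis by simp
  qed
  have dB: "(B has_real_derivative \<beta> t) (at t)" for t
  proof (cases "t > -2")
    case True then show ?thesis using dB0[of 2 t] by (simp add: B_def)
  next
    case False
    have "((\<lambda>_. 0::real) has_real_derivative \<beta> t) (at t)" using out[of t] False by auto
    then show ?thesis
      by (rule has_field_derivative_transform_within_open[where S="{..< -1}"]) (use False in \<open>auto simp: B_def lowB\<close>)
  qed
  have sB: "smooth1 B" by (rule smooth1_antideriv[OF sb dB])
  have monoB: "B s \<le> B t" if "s \<le> t" for s t
    by (rule DERIV_nonneg_imp_nondecreasing[OF that]) (use dB b0 in auto)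
  have lo: "B t = 0" if "t \<le> -1" for t using lowB[OF that] by (simp add: B_def)
  \<comment> \<open>\<open>\<beta>\<close> is even, so \<open>B t + B (- t)\<close> has zero
    derivative. This symmetry of the step later lets the reflection x to -x exchange the sine and
    cosine cutoffs.\<close>
  have symc: "B t + B (-t) = B 2" for t
  proof -
    have "((\<lambda>t. B t + B (-t)) has_real_derivative 0) (at s)" for s
      by (rule derivative_eq_intros dB DERIV_chain2[OF dB] refl)+ (simp add: even)
    then have "B t + B (-t) = B 2 + B (-2)"
      using DERIV_isconst_all[of "\<lambda>t. B t + B (-t)" t 2] by blast
    then show ?thesis using lo[of "-2"] by simp
  qed
  have pos: "B 2 > 0"
  proof -
    \<comment> \<open>Equal values would make the monotone \<open>B\<close> constant in between,
      forcing its derivative \<open>\<beta> 0\<close> to vanish, although the bump is positive at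
      0.\<close>
    have "B (1/2) \<noteq> B (-1/2)"
    proof
      assume e: "B (1/2) = B (-1/2)"
      define b0 where "b0 = B 0"
      have c: "B s = b0" if "\<bar>s\<bar> < 1/2" for s
      proof -
        have "s \<le> 1/2" "-1/2 \<le> s" using that by linarith+
        then show ?thesis
          using monoB[of s "1/2"] monoB[of "-1/2" s] monoB[of 0 "1/2"] monoB[of "-1/2" 0] e by (auto simp: b0_def)
      qed
      have "((\<lambda>s. b0) has_real_derivative \<beta> 0) (at 0)"
        by (rule has_field_derivative_transform_within_open[OF dB, where S="ball 0 (1/2)"]) (use c in auto)
      then have "\<beta> 0 = 0" using DERIV_unique[OF _ DERIV_const] by blast
      then show False by (auto simp: \<beta>_def flat_def)
    qed
    then show ?thesis using monoB[of "-1/2" "1/2"] monoB[of "-2" "-1/2"] monoB[of "1/2" 2] lo[of "-2"] by auto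
  qed
  have hi: "B t = B 2" if "t \<ge> 1" for t using symc[of t] lo[of "-t"] that by simp
  define \<sigma> where "\<sigma> = (\<lambda>t. (1 / B 2) * B t)"
  have "smooth1 (\<lambda>_. c)" for c::real by (rule smooth_fun_imp_smooth1[OF smooth_fun_const])
  then have "smooth1 \<sigma>" unfolding \<sigma>_def by (intro smooth1_mult sB)
  moreover have "\<sigma> t \<ge> 0" for t using monoB[of "min t (-2)" t] lo[of "min t (-2)"] pos by (auto simp: \<sigma>_def)
  moreover have "\<sigma> (-t) = 1 - \<sigma> t" for t using symc[of t] pos by (auto simp: \<sigma>_def field_simps)
  moreover have "\<sigma> t \<le> 1" for t using calculation(2)[of "-t"] calculation(3)[of t] by linarith
  moreover have "\<sigma> t = 0" if "t \<le> -1" for t using lo[OF that] by (simp add: \<sigma>_def)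
  moreover have "\<sigma> t = 1" if "t \<ge> 1" for t using hi[OF that] pos by (simp add: \<sigma>_def)
  ultimately show thesis by (intro that[of \<sigma>])
qed

section \<open>Test functions\<close>

lemma test_fun_smooth: "\<phi> \<in> test_funs U \<Longrightarrow> smooth_fun \<phi>"
  and test_fun_differentiable: "\<phi> \<in> test_funs U \<Longrightarrow> \<phi> differentiable (at x)"
  by (auto simp: test_funs_def intro: smooth_fun_differentiable)

lemma test_funs_mono: "U \<subseteq> V \<Longrightarrow> test_funs U \<subseteq> test_funs V"
  by (auto simp: test_funs_def)

lemma test_fun_UNIV: "\<phi> \<in> test_funs U \<Longrightarrow> \<phi> \<in> test_funs UNIV"
  using test_funs_mono by blast

lemma smooth_fun_continuous: "smooth_fun f \<Longrightarrow> continuous_on A f"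
  by (rule continuous_at_imp_continuous_on) (blast intro: differentiable_imp_continuous_within smooth_fun_differentiable)

lemma test_fun_continuous: "\<phi> \<in> test_funs U \<Longrightarrow> continuous_on A \<phi>"
  by (simp add: smooth_fun_continuous test_fun_smooth)

lemma test_fun_borel: "\<phi> \<in> test_funs U \<Longrightarrow> \<phi> \<in> borel_measurable borel"
  by (rule borel_measurable_continuous_onI) (rule test_fun_continuous)

lemma test_fun_vanishes: "\<phi> \<in> test_funs U \<Longrightarrow> x \<notin> U \<Longrightarrow> \<phi> x = 0"
  using closure_subset[of "{x. \<phi> x \<noteq> 0}"] by (auto simp: test_funs_def)

lemma test_funsI:
  assumes "smooth_fun f" "compact K" "K \<subseteq> U" "\<And>x. x \<notin> K \<Longrightarrow> f x = 0"
  shows "f \<in> test_funs U"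
proof -
  have "closure {x. f x \<noteq> 0} \<subseteq> K"
    by (rule closure_minimal) (use assms in \<open>auto simp: compact_imp_closed\<close>)
  moreover from this have "compact (closure {x. f x \<noteq> 0})"
    using compact_Int_closed[OF assms(2) closed_closure, of "{x. f x \<noteq> 0}"] by (simp only: Int_absorb1)
  ultimately show ?thesis using assms(1,3) unfolding test_funs_def by blast
qed

lemma test_fun_support:
  assumes "\<phi> \<in> test_funs U"
  obtains K where "compact K" "K \<subseteq> U" "\<And>x. x \<notin> K \<Longrightarrow> \<phi> x = 0" "\<And>x b. x \<notin> K \<Longrightarrow> pd b \<phi> x = 0"
proof -
  let ?K = "closure {x. \<phi> x \<noteq> 0}"
  have 1: "pd b \<phi> x = 0" if "x \<notin> ?K" for x b
  proof -
    have "((\<lambda>_. 0) has_derivative (\<lambda>_. 0)) (at x)" by simp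
    then have "(\<phi> has_derivative (\<lambda>_. 0)) (at x)"
      by (rule has_derivative_transform_within_open[of _ _ _ _ "- ?K"])
        (use that closure_subset[of "{x. \<phi> x \<noteq> 0}"] in auto)
    then show ?thesis by (rule pd_eqI)
  qed
  have 2: "\<phi> x = 0" if "x \<notin> ?K" for x using closure_subset[of "{x. \<phi> x \<noteq> 0}"] that by blast
  have 3: "compact ?K" "?K \<subseteq> U" using assms by (simp_all add: test_funs_def)
  show thesis by (rule that[OF 3 2 1])
qed

lemma test_fun_pd: "\<phi> \<in> test_funs U \<Longrightarrow> b \<in> Basis \<Longrightarrow> (\<lambda>x. pd b \<phi> x) \<in> test_funs U"
  by (rule test_fun_support, assumption, rule test_funsI) (auto intro: smooth_fun_pd test_fun_smooth)

lemma test_fun_mult: "smooth_fun g \<Longrightarrow> \<phi> \<in> test_funs U \<Longrightarrow> (\<lambda>x. g x * \<phi> x) \<in> test_funs U"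
  by (rule test_fun_support, assumption, rule test_funsI) (auto intro: smooth_fun_mult test_fun_smooth)

lemma test_fun_cmult: "\<phi> \<in> test_funs U \<Longrightarrow> (\<lambda>x. c * \<phi> x) \<in> test_funs U"
  by (rule test_fun_mult[OF smooth_fun_const])

lemma test_fun_add:
  assumes "\<phi> \<in> test_funs U" "\<psi> \<in> test_funs U" shows "(\<lambda>x. \<phi> x + \<psi> x) \<in> test_funs U"
proof -
  obtain K where K: "compact K" "K \<subseteq> U" "\<And>x. x \<notin> K \<Longrightarrow> \<phi> x = 0" using test_fun_support[OF assms(1)] by metis
  obtain L where L: "compact L" "L \<subseteq> U" "\<And>x. x \<notin> L \<Longrightarrow> \<psi> x = 0" using test_fun_support[OF assms(2)] by metis
  show ?thesis by (rule test_funsI[of _ "K \<union> L"])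
      (use K L assms in \<open>auto simp: smooth_fun_add test_fun_smooth\<close>)
qed

lemma test_fun_diff:
  assumes "\<phi> \<in> test_funs U" "\<psi> \<in> test_funs U" shows "(\<lambda>x. \<phi> x - \<psi> x) \<in> test_funs U"
  using test_fun_add[OF assms(1) test_fun_cmult[OF assms(2), of "-1"]] by simp

lemma test_fun_comp: "smooth1 h \<Longrightarrow> h 0 = 0 \<Longrightarrow> \<phi> \<in> test_funs U \<Longrightarrow> (\<lambda>x. h (\<phi> x)) \<in> test_funs U"
  by (rule test_fun_support, assumption, rule test_funsI) (auto intro: smooth_fun_comp test_fun_smooth)

lemma continuous_compact_support_integrable:
  fixes f :: "'a::euclidean_space \<Rightarrow> real"
  assumes "continuous_on UNIV f" "compact K" "\<And>x. x \<notin> K \<Longrightarrow> f x = 0"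
  shows "integrable lborel f"
proof -
  have "integrable lborel (\<lambda>x. indicator K x *\<^sub>R f x)"
    by (rule borel_integrable_compact) (use assms in \<open>auto intro: continuous_on_subset\<close>)
  moreover have "(\<lambda>x. indicator K x *\<^sub>R f x) = f" using assms(3) by (fastforce simp: indicator_def)
  ultimately show ?thesis by simp
qed

lemma test_fun_bounded:
  assumes "\<phi> \<in> test_funs U" obtains B where "B > 0" "\<And>x. \<bar>\<phi> x\<bar> \<le> B"
proof -
  obtain K where K: "compact K" "\<And>x. x \<notin> K \<Longrightarrow> \<phi> x = 0" using test_fun_support[OF assms] by metis
  have "bounded (\<phi> ` K)" by (intro compact_imp_bounded compact_continuous_image K test_fun_continuous[OF assms])
  then obtain B where B: "B > 0" "\<forall>y\<in>\<phi> ` K. norm y \<le> B" using bounded_pos by blast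
  have "\<bar>\<phi> x\<bar> \<le> B" for x by (cases "x \<in> K") (use B K in auto)
  then show thesis using that B by blast
qed

lemma test_fun_integrable_comp:
  fixes h :: "real \<Rightarrow> real"
  assumes "\<phi> \<in> test_funs U" "continuous_on UNIV h" "h 0 = 0"
  shows "integrable lborel (\<lambda>x. h (\<phi> x))"
proof -
  obtain K where K: "compact K" "\<And>x. x \<notin> K \<Longrightarrow> \<phi> x = 0" using test_fun_support[OF assms(1)] by metis
  have "continuous_on UNIV (\<lambda>x. h (\<phi> x))"
    by (rule continuous_on_compose2[OF assms(2) test_fun_continuous[OF assms(1)]]) simp
  then show ?thesis
    by (rule continuous_compact_support_integrable) (use K(1) K(2) assms(3) in auto)
qed

lemma test_fun_integrable: "\<phi> \<in> test_funs U \<Longrightarrow> integrable lborel \<phi>"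
  using test_fun_integrable_comp[of \<phi> U "\<lambda>x. x"] by simp

lemma test_fun_integrable_sq: "\<phi> \<in> test_funs U \<Longrightarrow> integrable lborel (\<lambda>x. (\<phi> x)\<^sup>2)"
  using test_fun_integrable_comp[of \<phi> U "\<lambda>x. x\<^sup>2"] by (simp add: continuous_intros)

lemma continuous_on_abs_powr: "0 < p \<Longrightarrow> continuous_on UNIV (\<lambda>x::real. \<bar>x\<bar> powr p)"
  by (rule continuous_on_powr') (auto intro!: continuous_intros)

lemma test_fun_integrable_powr: "\<phi> \<in> test_funs U \<Longrightarrow> 0 < p \<Longrightarrow> integrable lborel (\<lambda>x. \<bar>\<phi> x\<bar> powr p)"
  using test_fun_integrable_comp[of \<phi> U "\<lambda>x. \<bar>x\<bar> powr p"] by (simp add: continuous_on_abs_powr)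

section \<open>Gradients and the Dirichlet integral\<close>

lemma cgrad_inner: "b \<in> Basis \<Longrightarrow> cgrad f x \<bullet> b = pd b f x"
  by (simp add: cgrad_def inner_sum_left inner_Basis if_distrib cong: if_cong)

lemma cgrad_eqI: "(\<And>b. b \<in> Basis \<Longrightarrow> pd b f x = v \<bullet> b) \<Longrightarrow> cgrad f x = v"
  by (rule euclidean_eqI) (simp add: cgrad_inner)

lemma has_derivative_cgrad: "f differentiable (at x) \<Longrightarrow> (f has_derivative (\<lambda>h. cgrad f x \<bullet> h)) (at x)"
proof -
  assume "f differentiable (at x)"
  then have d: "(f has_derivative (\<lambda>b. pd b f x)) (at x)" by (simp add: frechet_derivative_works)
  have "pd h f x = cgrad f x \<bullet> h" for h
  proof -
    have "pd h f x = pd (\<Sum>b\<in>Basis. (h \<bullet> b) *\<^sub>R b) f x" by (simp add: euclidean_representation)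
    also have "\<dots> = (\<Sum>b\<in>Basis. (h \<bullet> b) * pd b f x)"
      using has_derivative_linear[OF d] by (simp add: linear_sum linear_scale)
    also have "\<dots> = cgrad f x \<bullet> h"
      unfolding cgrad_def inner_sum_left by (simp add: inner_commute[of _ h] mult.commute)
    finally show ?thesis .
  qed
  then have "(\<lambda>b. pd b f x) = (\<lambda>h. cgrad f x \<bullet> h)" by (intro ext)
  then show ?thesis by (rule has_derivative_eq_rhs[OF d])
qed

lemma norm_cgrad_sq: "(norm (cgrad f x))\<^sup>2 = (\<Sum>b\<in>Basis. (pd b f x)\<^sup>2)"
proof -
  have "cgrad f x \<bullet> cgrad f x = (\<Sum>b\<in>Basis. (cgrad f x \<bullet> b) * (cgrad f x \<bullet> b))"
    by (rule euclidean_inner)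
  then show ?thesis unfolding power2_norm_eq_inner by (simp add: cgrad_inner power2_eq_square[of "pd _ f x"])
qed

lemma cgrad_cmult: "f differentiable (at x) \<Longrightarrow> cgrad (\<lambda>x. c * f x) x = c *\<^sub>R cgrad f x"
  by (rule cgrad_eqI) (simp add: pd_cmult cgrad_inner)

lemma cgrad_add:
  "f differentiable (at x) \<Longrightarrow> g differentiable (at x) \<Longrightarrow> cgrad (\<lambda>x. f x + g x) x = cgrad f x + cgrad g x"
  by (rule cgrad_eqI) (simp add: pd_add cgrad_inner inner_add_left)

lemma cgrad_diff:
  "f differentiable (at x) \<Longrightarrow> g differentiable (at x) \<Longrightarrow> cgrad (\<lambda>x. f x - g x) x = cgrad f x - cgrad g x"
  using cgrad_add[of f x "\<lambda>x. (-1) * g x"] cgrad_cmult[of g x "-1"] by simp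

lemma cgrad_mult:
  "f differentiable (at x) \<Longrightarrow> g differentiable (at x) \<Longrightarrow>
    cgrad (\<lambda>x. f x * g x) x = f x *\<^sub>R cgrad g x + g x *\<^sub>R cgrad f x"
  by (rule cgrad_eqI) (simp add: pd_mult cgrad_inner inner_add_left)

lemma cgrad_comp:
  "f differentiable (at x) \<Longrightarrow> (h has_real_derivative h') (at (f x)) \<Longrightarrow>
    cgrad (\<lambda>x. h (f x)) x = h' *\<^sub>R cgrad f x"
  by (rule cgrad_eqI) (simp add: pd_comp_real cgrad_inner)

lemma continuous_on_cgrad: "smooth_fun f \<Longrightarrow> continuous_on A (cgrad f)"
  unfolding cgrad_def[abs_def] by (intro continuous_intros smooth_fun_continuous smooth_fun_pd)

lemma test_fun_cgrad_borel: "\<phi> \<in> test_funs U \<Longrightarrow> cgrad \<phi> \<in> borel_measurable borel"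
  by (rule borel_measurable_continuous_onI) (simp add: continuous_on_cgrad test_fun_smooth)

lemma test_fun_cgrad_bounded:
  assumes "\<phi> \<in> test_funs U" obtains B where "B > 0" "\<And>x. norm (cgrad \<phi> x) \<le> B"
proof -
  obtain K where K: "compact K" "\<And>x b. x \<notin> K \<Longrightarrow> pd b \<phi> x = 0" using test_fun_support[OF assms] by metis
  have "bounded (cgrad \<phi> ` K)" by (intro compact_imp_bounded compact_continuous_image K continuous_on_cgrad test_fun_smooth[OF assms])
  then obtain B where B: "B > 0" "\<forall>y\<in>cgrad \<phi> ` K. norm y \<le> B" using bounded_pos by blast
  have "norm (cgrad \<phi> x) \<le> B" for x by (cases "x \<in> K") (use B K in \<open>auto simp: cgrad_def\<close>)
  then show thesis using that B by blast
qed

definition dirichlet :: "('a::euclidean_space \<Rightarrow> real) \<Rightarrow> real" where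
  "dirichlet f = (LINT x|lborel. (norm (cgrad f x))\<^sup>2)"

lemma test_fun_integrable_cgrad:
  assumes "\<phi> \<in> test_funs U" shows "integrable lborel (\<lambda>x. (norm (cgrad \<phi> x))\<^sup>2)"
  unfolding norm_cgrad_sq
  by (intro Bochner_Integration.integrable_sum test_fun_integrable_sq[OF test_fun_pd[OF assms]])

lemma dirichlet_nonneg: "dirichlet f \<ge> 0"
  unfolding dirichlet_def by (intro integral_nonneg_AE) auto

lemma dirichlet_cmult: "\<phi> \<in> test_funs U \<Longrightarrow> dirichlet (\<lambda>x. c * \<phi> x) = c\<^sup>2 * dirichlet \<phi>"
  unfolding dirichlet_def by (simp add: cgrad_cmult test_fun_differentiable power_mult_distrib)

lemma dirichlet_parallelogram:
  assumes "\<phi> \<in> test_funs U" "\<psi> \<in> test_funs U"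
  shows "dirichlet (\<lambda>x. \<phi> x + \<psi> x) + dirichlet (\<lambda>x. \<phi> x - \<psi> x) = 2 * dirichlet \<phi> + 2 * dirichlet \<psi>"
proof -
  note i = test_fun_integrable_cgrad[OF assms(1)] test_fun_integrable_cgrad[OF assms(2)]
    test_fun_integrable_cgrad[OF test_fun_add[OF assms]] test_fun_integrable_cgrad[OF test_fun_diff[OF assms]]
  have "dirichlet (\<lambda>x. \<phi> x + \<psi> x) + dirichlet (\<lambda>x. \<phi> x - \<psi> x)
      = (LINT x|lborel. (norm (cgrad (\<lambda>x. \<phi> x + \<psi> x) x))\<^sup>2 + (norm (cgrad (\<lambda>x. \<phi> x - \<psi> x) x))\<^sup>2)"
    unfolding dirichlet_def using i by (simp add: Bochner_Integration.integral_add)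
  also have "\<dots> = (LINT x|lborel. 2 * (norm (cgrad \<phi> x))\<^sup>2 + 2 * (norm (cgrad \<psi> x))\<^sup>2)"
    using assms by (intro Bochner_Integration.integral_cong refl)
      (simp add: cgrad_add cgrad_diff test_fun_differentiable power2_norm_eq_inner inner_simps inner_commute)
  also have "\<dots> = 2 * dirichlet \<phi> + 2 * dirichlet \<psi>" unfolding dirichlet_def
    using i by (subst Bochner_Integration.integral_add) auto
  finally show ?thesis .
qed

section \<open>Translations, scaling and integration by parts\<close>

lemma lborel_integral_translate:
  fixes f :: "'a::euclidean_space \<Rightarrow> real"
  assumes [measurable]: "f \<in> borel_measurable borel"
  shows "(LINT x|lborel. f (x + y)) = (LINT x|lborel. f x)"
  by (subst (2) lborel_distr_plus[of y, symmetric]) (simp add: integral_distr add.commute)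

lemma lborel_integrable_translate:
  fixes f :: "'a::euclidean_space \<Rightarrow> real"
  assumes "integrable lborel f"
  shows "integrable lborel (\<lambda>x. f (x + y))"
proof -
  have [measurable]: "f \<in> borel_measurable borel" using assms by (auto dest: borel_measurable_integrable)
  have "integrable (distr lborel borel ((+) y)) f" using assms by (simp add: lborel_distr_plus)
  then show ?thesis by (simp add: integrable_distr_eq add.commute)
qed

lemma nn_integral_lborel_translate:
  fixes f :: "'a::euclidean_space \<Rightarrow> ennreal"
  assumes [measurable]: "f \<in> borel_measurable borel"
  shows "(\<integral>\<^sup>+x. f (x + y) \<partial>lborel) = (\<integral>\<^sup>+x. f x \<partial>lborel)"
  by (subst (2) lborel_distr_plus[of y, symmetric]) (simp add: nn_integral_distr add.commute)

lemma lborel_integral_scale: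
  fixes f :: "'a::euclidean_space \<Rightarrow> real"
  assumes [measurable]: "f \<in> borel_measurable borel" and c: "c > 0"
  shows "(LINT x|lborel. f x) = c ^ DIM('a) * (LINT x|lborel. f (v + c *\<^sub>R x))"
  by (subst lborel_affine[of c v]) (use c in \<open>auto simp: integral_density integral_distr\<close>)

text \<open>The integral of a difference quotient vanishes by translation invariance, and the
  quotients converge to the partial derivative. They are dominated by a Lipschitz constant times the
  indicator of a ball one unit larger than one containing the support, since the steps are at most
  1.\<close>

lemma test_fun_integral_pd:
  assumes "\<phi> \<in> test_funs U" "b \<in> Basis" shows "(LINT x|lborel. pd b \<phi> x) = 0"
proof -
  have [measurable]: "\<phi> \<in> borel_measurable borel" "(\<lambda>x. pd b \<phi> x) \<in> borel_measurable borel"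
    using test_fun_borel assms test_fun_pd by blast+
  obtain K where K: "compact K" "\<And>x. x \<notin> K \<Longrightarrow> \<phi> x = 0" using test_fun_support[OF assms(1)] by metis
  obtain \<rho> where \<rho>: "\<forall>x\<in>K. norm x \<le> \<rho>" using compact_imp_bounded[OF K(1)] by (auto simp: bounded_iff)
  obtain B where B: "B > 0" "\<And>x. norm (cgrad \<phi> x) \<le> B" using test_fun_cgrad_bounded[OF assms(1)] by metis
  have lip: "\<bar>\<phi> y - \<phi> x\<bar> \<le> B * norm (y - x)" for x y
  proof -
    have "norm (\<phi> y - \<phi> x) \<le> B * norm (y - x)"
    proof (rule differentiable_bound[of UNIV])
      show "(\<phi> has_derivative (\<lambda>h. cgrad \<phi> z \<bullet> h)) (at z within UNIV)" for z
        using has_derivative_cgrad test_fun_differentiable[OF assms(1)] by auto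
      show "onorm (\<lambda>h. cgrad \<phi> z \<bullet> h) \<le> B" for z
        by (rule onorm_le) (use Cauchy_Schwarz_ineq2[of "cgrad \<phi> z"] mult_right_mono[OF B(2)[of z] norm_ge_zero] in
          \<open>fastforce intro: order_trans\<close>)
    qed auto
    then show ?thesis by simp
  qed
  define e where "e = (\<lambda>n::nat. inverse (real (Suc n)))"
  have e: "e n > 0" "e n \<le> 1" for n by (auto simp: e_def field_simps)
  have e0: "e \<longlonglongrightarrow> 0" unfolding e_def by (rule LIMSEQ_inverse_real_of_nat)
  define s where "s = (\<lambda>n x. (\<phi> (x + e n *\<^sub>R b) - \<phi> x) / e n)"
  have "(\<lambda>n. LINT x|lborel. s n x) \<longlonglongrightarrow> (LINT x|lborel. pd b \<phi> x)"
  proof (rule integral_dominated_convergence[where w="\<lambda>x. B * indicator (cball 0 (\<rho> + 1)) x"])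
    show "integrable lborel (\<lambda>x. B * indicator (cball 0 (\<rho> + 1)) x :: real)"
      by (intro integrable_mult_right integrable_real_indicator) (use emeasure_lborel_cball_finite in auto)
    show "AE x in lborel. (\<lambda>n. s n x) \<longlonglongrightarrow> pd b \<phi> x"
    proof (rule AE_I2)
      fix x
      have "((\<lambda>h. \<phi> (x + h *\<^sub>R b)) has_real_derivative pd b \<phi> x) (at 0)"
      proof -
        have "((\<lambda>h. \<phi> (x + h *\<^sub>R b)) has_derivative (\<lambda>h. cgrad \<phi> x \<bullet> (h *\<^sub>R b))) (at 0)"
          by (rule has_derivative_compose[of "\<lambda>h. x + h *\<^sub>R b" "\<lambda>h. h *\<^sub>R b" 0 UNIV \<phi> "\<lambda>h. cgrad \<phi> x \<bullet> h"])
            (use has_derivative_cgrad[OF test_fun_differentiable[OF assms(1)]] in \<open>auto intro!: derivative_eq_intros\<close>)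
        then show ?thesis unfolding has_field_derivative_def
          by (rule has_derivative_eq_rhs) (use assms in \<open>auto simp: cgrad_inner\<close>)
      qed
      then have "((\<lambda>h. (\<phi> (x + h *\<^sub>R b) - \<phi> x) / h) \<longlongrightarrow> pd b \<phi> x) (at 0)"
        unfolding DERIV_def by simp
      moreover have "filterlim e (at 0) sequentially"
        using e0 e(1) by (auto simp: filterlim_at intro!: always_eventually) (metis less_irrefl)
      ultimately show "(\<lambda>n. s n x) \<longlonglongrightarrow> pd b \<phi> x" unfolding s_def by (rule filterlim_compose)
    qed
    show "AE x in lborel. norm (s n x) \<le> B * indicator (cball 0 (\<rho> + 1)) x" for n
    proof (rule AE_I2)
      fix x
      show "norm (s n x) \<le> B * indicator (cball 0 (\<rho> + 1)) x"
      proof (cases "norm x \<le> \<rho> + 1")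
        case True
        have "\<bar>\<phi> (x + e n *\<^sub>R b) - \<phi> x\<bar> \<le> B * e n" using lip[of "x + e n *\<^sub>R b" x] assms(2) e(1)[of n] by simp
        then show ?thesis using True e(1)[of n] by (simp add: s_def abs_div field_simps)
      next
        case False
        have "norm x \<le> norm (x + e n *\<^sub>R b) + norm (e n *\<^sub>R b)" by (metis norm_triangle_ineq4 add_diff_cancel_right')
        then have "norm (x + e n *\<^sub>R b) > \<rho>" "norm x > \<rho>" using False e[of n] assms(2) by auto
        then have "\<phi> x = 0" "\<phi> (x + e n *\<^sub>R b) = 0" using K \<rho> by (meson not_less)+
        then show ?thesis using B by (simp add: s_def)
      qed
    qed
  qed (auto simp: s_def)
  moreover have "(LINT x|lborel. s n x) = 0" for n
  proof -
    have i: "integrable lborel \<phi>" using test_fun_integrable assms by blast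
    have "(LINT x|lborel. s n x) = ((LINT x|lborel. \<phi> (x + e n *\<^sub>R b)) - (LINT x|lborel. \<phi> x)) / e n"
      unfolding s_def by (simp add: Bochner_Integration.integral_diff[OF lborel_integrable_translate[OF i] i])
    then show ?thesis by (simp add: lborel_integral_translate)
  qed
  ultimately show ?thesis by (simp add: LIMSEQ_const_iff)
qed

lemma test_fun_integration_by_parts:
  assumes "\<phi> \<in> test_funs U" "\<psi> \<in> test_funs V" "b \<in> Basis"
  shows "(LINT x|lborel. \<phi> x * pd b \<psi> x) = - (LINT x|lborel. pd b \<phi> x * \<psi> x)"
proof -
  have 1: "integrable lborel (\<lambda>x. \<phi> x * pd b \<psi> x)" "integrable lborel (\<lambda>x. pd b \<phi> x * \<psi> x)"
    using assms by (auto intro!: test_fun_integrable[OF test_fun_mult] test_fun_smooth test_fun_pd)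
  have "0 = (LINT x|lborel. pd b (\<lambda>x. \<phi> x * \<psi> x) x)"
    using test_fun_integral_pd[OF test_fun_mult[OF test_fun_smooth[OF assms(1)] assms(2)] assms(3)] by simp
  also have "\<dots> = (LINT x|lborel. \<phi> x * pd b \<psi> x + pd b \<phi> x * \<psi> x)"
    using assms by (simp add: pd_mult test_fun_differentiable)
  also have "\<dots> = (LINT x|lborel. \<phi> x * pd b \<psi> x) + (LINT x|lborel. pd b \<phi> x * \<psi> x)"
    using 1 by (rule Bochner_Integration.integral_add)
  finally show ?thesis by simp
qed

text \<open>The increment is the mean over the segment of the directional derivative, and the square
  of a mean is at most the mean of the square. The nonnegative integral on the right lets Fubini be
  applied later without integrability conditions.\<close>

lemma increment_sq_le:
  assumes "\<phi> \<in> test_funs U"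
  shows "ennreal ((\<phi> (x + y) - \<phi> x)\<^sup>2) \<le>
    (\<integral>\<^sup>+s. indicator {0..1::real} s * ennreal ((norm y)\<^sup>2 * (norm (cgrad \<phi> (x + s *\<^sub>R y)))\<^sup>2) \<partial>lborel)"
proof -
  define g where "g = (\<lambda>s::real. cgrad \<phi> (x + s *\<^sub>R y) \<bullet> y)"
  define c where "c = \<phi> (x + y) - \<phi> x"
  have cg: "continuous_on A g" for A unfolding g_def
    by (intro continuous_intros continuous_on_compose2[OF continuous_on_cgrad[OF test_fun_smooth[OF assms], of UNIV]]) auto
  have "has_bochner_integral lborel (\<lambda>s. indicator {0..1} s *\<^sub>R g s) (\<phi> (x + 1 *\<^sub>R y) - \<phi> (x + 0 *\<^sub>R y))"
  proof (rule has_bochner_integral_FTC_Icc[where F="\<lambda>s. \<phi> (x + s *\<^sub>R y)"])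
    fix s :: real
    have "((\<lambda>s. \<phi> (x + s *\<^sub>R y)) has_derivative (\<lambda>h. cgrad \<phi> (x + s *\<^sub>R y) \<bullet> (h *\<^sub>R y))) (at s)"
      by (rule has_derivative_compose[of "\<lambda>h. x + h *\<^sub>R y" "\<lambda>h. h *\<^sub>R y" s UNIV \<phi> "\<lambda>h. cgrad \<phi> (x + s *\<^sub>R y) \<bullet> h"])
        (use has_derivative_cgrad[OF test_fun_differentiable[OF assms(1)]] in \<open>auto intro!: derivative_eq_intros\<close>)
    then show "((\<lambda>s. \<phi> (x + s *\<^sub>R y)) has_vector_derivative g s) (at s within {0..1})"
      unfolding has_vector_derivative_def by (auto intro: has_derivative_at_withinI simp: g_def)
  qed (auto simp: cg)
  then have 1: "has_bochner_integral lborel (\<lambda>s. indicator {0..1} s *\<^sub>R g s) c" by (simp add: c_def)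
  have i2: "integrable lborel (\<lambda>s. indicator {0..1::real} s *\<^sub>R (g s)\<^sup>2)"
    by (rule borel_integrable_compact) (auto intro!: continuous_intros cg)
  have i0: "integrable lborel (\<lambda>s. indicator {0..1::real} s *\<^sub>R (c\<^sup>2))" by (rule borel_integrable_compact) auto
  have i1: "integrable lborel (\<lambda>s. indicator {0..1::real} s *\<^sub>R g s)" using 1 by (simp add: has_bochner_integral_iff)
  \<comment> \<open>Since \<open>c\<close> is the mean of \<open>g\<close> on the unit interval,
    nonnegativity of this variance is Jensen's inequality for the square.\<close>
  have "0 \<le> (LINT s|lborel. indicator {0..1::real} s *\<^sub>R (g s - c)\<^sup>2)"
    by (intro integral_nonneg_AE) auto
  also have "\<dots> = (LINT s|lborel. indicator {0..1::real} s *\<^sub>R (g s)\<^sup>2 - 2 * c * (indicator {0..1::real} s *\<^sub>R g s) + indicator {0..1::real} s *\<^sub>R c\<^sup>2)"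
    by (intro Bochner_Integration.integral_cong) (auto simp: indicator_def power2_eq_square algebra_simps)
  also have "\<dots> = (LINT s|lborel. indicator {0..1::real} s *\<^sub>R (g s)\<^sup>2) - 2 * c * c + c\<^sup>2"
    using 1 i2 i1 i0 by (simp add: has_bochner_integral_iff)
  finally have "c\<^sup>2 \<le> (LINT s|lborel. indicator {0..1::real} s *\<^sub>R (g s)\<^sup>2)" by (simp add: power2_eq_square)
  then have a: "ennreal (c\<^sup>2) \<le> ennreal (LINT s|lborel. indicator {0..1::real} s *\<^sub>R (g s)\<^sup>2)" by (rule ennreal_leI)
  have b: "ennreal (LINT s|lborel. indicator {0..1::real} s *\<^sub>R (g s)\<^sup>2) = (\<integral>\<^sup>+s. ennreal (indicator {0..1::real} s *\<^sub>R (g s)\<^sup>2) \<partial>lborel)"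
    by (rule nn_integral_eq_integral[symmetric]) (use i2 in auto)
  have "(\<integral>\<^sup>+s. ennreal (indicator {0..1::real} s *\<^sub>R (g s)\<^sup>2) \<partial>lborel) \<le>
     (\<integral>\<^sup>+s. indicator {0..1::real} s * ennreal ((norm y)\<^sup>2 * (norm (cgrad \<phi> (x + s *\<^sub>R y)))\<^sup>2) \<partial>lborel)"
  proof (rule nn_integral_mono)
    fix s :: real
    have "\<bar>g s\<bar> \<le> norm (cgrad \<phi> (x + s *\<^sub>R y)) * norm y" unfolding g_def by (rule Cauchy_Schwarz_ineq2)
    then have "(g s)\<^sup>2 \<le> (norm (cgrad \<phi> (x + s *\<^sub>R y)) * norm y)\<^sup>2" 
      using power_mono[OF _ abs_ge_zero, of "g s" _ 2] by simp
    then show "ennreal (indicator {0..1::real} s *\<^sub>R (g s)\<^sup>2) \<le> indicator {0..1::real} s * ennreal ((norm y)\<^sup>2 * (norm (cgrad \<phi> (x + s *\<^sub>R y)))\<^sup>2)"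
      by (auto simp: indicator_def power_mult_distrib mult.commute intro: ennreal_leI)
  qed
  from order_trans[OF a[unfolded b] this] show ?thesis unfolding c_def .
qed

text \<open>After integrating the pointwise bound over \<open>x\<close> and exchanging the
  integrals, translation invariance makes the inner integral the same for every point of the
  segment.\<close>

lemma nn_translation_estimate:
  fixes \<phi> :: "'a::euclidean_space \<Rightarrow> real"
  assumes "\<phi> \<in> test_funs U"
  shows "(\<integral>\<^sup>+x. ennreal ((\<phi> (x + y) - \<phi> x)\<^sup>2) \<partial>lborel) \<le> ennreal ((norm y)\<^sup>2 * dirichlet \<phi>)"
proof -
  have [measurable]: "cgrad \<phi> \<in> borel_measurable borel" using test_fun_cgrad_borel assms by blast
  have "(\<integral>\<^sup>+x. ennreal ((\<phi> (x + y) - \<phi> x)\<^sup>2) \<partial>lborel) \<le>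
     (\<integral>\<^sup>+x. \<integral>\<^sup>+s. indicator {0..1::real} s * ennreal ((norm y)\<^sup>2 * (norm (cgrad \<phi> (x + s *\<^sub>R y)))\<^sup>2) \<partial>lborel \<partial>lborel)"
    by (rule nn_integral_mono) (rule increment_sq_le[OF assms])
  also have "\<dots> = (\<integral>\<^sup>+s. \<integral>\<^sup>+x. indicator {0..1::real} s * ennreal ((norm y)\<^sup>2 * (norm (cgrad \<phi> (x + s *\<^sub>R y)))\<^sup>2) \<partial>lborel \<partial>lborel)"
    by (rule lborel_pair.Fubini') measurable
  also have "\<dots> = (\<integral>\<^sup>+s. indicator {0..1::real} s * ennreal ((norm y)\<^sup>2 * dirichlet \<phi>) \<partial>lborel)"
  proof (rule nn_integral_cong)
    fix s :: real
    have "(\<integral>\<^sup>+x. indicator {0..1::real} s * ennreal ((norm y)\<^sup>2 * (norm (cgrad \<phi> (x + s *\<^sub>R y)))\<^sup>2) \<partial>lborel)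
        = indicator {0..1::real} s * (\<integral>\<^sup>+x. ennreal ((norm y)\<^sup>2 * (norm (cgrad \<phi> (x + s *\<^sub>R y)))\<^sup>2) \<partial>lborel)"
      by (rule nn_integral_cmult) measurable
    also have "(\<integral>\<^sup>+x. ennreal ((norm y)\<^sup>2 * (norm (cgrad \<phi> (x + s *\<^sub>R y)))\<^sup>2) \<partial>lborel) = (\<integral>\<^sup>+x. ennreal ((norm y)\<^sup>2 * (norm (cgrad \<phi> x))\<^sup>2) \<partial>lborel)"
      by (rule nn_integral_lborel_translate) measurable
    also have "\<dots> = ennreal ((norm y)\<^sup>2 * dirichlet \<phi>)"
      using test_fun_integrable_cgrad[OF assms] unfolding dirichlet_def
      by (subst nn_integral_eq_integral) auto
    finally show "(\<integral>\<^sup>+x. indicator {0..1::real} s * ennreal ((norm y)\<^sup>2 * (norm (cgrad \<phi> (x + s *\<^sub>R y)))\<^sup>2) \<partial>lborel)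
        = indicator {0..1::real} s * ennreal ((norm y)\<^sup>2 * dirichlet \<phi>)" .
  qed
  also have "\<dots> = ennreal ((norm y)\<^sup>2 * dirichlet \<phi>)"
    by (subst nn_integral_multc) auto
  finally show ?thesis .
qed

lemma translation_estimate:
  fixes \<phi> :: "'a::euclidean_space \<Rightarrow> real"
  assumes "\<phi> \<in> test_funs U"
  shows "(LINT x|lborel. (\<phi> (x + y) - \<phi> x)\<^sup>2) \<le> (norm y)\<^sup>2 * dirichlet \<phi>"
proof -
  have [measurable]: "\<phi> \<in> borel_measurable borel" using test_fun_borel assms by blast
  have "(LINT x|lborel. (\<phi> (x + y) - \<phi> x)\<^sup>2) = enn2real (\<integral>\<^sup>+x. ennreal ((\<phi> (x + y) - \<phi> x)\<^sup>2) \<partial>lborel)"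
    by (rule integral_eq_nn_integral) auto
  also have "\<dots> \<le> enn2real (ennreal ((norm y)\<^sup>2 * dirichlet \<phi>))"
    by (rule enn2real_mono[OF nn_translation_estimate[OF assms]]) simp
  finally show ?thesis by (simp add: dirichlet_nonneg)
qed

section \<open>The Sobolev inequality\<close>

text \<open>The bound on the \<open>L^q\<close> mass keeps the mean of \<open>g\<close> over the
  ball around \<open>x\<close> at most t/4 + t/4, while \<open>g x = t\<close>. So \<open>g\<close>
  differs from \<open>t\<close> by order \<open>t\<close> on average over the ball.\<close>

lemma ball_average_lower_bound:
  fixes g :: "'a::euclidean_space \<Rightarrow> real"
  assumes g: "g \<in> test_funs UNIV" "\<And>x. g x \<ge> 0" and t: "t > 0" and q: "q > 1"
    and M: "(LINT x|lborel. \<bar>g x\<bar> powr q) \<le> (t/4) powr q * measure lborel (ball (0::'a) r)"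
    and x: "g x = t"
  shows "ennreal (measure lborel (ball (0::'a) r) * (t\<^sup>2/4)) \<le>
     (\<integral>\<^sup>+y. indicator (ball 0 r) y * ennreal ((g (x + y) - g x)\<^sup>2) \<partial>lborel)"
proof -
  let ?B = "ball (0::'a) r"
  have [measurable]: "g \<in> borel_measurable borel" using test_fun_borel g by blast
  have iq: "integrable lborel (\<lambda>y. \<bar>g (y + x)\<bar> powr q)"
    by (rule lborel_integrable_translate) (rule test_fun_integrable_powr[OF g(1)], use q in simp)
  have ib: "integrable lborel (\<lambda>y. indicat_real ?B y)"
    by (rule integrable_real_indicator) (use emeasure_lborel_ball_finite in auto)
  obtain b where b: "b > 0" "\<And>x. \<bar>g x\<bar> \<le> b" using test_fun_bounded[OF g(1)] by metis
  have isq: "integrable lborel (\<lambda>y. indicat_real ?B y * (g (y + x) - t)\<^sup>2)"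
  proof (rule Bochner_Integration.integrable_bound[where f="\<lambda>y. (b + t)\<^sup>2 * indicat_real ?B y"])
    have "\<bar>g (y + x) - t\<bar> \<le> b + t" for y using b(2)[of "y + x"] t by linarith
    then have "(g (y + x) - t)\<^sup>2 \<le> (b + t)\<^sup>2" for y
      using power_mono[OF _ abs_ge_zero, of "g (y + x) - t" _ 2] by simp
    then show "AE y in lborel. norm (indicat_real ?B y * (g (y + x) - t)\<^sup>2) \<le> norm ((b + t)\<^sup>2 * indicat_real ?B y)"
      by (intro AE_I2) (auto simp: indicator_def)
  qed (use ib in auto)
  have pw: "indicat_real ?B y * (t\<^sup>2/2) - t * (t/4) powr (1 - q) * \<bar>g (y + x)\<bar> powr q
      \<le> indicat_real ?B y * (g (y + x) - t)\<^sup>2" for y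
  proof -
    define s where "s = g (y + x)"
    have s: "s \<ge> 0" using g s_def by simp
    \<comment> \<open>Above t/4, the identity \<open>s = s powr (1 - q) * s powr q\<close> has its
      first factor at most \<open>(t/4) powr (1 - q)\<close>, because \<open>1 - q\<close> is
      negative.\<close>
    have "s \<le> t/4 + (t/4) powr (1 - q) * s powr q"
    proof (cases "s \<le> t/4")
      case False
      then have "s powr (1 - q) \<le> (t/4) powr (1 - q)" by (intro powr_mono2') (use t q in auto)
      moreover have "s powr (1 - q) * s powr q = s" using False t by (simp add: powr_add[symmetric])
      ultimately show ?thesis using mult_right_mono[of "s powr (1 - q)" "(t/4) powr (1 - q)" "s powr q"] t by simp
    qed (use s in \<open>auto simp: add_increasing2\<close>)
    then have "t * s \<le> t * (t/4 + (t/4) powr (1 - q) * s powr q)" using t by (intro mult_left_mono) auto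
    moreover have "(s - t)\<^sup>2 \<ge> 3/4 * t\<^sup>2 - t * s"
      using zero_le_power2[of "s - t/2"] by (simp add: power2_eq_square algebra_simps)
    ultimately have "t\<^sup>2/2 - t * (t/4) powr (1 - q) * s powr q \<le> (s - t)\<^sup>2"
      by (simp add: power2_eq_square algebra_simps)
    moreover have "0 \<le> t * (t/4) powr (1 - q) * s powr q" using t by simp
    ultimately show ?thesis using s by (auto simp: indicator_def s_def[symmetric])
  qed
  have "measure lborel ?B * (t\<^sup>2/4) \<le> measure lborel ?B * (t\<^sup>2/2) - t * (t/4) powr (1 - q) * (LINT y|lborel. \<bar>g y\<bar> powr q)"
  proof -
    have "t * (t/4) powr (1 - q) * (LINT y|lborel. \<bar>g y\<bar> powr q) \<le> t * (t/4) powr (1 - q) * ((t/4) powr q * measure lborel ?B)"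
      by (intro mult_left_mono M) (use t in auto)
    also have "\<dots> = t * ((t/4) powr (1 - q) * (t/4) powr q) * measure lborel ?B" by simp
    also have "(t/4) powr (1 - q) * (t/4) powr q = t/4" using t by (simp add: powr_add[symmetric])
    finally show ?thesis by (simp add: power2_eq_square algebra_simps)
  qed
  also have "\<dots> = (LINT y|lborel. indicat_real ?B y * (t\<^sup>2/2)) - (LINT y|lborel. t * (t/4) powr (1 - q) * \<bar>g (y + x)\<bar> powr q)"
    using iq ib lborel_integral_translate[of "\<lambda>y. \<bar>g y\<bar> powr q" x] by simp
  also have "\<dots> = (LINT y|lborel. indicat_real ?B y * (t\<^sup>2/2) - t * (t/4) powr (1 - q) * \<bar>g (y + x)\<bar> powr q)"
    using iq ib by (intro Bochner_Integration.integral_diff[symmetric]) auto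
  also have "\<dots> \<le> (LINT y|lborel. indicat_real ?B y * (g (y + x) - t)\<^sup>2)"
    by (rule integral_mono[OF _ isq]) (use iq ib pw in auto)
  finally have "ennreal (measure lborel ?B * (t\<^sup>2/4)) \<le> ennreal (LINT y|lborel. indicat_real ?B y * (g (y + x) - t)\<^sup>2)"
    by (rule ennreal_leI)
  also have "\<dots> = (\<integral>\<^sup>+y. ennreal (indicat_real ?B y * (g (y + x) - t)\<^sup>2) \<partial>lborel)"
    by (rule nn_integral_eq_integral[symmetric]) (use isq in auto)
  also have "\<dots> = (\<integral>\<^sup>+y. indicator ?B y * ennreal ((g (x + y) - g x)\<^sup>2) \<partial>lborel)"
    by (intro nn_integral_cong) (auto simp: indicator_def x add.commute)
  finally show ?thesis .
qed

text \<open>Integrate the lower bound for the ball averages over \<open>E\<close>, exchange the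
  integrals, and use that a translation by less than \<open>r\<close> costs at most r^2 times the
  Dirichlet integral; the volume of the ball cancels.\<close>

lemma level_set_bound:
  fixes g :: "'a::euclidean_space \<Rightarrow> real"
  assumes g: "g \<in> test_funs UNIV" "\<And>x. g x \<ge> 0" and t: "t > 0" and q: "q > 1" and r: "r > 0"
    and M: "(LINT x|lborel. \<bar>g x\<bar> powr q) \<le> (t/4) powr q * measure lborel (ball (0::'a) r)"
    and E[measurable]: "E \<in> sets borel" and x: "\<And>x. x \<in> E \<Longrightarrow> g x = t"
  shows "measure lborel E * (t\<^sup>2/4) \<le> r\<^sup>2 * dirichlet g"
proof -
  let ?B = "ball (0::'a) r"
  have [measurable]: "g \<in> borel_measurable borel" using test_fun_borel g by blast
  have [measurable]: "?B \<in> sets borel" by simp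
  have B: "measure lborel ?B > 0" using r by simp
  have "ennreal (measure lborel ?B * (t\<^sup>2/4)) * emeasure lborel E = (\<integral>\<^sup>+x. ennreal (measure lborel ?B * (t\<^sup>2/4)) * indicator E x \<partial>lborel)"
    by (simp add: nn_integral_cmult_indicator)
  also have "\<dots> \<le> (\<integral>\<^sup>+x. \<integral>\<^sup>+y. indicator ?B y * ennreal ((g (x + y) - g x)\<^sup>2) \<partial>lborel \<partial>lborel)"
    by (rule nn_integral_mono) (use ball_average_lower_bound[OF g t q M] x in \<open>auto simp: indicator_def\<close>)
  also have "\<dots> = (\<integral>\<^sup>+y. \<integral>\<^sup>+x. indicator ?B y * ennreal ((g (x + y) - g x)\<^sup>2) \<partial>lborel \<partial>lborel)"
    by (rule lborel_pair.Fubini') measurable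
  also have "\<dots> \<le> (\<integral>\<^sup>+y. indicator ?B y * ennreal (r\<^sup>2 * dirichlet g) \<partial>lborel)"
  proof (rule nn_integral_mono)
    fix y :: 'a
    have "(\<integral>\<^sup>+x. indicator ?B y * ennreal ((g (x + y) - g x)\<^sup>2) \<partial>lborel) = indicator ?B y * (\<integral>\<^sup>+x. ennreal ((g (x + y) - g x)\<^sup>2) \<partial>lborel)"
      by (rule nn_integral_cmult) measurable
    also have "\<dots> \<le> indicator ?B y * ennreal (r\<^sup>2 * dirichlet g)"
    proof (cases "y \<in> ?B")
      case True
      have "(norm y)\<^sup>2 * dirichlet g \<le> r\<^sup>2 * dirichlet g"
        by (intro mult_right_mono power_mono) (use True dirichlet_nonneg in auto)
      then show ?thesis using nn_translation_estimate[OF g(1), of y] True by (auto intro: order_trans ennreal_leI)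
    qed simp
    finally show "(\<integral>\<^sup>+x. indicator ?B y * ennreal ((g (x + y) - g x)\<^sup>2) \<partial>lborel) \<le> indicator ?B y * ennreal (r\<^sup>2 * dirichlet g)" .
  qed
  also have "\<dots> = emeasure lborel ?B * ennreal (r\<^sup>2 * dirichlet g)"
    by (subst nn_integral_multc) auto
  also have "\<dots> = ennreal (measure lborel ?B * (r\<^sup>2 * dirichlet g))"
    by (subst emeasure_eq_ennreal_measure) (use emeasure_lborel_ball_finite[of "0::'a" r] in \<open>auto simp: ennreal_mult' dirichlet_nonneg\<close>)
  finally have "enn2real (ennreal (measure lborel ?B * (t\<^sup>2/4)) * emeasure lborel E) \<le> measure lborel ?B * (r\<^sup>2 * dirichlet g)"
    using enn2real_mono[of _ "ennreal (measure lborel ?B * (r\<^sup>2 * dirichlet g))"] by (simp add: dirichlet_nonneg)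
  then have "measure lborel ?B * (measure lborel E * (t\<^sup>2/4)) \<le> measure lborel ?B * (r\<^sup>2 * dirichlet g)"
    by (simp add: enn2real_mult measure_def algebra_simps)
  then show ?thesis using B by simp
qed

lemma smooth_truncation:
  obtains \<zeta> \<zeta>' :: "real \<Rightarrow> real" and L where "smooth1 \<zeta>" "\<And>t. (\<zeta> has_real_derivative \<zeta>' t) (at t)"
    "\<And>t. 0 \<le> \<zeta> t" "\<And>t. \<zeta> t \<le> 1" "\<And>t. \<bar>t\<bar> \<le> 1 \<Longrightarrow> \<zeta> t = 0" "\<And>t. \<bar>t\<bar> \<ge> 2 \<Longrightarrow> \<zeta> t = 1"
    "L > 0" "\<And>t. \<bar>\<zeta>' t\<bar> \<le> L" "\<And>t. \<bar>t\<bar> \<le> 1 \<or> \<bar>t\<bar> \<ge> 2 \<Longrightarrow> \<zeta>' t = 0"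
proof -
  obtain \<sigma> where \<sigma>: "smooth1 \<sigma>" "\<And>t. t \<le> -1 \<Longrightarrow> \<sigma> t = (0::real)" "\<And>t. t \<ge> 1 \<Longrightarrow> \<sigma> t = 1"
    "\<And>t. 0 \<le> \<sigma> t" "\<And>t. \<sigma> t \<le> 1" "\<And>t. \<sigma> (- t) = 1 - \<sigma> t" by (rule smooth_step) blast
  \<comment> \<open>The inner quadratic polynomial takes the value -1 at |t| = 1 and 1 at |t| = 2,
    and using t^2 in place of |t| keeps the function smooth at 0.\<close>
  define \<zeta> where "\<zeta> = (\<lambda>t::real. \<sigma> (-5/3 + 2/3 * (t \<bullet> t)))"
  have s: "smooth1 \<zeta>" unfolding \<zeta>_def
    by (rule smooth_fun_imp_smooth1, rule smooth_fun_comp[OF \<sigma>(1)], rule smooth_fun_add[OF smooth_fun_const],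
        rule smooth_fun_mult[OF smooth_fun_const smooth_fun_inner_self])
  obtain \<zeta>' where \<zeta>': "smooth1 \<zeta>'" "\<And>x. (\<zeta> has_real_derivative \<zeta>' x) (at x)" by (rule smooth1_deriv[OF s]) blast
  have 0: "\<zeta> t = 0" if "\<bar>t\<bar> \<le> 1" for t
    unfolding \<zeta>_def by (rule \<sigma>(2)) (use that abs_square_le_1[of t] in \<open>auto simp: power2_eq_square\<close>)
  have 1: "\<zeta> t = 1" if "\<bar>t\<bar> \<ge> 2" for t
    unfolding \<zeta>_def by (rule \<sigma>(3)) (use that abs_le_square_iff[of 2 t] in \<open>auto simp: power2_eq_square\<close>)
  have b: "0 \<le> \<zeta> t" "\<zeta> t \<le> 1" for t using \<sigma>(4,5) by (auto simp: \<zeta>_def)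
  \<comment> \<open>On the plateaus, endpoints included, \<open>\<zeta>\<close> attains its minimum
    0 or its maximum 1, so the derivative vanishes there.\<close>
  have z: "\<zeta>' t = 0" if "\<bar>t\<bar> \<le> 1 \<or> \<bar>t\<bar> \<ge> 2" for t
  proof (cases "\<bar>t\<bar> \<le> 1")
    case True
    show ?thesis by (rule DERIV_local_min[OF \<zeta>'(2), of 1]) (use 0[OF True] b in auto)
  next
    case False
    then have "\<zeta> t = 1" using that 1 by auto
    then show ?thesis using DERIV_local_max[OF \<zeta>'(2)[of t], of 1] b by auto
  qed
  have "bounded (\<zeta>' ` {-2..2})" by (intro compact_imp_bounded compact_continuous_image smooth1_continuous \<zeta>') auto
  then obtain L where L: "L > 0" "\<forall>y\<in>\<zeta>' ` {-2..2}. norm y \<le> L" using bounded_pos by blast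
  have bd: "\<bar>\<zeta>' t\<bar> \<le> L" for t
  proof (cases "\<bar>t\<bar> \<ge> 2")
    case True then show ?thesis using z[of t] L by simp
  next
    case False then have "t \<in> {-2..2}" by auto
    then show ?thesis using L by auto
  qed
  show thesis by (rule that[OF s \<zeta>'(2) b 0 1 L(1) bd z])
qed

text \<open>A weak-type form of the Sobolev inequality. The truncation of \<open>f\<close> at level
  \<open>t\<close> equals \<open>t\<close> where |f| \<ge> 2t, and its gradient lives only where |f|
  lies between \<open>t\<close> and \<open>2t\<close>, so that a sum over dyadic levels will use
  each part of the Dirichlet integral at most once.\<close>

lemma superlevel_bound:
  assumes "DIM('a::euclidean_space) \<ge> 3"
  defines "q \<equiv> 2 * real DIM('a) / (real DIM('a) - 2)"
  shows "\<exists>C>0. \<forall>f \<in> test_funs (UNIV::'a set). \<forall>t>0. (LINT x|lborel. \<bar>f x\<bar> powr q) > 0 \<longrightarrow>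
    t powr q * measure lborel {x. \<bar>f x\<bar> \<ge> 2 * t} \<le> C * (LINT x|lborel. \<bar>f x\<bar> powr q) powr (2 / real DIM('a)) *
      (LINT x|lborel. indicator {x. t < \<bar>f x\<bar> \<and> \<bar>f x\<bar> < 2 * t} x * (norm (cgrad f x))\<^sup>2)"
proof -
  let ?N = "real DIM('a)"
  have N: "?N \<ge> 3" using assms by simp
  \<comment> \<open>The identity 2q/N = q - 2 expresses the criticality of \<open>q\<close>; because
    of it all powers of \<open>t\<close> cancel at the end.\<close>
  have q: "q > 2" "2 * q / ?N = q - 2" using N by (auto simp: q_def field_simps)
  obtain \<zeta> \<zeta>' L where \<zeta>: "smooth1 \<zeta>" "\<And>t. (\<zeta> has_real_derivative \<zeta>' t) (at t)"
    "\<And>t. 0 \<le> \<zeta> t" "\<And>t. \<zeta> t \<le> 1" "\<And>t. \<bar>t\<bar> \<le> 1 \<Longrightarrow> \<zeta> t = 0" "\<And>t. \<bar>t\<bar> \<ge> 2 \<Longrightarrow> \<zeta> t = 1"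
    "L > 0" "\<And>t. \<bar>\<zeta>' t\<bar> \<le> L" "\<And>t. \<bar>t\<bar> \<le> 1 \<or> \<bar>t\<bar> \<ge> 2 \<Longrightarrow> \<zeta>' t = 0"
    by (rule smooth_truncation) blast
  define V where "V = measure lborel (ball (0::'a) 1)"
  have V: "V > 0" by (simp add: V_def)
  define C where "C = 4 * 4 powr (q - 2) * L\<^sup>2 * V powr (- 2 / ?N)"
  have "C > 0" using \<zeta>(7) V by (simp add: C_def)
  moreover have "t powr q * measure lborel {x. \<bar>f x\<bar> \<ge> 2 * t} \<le> C * (LINT x|lborel. \<bar>f x\<bar> powr q) powr (2 / ?N) *
      (LINT x|lborel. indicator {x. t < \<bar>f x\<bar> \<and> \<bar>f x\<bar> < 2 * t} x * (norm (cgrad f x))\<^sup>2)"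
    if f: "f \<in> test_funs (UNIV::'a set)" and t: "t > 0" and M0: "(LINT x|lborel. \<bar>f x\<bar> powr q) > 0" for f t
  proof -
    define M where "M = (LINT x|lborel. \<bar>f x\<bar> powr q)"
    define G where "G = (LINT x|lborel. indicator {x. t < \<bar>f x\<bar> \<and> \<bar>f x\<bar> < 2 * t} x * (norm (cgrad f x))\<^sup>2)"
    have M: "M > 0" using M0 M_def by simp
    have [measurable]: "f \<in> borel_measurable borel" "cgrad f \<in> borel_measurable borel"
      using test_fun_borel test_fun_cgrad_borel f by blast+
    define h where "h = (\<lambda>s. t * \<zeta> (0 + (1/t) * s))"
    have h: "smooth1 h" unfolding h_def
      by (rule smooth1_mult[OF smooth_fun_imp_smooth1[OF smooth_fun_const] smooth1_affine[OF \<zeta>(1)]])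
    define g where "g = (\<lambda>x. h (f x))"
    have g: "g \<in> test_funs UNIV" unfolding g_def
      by (rule test_fun_comp[OF h _ f]) (use \<zeta> in \<open>auto simp: h_def\<close>)
    have dh: "(h has_real_derivative \<zeta>' (s/t)) (at s)" for s
      unfolding h_def using t by (auto intro!: derivative_eq_intros DERIV_chain2[OF \<zeta>(2)])
    have gpos: "g x \<ge> 0" for x using \<zeta> t by (simp add: g_def h_def)
    have gle: "\<bar>g x\<bar> \<le> \<bar>f x\<bar>" for x
    proof (cases "\<bar>f x\<bar> \<le> t")
      case True then have "\<bar>1/t * f x\<bar> \<le> 1" using t by (simp add: abs_mult field_simps)
      then show ?thesis using \<zeta>(5)[of "1/t * f x"] by (simp add: g_def h_def)
    next
      case False
      have "t * \<zeta> (1/t * f x) \<le> t * 1" using \<zeta> t by (intro mult_left_mono) auto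
      then show ?thesis using False gpos[of x] by (simp add: g_def h_def)
    qed
    define E where "E = {x. \<bar>f x\<bar> \<ge> 2 * t}"
    have gE: "g x = t" if "x \<in> E" for x
    proof -
      have "\<bar>1/t * f x\<bar> \<ge> 2" using that t by (simp add: E_def abs_mult field_simps)
      then show ?thesis using \<zeta>(6)[of "1/t * f x"] by (simp add: g_def h_def)
    qed
    \<comment> \<open>The radius makes (t/4)^q times the volume of the ball equal to
      \<open>M\<close>, which is the hypothesis of the level set bound with equality.\<close>
    define r where "r = (M / (V * (t/4) powr q)) powr (1 / ?N)"
    have r: "r > 0" using M V t by (simp add: r_def)
    have "r ^ DIM('a) = r powr ?N" using r by (simp add: powr_realpow)
    also have "\<dots> = M / (V * (t/4) powr q)" using N M V t by (simp add: r_def powr_powr)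
    finally have rN: "r ^ DIM('a) = M / (V * (t/4) powr q)" .
    have "measure lborel (ball (0::'a) r) = V * r ^ DIM('a)" using r by (simp add: V_def content_ball)
    then have B: "(t/4) powr q * measure lborel (ball (0::'a) r) = M" using rN V t by simp
    have "(LINT x|lborel. \<bar>g x\<bar> powr q) \<le> M" unfolding M_def
      by (rule integral_mono) (use test_fun_integrable_powr[OF f] test_fun_integrable_powr[OF g] q gle in \<open>auto intro!: powr_mono2\<close>)
    then have 1: "measure lborel E * (t\<^sup>2/4) \<le> r\<^sup>2 * dirichlet g"
      by (intro level_set_bound[OF g gpos t _ r]) (use q B gE in \<open>auto simp: E_def\<close>)
    have "(norm (cgrad g x))\<^sup>2 \<le> L\<^sup>2 * (indicator {x. t < \<bar>f x\<bar> \<and> \<bar>f x\<bar> < 2 * t} x * (norm (cgrad f x))\<^sup>2)" for x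
    proof -
      have c: "cgrad g x = \<zeta>' (f x / t) *\<^sub>R cgrad f x"
        unfolding g_def by (rule cgrad_comp[OF test_fun_differentiable[OF f] dh])
      show ?thesis
      proof (cases "t < \<bar>f x\<bar> \<and> \<bar>f x\<bar> < 2 * t")
        case True
        have "(\<zeta>' (f x / t))\<^sup>2 \<le> L\<^sup>2" using power_mono[OF \<zeta>(8) abs_ge_zero, of "f x / t" 2] by simp
        then show ?thesis using True c by (auto simp: power_mult_distrib intro: mult_right_mono)
      next
        case False
        then have "\<bar>f x / t\<bar> \<le> 1 \<or> \<bar>f x / t\<bar> \<ge> 2" using t by (auto simp: field_simps)
        then show ?thesis using c \<zeta>(9)[of "f x / t"] by simp
      qed
    qed
    then have 2: "dirichlet g \<le> L\<^sup>2 * G"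
      unfolding dirichlet_def G_def integral_mult_right_zero[symmetric]
      by (intro integral_mono test_fun_integrable_cgrad[OF g] integrable_mult_right
          Bochner_Integration.integrable_bound[OF test_fun_integrable_cgrad[OF f]])
        (auto simp: indicator_def)
    have r2: "r\<^sup>2 = M powr (2/?N) * V powr (-2/?N) * (t/4) powr (-(q - 2))"
    proof -
      have "r\<^sup>2 = r powr 2" using r by (simp add: powr_numeral)
      also have "\<dots> = (M / (V * (t/4) powr q)) powr (2/?N)" by (simp add: r_def powr_powr)
      also have "\<dots> = M powr (2/?N) / (V powr (2/?N) * (t/4) powr (q * (2/?N)))"
        using M V t by (simp add: powr_divide powr_mult powr_powr)
      also have "q * (2/?N) = q - 2" using q(2) by (simp add: mult.commute)
      finally have e: "r\<^sup>2 = M powr (2/?N) / (V powr (2/?N) * (t/4) powr (q - 2))" .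
      have "V powr (-2/?N) = inverse (V powr (2/?N))" "(t/4) powr (-(q - 2)) = inverse ((t/4) powr (q - 2))"
        using powr_minus[of V "2/?N"] powr_minus[of "t/4" "q - 2"] by simp_all
      then show ?thesis unfolding e by (simp only: divide_inverse inverse_mult_distrib mult.assoc)
    qed
    have "t powr q * measure lborel E = 4 * t powr (q - 2) * (measure lborel E * (t\<^sup>2/4))"
      using t powr_add[of t "q - 2" 2] by (simp add: powr_numeral)
    also have "\<dots> \<le> 4 * t powr (q - 2) * (r\<^sup>2 * (L\<^sup>2 * G))"
      by (intro mult_left_mono order_trans[OF 1] 2) auto
    also have "\<dots> = 4 * (t powr (q - 2) * (t/4) powr (-(q - 2))) * L\<^sup>2 * V powr (-2/?N) * M powr (2/?N) * G"
      unfolding r2 by simp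
    also have "t powr (q - 2) * (t/4) powr (-(q - 2)) = 4 powr (q - 2)"
    proof -
      have "w powr (- (q - 2)) * (4 * w) powr (q - 2) = 4 powr (q - 2)" if "w > 0" for w :: real
        using that unfolding powr_minus by (simp add: powr_mult)
      from this[of "t/4"] show ?thesis using t by (simp add: mult.commute)
    qed
    finally show ?thesis unfolding M_def[symmetric] G_def[symmetric] E_def[symmetric] C_def by simp
  qed
  ultimately show ?thesis by blast
qed

text \<open>The shells are disjoint. The induction needs the sharper right side: the next shell
  starts at \<open>a * 2 ^ m\<close>, above all the earlier ones.\<close>

lemma sum_dyadic_indicator_le_1:
  fixes s :: real
  assumes "a > 0"
  shows "(\<Sum>k<m. if a * 2 ^ k < s \<and> s < 2 * (a * 2 ^ k) then 1 else 0) \<le> (if s < a * 2 ^ m then 1 else 0 :: real)"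
proof (induction m)
  case (Suc m)
  have "a * 2 ^ m > 0" using assms by simp
  then show ?case using Suc by (auto split: if_splits)
qed simp

text \<open>The last level reached already suffices: if \<open>2 a 2^k \<le> s\<close> and
  \<open>s\<close> is below the next level, then \<open>s < 4 a 2^k\<close>.\<close>

lemma powr_le_sum_dyadic:
  fixes s :: real
  assumes "a > 0" "2 * a \<le> s" "s < 2 * a * 2 ^ m" "q > 0"
  shows "s powr q \<le> (\<Sum>k<m. (4 * (a * 2 ^ k)) powr q * (if s \<ge> 2 * (a * 2 ^ k) then 1 else 0))"
  using assms(3)
proof (induction m)
  case (Suc m)
  show ?case
  proof (cases "s < 2 * a * 2 ^ m")
    case True then show ?thesis using Suc by (auto intro: add_increasing2)
  next
    case False
    have "s powr q \<le> (4 * (a * 2 ^ m)) powr q" by (rule powr_mono2) (use Suc assms in auto)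
    moreover have "0 \<le> (\<Sum>k<m. (4 * (a * 2 ^ k)) powr q * (if s \<ge> 2 * (a * 2 ^ k) then 1 else 0))"
      by (intro sum_nonneg) auto
    ultimately show ?thesis using False by (simp add: mult.assoc)
  qed
qed (use assms in auto)

text \<open>Maz'ya's truncation method: the weak-type bounds are summed over dyadic levels. The
  gradients on the disjoint shells add up to at most one Dirichlet integral, and dividing by
  \<open>M powr (2/N)\<close> leaves the exponent 1 - 2/N = 2/q.\<close>

theorem sobolev_inequality:
  assumes "DIM('a::euclidean_space) \<ge> 3"
  defines "q \<equiv> 2 * real DIM('a) / (real DIM('a) - 2)"
  shows "\<exists>C>0. \<forall>f \<in> test_funs (UNIV::'a set). (LINT x|lborel. \<bar>f x\<bar> powr q) powr (2 / q) \<le> C * dirichlet f"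
proof -
  let ?N = "real DIM('a)"
  have N: "?N \<ge> 3" using assms by simp
  have q: "q > 2" "2 / q = 1 - 2 / ?N" using N by (auto simp: q_def field_simps)
  obtain C where C0: "C > 0" and C1: "\<forall>f \<in> test_funs (UNIV::'a set). \<forall>t>0. (LINT x|lborel. \<bar>f x\<bar> powr q) > 0 \<longrightarrow>
    t powr q * measure lborel {x. \<bar>f x\<bar> \<ge> 2 * t} \<le> C * (LINT x|lborel. \<bar>f x\<bar> powr q) powr (2 / ?N) *
      (LINT x|lborel. indicator {x. t < \<bar>f x\<bar> \<and> \<bar>f x\<bar> < 2 * t} x * (norm (cgrad f x))\<^sup>2)"
    using superlevel_bound[OF assms(1)] unfolding q_def[symmetric] by (elim exE conjE)
  note C = C0 C1[rule_format]
  define C2 where "C2 = 2 * 4 powr q * C"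
  have "C2 > 0" using C by (simp add: C2_def)
  moreover have "(LINT x|lborel. \<bar>f x\<bar> powr q) powr (2 / q) \<le> C2 * dirichlet f" if f: "f \<in> test_funs (UNIV::'a set)" for f
  proof -
    define M where "M = (LINT x|lborel. \<bar>f x\<bar> powr q)"
    have [measurable]: "f \<in> borel_measurable borel" "cgrad f \<in> borel_measurable borel"
      using test_fun_borel test_fun_cgrad_borel f by blast+
    have "M \<ge> 0" unfolding M_def by (intro integral_nonneg_AE) auto
    moreover have ?thesis if M: "M > 0"
    proof -
      obtain K where K: "compact K" "\<And>x. x \<notin> K \<Longrightarrow> f x = 0" using test_fun_support[OF f] by metis
      obtain b where b: "b > 0" "\<And>x. \<bar>f x\<bar> \<le> b" using test_fun_bounded[OF f] by metis
      have Kf: "emeasure lborel K < \<infinity>" using emeasure_bounded_finite[OF compact_imp_bounded[OF K(1)]] by simp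
      have [measurable]: "K \<in> sets borel" using K(1) by (simp add: borel_closed compact_imp_closed)
      define \<kappa> where "\<kappa> = measure lborel K + 1"
      have \<kappa>: "\<kappa> > 0" "measure lborel K \<le> \<kappa>" by (auto simp: \<kappa>_def add_nonneg_pos)
      \<comment> \<open>Values below \<open>2 a\<close> contribute at most \<open>M / 2\<close> on
        the support, so they can be absorbed on the left; the summand 1 in \<open>\<kappa>\<close>
        keeps the denominator positive.\<close>
      define a where "a = (M / (2 * \<kappa>)) powr (1/q) / 2"
      have a: "a > 0" using M \<kappa> by (simp add: a_def)
      have "(2 * a) powr q = M / (2 * \<kappa>)" using M \<kappa> q by (simp add: a_def powr_powr)
      then have ak: "(2 * a) powr q * measure lborel K \<le> M / 2"
        using mult_left_mono[OF \<kappa>(2), of "(2 * a) powr q"] \<kappa>(1) M by simp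
      \<comment> \<open>\<open>f\<close> is bounded, so finitely many dyadic levels exhaust its
        range.\<close>
      obtain m where "b / (2 * a) < 2 ^ m" using real_arch_pow[of 2 "b / (2 * a)"] by auto
      then have m: "b < 2 * a * 2 ^ m" using a by (simp add: field_simps)
      define E where "E = (\<lambda>k::nat. {x. \<bar>f x\<bar> \<ge> 2 * (a * 2 ^ k)})"
      define F where "F = (\<lambda>k::nat. {x. a * 2 ^ k < \<bar>f x\<bar> \<and> \<bar>f x\<bar> < 2 * (a * 2 ^ k)})"
      define eE where "eE = (\<lambda>k. indicat_real (E k))"
      define eF where "eF = (\<lambda>k. indicat_real (F k))"
      have EK: "E k \<subseteq> K" for k
      proof
        fix x assume "x \<in> E k"
        moreover have "2 * (a * 2 ^ k) > 0" using a by simp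
        ultimately have "f x \<noteq> 0" by (auto simp: E_def)
        then show "x \<in> K" using K(2) by blast
      qed
      have iE: "integrable lborel (eE k)" for k unfolding eE_def
      proof (rule integrable_real_indicator)
        show "emeasure lborel (E k) < \<infinity>" using emeasure_mono[OF EK, of lborel k] Kf by (auto intro: le_less_trans)
      qed (simp add: E_def)
      have mE: "(LINT x|lborel. eE k x) = measure lborel (E k)" for k by (simp add: eE_def E_def)
      have iF: "integrable lborel (\<lambda>x. eF k x * (norm (cgrad f x))\<^sup>2)" for k
        by (rule Bochner_Integration.integrable_bound[OF test_fun_integrable_cgrad[OF f]]) (auto simp: F_def eF_def indicator_def)
      have pw: "\<bar>f x\<bar> powr q \<le> (2 * a) powr q * indicat_real K x + (\<Sum>k<m. (4 * (a * 2 ^ k)) powr q * eE k x)" for x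
      proof (cases "\<bar>f x\<bar> \<ge> 2 * a")
        case True
        have "\<bar>f x\<bar> powr q \<le> (\<Sum>k<m. (4 * (a * 2 ^ k)) powr q * (if \<bar>f x\<bar> \<ge> 2 * (a * 2 ^ k) then 1 else 0))"
          by (rule powr_le_sum_dyadic[OF a True]) (use b(2)[of x] m q in auto)
        also have "\<dots> = (\<Sum>k<m. (4 * (a * 2 ^ k)) powr q * eE k x)"
          by (intro sum.cong) (auto simp: E_def eE_def indicator_def)
        finally show ?thesis by (simp add: add_increasing)
      next
        case False
        have "\<bar>f x\<bar> powr q \<le> (2 * a) powr q * indicat_real K x"
        proof (cases "x \<in> K")
          case True then show ?thesis using False a q by (auto intro!: powr_mono2)
        qed (use K in auto)
        moreover have "0 \<le> (\<Sum>k<m. (4 * (a * 2 ^ k)) powr q * eE k x)" by (intro sum_nonneg) (auto simp: eE_def)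
        ultimately show ?thesis by linarith
      qed
      have iK: "integrable lborel (indicat_real K)" by (rule integrable_real_indicator) (use Kf in auto)
      have "M \<le> (LINT x|lborel. (2 * a) powr q * indicat_real K x + (\<Sum>k<m. (4 * (a * 2 ^ k)) powr q * eE k x))"
        unfolding M_def by (rule integral_mono) (use test_fun_integrable_powr[OF f] q iE iK pw in auto)
      also have "\<dots> = (2 * a) powr q * measure lborel K + (\<Sum>k<m. (4 * (a * 2 ^ k)) powr q * measure lborel (E k))"
        using iE iK by (simp add: mE)
      finally have "M / 2 \<le> (\<Sum>k<m. (4 * (a * 2 ^ k)) powr q * measure lborel (E k))" using ak by linarith
      also have "\<dots> = (\<Sum>k<m. 4 powr q * ((a * 2 ^ k) powr q * measure lborel (E k)))"
        using a by (intro sum.cong refl) (simp add: powr_mult)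
      also have "\<dots> \<le> (\<Sum>k<m. 4 powr q * (C * M powr (2/?N) * (LINT x|lborel. eF k x * (norm (cgrad f x))\<^sup>2)))"
      proof (intro sum_mono mult_left_mono)
        fix k
        show "(a * 2 ^ k) powr q * measure lborel (E k) \<le> C * M powr (2/?N) * (LINT x|lborel. eF k x * (norm (cgrad f x))\<^sup>2)"
          using C(2)[OF f, of "a * 2 ^ k"] a M unfolding M_def E_def F_def eF_def by simp
      qed auto
      also have "\<dots> = 4 powr q * C * M powr (2/?N) * (LINT x|lborel. (\<Sum>k<m. eF k x * (norm (cgrad f x))\<^sup>2))"
        using iF by (simp add: sum_distrib_left[symmetric] mult.assoc)
      also have "\<dots> \<le> 4 powr q * C * M powr (2/?N) * dirichlet f"
        unfolding dirichlet_def
      proof (intro mult_left_mono integral_mono)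
        fix x
        have "(\<Sum>k<m. eF k x) = (\<Sum>k<m. if a * 2 ^ k < \<bar>f x\<bar> \<and> \<bar>f x\<bar> < 2 * (a * 2 ^ k) then 1 else 0)"
          by (intro sum.cong) (auto simp: F_def eF_def indicator_def)
        also have "\<dots> \<le> 1" using sum_dyadic_indicator_le_1[OF a, where m=m and s="\<bar>f x\<bar>"] by (auto split: if_splits)
        finally show "(\<Sum>k<m. eF k x * (norm (cgrad f x))\<^sup>2) \<le> (norm (cgrad f x))\<^sup>2"
          using mult_right_mono[of "\<Sum>k<m. eF k x" 1 "(norm (cgrad f x))\<^sup>2"] by (simp add: sum_distrib_right)
      qed (use iF test_fun_integrable_cgrad[OF f] C in auto)
      finally have "M \<le> C2 * M powr (2/?N) * dirichlet f" by (simp add: C2_def)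
      then have "M / M powr (2/?N) \<le> C2 * dirichlet f" using M by (simp add: field_simps)
      moreover have "M / M powr (2/?N) = M powr (2/q)" unfolding q(2) using M powr_diff[of M 1 "2/?N"] by simp
      ultimately show ?thesis unfolding M_def by simp
    qed
    moreover have ?thesis if "M = 0" using that C \<open>C2 > 0\<close> dirichlet_nonneg[of f] by (simp add: M_def)
    ultimately show ?thesis by linarith
  qed
  ultimately show ?thesis by blast
qed

section \<open>Compactness\<close>

text \<open>A translation by \<open>2 \<rho>\<close> moves \<open>U\<close> off itself, so the
  squared norm of the increment is exactly twice that of \<open>\<phi>\<close>; the translation
  estimate bounds it from above.\<close>

lemma poincare_inequality:
  fixes \<phi> :: "'a::euclidean_space \<Rightarrow> real"
  assumes "\<phi> \<in> test_funs U" "U \<subseteq> ball 0 \<rho>" "\<rho> > 0"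
  shows "(LINT x|lborel. (\<phi> x)\<^sup>2) \<le> 2 * \<rho>\<^sup>2 * dirichlet \<phi>"
proof -
  obtain b :: 'a where b: "b \<in> Basis" using nonempty_Basis by blast
  define y where "y = (2 * \<rho>) *\<^sub>R b"
  have y: "norm y = 2 * \<rho>" using b assms(3) by (simp add: y_def)
  have z: "\<phi> (x + y) * \<phi> x = 0" for x
  proof (cases "x \<in> U")
    case True
    then have "norm x < \<rho>" using assms by auto
    then have "norm (x + y) > \<rho>" using norm_triangle_ineq2[of y "-x"] y by (simp add: add.commute)
    then have "x + y \<notin> U" using assms by auto
    then show ?thesis using test_fun_vanishes[OF assms(1)] by simp
  qed (use test_fun_vanishes[OF assms(1)] in simp)
  have i: "integrable lborel (\<lambda>x. (\<phi> x)\<^sup>2)" using test_fun_integrable_sq assms by blast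
  have [measurable]: "\<phi> \<in> borel_measurable borel" using test_fun_borel assms by blast
  have "(LINT x|lborel. (\<phi> (x + y) - \<phi> x)\<^sup>2) = (LINT x|lborel. (\<phi> (x + y))\<^sup>2 + (\<phi> x)\<^sup>2)"
    by (intro Bochner_Integration.integral_cong refl) (use z in \<open>simp add: power2_diff\<close>)
  also have "\<dots> = (LINT x|lborel. (\<phi> (x + y))\<^sup>2) + (LINT x|lborel. (\<phi> x)\<^sup>2)"
    by (rule Bochner_Integration.integral_add[OF lborel_integrable_translate[OF i] i])
  also have "\<dots> = 2 * (LINT x|lborel. (\<phi> x)\<^sup>2)"
    using lborel_integral_translate[of "\<lambda>x. (\<phi> x)\<^sup>2" y] by simp
  finally show ?thesis using translation_estimate[OF assms(1), of y] y by (simp add: power_mult_distrib mult.commute)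
qed

text \<open>Cauchy-Schwarz against the constant 1, obtained by expanding the nonnegative integral of
  (m g - c)^2.\<close>

lemma integral_indicator_sq_le:
  fixes g :: "'a::euclidean_space \<Rightarrow> real"
  assumes B: "B \<in> sets borel" "emeasure lborel B < \<infinity>" "measure lborel B > 0"
    and i1: "integrable lborel (\<lambda>y. indicator B y * g y)" and i2: "integrable lborel (\<lambda>y. indicator B y * (g y)\<^sup>2)"
  shows "(LINT y|lborel. indicator B y * g y)\<^sup>2 \<le> measure lborel B * (LINT y|lborel. indicator B y * (g y)\<^sup>2)"
proof -
  define c where "c = (LINT y|lborel. indicator B y * g y)"
  define m where "m = measure lborel B"
  have iB: "integrable lborel (indicat_real B)" using B by simp
  have "0 \<le> (LINT y|lborel. indicator B y * (m * g y - c)\<^sup>2)" by (intro integral_nonneg_AE) auto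
  also have "\<dots> = (LINT y|lborel. m\<^sup>2 * (indicator B y * (g y)\<^sup>2) - 2 * m * c * (indicator B y * g y) + c\<^sup>2 * indicator B y)"
    by (intro Bochner_Integration.integral_cong) (auto simp: power2_eq_square algebra_simps indicator_def)
  also have "\<dots> = m\<^sup>2 * (LINT y|lborel. indicator B y * (g y)\<^sup>2) - 2 * m * c * c + c\<^sup>2 * m"
    using i1 i2 iB B(1) unfolding c_def m_def by simp
  finally have "0 \<le> m * (m * (LINT y|lborel. indicator B y * (g y)\<^sup>2) - c\<^sup>2)" by (simp add: power2_eq_square algebra_simps)
  then have "0 \<le> m * (LINT y|lborel. indicator B y * (g y)\<^sup>2) - c\<^sup>2" using B(3) by (simp add: zero_le_mult_iff m_def)
  then show ?thesis by (simp add: c_def m_def)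
qed

text \<open>The mean over the ball of radius \<open>r\<close> about \<open>x\<close>, up to the
  factor volume. In the compactness proof these functionals take the place of weak
  convergence.\<close>

definition ball_integral :: "real \<Rightarrow> ('a::euclidean_space \<Rightarrow> real) \<Rightarrow> 'a \<Rightarrow> real" where
  "ball_integral r f x = (LINT y|lborel. indicator (ball 0 r) y * f (y + x))"

lemma test_fun_integrable_ball:
  fixes f :: "'a::euclidean_space \<Rightarrow> real"
  assumes "f \<in> test_funs U"
  shows "integrable lborel (\<lambda>y. indicator (ball 0 r) y * f (y + x))"
    "integrable lborel (\<lambda>y. indicator (ball 0 r) y * (f (y + x) - c)\<^sup>2)"
    "integrable lborel (\<lambda>y. indicator (ball 0 r) y * (f (y + x) - f (y + z)))"
    "integrable lborel (\<lambda>y. indicator (ball 0 r) y * (f (y + x) - f (y + z))\<^sup>2)"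
proof -
  let ?B = "ball (0::'a) r"
  have [measurable]: "f \<in> borel_measurable borel" using test_fun_borel assms by blast
  obtain b where b: "b > 0" "\<And>x. \<bar>f x\<bar> \<le> b" using test_fun_bounded[OF assms] by metis
  have iB: "integrable lborel (indicat_real ?B)"
    by (rule integrable_real_indicator) (use emeasure_lborel_ball_finite in auto)
  have *: "integrable lborel (\<lambda>y. indicator ?B y * g y)"
    if [measurable]: "g \<in> borel_measurable borel" and "\<And>y. \<bar>g y\<bar> \<le> C" for g :: "'a \<Rightarrow> real" and C
    by (rule Bochner_Integration.integrable_bound[where f="\<lambda>y. C * indicat_real ?B y"])
       (use integrable_mult_right[OF iB, of C] that(2) in
         \<open>auto simp: indicator_def simp del: mem_ball mem_ball_0 intro: order_trans[OF _ abs_ge_self]\<close>)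
  have sq: "\<bar>s\<^sup>2\<bar> \<le> C\<^sup>2" if "\<bar>s\<bar> \<le> C" for s C :: real using power_mono[OF that, of 2] by simp
  have d: "\<bar>f (y + x) - f (y + z)\<bar> \<le> 2 * b" for y using b(2)[of "y + x"] b(2)[of "y + z"] by linarith
  have e: "\<bar>f (y + x) - c\<bar> \<le> b + \<bar>c\<bar>" for y using b(2)[of "y + x"] by linarith
  show "integrable lborel (\<lambda>y. indicator ?B y * f (y + x))" by (rule *[of _ b]) (use b in auto)
  show "integrable lborel (\<lambda>y. indicator ?B y * (f (y + x) - c)\<^sup>2)" by (rule *[OF _ sq[OF e]]) simp
  show "integrable lborel (\<lambda>y. indicator ?B y * (f (y + x) - f (y + z)))" by (rule *[OF _ d]) simp
  show "integrable lborel (\<lambda>y. indicator ?B y * (f (y + x) - f (y + z))\<^sup>2)" by (rule *[OF _ sq[OF d]]) simp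
qed

lemma ball_integral_bound:
  fixes f :: "'a::euclidean_space \<Rightarrow> real"
  assumes f: "f \<in> test_funs U" and r: "r > 0"
  shows "(ball_integral r f x)\<^sup>2 \<le> measure lborel (ball (0::'a) r) * (LINT y|lborel. (f y)\<^sup>2)"
proof -
  let ?B = "ball (0::'a) r"
  have [measurable]: "f \<in> borel_measurable borel" using test_fun_borel assms by blast
  have i: "integrable lborel (\<lambda>x. (f x)\<^sup>2)" using test_fun_integrable_sq f by blast
  note j = test_fun_integrable_ball(2)[OF f, where c=0, simplified]
  have "(ball_integral r f x)\<^sup>2 \<le> measure lborel ?B * (LINT y|lborel. indicator ?B y * (f (y + x))\<^sup>2)"
    unfolding ball_integral_def
    by (rule integral_indicator_sq_le) (use r emeasure_lborel_ball_finite test_fun_integrable_ball[OF f] j in auto)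
  also have "\<dots> \<le> measure lborel ?B * (LINT y|lborel. (f (y + x))\<^sup>2)"
    by (intro mult_left_mono integral_mono j lborel_integrable_translate[OF i]) (auto simp: indicator_def)
  also have "\<dots> = measure lborel ?B * (LINT y|lborel. (f y)\<^sup>2)"
    using lborel_integral_translate[of "\<lambda>x. (f x)\<^sup>2" x] by simp
  finally show ?thesis .
qed

text \<open>The difference of two ball integrals is the integral of one increment over the ball, so
  the translation estimate gives a modulus of continuity depending only on \<open>r\<close> and the
  Dirichlet integral.\<close>

lemma ball_integral_lipschitz:
  fixes f :: "'a::euclidean_space \<Rightarrow> real"
  assumes f: "f \<in> test_funs U" and r: "r > 0"
  shows "(ball_integral r f x - ball_integral r f z)\<^sup>2 \<le> measure lborel (ball (0::'a) r) * ((norm (x - z))\<^sup>2 * dirichlet f)"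
proof -
  let ?B = "ball (0::'a) r"
  have [measurable]: "f \<in> borel_measurable borel" using test_fun_borel assms by blast
  have s: "(\<lambda>y. (f (y + x) - f (y + z))\<^sup>2) = (\<lambda>y. (\<lambda>w. (f (w + (x - z)) - f w)\<^sup>2) (y + z))"
    by (simp add: algebra_simps)
  have i0: "integrable lborel (\<lambda>w. (f (w + (x - z)) - f w)\<^sup>2)"
  proof (rule Bochner_Integration.integrable_bound[where f="\<lambda>w. 2 * (f (w + (x - z)))\<^sup>2 + 2 * (f w)\<^sup>2"])
    have i: "integrable lborel (\<lambda>x. (f x)\<^sup>2)" using test_fun_integrable_sq f by blast
    show "integrable lborel (\<lambda>w. 2 * (f (w + (x - z)))\<^sup>2 + 2 * (f w)\<^sup>2)"
      using i lborel_integrable_translate[OF i] by auto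
    have "(a - b)\<^sup>2 \<le> 2 * a\<^sup>2 + 2 * b\<^sup>2" for a b :: real
      using zero_le_power2[of "a + b"] by (simp add: power2_eq_square algebra_simps)
    then show "AE w in lborel. norm ((f (w + (x - z)) - f w)\<^sup>2) \<le> norm (2 * (f (w + (x - z)))\<^sup>2 + 2 * (f w)\<^sup>2)"
      by (intro AE_I2) simp
  qed simp
  have "ball_integral r f x - ball_integral r f z = (LINT y|lborel. indicator ?B y * f (y + x) - indicator ?B y * f (y + z))"
    unfolding ball_integral_def by (intro Bochner_Integration.integral_diff[symmetric] test_fun_integrable_ball[OF f])
  also have "\<dots> = (LINT y|lborel. indicator ?B y * (f (y + x) - f (y + z)))" by (simp add: right_diff_distrib)
  finally have "(ball_integral r f x - ball_integral r f z)\<^sup>2 = (LINT y|lborel. indicator ?B y * (f (y + x) - f (y + z)))\<^sup>2" by simp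
  also have "\<dots> \<le> measure lborel ?B * (LINT y|lborel. indicator ?B y * (f (y + x) - f (y + z))\<^sup>2)"
    by (rule integral_indicator_sq_le) (use r emeasure_lborel_ball_finite test_fun_integrable_ball[OF f] in auto)
  also have "\<dots> \<le> measure lborel ?B * (LINT y|lborel. (f (y + x) - f (y + z))\<^sup>2)"
  proof (intro mult_left_mono integral_mono test_fun_integrable_ball[OF f])
    show "integrable lborel (\<lambda>y. (f (y + x) - f (y + z))\<^sup>2)"
      unfolding s by (rule lborel_integrable_translate[OF i0])
  qed (auto simp: indicator_def)
  also have "\<dots> = measure lborel ?B * (LINT w|lborel. (f (w + (x - z)) - f w)\<^sup>2)"
    unfolding s by (subst lborel_integral_translate) simp_all
  also have "\<dots> \<le> measure lborel ?B * ((norm (x - z))\<^sup>2 * dirichlet f)"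
    by (intro mult_left_mono translation_estimate[OF f]) simp
  finally show ?thesis .
qed

text \<open>In L2, \<open>f\<close> differs from its means over balls of radius \<open>r\<close> by
  at most \<open>r\<close> times the root of the Dirichlet integral, because the mean is the best
  approximating constant; small means therefore give a small norm.\<close>

lemma L2_bound_by_ball_integrals:
  fixes f :: "'a::euclidean_space \<Rightarrow> real"
  assumes f: "f \<in> test_funs U" and r: "r > 0" and U: "U \<in> sets borel" "emeasure lborel U < \<infinity>"
    and a: "\<And>x. x \<in> U \<Longrightarrow> \<bar>ball_integral r f x\<bar> \<le> a * measure lborel (ball (0::'a) r)"
  shows "(LINT x|lborel. (f x)\<^sup>2) \<le> 2 * r\<^sup>2 * dirichlet f + 2 * a\<^sup>2 * measure lborel U"
proof -
  let ?B = "ball (0::'a) r"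
  define m where "m = measure lborel ?B"
  have m: "m > 0" using r by (simp add: m_def)
  have em: "emeasure lborel ?B = ennreal m" unfolding m_def
    by (rule emeasure_eq_ennreal_measure) (use emeasure_lborel_ball_finite[of "0::'a" r] in auto)
  have [measurable]: "f \<in> borel_measurable borel" "?B \<in> sets borel" using test_fun_borel f by auto
  note [measurable] = U(1)
  have iB: "integrable lborel (indicat_real ?B)"
    by (rule integrable_real_indicator) (use emeasure_lborel_ball_finite in auto)
  have pw: "ennreal (m * (f x)\<^sup>2) \<le> (\<integral>\<^sup>+y. indicator ?B y * ennreal (2 * (f (x + y) - f x)\<^sup>2) \<partial>lborel) + ennreal (2 * m * a\<^sup>2) * indicator U x" for x
  proof (cases "x \<in> U")
    case True
    define c where "c = ball_integral r f x / m"
    have c: "c\<^sup>2 \<le> a\<^sup>2"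
    proof -
      have "\<bar>c\<bar> \<le> a" using a[OF True] m by (simp add: c_def m_def[symmetric] field_simps)
      then show ?thesis using power_mono[of "\<bar>c\<bar>" a 2] by simp
    qed
    note i = test_fun_integrable_ball(1)[OF f, of r x] test_fun_integrable_ball(2)[OF f, of r x "f x"]
    have "0 \<le> (LINT y|lborel. indicator ?B y * (f (y + x) - c)\<^sup>2)" by (intro integral_nonneg_AE) auto
    \<comment> \<open>\<open>c\<close> is the mean of \<open>f\<close> over the ball, so this leads
      to the variance identity: replacing the centre \<open>c\<close> by \<open>f x\<close> adds m
      (f x - c)^2.\<close>
    also have "\<dots> = (LINT y|lborel. indicator ?B y * (f (y + x) - f x)\<^sup>2 + 2 * (f x - c) * (indicator ?B y * f (y + x)) + (c\<^sup>2 - (f x)\<^sup>2) * indicator ?B y)"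
      by (intro Bochner_Integration.integral_cong) (auto simp: power2_eq_square algebra_simps indicator_def)
    also have "\<dots> = (LINT y|lborel. indicator ?B y * (f (y + x) - f x)\<^sup>2) + 2 * (f x - c) * (c * m) + (c\<^sup>2 - (f x)\<^sup>2) * m"
      using i iB m by (simp add: ball_integral_def[symmetric] m_def[symmetric] c_def)
    also have "\<dots> = (LINT y|lborel. indicator ?B y * (f (y + x) - f x)\<^sup>2) - m * (f x - c)\<^sup>2"
      by (simp add: power2_eq_square algebra_simps)
    finally have 1: "m * (f x - c)\<^sup>2 \<le> (LINT y|lborel. indicator ?B y * (f (y + x) - f x)\<^sup>2)" by simp
    have "(f x)\<^sup>2 \<le> 2 * (f x - c)\<^sup>2 + 2 * c\<^sup>2"
      using zero_le_power2[of "f x - 2 * c"] by (simp add: power2_eq_square algebra_simps)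
    then have "m * (f x)\<^sup>2 \<le> m * (2 * (f x - c)\<^sup>2 + 2 * a\<^sup>2)" using c m by (intro mult_left_mono) auto
    then have "m * (f x)\<^sup>2 \<le> 2 * (LINT y|lborel. indicator ?B y * (f (y + x) - f x)\<^sup>2) + 2 * m * a\<^sup>2"
      using 1 by (simp add: algebra_simps)
    then have 2: "m * (f x)\<^sup>2 \<le> (LINT y|lborel. indicator ?B y * (2 * (f (y + x) - f x)\<^sup>2)) + 2 * m * a\<^sup>2"
      using i(2) by (simp add: mult.left_commute)
    have "ennreal (LINT y|lborel. indicator ?B y * (2 * (f (y + x) - f x)\<^sup>2)) = (\<integral>\<^sup>+y. ennreal (indicator ?B y * (2 * (f (y + x) - f x)\<^sup>2)) \<partial>lborel)"
      by (rule nn_integral_eq_integral[symmetric]) (use i(2) in \<open>auto simp: mult.left_commute\<close>)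
    also have "\<dots> = (\<integral>\<^sup>+y. indicator ?B y * ennreal (2 * (f (x + y) - f x)\<^sup>2) \<partial>lborel)"
      by (intro nn_integral_cong) (auto simp: indicator_def add.commute)
    finally have 3: "ennreal (LINT y|lborel. indicator ?B y * (2 * (f (y + x) - f x)\<^sup>2)) = (\<integral>\<^sup>+y. indicator ?B y * ennreal (2 * (f (x + y) - f x)\<^sup>2) \<partial>lborel)" .
    have "ennreal (m * (f x)\<^sup>2) \<le> ennreal ((LINT y|lborel. indicator ?B y * (2 * (f (y + x) - f x)\<^sup>2)) + 2 * m * a\<^sup>2)"
      using 2 by (rule ennreal_leI)
    also have "\<dots> = ennreal (LINT y|lborel. indicator ?B y * (2 * (f (y + x) - f x)\<^sup>2)) + ennreal (2 * m * a\<^sup>2)"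
      by (rule ennreal_plus) (use m in \<open>auto intro!: integral_nonneg_AE\<close>)
    finally show ?thesis unfolding 3 using True by simp
  qed (use test_fun_vanishes[OF f] in simp)
  have "ennreal (m * (LINT x|lborel. (f x)\<^sup>2)) = (\<integral>\<^sup>+x. ennreal (m * (f x)\<^sup>2) \<partial>lborel)"
    using test_fun_integrable_sq[OF f] m by (subst nn_integral_eq_integral) auto
  also have "\<dots> \<le> (\<integral>\<^sup>+x. ((\<integral>\<^sup>+y. indicator ?B y * ennreal (2 * (f (x + y) - f x)\<^sup>2) \<partial>lborel) + ennreal (2 * m * a\<^sup>2) * indicator U x) \<partial>lborel)"
    by (rule nn_integral_mono) (rule pw)
  also have "\<dots> = (\<integral>\<^sup>+x. (\<integral>\<^sup>+y. indicator ?B y * ennreal (2 * (f (x + y) - f x)\<^sup>2) \<partial>lborel) \<partial>lborel) + (\<integral>\<^sup>+x. ennreal (2 * m * a\<^sup>2) * indicator U x \<partial>lborel)"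
    by (rule nn_integral_add) measurable
  also have "(\<integral>\<^sup>+x. (\<integral>\<^sup>+y. indicator ?B y * ennreal (2 * (f (x + y) - f x)\<^sup>2) \<partial>lborel) \<partial>lborel) =
     (\<integral>\<^sup>+y. (\<integral>\<^sup>+x. indicator ?B y * ennreal (2 * (f (x + y) - f x)\<^sup>2) \<partial>lborel) \<partial>lborel)"
    by (rule lborel_pair.Fubini') measurable
  also have "\<dots> \<le> (\<integral>\<^sup>+y. indicator ?B y * ennreal (2 * r\<^sup>2 * dirichlet f) \<partial>lborel)"
  proof (rule nn_integral_mono)
    fix y :: 'a
    have "(\<integral>\<^sup>+x. indicator ?B y * ennreal (2 * (f (x + y) - f x)\<^sup>2) \<partial>lborel) = indicator ?B y * (ennreal 2 * (\<integral>\<^sup>+x. ennreal ((f (x + y) - f x)\<^sup>2) \<partial>lborel))"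
      by (subst nn_integral_cmult[symmetric], measurable, subst nn_integral_cmult[symmetric], measurable)
         (auto simp: ennreal_mult')
    also have "\<dots> \<le> indicator ?B y * ennreal (2 * r\<^sup>2 * dirichlet f)"
    proof (cases "y \<in> ?B")
      case True
      have "(norm y)\<^sup>2 * dirichlet f \<le> r\<^sup>2 * dirichlet f"
        by (intro mult_right_mono power_mono) (use True dirichlet_nonneg in auto)
      then have "(\<integral>\<^sup>+x. ennreal ((f (x + y) - f x)\<^sup>2) \<partial>lborel) \<le> ennreal (r\<^sup>2 * dirichlet f)"
        using nn_translation_estimate[OF f, of y] by (auto intro: order_trans ennreal_leI)
      then have "ennreal 2 * (\<integral>\<^sup>+x. ennreal ((f (x + y) - f x)\<^sup>2) \<partial>lborel) \<le> ennreal 2 * ennreal (r\<^sup>2 * dirichlet f)"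
        by (rule mult_left_mono) simp
      also have "\<dots> = ennreal (2 * r\<^sup>2 * dirichlet f)" 
        by (subst ennreal_mult'[symmetric]) (simp_all add: mult.assoc)
      finally show ?thesis using True by simp
    qed simp
    finally show "(\<integral>\<^sup>+x. indicator ?B y * ennreal (2 * (f (x + y) - f x)\<^sup>2) \<partial>lborel) \<le> indicator ?B y * ennreal (2 * r\<^sup>2 * dirichlet f)" .
  qed
  also have "(\<integral>\<^sup>+y. indicator ?B y * ennreal (2 * r\<^sup>2 * dirichlet f) \<partial>lborel) = ennreal (m * (2 * r\<^sup>2 * dirichlet f))"
    using m by (subst nn_integral_multc) (auto simp: em ennreal_mult' dirichlet_nonneg)
  also have "(\<integral>\<^sup>+x. ennreal (2 * m * a\<^sup>2) * indicator U x \<partial>lborel) = ennreal (2 * m * a\<^sup>2 * measure lborel U)"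
    using m U by (simp add: nn_integral_cmult_indicator emeasure_eq_ennreal_measure less_top ennreal_mult')
  also have "ennreal (m * (2 * r\<^sup>2 * dirichlet f)) + ennreal (2 * m * a\<^sup>2 * measure lborel U) = ennreal (m * (2 * r\<^sup>2 * dirichlet f + 2 * a\<^sup>2 * measure lborel U))"
    using m by (subst ennreal_plus[symmetric]) (auto simp: dirichlet_nonneg algebra_simps)
  finally have "ennreal (m * (LINT x|lborel. (f x)\<^sup>2)) \<le> ennreal (m * (2 * r\<^sup>2 * dirichlet f + 2 * a\<^sup>2 * measure lborel U))"
    by (simp add: add_right_mono)
  then have "m * (LINT x|lborel. (f x)\<^sup>2) \<le> m * (2 * r\<^sup>2 * dirichlet f + 2 * a\<^sup>2 * measure lborel U)"
    using m by (subst (asm) ennreal_le_iff) (auto simp: dirichlet_nonneg)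
  then show ?thesis using m by simp
qed

lemma diagonal_convergent_subsequence:
  fixes F :: "nat \<Rightarrow> nat \<Rightarrow> real"
  assumes "\<And>i. bounded (range (F i))"
  obtains s :: "nat \<Rightarrow> nat" where "strict_mono s" "\<And>i. convergent (\<lambda>n. F i (s n))"
proof -
  interpret D: subseqs "\<lambda>i s. convergent (\<lambda>n. F i (s n))"
  proof
    fix i and s :: "nat \<Rightarrow> nat" assume "strict_mono s"
    have "bounded (range (\<lambda>n. F i (s n)))" by (rule bounded_subset[OF assms[of i]]) auto
    then obtain l r where "strict_mono r" "((\<lambda>n. F i (s n)) \<circ> r) \<longlonglongrightarrow> l"
      using bounded_imp_convergent_subsequence by blast
    then show "\<exists>r'. strict_mono r' \<and> convergent (\<lambda>n. F i ((s \<circ> r') n))"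
      by (auto simp: convergent_def o_def)
  qed
  have "convergent (\<lambda>n. F i (D.diagseq n))" for i
  proof -
    have "convergent (\<lambda>n. F i ((D.diagseq \<circ> (+) (Suc i)) n))"
    proof (rule D.diagseq_holds)
      fix r s :: "nat \<Rightarrow> nat" and n assume "strict_mono r" "convergent (\<lambda>k. F n (s k))"
      then show "convergent (\<lambda>k. F n ((s \<circ> r) k))"
        using LIMSEQ_subseq_LIMSEQ[of "\<lambda>k. F n (s k)" _ r] by (auto simp: convergent_def o_def)
    qed
    then obtain l where "(\<lambda>n. F i (D.diagseq (n + Suc i))) \<longlonglongrightarrow> l" by (auto simp: convergent_def add.commute)
    then have "(\<lambda>n. F i (D.diagseq n)) \<longlonglongrightarrow> l" by (rule LIMSEQ_offset)
    then show ?thesis by (auto simp: convergent_def)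
  qed
  then show thesis using that[OF D.subseq_diagseq] by blast
qed

text \<open>Ball integrals with radii 1/(i+1) about a countable dense set of centres are countably
  many bounded sequences, and a diagonal subsequence makes all of them converge. For a given
  tolerance one small radius and, by compactness and the Lipschitz bound, finitely many centres
  control the L2 norm of differences.\<close>

theorem rellich_compactness:
  fixes \<phi> :: "nat \<Rightarrow> 'a::euclidean_space \<Rightarrow> real"
  assumes \<phi>: "\<And>n. \<phi> n \<in> test_funs U" and U: "U \<in> sets borel" "U \<subseteq> ball 0 \<rho>" "\<rho> > 0"
    and K: "\<And>n. dirichlet (\<phi> n) \<le> K"
  obtains s :: "nat \<Rightarrow> nat" where "strict_mono s"
    "\<And>\<epsilon>. \<epsilon> > 0 \<Longrightarrow> \<exists>n0. \<forall>m\<ge>n0. \<forall>n\<ge>n0. (LINT x|lborel. (\<phi> (s m) x - \<phi> (s n) x)\<^sup>2) < \<epsilon>"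
proof -
  obtain D :: "'a set" where D: "countable D" "\<And>X. open X \<Longrightarrow> X \<noteq> {} \<Longrightarrow> \<exists>d\<in>D. d \<in> X" by (rule countable_dense_setE) blast
  have Dne: "D \<noteq> {}" using D(2)[of UNIV] by auto
  define d where "d = from_nat_into D"
  have d: "range d = D" unfolding d_def by (rule range_from_nat_into[OF Dne D(1)])
  have K0: "K \<ge> 0" using K[of 0] dirichlet_nonneg[of "\<phi> 0"] by linarith
  define F where "F = (\<lambda>k n. ball_integral (1 / real (Suc (fst (prod_decode k)))) (\<phi> n) (d (snd (prod_decode k))))"
  have "bounded (range (F k))" for k
  proof -
    define r where "r = 1 / real (Suc (fst (prod_decode k)))"
    have r: "r > 0" by (simp add: r_def)
    have "\<bar>F k n\<bar> \<le> sqrt (measure lborel (ball (0::'a) r) * (2 * \<rho>\<^sup>2 * K))" for n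
    proof -
      have "(F k n)\<^sup>2 \<le> measure lborel (ball (0::'a) r) * (LINT y|lborel. (\<phi> n y)\<^sup>2)"
        unfolding F_def r_def[symmetric] by (rule ball_integral_bound[OF \<phi> r])
      also have "\<dots> \<le> measure lborel (ball (0::'a) r) * (2 * \<rho>\<^sup>2 * K)"
        by (intro mult_left_mono order_trans[OF poincare_inequality[OF \<phi> U(2,3)]]) (use K in auto)
      finally show ?thesis by (simp add: real_le_rsqrt flip: real_sqrt_abs)
    qed
    then show ?thesis by (auto simp: bounded_iff)
  qed
  then obtain s where s: "strict_mono s" "\<And>k. convergent (\<lambda>n. F k (s n))"
    using diagonal_convergent_subsequence by blast
  have Uf: "emeasure lborel U < \<infinity>"
    by (rule emeasure_bounded_finite) (use U bounded_subset[OF bounded_ball] in auto)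
  have "\<exists>n0. \<forall>m\<ge>n0. \<forall>n\<ge>n0. (LINT x|lborel. (\<phi> (s m) x - \<phi> (s n) x)\<^sup>2) < \<epsilon>" if \<epsilon>: "\<epsilon> > 0" for \<epsilon>
  proof -
    define \<mu> where "\<mu> = measure lborel U"
    have \<mu>: "\<mu> \<ge> 0" by (simp add: \<mu>_def)
    \<comment> \<open>Differences have Dirichlet integral at most \<open>4 K\<close> by the
      parallelogram law, so a radius below \<open>e\<close> makes the gradient term at most
      \<open>\<epsilon>/2\<close>.\<close>
    define e where "e = sqrt (\<epsilon> / (16 * (K + 1)))"
    have e: "e > 0" using \<epsilon> K0 by (simp add: e_def)
    obtain i where i: "1 / real (Suc i) < e" using nat_approx_posE[OF e] by metis
    define r where "r = 1 / real (Suc i)"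
    have r: "r > 0" by (simp add: r_def)
    have r2: "2 * r\<^sup>2 * (4 * K) \<le> \<epsilon> / 2"
    proof -
      have "r\<^sup>2 \<le> e\<^sup>2" using i r by (intro power_mono) (auto simp: r_def)
      also have "e\<^sup>2 = \<epsilon> / (16 * (K + 1))" using \<epsilon> K0 by (simp add: e_def)
      finally have "r\<^sup>2 * (16 * (K + 1)) \<le> \<epsilon>" using K0 by (simp add: field_simps)
      then have "16 * (r\<^sup>2 * K) + 16 * r\<^sup>2 \<le> \<epsilon>" by (simp add: algebra_simps)
      then show ?thesis using zero_le_power2[of r] by linarith
    qed
    define a where "a = sqrt (\<epsilon> / (8 * (\<mu> + 1)))"
    have a: "a > 0" using \<epsilon> \<mu> by (simp add: a_def)
    have a2: "2 * a\<^sup>2 * \<mu> < \<epsilon> / 2"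
    proof -
      have "a\<^sup>2 = \<epsilon> / (8 * (\<mu> + 1))" using \<epsilon> \<mu> by (simp add: a_def)
      then have "8 * (a\<^sup>2 * \<mu>) + 8 * a\<^sup>2 = \<epsilon>" using \<mu> by (simp add: field_simps)
      moreover have "a\<^sup>2 * \<mu> \<ge> 0" using \<mu> by simp
      ultimately show ?thesis using a zero_less_power[OF a, of 2] \<epsilon> by linarith
    qed
    define w where "w = measure lborel (ball (0::'a) r)"
    have w: "w > 0" using r by (simp add: w_def)
    \<comment> \<open>Chosen so that moving the centre by less than \<open>\<delta>\<close> changes
      a ball integral by at most \<open>a w / 2\<close>.\<close>
    define \<delta> where "\<delta> = a * w / (2 * sqrt (w * (4 * K + 1)))"
    have \<delta>: "\<delta> > 0" using a w K0 by (simp add: \<delta>_def)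
    have "compact (closure U)" using U bounded_subset[OF bounded_ball] by auto
    moreover have "closure U \<subseteq> (\<Union>j. ball (d j) \<delta>)"
    proof
      fix x assume "x \<in> closure U"
      obtain z where "z \<in> D" "z \<in> ball x \<delta>" using D(2)[of "ball x \<delta>"] \<delta> by auto
      then obtain j where "z = d j" using d by auto
      then show "x \<in> (\<Union>j. ball (d j) \<delta>)" using \<open>z \<in> ball x \<delta>\<close> by (auto simp: dist_commute)
    qed
    ultimately obtain J where J: "finite J" "closure U \<subseteq> (\<Union>j\<in>J. ball (d j) \<delta>)"
      using compactE_image[of "closure U" UNIV "\<lambda>j. ball (d j) \<delta>"] by auto
    have "\<forall>\<^sub>F p in sequentially \<times>\<^sub>F sequentially. \<forall>j\<in>J. \<bar>F (prod_encode (i, j)) (s (fst p)) - F (prod_encode (i, j)) (s (snd p))\<bar> < a * w / 2"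
    proof (subst eventually_ball_finite_distrib[OF J(1)], rule ballI)
      fix j
      have "Cauchy (\<lambda>n. F (prod_encode (i, j)) (s n))" using s(2) by (rule convergent_Cauchy)
      moreover have "a * w / 2 > 0" using a w by simp
      ultimately obtain n0 where n0: "\<forall>m\<ge>n0. \<forall>n\<ge>n0. dist (F (prod_encode (i, j)) (s m)) (F (prod_encode (i, j)) (s n)) < a * w / 2"
        using metric_CauchyD by blast
      show "\<forall>\<^sub>F p in sequentially \<times>\<^sub>F sequentially. \<bar>F (prod_encode (i, j)) (s (fst p)) - F (prod_encode (i, j)) (s (snd p))\<bar> < a * w / 2"
        by (rule eventually_mono[OF eventually_prodI[OF eventually_ge_at_top[of n0] eventually_ge_at_top[of n0]]]) (use n0 in \<open>auto simp: dist_real_def\<close>)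
    qed
    then obtain n0 where n0: "\<And>m n j. m \<ge> n0 \<Longrightarrow> n \<ge> n0 \<Longrightarrow> j \<in> J \<Longrightarrow> \<bar>F (prod_encode (i, j)) (s m) - F (prod_encode (i, j)) (s n)\<bar> < a * w / 2"
      unfolding eventually_prod_sequentially by auto
    have "(LINT x|lborel. (\<phi> (s m) x - \<phi> (s n) x)\<^sup>2) < \<epsilon>" if mn: "m \<ge> n0" "n \<ge> n0" for m n
    proof -
      define f where "f = (\<lambda>x. \<phi> (s m) x - \<phi> (s n) x)"
      have f: "f \<in> test_funs U" unfolding f_def by (rule test_fun_diff[OF \<phi> \<phi>])
      have Df: "dirichlet f \<le> 4 * K"
        using dirichlet_parallelogram[OF \<phi>[of "s m"] \<phi>[of "s n"]] K[of "s m"] K[of "s n"]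
          dirichlet_nonneg[of "\<lambda>x. \<phi> (s m) x + \<phi> (s n) x"] unfolding f_def by linarith
      have "\<bar>ball_integral r f x\<bar> \<le> a * measure lborel (ball (0::'a) r)" if x: "x \<in> U" for x
      proof -
        have "x \<in> (\<Union>j\<in>J. ball (d j) \<delta>)" using x J(2) closure_subset[of U] by blast
        then obtain j where j: "j \<in> J" "dist (d j) x < \<delta>" by auto
        have "ball_integral r f (d j) = F (prod_encode (i, j)) (s m) - F (prod_encode (i, j)) (s n)"
          unfolding F_def f_def ball_integral_def r_def
          using test_fun_integrable_ball(1)[OF \<phi>, where x="d j"]
          by (simp add: right_diff_distrib)
        then have 1: "\<bar>ball_integral r f (d j)\<bar> < a * w / 2" using n0[OF mn j(1)] by simp
        have "(ball_integral r f x - ball_integral r f (d j))\<^sup>2 \<le> w * ((norm (x - d j))\<^sup>2 * dirichlet f)"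
          unfolding w_def by (rule ball_integral_lipschitz[OF f r])
        also have "\<dots> \<le> w * (\<delta>\<^sup>2 * (4 * K + 1))"
          using w j Df dirichlet_nonneg[of f] by (intro mult_left_mono mult_mono power_mono) (auto simp: dist_norm norm_minus_commute)
        also have "\<dots> = (\<delta> * sqrt (w * (4 * K + 1)))\<^sup>2" using w K0 by (simp add: power_mult_distrib)
        also have "\<delta> * sqrt (w * (4 * K + 1)) = a * w / 2" using w K0 by (simp add: \<delta>_def)
        finally have "\<bar>ball_integral r f x - ball_integral r f (d j)\<bar> \<le> a * w / 2"
          using abs_le_square_iff[of "ball_integral r f x - ball_integral r f (d j)" "a * w / 2"] a w by simp
        then have "\<bar>ball_integral r f x\<bar> \<le> a * w" using 1 by linarith
        then show ?thesis by (simp add: w_def)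
      qed
      then have "(LINT x|lborel. (f x)\<^sup>2) \<le> 2 * r\<^sup>2 * dirichlet f + 2 * a\<^sup>2 * measure lborel U"
        by (rule L2_bound_by_ball_integrals[OF f r U(1) Uf])
      also have "2 * r\<^sup>2 * dirichlet f \<le> 2 * r\<^sup>2 * (4 * K)" using Df by (intro mult_left_mono) auto
      finally show ?thesis using r2 a2 by (simp add: \<mu>_def f_def)
    qed
    then show ?thesis by blast
  qed
  then show thesis using that s(1) by blast
qed

text \<open>The powers t^p and \<epsilon> t^q cross at \<open>T\<close>: above it the critical power
  dominates, below it t^(p-2) is bounded.\<close>

lemma powr_interpolation:
  fixes p q \<epsilon> :: real
  assumes "2 < p" "p < q" "\<epsilon> > 0"
  obtains C where "C > 0" "\<And>t. t \<ge> 0 \<Longrightarrow> t powr p \<le> \<epsilon> * t powr q + C * t\<^sup>2"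
proof -
  define T where "T = (1 / \<epsilon>) powr (1 / (q - p))"
  have T: "T > 0" using assms by (simp add: T_def)
  have TT: "T powr (q - p) = 1 / \<epsilon>" using assms by (simp add: T_def powr_powr)
  have "t powr p \<le> \<epsilon> * t powr q + T powr (p - 2) * t\<^sup>2" if t: "t \<ge> 0" for t
  proof (cases "t = 0")
    case False
    then have t0: "t > 0" using t by simp
    show ?thesis
    proof (cases "t \<le> T")
      case True
      have "t powr p = t powr (p - 2) * t\<^sup>2" using t0 powr_add[of t "p - 2" 2] by simp
      also have "\<dots> \<le> T powr (p - 2) * t\<^sup>2" using True t0 assms by (intro mult_right_mono powr_mono2) auto
      finally show ?thesis using assms t0 by (simp add: add_increasing)
    next
      case False
      have "T powr (q - p) \<le> t powr (q - p)" using False T assms by (intro powr_mono2) auto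
      then have "1 \<le> \<epsilon> * t powr (q - p)" using TT assms by (simp add: field_simps)
      then have "t powr p * 1 \<le> t powr p * (\<epsilon> * t powr (q - p))" by (intro mult_left_mono) auto
      also have "\<dots> = \<epsilon> * t powr q" using t0 powr_add[of t p "q - p"] by simp
      finally show ?thesis using T by (simp add: add_increasing2)
    qed
  qed simp
  then show thesis using that[of "T powr (p - 2)"] T by simp
qed

lemma powr_le_critical_plus_square:
  fixes p q t :: real
  assumes "2 < p" "p < q" "t \<ge> 0" shows "t powr p \<le> t powr q + t\<^sup>2"
proof (cases "t \<le> 1")
  case True
  then have "t powr p \<le> t powr 2" using assms by (intro powr_mono') auto
  then show ?thesis using assms by (simp add: add_increasing)
next
  case False
  then have "t powr p \<le> t powr q" using assms by (intro powr_mono) auto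
  then show ?thesis by (simp add: add_increasing2)
qed

section \<open>Convergence in \<open>L\<^sup>2\<close> and \<open>L\<^sup>p\<close>\<close>

lemma norm_sq_diff_le:
  fixes a b :: "'b::real_inner"
  shows "(norm (a - b))\<^sup>2 \<le> 2 * (norm a)\<^sup>2 + 2 * (norm b)\<^sup>2"
  using zero_le_power2[of "norm (a + b)"] by (simp add: power2_norm_eq_inner inner_simps inner_commute)

lemma norm_sq_close:
  fixes a b :: "'b::real_inner"
  assumes "\<epsilon> > 0"
  shows "\<bar>(norm a)\<^sup>2 - (norm b)\<^sup>2\<bar> \<le> \<epsilon> * (norm b)\<^sup>2 + (1 + 1 / \<epsilon>) * (norm (a - b))\<^sup>2"
proof -
  define d where "d = norm (a - b)"
  have "(norm a)\<^sup>2 - (norm b)\<^sup>2 = (norm (a - b))\<^sup>2 + 2 * (b \<bullet> (a - b))"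
    by (simp add: power2_norm_eq_inner inner_simps inner_commute)
  then have "\<bar>(norm a)\<^sup>2 - (norm b)\<^sup>2\<bar> \<le> d\<^sup>2 + 2 * (norm b * d)"
    using Cauchy_Schwarz_ineq2[of b "a - b"] zero_le_power2[of "norm (a - b)"] unfolding d_def by linarith
  moreover have "2 * (norm b * d) \<le> \<epsilon> * (norm b)\<^sup>2 + d\<^sup>2 / \<epsilon>"
  proof -
    have "0 \<le> (\<epsilon> * norm b - d)\<^sup>2 / \<epsilon>" using assms by simp
    also have "\<dots> = \<epsilon> * (norm b)\<^sup>2 - 2 * (norm b * d) + d\<^sup>2 / \<epsilon>" using assms by (simp add: power2_eq_square field_simps)
    finally show ?thesis by simp
  qed
  ultimately show ?thesis by (simp add: d_def algebra_simps)
qed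

text \<open>The common pattern of the convergence proofs below: the error is a small multiple of a
  fixed quantity plus a large multiple of a null sequence, as Young-type inequalities produce
  it.\<close>

lemma tendsto_by_eps_const:
  fixes a :: "nat \<Rightarrow> real"
  assumes b: "b \<longlonglongrightarrow> 0" and A: "A \<ge> 0"
    and le: "\<And>\<epsilon>. \<epsilon> > 0 \<Longrightarrow> \<exists>C. \<forall>k. \<bar>a k - l\<bar> \<le> \<epsilon> * A + C * b k"
  shows "a \<longlonglongrightarrow> l"
proof (rule LIMSEQ_I)
  fix e :: real assume e: "e > 0"
  define \<epsilon> where "\<epsilon> = e / (2 * (A + 1))"
  have \<epsilon>: "\<epsilon> > 0" "\<epsilon> * A < e / 2 \<or> \<epsilon> * A \<le> e / 2" using e A by (auto simp: \<epsilon>_def field_simps)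
  then obtain C where C: "\<forall>k. \<bar>a k - l\<bar> \<le> \<epsilon> * A + C * b k" using le by blast
  have "(\<lambda>k. C * b k) \<longlonglongrightarrow> C * 0" by (intro tendsto_intros b)
  then obtain n0 where n0: "\<forall>k\<ge>n0. norm (C * b k - 0) < e / 2" using LIMSEQ_D[of _ _ "e/2"] e by fastforce
  have "norm (a k - l) < e" if k: "k \<ge> n0" for k
    using spec[OF C, of k] n0[rule_format, OF k] \<epsilon>(2) by (auto simp: abs_if split: if_splits)
  then show "\<exists>n0. \<forall>k\<ge>n0. norm (a k - l) < e" by blast
qed

lemma L2_tendsto_norm:
  fixes f :: "nat \<Rightarrow> 'x \<Rightarrow> 'b::euclidean_space"
  assumes [measurable]: "\<And>k. f k \<in> borel_measurable M" "F \<in> borel_measurable M"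
    and F: "integrable M (\<lambda>x. (norm (F x))\<^sup>2)" and d: "\<And>k. integrable M (\<lambda>x. (norm (f k x - F x))\<^sup>2)"
    and lim: "(\<lambda>k. LINT x|M. (norm (f k x - F x))\<^sup>2) \<longlonglongrightarrow> 0"
  shows "integrable M (\<lambda>x. (norm (f k x))\<^sup>2)" "(\<lambda>k. LINT x|M. (norm (f k x))\<^sup>2) \<longlonglongrightarrow> (LINT x|M. (norm (F x))\<^sup>2)"
proof -
  have i: "integrable M (\<lambda>x. (norm (f k x))\<^sup>2)" for k
  proof (rule Bochner_Integration.integrable_bound[where f="\<lambda>x. 2 * (norm (f k x - F x))\<^sup>2 + 2 * (norm (F x))\<^sup>2"])
    show "AE x in M. norm ((norm (f k x))\<^sup>2) \<le> norm (2 * (norm (f k x - F x))\<^sup>2 + 2 * (norm (F x))\<^sup>2)"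
      by (intro AE_I2) (use norm_sq_diff_le[of "f k x - F x" "- F x" for x] in simp)
  qed (use F d in auto)
  then show "integrable M (\<lambda>x. (norm (f k x))\<^sup>2)" .
  show "(\<lambda>k. LINT x|M. (norm (f k x))\<^sup>2) \<longlonglongrightarrow> (LINT x|M. (norm (F x))\<^sup>2)"
  proof (rule tendsto_by_eps_const[OF lim, of "LINT x|M. (norm (F x))\<^sup>2"])
    fix \<epsilon> :: real assume \<epsilon>: "\<epsilon> > 0"
    have "\<bar>(LINT x|M. (norm (f k x))\<^sup>2) - (LINT x|M. (norm (F x))\<^sup>2)\<bar> \<le> \<epsilon> * (LINT x|M. (norm (F x))\<^sup>2) + (1 + 1/\<epsilon>) * (LINT x|M. (norm (f k x - F x))\<^sup>2)" for k
    proof -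
      have "\<bar>(LINT x|M. (norm (f k x))\<^sup>2) - (LINT x|M. (norm (F x))\<^sup>2)\<bar> = \<bar>LINT x|M. (norm (f k x))\<^sup>2 - (norm (F x))\<^sup>2\<bar>"
        using i F by simp
      also have "\<dots> \<le> (LINT x|M. \<bar>(norm (f k x))\<^sup>2 - (norm (F x))\<^sup>2\<bar>)" by (rule integral_abs_bound)
      also have "\<dots> \<le> (LINT x|M. \<epsilon> * (norm (F x))\<^sup>2 + (1 + 1/\<epsilon>) * (norm (f k x - F x))\<^sup>2)"
        by (intro integral_mono norm_sq_close[OF \<epsilon>]) (use i F d in auto)
      also have "\<dots> = \<epsilon> * (LINT x|M. (norm (F x))\<^sup>2) + (1 + 1/\<epsilon>) * (LINT x|M. (norm (f k x - F x))\<^sup>2)"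
        using F d by simp
      finally show ?thesis .
    qed
    then show "\<exists>C. \<forall>k. \<bar>(LINT x|M. (norm (f k x))\<^sup>2) - (LINT x|M. (norm (F x))\<^sup>2)\<bar> \<le> \<epsilon> * (LINT x|M. (norm (F x))\<^sup>2) + C * (LINT x|M. (norm (f k x - F x))\<^sup>2)"
      by blast
  qed (auto intro!: integral_nonneg_AE)
qed

lemma L2_mult_integrable:
  fixes f g :: "'x \<Rightarrow> real"
  assumes [measurable]: "f \<in> borel_measurable M" "g \<in> borel_measurable M"
    and "integrable M (\<lambda>x. (f x)\<^sup>2)" "integrable M (\<lambda>x. (g x)\<^sup>2)"
  shows "integrable M (\<lambda>x. f x * g x)"
proof (rule Bochner_Integration.integrable_bound[where f="\<lambda>x. (f x)\<^sup>2 + (g x)\<^sup>2"])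
  have "\<bar>s * t\<bar> \<le> s\<^sup>2 + t\<^sup>2" for s t :: real
  proof -
    have "0 \<le> \<bar>s\<bar> * \<bar>t\<bar>" by simp
    then show ?thesis using sum_squares_bound[of "\<bar>s\<bar>" "\<bar>t\<bar>"] unfolding abs_mult power2_abs by linarith
  qed
  then show "AE x in M. norm (f x * g x) \<le> norm ((f x)\<^sup>2 + (g x)\<^sup>2)" by (intro AE_I2) simp
qed (use assms in auto)

lemma L2_tendsto_weak:
  fixes f :: "nat \<Rightarrow> 'x \<Rightarrow> real"
  assumes [measurable]: "\<And>k. f k \<in> borel_measurable M" "F \<in> borel_measurable M" "h \<in> borel_measurable M"
    and F: "integrable M (\<lambda>x. (F x)\<^sup>2)" and f: "\<And>k. integrable M (\<lambda>x. (f k x)\<^sup>2)"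
    and d: "\<And>k. integrable M (\<lambda>x. (f k x - F x)\<^sup>2)" and h: "integrable M (\<lambda>x. (h x)\<^sup>2)"
    and lim: "(\<lambda>k. LINT x|M. (f k x - F x)\<^sup>2) \<longlonglongrightarrow> 0"
  shows "(\<lambda>k. LINT x|M. f k x * h x) \<longlonglongrightarrow> (LINT x|M. F x * h x)"
proof (rule tendsto_by_eps_const[OF lim, of "LINT x|M. (h x)\<^sup>2"])
  fix \<epsilon> :: real assume \<epsilon>: "\<epsilon> > 0"
  have "\<bar>(LINT x|M. f k x * h x) - (LINT x|M. F x * h x)\<bar> \<le> \<epsilon> * (LINT x|M. (h x)\<^sup>2) + (1/\<epsilon>) * (LINT x|M. (f k x - F x)\<^sup>2)" for k
  proof -
    have m: "integrable M (\<lambda>x. f k x * h x)" "integrable M (\<lambda>x. F x * h x)"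
      by (intro L2_mult_integrable; use assms in simp)+
    have "\<bar>(LINT x|M. f k x * h x) - (LINT x|M. F x * h x)\<bar> = \<bar>LINT x|M. f k x * h x - F x * h x\<bar>"
      using m by simp
    also have "\<dots> \<le> (LINT x|M. \<bar>f k x * h x - F x * h x\<bar>)" by (rule integral_abs_bound)
    also have "\<dots> \<le> (LINT x|M. \<epsilon> * (h x)\<^sup>2 + (1/\<epsilon>) * (f k x - F x)\<^sup>2)"
    proof (rule integral_mono)
      fix x
      define s where "s = \<bar>f k x - F x\<bar>" define t where "t = \<bar>h x\<bar>"
      have "0 \<le> ((\<epsilon> * t - s)\<^sup>2 + \<epsilon> * t * s + \<epsilon> * t * s - \<epsilon> * t * s) / \<epsilon>" using \<epsilon> by (simp add: s_def t_def)
      also have "\<dots> = \<epsilon> * t\<^sup>2 - t * s + s\<^sup>2 / \<epsilon>" using \<epsilon> by (simp add: power2_eq_square field_simps)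
      finally have "s * t \<le> \<epsilon> * t\<^sup>2 + s\<^sup>2 / \<epsilon>" by (simp add: mult.commute)
      moreover have "\<bar>f k x * h x - F x * h x\<bar> = s * t" by (simp add: s_def t_def abs_mult left_diff_distrib[symmetric])
      ultimately show "\<bar>f k x * h x - F x * h x\<bar> \<le> \<epsilon> * (h x)\<^sup>2 + (1/\<epsilon>) * (f k x - F x)\<^sup>2" by (simp add: s_def t_def)
    qed (use m h d in auto)
    also have "\<dots> = \<epsilon> * (LINT x|M. (h x)\<^sup>2) + (1/\<epsilon>) * (LINT x|M. (f k x - F x)\<^sup>2)" using h d by simp
    finally show ?thesis .
  qed
  then show "\<exists>C. \<forall>k. \<bar>(LINT x|M. f k x * h x) - (LINT x|M. F x * h x)\<bar> \<le> \<epsilon> * (LINT x|M. (h x)\<^sup>2) + C * (LINT x|M. (f k x - F x)\<^sup>2)"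
    by blast
qed (auto intro!: integral_nonneg_AE)

text \<open>Cauchy estimates pass to the limit by Fatou with one index fixed. The gauge
  \<open>h\<close> is later the squared norm and the \<open>p\<close>-th power of the absolute
  value.\<close>

lemma Fatou_cauchy_limit:
  fixes f :: "nat \<Rightarrow> 'x \<Rightarrow> 'b::euclidean_space" and h :: "'b \<Rightarrow> real"
  assumes [measurable]: "\<And>k. f k \<in> borel_measurable M" "F \<in> borel_measurable M"
    and h: "continuous_on UNIV h" "\<And>y. h y \<ge> 0"
    and ae: "AE x in M. (\<lambda>j. f (r j) x) \<longlonglongrightarrow> F x" and r: "filterlim r at_top sequentially"
    and c: "\<And>m n. m \<ge> nz \<Longrightarrow> n \<ge> nz \<Longrightarrow> integrable M (\<lambda>x. h (f m x - f n x)) \<and> (LINT x|M. h (f m x - f n x)) \<le> \<epsilon>"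
    and n: "n \<ge> nz"
  shows "integrable M (\<lambda>x. h (f n x - F x))" "(LINT x|M. h (f n x - F x)) \<le> \<epsilon>"
proof -
  have [measurable]: "h \<in> borel_measurable borel" by (rule borel_measurable_continuous_onI[OF h(1)])
  have "0 \<le> (LINT x|M. h (f n x - f n x))" by (intro integral_nonneg_AE) (auto simp: h)
  then have e0: "\<epsilon> \<ge> 0" using c[OF n n] by linarith
  have "(\<integral>\<^sup>+x. ennreal (h (f n x - F x)) \<partial>M) = (\<integral>\<^sup>+x. liminf (\<lambda>j. ennreal (h (f n x - f (r j) x))) \<partial>M)"
  proof (rule nn_integral_cong_AE, use ae in eventually_elim)
    fix x assume "(\<lambda>j. f (r j) x) \<longlonglongrightarrow> F x"
    then have "(\<lambda>j. f n x - f (r j) x) \<longlonglongrightarrow> f n x - F x" by (intro tendsto_intros)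
    then have "(\<lambda>j. h (f n x - f (r j) x)) \<longlonglongrightarrow> h (f n x - F x)"
      by (rule continuous_on_tendsto_compose[OF h(1)]) auto
    then have "(\<lambda>j. ennreal (h (f n x - f (r j) x))) \<longlonglongrightarrow> ennreal (h (f n x - F x))" by (rule tendsto_ennrealI)
    then show "ennreal (h (f n x - F x)) = liminf (\<lambda>j. ennreal (h (f n x - f (r j) x)))"
      by (simp add: lim_imp_Liminf)
  qed
  also have "\<dots> \<le> liminf (\<lambda>j. \<integral>\<^sup>+x. ennreal (h (f n x - f (r j) x)) \<partial>M)" by (rule nn_integral_liminf) measurable
  also have "\<dots> \<le> ennreal \<epsilon>"
  proof (rule Liminf_le)
    have "\<forall>\<^sub>F j in sequentially. r j \<ge> nz" using r by (simp add: filterlim_at_top)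
    then show "\<forall>\<^sub>F j in sequentially. (\<integral>\<^sup>+x. ennreal (h (f n x - f (r j) x)) \<partial>M) \<le> ennreal \<epsilon>"
    proof eventually_elim
      case (elim j)
      have "(\<integral>\<^sup>+x. ennreal (h (f n x - f (r j) x)) \<partial>M) = ennreal (LINT x|M. h (f n x - f (r j) x))"
        by (rule nn_integral_eq_integral) (use c[OF n elim] h in auto)
      then show ?case using c[OF n elim] by (simp add: ennreal_leI)
    qed
  qed simp
  finally have le: "(\<integral>\<^sup>+x. ennreal (h (f n x - F x)) \<partial>M) \<le> ennreal \<epsilon>" .
  show "integrable M (\<lambda>x. h (f n x - F x))"
  proof (rule integrableI_bounded)
    have "(\<integral>\<^sup>+x. ennreal (norm (h (f n x - F x))) \<partial>M) \<le> ennreal \<epsilon>" using le h by simp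
    then show "(\<integral>\<^sup>+x. ennreal (norm (h (f n x - F x))) \<partial>M) < \<infinity>" by (rule le_less_trans) simp
  qed measurable
  have "(LINT x|M. h (f n x - F x)) = enn2real (\<integral>\<^sup>+x. ennreal (h (f n x - F x)) \<partial>M)"
    by (rule integral_eq_nn_integral) (auto simp: h)
  also have "\<dots> \<le> enn2real (ennreal \<epsilon>)" by (rule enn2real_mono[OF le]) simp
  finally show "(LINT x|M. h (f n x - F x)) \<le> \<epsilon>" using e0 by simp
qed

text \<open>The Riesz-Fischer argument without Minkowski: along a subsequence the integrals of the
  squared differences are at most 4^-k, so the sum of the squares with weights 2^k is finite almost
  everywhere, and 2t \<le> 2^-k + 2^k t^2 makes the differences summable.\<close>

lemma L2_cauchy_AE_subseq:
  fixes f :: "nat \<Rightarrow> 'x \<Rightarrow> 'b::euclidean_space"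
  assumes [measurable]: "\<And>k. f k \<in> borel_measurable M"
    and c: "\<And>\<epsilon>. \<epsilon> > 0 \<Longrightarrow> \<exists>n0. \<forall>m\<ge>n0. \<forall>n\<ge>n0. integrable M (\<lambda>x. (norm (f m x - f n x))\<^sup>2) \<and> (LINT x|M. (norm (f m x - f n x))\<^sup>2) \<le> \<epsilon>"
  obtains r :: "nat \<Rightarrow> nat" and F where "F \<in> borel_measurable M" "strict_mono r" "AE x in M. (\<lambda>j. f (r j) x) \<longlonglongrightarrow> F x"
proof -
  have "\<forall>k::nat. \<exists>n0. \<forall>m\<ge>n0. \<forall>n\<ge>n0. integrable M (\<lambda>x. (norm (f m x - f n x))\<^sup>2) \<and> (LINT x|M. (norm (f m x - f n x))\<^sup>2) \<le> (1/4) ^ k"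
    by (intro allI c) simp
  from choice[OF this] obtain N where N0: "\<forall>k. \<forall>m\<ge>N k. \<forall>n\<ge>N k. integrable M (\<lambda>x. (norm (f m x - f n x))\<^sup>2) \<and> (LINT x|M. (norm (f m x - f n x))\<^sup>2) \<le> (1/4) ^ k" ..
  note N = N0[rule_format]
  \<comment> \<open>The partial sums dominate each \<open>N k\<close>, and the added
    \<open>k\<close> makes the index sequence strictly increasing.\<close>
  define r where "r = (\<lambda>k. (\<Sum>i\<le>k. N i) + k)"
  have rN: "r k \<ge> N k" "r (Suc k) \<ge> N k" for k
    using member_le_sum[of k "{..k}" N] by (auto simp: r_def)
  have r: "strict_mono r" by (rule strict_monoI_Suc) (simp add: r_def)
  define D where "D = (\<lambda>k x. f (r (Suc k)) x - f (r k) x)"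
  have [measurable]: "D k \<in> borel_measurable M" for k unfolding D_def by measurable
  have D: "(\<integral>\<^sup>+x. ennreal (2 ^ k * (norm (D k x))\<^sup>2) \<partial>M) \<le> ennreal ((1/2) ^ k)" for k
  proof -
    note n = N[OF rN(2) rN(1), of k]
    have "(\<integral>\<^sup>+x. ennreal (2 ^ k * (norm (D k x))\<^sup>2) \<partial>M) = ennreal (LINT x|M. 2 ^ k * (norm (D k x))\<^sup>2)"
      by (rule nn_integral_eq_integral) (use n in \<open>auto simp: D_def\<close>)
    also have "(LINT x|M. 2 ^ k * (norm (D k x))\<^sup>2) \<le> 2 ^ k * (1/4) ^ k" using n by (simp add: D_def)
    also have "2 ^ k * (1/4) ^ k = (1/2 :: real) ^ k" by (simp add: power_mult_distrib[symmetric])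
    finally show ?thesis by (simp add: ennreal_leI)
  qed
  have "(\<integral>\<^sup>+x. (\<Sum>k. ennreal (2 ^ k * (norm (D k x))\<^sup>2)) \<partial>M) = (\<Sum>k. \<integral>\<^sup>+x. ennreal (2 ^ k * (norm (D k x))\<^sup>2) \<partial>M)"
    by (rule nn_integral_suminf) measurable
  also have "\<dots> \<le> (\<Sum>k. ennreal ((1/2) ^ k))" by (intro suminf_le D) auto
  also have "\<dots> = ennreal (\<Sum>k. (1/2) ^ k)" by (rule suminf_ennreal2) (auto intro: summable_geometric)
  also have "\<dots> < \<infinity>" by simp
  finally have "AE x in M. (\<Sum>k. ennreal (2 ^ k * (norm (D k x))\<^sup>2)) \<noteq> \<infinity>"
    by (intro nn_integral_noteq_infinite) auto
  then have "AE x in M. convergent (\<lambda>j. f (r j) x)"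
  proof eventually_elim
    case (elim x)
    have s: "summable (\<lambda>k. 2 ^ k * (norm (D k x))\<^sup>2)"
      by (rule summable_suminf_not_top) (use elim in auto)
    have "summable (\<lambda>k. (1/2) ^ k + 2 ^ k * (norm (D k x))\<^sup>2)" by (intro summable_add s summable_geometric) simp
    then have "summable (\<lambda>k. D k x)"
    proof (rule summable_comparison_test'[where N=0])
      fix k :: nat
      define t where "t = norm (D k x)"
      have "0 \<le> (1 - 2 ^ k * t)\<^sup>2 / 2 ^ k" by simp
      also have "\<dots> = 1 / 2 ^ k - 2 * t + 2 ^ k * t\<^sup>2" by (simp add: power2_eq_square field_simps)
      finally have "2 * t \<le> (1/2) ^ k + 2 ^ k * t\<^sup>2" by (simp add: power_one_over)
      then show "norm (D k x) \<le> (1/2) ^ k + 2 ^ k * (norm (D k x))\<^sup>2" using norm_ge_zero[of "D k x"] unfolding t_def by linarith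
    qed
    then have "convergent (\<lambda>n. \<Sum>k<n. D k x)" by (simp add: summable_iff_convergent)
    moreover have "(\<Sum>k<n. D k x) = f (r n) x - f (r 0) x" for n 
      unfolding D_def by (rule sum_lessThan_telescope[of "\<lambda>k. f (r k) x"])
    ultimately have "convergent (\<lambda>n. f (r n) x - f (r 0) x)" by simp
    then have "convergent (\<lambda>n. (f (r n) x - f (r 0) x) + f (r 0) x)" by (intro convergent_add convergent_const)
    then show ?case by simp
  qed
  then have "AE x in M. (\<lambda>j. f (r j) x) \<longlonglongrightarrow> lim (\<lambda>j. f (r j) x)" by (simp add: convergent_LIMSEQ_iff)
  then show thesis by (intro that[of "\<lambda>x. lim (\<lambda>j. f (r j) x)" r] r) auto
qed

lemma L2_complete:
  fixes f :: "nat \<Rightarrow> 'x \<Rightarrow> 'b::euclidean_space"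
  assumes m[measurable]: "\<And>k. f k \<in> borel_measurable M"
    and c: "\<And>\<epsilon>. \<epsilon> > 0 \<Longrightarrow> \<exists>n0. \<forall>m\<ge>n0. \<forall>n\<ge>n0. integrable M (\<lambda>x. (norm (f m x - f n x))\<^sup>2) \<and> (LINT x|M. (norm (f m x - f n x))\<^sup>2) \<le> \<epsilon>"
    and i: "\<And>k. integrable M (\<lambda>x. (norm (f k x))\<^sup>2)"
  obtains F where "F \<in> borel_measurable M" "integrable M (\<lambda>x. (norm (F x))\<^sup>2)"
    "\<And>k. integrable M (\<lambda>x. (norm (f k x - F x))\<^sup>2)" "(\<lambda>k. LINT x|M. (norm (f k x - F x))\<^sup>2) \<longlonglongrightarrow> 0"
proof -
  obtain r F where F[measurable]: "F \<in> borel_measurable M" and r: "strict_mono r" and ae: "AE x in M. (\<lambda>j. f (r j) x) \<longlonglongrightarrow> F x"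
    by (rule L2_cauchy_AE_subseq[OF m c]) blast+
  have *: "\<exists>n0. \<forall>n\<ge>n0. integrable M (\<lambda>x. (norm (f n x - F x))\<^sup>2) \<and> (LINT x|M. (norm (f n x - F x))\<^sup>2) \<le> \<epsilon>" if \<epsilon>: "\<epsilon> > 0" for \<epsilon>
  proof -
    obtain n0 where n0: "\<forall>m\<ge>n0. \<forall>n\<ge>n0. integrable M (\<lambda>x. (norm (f m x - f n x))\<^sup>2) \<and> (LINT x|M. (norm (f m x - f n x))\<^sup>2) \<le> \<epsilon>" using c[OF \<epsilon>] by blast
    have "integrable M (\<lambda>x. (norm (f n x - F x))\<^sup>2)" "(LINT x|M. (norm (f n x - F x))\<^sup>2) \<le> \<epsilon>" if n: "n \<ge> n0" for n
      by (rule Fatou_cauchy_limit[where h="\<lambda>y. (norm y)\<^sup>2" and nz=n0 and \<epsilon>=\<epsilon>, OF m F _ _ ae filterlim_subseq[OF r] _ n];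
          use n0 in \<open>auto intro!: continuous_intros\<close>)+
    then show ?thesis by blast
  qed
  obtain n0 where n0: "integrable M (\<lambda>x. (norm (f n0 x - F x))\<^sup>2)" using *[of 1] by auto
  have iF: "integrable M (\<lambda>x. (norm (F x))\<^sup>2)"
  proof (rule Bochner_Integration.integrable_bound[where f="\<lambda>x. 2 * (norm (f n0 x))\<^sup>2 + 2 * (norm (f n0 x - F x))\<^sup>2"])
    show "AE x in M. norm ((norm (F x))\<^sup>2) \<le> norm (2 * (norm (f n0 x))\<^sup>2 + 2 * (norm (f n0 x - F x))\<^sup>2)"
      by (intro AE_I2) (use norm_sq_diff_le[of "f n0 x" "f n0 x - F x" for x] in simp)
  qed (use n0 i in auto)
  have "integrable M (\<lambda>x. (norm (f k x - F x))\<^sup>2)" for k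
  proof (rule Bochner_Integration.integrable_bound[where f="\<lambda>x. 2 * (norm (f k x))\<^sup>2 + 2 * (norm (F x))\<^sup>2"])
    show "AE x in M. norm ((norm (f k x - F x))\<^sup>2) \<le> norm (2 * (norm (f k x))\<^sup>2 + 2 * (norm (F x))\<^sup>2)"
      by (intro AE_I2) (use norm_sq_diff_le[of "f k x" "F x" for x] in simp)
  qed (use iF i in auto)
  moreover have "(\<lambda>k. LINT x|M. (norm (f k x - F x))\<^sup>2) \<longlonglongrightarrow> 0"
  proof (rule LIMSEQ_I)
    fix e :: real assume "e > 0"
    then obtain n0 where n0: "\<forall>n\<ge>n0. (LINT x|M. (norm (f n x - F x))\<^sup>2) \<le> e/2" using *[of "e/2"] by auto
    have "(LINT x|M. (norm (f n x - F x))\<^sup>2) \<ge> 0" for n by (intro integral_nonneg_AE) auto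
    then show "\<exists>n0. \<forall>n\<ge>n0. norm ((LINT x|M. (norm (f n x - F x))\<^sup>2) - 0) < e"
      using n0 \<open>e > 0\<close> by (intro exI[of _ n0]) (fastforce simp: abs_of_nonneg)
  qed
  ultimately show thesis using that[OF F iF] by blast
qed

text \<open>If |a - b| is small relative to |b|, continuity of \<open>s powr p\<close> at
  \<open>s = 1\<close> gives the first term; otherwise both powers are controlled by |a -
  b|.\<close>

lemma abs_powr_close:
  fixes p :: real
  assumes "p > 0" "\<epsilon> > 0"
  obtains C where "C > 0" "\<And>a b::real. \<bar>\<bar>a\<bar> powr p - \<bar>b\<bar> powr p\<bar> \<le> \<epsilon> * \<bar>b\<bar> powr p + C * \<bar>a - b\<bar> powr p"
proof -
  have "isCont (\<lambda>s::real. s powr p) 1" by (intro continuous_intros) auto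
  then obtain \<delta>0 where \<delta>0: "\<delta>0 > 0" "\<And>s. \<bar>s - 1\<bar> < \<delta>0 \<Longrightarrow> \<bar>s powr p - 1\<bar> < \<epsilon>"
    using assms(2) by (auto simp: continuous_at_eps_delta dist_real_def)
  define \<delta> where "\<delta> = min (\<delta>0/2) (1/2)"
  have \<delta>: "\<delta> > 0" "\<delta> < 1" "\<delta> < \<delta>0" using \<delta>0 by (auto simp: \<delta>_def)
  define C where "C = (1 + 1/\<delta>) powr p + (1/\<delta>) powr p"
  have "1 + 1/\<delta> > 0" using \<delta> by (simp add: add_pos_pos)
  then have C: "C > 0" by (simp add: C_def add_pos_nonneg)
  have "\<bar>\<bar>a\<bar> powr p - \<bar>b\<bar> powr p\<bar> \<le> \<epsilon> * \<bar>b\<bar> powr p + C * \<bar>a - b\<bar> powr p" for a b :: real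
  proof (cases "\<bar>a - b\<bar> \<le> \<delta> * \<bar>b\<bar>")
    case True
    show ?thesis
    proof (cases "b = 0")
      case False
      define s where "s = \<bar>a\<bar> / \<bar>b\<bar>"
      have as: "\<bar>a\<bar> = s * \<bar>b\<bar>" "s \<ge> 0" using False by (auto simp: s_def)
      have "\<bar>\<bar>a\<bar> - \<bar>b\<bar>\<bar> \<le> \<delta> * \<bar>b\<bar>" using True by linarith
      then have "\<bar>s - 1\<bar> * \<bar>b\<bar> \<le> \<delta> * \<bar>b\<bar>" by (simp add: as abs_mult[symmetric] left_diff_distrib)
      then have "\<bar>s - 1\<bar> \<le> \<delta>" using False by simp
      then have "\<bar>s powr p - 1\<bar> < \<epsilon>" using \<delta> \<delta>0 by auto
      then have "\<bar>s powr p - 1\<bar> * \<bar>b\<bar> powr p \<le> \<epsilon> * \<bar>b\<bar> powr p" by (intro mult_right_mono) auto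
      moreover have "\<bar>\<bar>a\<bar> powr p - \<bar>b\<bar> powr p\<bar> = \<bar>s powr p - 1\<bar> * \<bar>b\<bar> powr p"
      proof -
        have "\<bar>a\<bar> powr p = s powr p * \<bar>b\<bar> powr p" unfolding as(1) by (rule powr_mult)
        then have "\<bar>a\<bar> powr p - \<bar>b\<bar> powr p = (s powr p - 1) * \<bar>b\<bar> powr p" by (simp add: left_diff_distrib)
        then show ?thesis by (simp add: abs_mult)
      qed
      ultimately show ?thesis using C by (simp add: add_increasing2)
    qed (use True assms in simp)
  next
    case False
    define d where "d = \<bar>a - b\<bar>"
    have b: "\<bar>b\<bar> \<le> (1/\<delta>) * d" using False \<delta> by (simp add: d_def field_simps)
    have a: "\<bar>a\<bar> \<le> (1 + 1/\<delta>) * d" using b by (simp add: d_def algebra_simps)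
    have "\<bar>a\<bar> powr p \<le> ((1 + 1/\<delta>) * d) powr p" "\<bar>b\<bar> powr p \<le> ((1/\<delta>) * d) powr p"
      using a b assms by (intro powr_mono2; simp)+
    then have "\<bar>a\<bar> powr p + \<bar>b\<bar> powr p \<le> C * d powr p"
      unfolding powr_mult C_def
      distrib_right[of "(1 + 1/\<delta>) powr p" "(1/\<delta>) powr p" "d powr p"] by linarith
    moreover have "\<bar>\<bar>a\<bar> powr p - \<bar>b\<bar> powr p\<bar> \<le> \<bar>a\<bar> powr p + \<bar>b\<bar> powr p"
      using powr_ge_zero[of "\<bar>a\<bar>" p] powr_ge_zero[of "\<bar>b\<bar>" p] by linarith
    moreover have "0 \<le> \<epsilon> * \<bar>b\<bar> powr p" using assms by simp
    ultimately show ?thesis by (simp add: d_def)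
  qed
  then show thesis using that C by blast
qed

lemma weighted_powr_integral_close:
  fixes f g w :: "'x \<Rightarrow> real"
  assumes [measurable]: "f \<in> borel_measurable M" "g \<in> borel_measurable M" "w \<in> borel_measurable M"
    and w: "\<And>x. 0 \<le> w x" "\<And>x. x \<in> space M \<Longrightarrow> w x \<le> 1"
    and i: "integrable M (\<lambda>x. \<bar>g x\<bar> powr p)" "integrable M (\<lambda>x. \<bar>f x - g x\<bar> powr p)"
    and C: "C > 0" "\<epsilon> > 0" "\<And>a b::real. \<bar>\<bar>a\<bar> powr p - \<bar>b\<bar> powr p\<bar> \<le> \<epsilon> * \<bar>b\<bar> powr p + C * \<bar>a - b\<bar> powr p"
  shows "integrable M (\<lambda>x. \<bar>f x\<bar> powr p)" "integrable M (\<lambda>x. w x * \<bar>f x\<bar> powr p)" "integrable M (\<lambda>x. w x * \<bar>g x\<bar> powr p)"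
    "\<bar>(LINT x|M. w x * \<bar>f x\<bar> powr p) - (LINT x|M. w x * \<bar>g x\<bar> powr p)\<bar>
      \<le> \<epsilon> * (LINT x|M. \<bar>g x\<bar> powr p) + C * (LINT x|M. \<bar>f x - g x\<bar> powr p)"
proof -
  show if': "integrable M (\<lambda>x. \<bar>f x\<bar> powr p)"
  proof (rule Bochner_Integration.integrable_bound[where f="\<lambda>x. (1 + \<epsilon>) * \<bar>g x\<bar> powr p + C * \<bar>f x - g x\<bar> powr p"])
    show "AE x in M. norm (\<bar>f x\<bar> powr p) \<le> norm ((1 + \<epsilon>) * \<bar>g x\<bar> powr p + C * \<bar>f x - g x\<bar> powr p)"
    proof (rule AE_I2)
      fix x
      have "\<bar>f x\<bar> powr p \<le> (1 + \<epsilon>) * \<bar>g x\<bar> powr p + C * \<bar>f x - g x\<bar> powr p"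
        using C(3)[of "f x" "g x"] by (simp add: algebra_simps)
      then show "norm (\<bar>f x\<bar> powr p) \<le> norm ((1 + \<epsilon>) * \<bar>g x\<bar> powr p + C * \<bar>f x - g x\<bar> powr p)" by simp
    qed
  qed (use i in auto)
  have wi: "integrable M (\<lambda>x. w x * h x)" if "integrable M h" "\<And>x. h x \<ge> 0" for h
    by (rule Bochner_Integration.integrable_bound[OF that(1)])
       (use that w mult_right_mono[of "w _" 1 "h _"] borel_measurable_integrable[OF that(1)] in \<open>auto intro!: AE_I2\<close>)
  show wf: "integrable M (\<lambda>x. w x * \<bar>f x\<bar> powr p)" and wg: "integrable M (\<lambda>x. w x * \<bar>g x\<bar> powr p)"
    by (rule wi[OF if'], simp, rule wi[OF i(1)], simp)
  have "\<bar>(LINT x|M. w x * \<bar>f x\<bar> powr p) - (LINT x|M. w x * \<bar>g x\<bar> powr p)\<bar> = \<bar>LINT x|M. w x * \<bar>f x\<bar> powr p - w x * \<bar>g x\<bar> powr p\<bar>"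
    using wf wg by simp
  also have "\<dots> \<le> (LINT x|M. \<bar>w x * \<bar>f x\<bar> powr p - w x * \<bar>g x\<bar> powr p\<bar>)" by (rule integral_abs_bound)
  also have "\<dots> \<le> (LINT x|M. \<epsilon> * \<bar>g x\<bar> powr p + C * \<bar>f x - g x\<bar> powr p)"
  proof (rule integral_mono)
    fix x assume x: "x \<in> space M"
    have "\<bar>w x * \<bar>f x\<bar> powr p - w x * \<bar>g x\<bar> powr p\<bar> = w x * \<bar>\<bar>f x\<bar> powr p - \<bar>g x\<bar> powr p\<bar>"
      using w(1)[of x] by (simp add: right_diff_distrib[symmetric] abs_mult)
    also have "\<dots> \<le> 1 * \<bar>\<bar>f x\<bar> powr p - \<bar>g x\<bar> powr p\<bar>" using w(2)[OF x] by (intro mult_right_mono) auto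
    also have "\<dots> \<le> \<epsilon> * \<bar>g x\<bar> powr p + C * \<bar>f x - g x\<bar> powr p" using C(3) by simp
    finally show "\<bar>w x * \<bar>f x\<bar> powr p - w x * \<bar>g x\<bar> powr p\<bar> \<le> \<epsilon> * \<bar>g x\<bar> powr p + C * \<bar>f x - g x\<bar> powr p" .
  qed (use wf wg i in auto)
  also have "\<dots> = \<epsilon> * (LINT x|M. \<bar>g x\<bar> powr p) + C * (LINT x|M. \<bar>f x - g x\<bar> powr p)" using i by simp
  finally show "\<bar>(LINT x|M. w x * \<bar>f x\<bar> powr p) - (LINT x|M. w x * \<bar>g x\<bar> powr p)\<bar>
      \<le> \<epsilon> * (LINT x|M. \<bar>g x\<bar> powr p) + C * (LINT x|M. \<bar>f x - g x\<bar> powr p)" .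
qed

section \<open>The fundamental lemma of the calculus of variations\<close>

text \<open>A product \<open>\<psi>\<close> of one-variable flat functions takes values in [0,1] and
  is positive exactly on the open box, so 1 - (1 - \<psi>)^n tends to the indicator.\<close>

lemma box_indicator_test_fun_limit:
  fixes a c :: "'a::euclidean_space"
  assumes "cbox a c \<subseteq> U"
  obtains \<phi> :: "nat \<Rightarrow> 'a \<Rightarrow> real" where "\<And>n. \<phi> n \<in> test_funs U" "\<And>n x. \<bar>\<phi> n x\<bar> \<le> 1" "\<And>x. (\<lambda>n. \<phi> n x) \<longlonglongrightarrow> indicator (box a c) x"
proof -
  define \<psi> where "\<psi> = (\<lambda>x::'a. \<Prod>b\<in>Basis. flat 1 (- (a \<bullet> b) + 1 * (x \<bullet> b)) * flat 1 (c \<bullet> b + (-1) * (x \<bullet> b)))"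
  have s: "smooth_fun \<psi>" unfolding \<psi>_def
    by (intro smooth_fun_prod smooth_fun_mult smooth_fun_comp[OF smooth1_affine[OF smooth1_flat]] smooth_fun_inner) auto
  have 01: "0 \<le> \<psi> x" "\<psi> x \<le> 1" for x unfolding \<psi>_def
    by (auto intro!: prod_nonneg prod_le_1 mult_nonneg_nonneg mult_le_one simp: flat_nonneg flat_le_1)
  have pos: "\<psi> x > 0" if "x \<in> box a c" for x unfolding \<psi>_def
    using that by (intro prod_pos) (auto simp: mem_box intro!: mult_pos_pos flat_pos)
  have zero: "\<psi> x = 0" if xn: "x \<notin> box a c" for x
  proof -
    obtain b where b: "b \<in> Basis" "x \<bullet> b \<le> a \<bullet> b \<or> c \<bullet> b \<le> x \<bullet> b" 
      using xn unfolding mem_box by (meson not_less)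
    then have "flat 1 (- (a \<bullet> b) + 1 * (x \<bullet> b)) * flat 1 (c \<bullet> b + (-1) * (x \<bullet> b)) = 0" by (auto simp: flat_zero)
    then show ?thesis unfolding \<psi>_def using b(1) by (intro prod_zero) auto
  qed
  \<comment> \<open>The power is written as a product so that its smoothness follows from that of
    finite products.\<close>
  define \<phi> where "\<phi> = (\<lambda>(n::nat) x. 1 - (\<Prod>i\<in>{..<n}. 1 - \<psi> x))"
  have p: "\<phi> n x = 1 - (1 - \<psi> x) ^ n" for n x by (simp add: \<phi>_def)
  have "\<phi> n \<in> test_funs U" for n
  proof (rule test_funsI[of _ "cbox a c"])
    show "smooth_fun (\<phi> n)" unfolding \<phi>_def
      by (intro smooth_fun_diff smooth_fun_const smooth_fun_prod s) auto
    show "\<phi> n x = 0" if "x \<notin> cbox a c" for x 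
    proof -
      have "x \<notin> box a c" using that box_subset_cbox[of a c] by blast
      then show ?thesis using zero[of x] by (simp add: p)
    qed
  qed (use assms in auto)
  moreover have "\<bar>\<phi> n x\<bar> \<le> 1" for n x
    using 01[of x] power_le_one[of "1 - \<psi> x" n] zero_le_power[of "1 - \<psi> x" n] by (simp add: p)
  moreover have "(\<lambda>n. \<phi> n x) \<longlonglongrightarrow> indicator (box a c) x" for x
  proof (cases "x \<in> box a c")
    case True
    have "(\<lambda>n. 1 - (1 - \<psi> x) ^ n) \<longlonglongrightarrow> 1 - 0"
      using pos[OF True] 01[of x] by (intro tendsto_intros LIMSEQ_power_zero) auto
    then show ?thesis using True by (simp add: p)
  qed (simp add: p zero)
  ultimately show thesis using that by blast
qed

text \<open>Boxes form an intersection-stable generator of the Borel sets, so the integrals over all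
  Borel sets vanish, in particular over the sets where \<open>f\<close> is positive or
  negative.\<close>

lemma AE_zero_if_box_integrals_zero:
  fixes f :: "'a::euclidean_space \<Rightarrow> real"
  assumes f: "integrable lborel f" and z: "\<And>a b. (LINT x|lborel. indicator (box a b) x * f x) = 0"
  shows "AE x in lborel. f x = 0"
proof -
  have [measurable]: "f \<in> borel_measurable borel" using f by (auto dest: borel_measurable_integrable)
  have ii: "integrable lborel (\<lambda>x. indicator A x * f x)" if [measurable]: "A \<in> sets borel" for A
    by (rule Bochner_Integration.integrable_bound[OF f]) (auto simp: indicator_def)
  \<comment> \<open>Complements in the induction over Borel sets require the integral over the whole
    space, reached here along growing boxes.\<close>
  have U: "(LINT x|lborel. f x) = 0"
  proof -
    have "(\<lambda>n. LINT x|lborel. indicator (box (- (real n *\<^sub>R One)) (real n *\<^sub>R One)) x * f x) \<longlonglongrightarrow> (LINT x|lborel. f x)"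
    proof (rule integral_dominated_convergence[where w="\<lambda>x. \<bar>f x\<bar>"])
      show "AE x in lborel. (\<lambda>n. indicator (box (- (real n *\<^sub>R One)) (real n *\<^sub>R One)) x * f x) \<longlonglongrightarrow> f x"
      proof (rule AE_I2)
        fix x :: 'a
        obtain n0 :: nat where n0: "norm x < real n0" using reals_Archimedean2 by blast
        have "x \<in> box (- (real n *\<^sub>R One)) (real n *\<^sub>R One)" if "n \<ge> n0" for n
        proof -
          have "- real n < x \<bullet> b \<and> x \<bullet> b < real n" if "b \<in> Basis" for b
            using Basis_le_norm[OF that, of x] n0 \<open>n \<ge> n0\<close> by linarith
          then show ?thesis by (simp add: mem_box)
        qed
        then have "\<forall>\<^sub>F n in sequentially. indicator (box (- (real n *\<^sub>R One)) (real n *\<^sub>R One)) x * f x = f x"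
          by (intro eventually_sequentiallyI[of n0]) simp
        then show "(\<lambda>n. indicator (box (- (real n *\<^sub>R One)) (real n *\<^sub>R One)) x * f x) \<longlonglongrightarrow> f x"
          by (rule tendsto_eventually)
      qed
    qed (use f in \<open>auto simp: indicator_def\<close>)
    then show ?thesis using z by (simp add: LIMSEQ_const_iff)
  qed
  have all: "(LINT x|lborel. indicator A x * f x) = 0" if "A \<in> sets borel" for A
  proof -
    let ?G = "range (\<lambda>(a, b). box a b :: 'a set)"
    have A: "A \<in> sigma_sets UNIV ?G" using that unfolding borel_eq_box by simp
    have "Int_stable ?G"
    proof (rule Int_stableI)
      fix A B assume "A \<in> ?G" "B \<in> ?G"
      then obtain a b c d where AB: "A = box a b" "B = box c d" by auto
      show "A \<inter> B \<in> ?G" unfolding AB box_Int_box by (intro image_eqI[OF _ UNIV_I]) (rule case_prod_conv[symmetric])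
    qed
    moreover have "?G \<subseteq> Pow UNIV" by simp
    ultimately show ?thesis using A
    proof (induction rule: sigma_sets_induct_disjoint)
      case (compl A)
      have [measurable]: "A \<in> sets borel" using compl(1) unfolding borel_eq_box by simp
      have "(LINT x|lborel. indicator (UNIV - A) x * f x) = (LINT x|lborel. f x - indicator A x * f x)"
        by (intro Bochner_Integration.integral_cong) (auto simp: indicator_def)
      then show ?case using U compl f ii[of A] by simp
    next
      case (union A)
      have [measurable]: "A i \<in> sets borel" for i using union(2) unfolding borel_eq_box by auto
      have "(LINT x:(\<Union>i. A i)|lborel. f x) = (\<Sum>i. LINT x:A i|lborel. f x)"
        by (rule lebesgue_integral_countable_add)
           (use union(1) ii[of "\<Union>i. A i"] in \<open>auto simp: disjoint_family_on_def set_integrable_def\<close>)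
      then show ?case using union(3) by (simp add: set_lebesgue_integral_def)
    qed (auto simp: z)
  qed
  have "AE x in lborel. indicator {x. f x > 0} x * f x = 0"
    by (rule integral_nonneg_eq_0_iff_AE[THEN iffD1]) (use all[of "{x. f x > 0}"] ii[of "{x. f x > 0}"] in \<open>auto simp: indicator_def\<close>)
  moreover have "AE x in lborel. - (indicator {x. f x < 0} x * f x) = 0"
    by (rule integral_nonneg_eq_0_iff_AE[THEN iffD1]) (use all[of "{x. f x < 0}"] ii[of "{x. f x < 0}"] in \<open>auto simp: indicator_def\<close>)
  ultimately show ?thesis by eventually_elim (auto simp: indicator_def split: if_splits)
qed

text \<open>Test functions on \<open>U\<close> reach indicators of boxes whose closure lies in
  \<open>U\<close>, hence \<open>h\<close> vanishes almost everywhere on every closed box in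
  \<open>U\<close>, and countably many such boxes cover \<open>U\<close>.\<close>

lemma fundamental_lemma:
  fixes h :: "'a::euclidean_space \<Rightarrow> real"
  assumes U: "open U" and h: "h \<in> borel_measurable lebesgue" "integrable (lebesgue_on U) h"
    and z: "\<And>\<phi>. \<phi> \<in> test_funs U \<Longrightarrow> (LINT x:U|lebesgue. h x * \<phi> x) = 0"
  shows "AE x in lebesgue. x \<in> U \<longrightarrow> h x = 0"
proof -
  \<comment> \<open>The argument on boxes is carried out with Borel sets and \<open>lborel\<close>,
    so \<open>h\<close> is first replaced by a Borel version.\<close>
  obtain h' where h'[measurable]: "h' \<in> borel_measurable lborel" and ae: "AE x in lborel. h x = h' x"
    using completion_ex_borel_measurable_real[OF h(1)] by blast
  have aeL: "AE x in lebesgue. h x = h' x" using ae by (rule AE_completion)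
  have UL[measurable]: "U \<in> sets lebesgue" "U \<in> sets borel" using U by auto
  note h(1)[measurable]
  have m'[measurable]: "h' \<in> borel_measurable lebesgue" using h' by (simp add: measurable_completion)
  define H where "H = (\<lambda>x. indicator U x * h' x)"
  have Hm[measurable]: "H \<in> borel_measurable lborel" unfolding H_def by measurable
  have HmL[measurable]: "H \<in> borel_measurable lebesgue" unfolding H_def by measurable
  have iH: "integrable lborel H"
  proof -
    have "integrable lebesgue (\<lambda>x. indicator U x *\<^sub>R h x)" using h(2) by (simp add: integrable_restrict_space)
    then have "integrable lebesgue H"
      by (rule integrable_cong_AE_imp) (use aeL in \<open>auto simp: H_def\<close>)
    then show ?thesis using integrable_completion[OF Hm] by simp
  qed
  have zH: "(LINT x|lborel. \<phi> x * H x) = 0" if \<phi>: "\<phi> \<in> test_funs U" for \<phi>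
  proof -
    have [measurable]: "\<phi> \<in> borel_measurable lborel" using test_fun_borel[OF \<phi>] by simp
    have [measurable]: "\<phi> \<in> borel_measurable lebesgue" using test_fun_borel[OF \<phi>] by (simp add: measurable_completion)
    have "(LINT x|lborel. \<phi> x * H x) = (LINT x|lebesgue. \<phi> x * H x)"
      by (rule integral_completion[symmetric]) measurable
    also have "\<dots> = (LINT x:U|lebesgue. h x * \<phi> x)"
      unfolding set_lebesgue_integral_def by (rule integral_cong_AE) (use aeL in \<open>auto simp: H_def\<close>)
    finally show ?thesis using z[OF \<phi>] by simp
  qed
  have zbox: "(LINT x|lborel. indicator (box a c) x * H x) = 0" if ac: "cbox a c \<subseteq> U" for a c
  proof -
    obtain \<phi> :: "nat \<Rightarrow> 'a \<Rightarrow> real" where \<phi>: "\<And>n. \<phi> n \<in> test_funs U" "\<And>n x. \<bar>\<phi> n x\<bar> \<le> 1" "\<And>x. (\<lambda>n. \<phi> n x) \<longlonglongrightarrow> indicator (box a c) x"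
      using box_indicator_test_fun_limit[OF ac] by blast
    have [measurable]: "\<phi> n \<in> borel_measurable lborel" for n using test_fun_borel[OF \<phi>(1)] by simp
    have "(\<lambda>n. LINT x|lborel. \<phi> n x * H x) \<longlonglongrightarrow> (LINT x|lborel. indicator (box a c) x * H x)"
    proof (rule integral_dominated_convergence[where w="\<lambda>x. \<bar>H x\<bar>"])
      show "AE x in lborel. (\<lambda>n. \<phi> n x * H x) \<longlonglongrightarrow> indicator (box a c) x * H x"
        by (intro AE_I2 tendsto_intros \<phi>)
      show "AE x in lborel. norm (\<phi> n x * H x) \<le> \<bar>H x\<bar>" for n
        using \<phi>(2)[of n] by (intro AE_I2) (simp add: abs_mult mult_left_le_one_le)
    qed (use iH in auto)
    then show ?thesis using zH[OF \<phi>(1)] by (simp add: LIMSEQ_const_iff)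
  qed
  have loc: "AE x in lborel. x \<in> cbox c d \<longrightarrow> h' x = 0" if cd: "cbox c d \<subseteq> U" for c d
  proof -
    have "AE x in lborel. indicator (box c d) x * H x = 0"
    proof (rule AE_zero_if_box_integrals_zero)
      show "integrable lborel (\<lambda>x. indicator (box c d) x * H x)"
        by (rule Bochner_Integration.integrable_bound[OF iH]) (auto simp: indicator_def)
      fix a b
      obtain e f where ef: "box a b \<inter> box c d = box e f" using box_Int_box by blast
      have eq: "(\<lambda>x. indicator (box a b) x * (indicator (box c d) x * H x)) = (\<lambda>x. indicator (box e f) x * H x)"
        unfolding ef[symmetric] by (auto simp: indicator_def)
      show "(LINT x|lborel. indicator (box a b) x * (indicator (box c d) x * H x)) = 0"
      proof (cases "box e f = {}")
        case True then show ?thesis unfolding eq by simp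
      next
        case False
        have "box e f \<subseteq> cbox c d" using ef box_subset_cbox[of c d] by blast
        then have "closure (box e f) \<subseteq> cbox c d" by (rule closure_minimal) (rule closed_cbox)
        then have "cbox e f \<subseteq> U" using cd closure_box[OF False] by simp
        then show ?thesis unfolding eq by (rule zbox)
      qed
    qed
    moreover have "AE x in lborel. x \<notin> cbox c d - box c d"
    proof -
      have "negligible (cbox c d - box c d)" by (rule negligible_frontier_interval)
      then have "cbox c d - box c d \<in> null_sets lborel"
        by (simp add: negligible_iff_null_sets null_sets_completion_iff)
      then show ?thesis by (rule AE_not_in)
    qed
    ultimately show ?thesis by eventually_elim (use cd in \<open>auto simp: H_def indicator_def split: if_splits\<close>)
  qed
  obtain \<D> where D: "countable \<D>" "\<And>X. X \<in> \<D> \<Longrightarrow> X \<subseteq> U" "\<And>X. X \<in> \<D> \<Longrightarrow> \<exists>a b. X = cbox a b" "\<Union>\<D> = U"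
    by (rule open_countable_Union_open_cbox[OF U]) blast
  have "AE x in lborel. \<forall>X\<in>\<D>. x \<in> X \<longrightarrow> h' x = 0"
    unfolding AE_ball_countable[OF D(1)]
  proof
    fix X assume X: "X \<in> \<D>"
    then obtain a b where "X = cbox a b" using D(3) by blast
    then show "AE x in lborel. x \<in> X \<longrightarrow> h' x = 0" using loc D(2)[OF X] by simp
  qed
  then have "AE x in lebesgue. \<forall>X\<in>\<D>. x \<in> X \<longrightarrow> h' x = 0" by (rule AE_completion)
  with aeL show ?thesis
  proof eventually_elim
    case (elim x)
    then show ?case using D(4) by (metis UnionE)
  qed
qed

lemma inner_Basis_sq_le: "b \<in> Basis \<Longrightarrow> (v \<bullet> b)\<^sup>2 \<le> (norm v)\<^sup>2"
  using power_mono[OF Basis_le_norm abs_ge_zero, of b v 2] by simp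

section \<open>The space \<open>H\<^sup>1\<^sub>0\<close> of a bounded domain\<close>

locale bounded_domain =
  fixes U :: "'a::euclidean_space set" and \<rho> :: real
  assumes U_open: "open U" and U_ball: "U \<subseteq> ball 0 \<rho>" and rho_pos: "\<rho> > 0"
begin

abbreviation "L \<equiv> lebesgue_on U"

lemma U_sets [measurable, simp]: "U \<in> sets lebesgue" "U \<in> sets borel" "U \<inter> space lebesgue \<in> sets lebesgue"
  using U_open by auto

lemma space_L [simp]: "space L = U" by (simp add: space_restrict_space)

lemma set_integral_L: "(LINT x:U|lebesgue. f x) = (LINT x|L. f x)" for f :: "'a \<Rightarrow> real"
  by (simp add: set_lebesgue_integral_def integral_restrict_space)

lemma set_integrable_L: "set_integrable lebesgue U f \<longleftrightarrow> integrable L f" for f :: "'a \<Rightarrow> real"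
  by (simp add: set_integrable_def integrable_restrict_space)

lemma meas_L: "f \<in> borel_measurable lebesgue \<Longrightarrow> f \<in> borel_measurable L"
  by (rule measurable_restrict_space1)

lemma meas_leb: "f \<in> borel_measurable borel \<Longrightarrow> f \<in> borel_measurable lebesgue"
  by (rule measurable_completion) simp

lemma AE_L: "(AE x in L. P x) \<longleftrightarrow> (AE x in lebesgue. x \<in> U \<longrightarrow> P x)"
  by (simp add: AE_restrict_space_iff)

text \<open>The given definitions use the completed measure on \<open>U\<close>, the calculus above
  the Borel one on the whole space; for Borel functions vanishing off \<open>U\<close> the two
  integrals agree.\<close>

lemma integral_L_lborel:
  fixes F :: "'a \<Rightarrow> real"
  assumes [measurable]: "F \<in> borel_measurable borel" and z: "\<And>x. x \<notin> U \<Longrightarrow> F x = 0"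
  shows "(LINT x|L. F x) = (LINT x|lborel. F x)" "integrable L F \<longleftrightarrow> integrable lborel F"
proof -
  have e: "(\<lambda>x. indicator U x *\<^sub>R F x) = F" using z by (auto simp: indicator_def fun_eq_iff)
  have m: "F \<in> borel_measurable lborel" by simp
  show "(LINT x|L. F x) = (LINT x|lborel. F x)"
    using integral_completion[OF m] by (simp only: integral_restrict_space[OF U_sets(3)] e)
  show "integrable L F \<longleftrightarrow> integrable lborel F"
    using integrable_completion[OF m] by (simp only: integrable_restrict_space[OF U_sets(3)] e)
qed

lemma integral_L_mono:
  fixes F :: "'a \<Rightarrow> real"
  assumes "integrable lborel F" "\<And>x. F x \<ge> 0"
  shows "integrable L F" "(LINT x|L. F x) \<le> (LINT x|lborel. F x)" "0 \<le> (LINT x|L. F x)"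
proof -
  have m[measurable]: "F \<in> borel_measurable borel" using assms(1) by (auto dest: borel_measurable_integrable)
  have i: "integrable lborel (\<lambda>x. indicator U x * F x)"
    by (rule Bochner_Integration.integrable_bound[OF assms(1)]) (auto simp: indicator_def)
  have "integrable L (\<lambda>x. indicator U x * F x)" using i by (subst integral_L_lborel) auto
  moreover have "integrable L (\<lambda>x. indicator U x * F x) \<longleftrightarrow> integrable L F"
    by (rule Bochner_Integration.integrable_cong) auto
  ultimately show "integrable L F" by simp
  have "(LINT x|L. F x) = (LINT x|L. indicator U x * F x)" by (intro Bochner_Integration.integral_cong) auto
  also have "\<dots> = (LINT x|lborel. indicator U x * F x)" by (subst integral_L_lborel) auto
  also have "\<dots> \<le> (LINT x|lborel. F x)" by (rule integral_mono[OF i assms(1)]) (use assms(2) in \<open>auto simp: indicator_def\<close>)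
  finally show "(LINT x|L. F x) \<le> (LINT x|lborel. F x)" .
  show "0 \<le> (LINT x|L. F x)" using assms(2) by (intro integral_nonneg_AE) auto
qed

lemma test_fun_cgrad_vanishes: "\<phi> \<in> test_funs U \<Longrightarrow> x \<notin> U \<Longrightarrow> cgrad \<phi> x = 0"
proof -
  assume "\<phi> \<in> test_funs U" "x \<notin> U"
  then have "pd b \<phi> x = 0" for b by (meson test_fun_support subsetD)
  then show ?thesis by (simp add: cgrad_def)
qed

lemma dirichlet_L:
  assumes "\<phi> \<in> test_funs U"
  shows "(LINT x|L. (norm (cgrad \<phi> x))\<^sup>2) = dirichlet \<phi>" "integrable L (\<lambda>x. (norm (cgrad \<phi> x))\<^sup>2)"
  unfolding dirichlet_def using test_fun_cgrad_borel[OF assms] test_fun_integrable_cgrad[OF assms]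
  by (simp_all add: integral_L_lborel test_fun_cgrad_vanishes[OF assms])

lemma test_fun_L:
  assumes "\<phi> \<in> test_funs U"
  shows "integrable L (\<lambda>x. (\<phi> x)\<^sup>2)" "(LINT x|L. (\<phi> x)\<^sup>2) = (LINT x|lborel. (\<phi> x)\<^sup>2)"
    "0 < p \<Longrightarrow> integrable L (\<lambda>x. \<bar>\<phi> x\<bar> powr p)" "0 < p \<Longrightarrow> (LINT x|L. \<bar>\<phi> x\<bar> powr p) = (LINT x|lborel. \<bar>\<phi> x\<bar> powr p)"
    "\<phi> \<in> borel_measurable L" "cgrad \<phi> \<in> borel_measurable L"
  using test_fun_borel[OF assms] test_fun_integrable_sq[OF assms] test_fun_integrable_powr[OF assms, of p] test_fun_cgrad_borel[OF assms]
  by (auto simp: integral_L_lborel test_fun_vanishes[OF assms] intro!: meas_L meas_leb)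

lemma L2_imp_L1:
  fixes h :: "'a \<Rightarrow> real"
  assumes [measurable]: "h \<in> borel_measurable L" and i: "integrable L (\<lambda>x. (h x)\<^sup>2)"
  shows "integrable L h"
proof (rule Bochner_Integration.integrable_bound[where f="\<lambda>x. 1 + (h x)\<^sup>2"])
  have "emeasure lborel U < \<infinity>"
    by (rule emeasure_bounded_finite) (use U_ball bounded_subset[OF bounded_ball] in auto)
  then have "finite_measure L" by (intro finite_measureI) (simp add: emeasure_restrict_space)
  then show "integrable L (\<lambda>x. 1 + (h x)\<^sup>2)" using i by (simp add: finite_measure.integrable_const)
  have "\<bar>t\<bar> \<le> 1 + t\<^sup>2" for t :: real using zero_le_power2[of "\<bar>t\<bar> - 1"] abs_ge_zero[of t] by (simp add: power2_diff)
  then show "AE x in L. norm (h x) \<le> norm (1 + (h x)\<^sup>2)" by (intro AE_I2) simp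
qed simp

lemma weak_gradD:
  assumes "is_weak_grad U u g"
  shows "u \<in> borel_measurable lebesgue" "u \<in> borel_measurable L" "integrable L (\<lambda>x. (u x)\<^sup>2)"
    "g \<in> borel_measurable lebesgue" "g \<in> borel_measurable L" "integrable L (\<lambda>x. (norm (g x))\<^sup>2)"
    "\<And>\<phi> b. \<phi> \<in> test_funs U \<Longrightarrow> b \<in> Basis \<Longrightarrow> (LINT x|L. u x * pd b \<phi> x) = - (LINT x|L. (g x \<bullet> b) * \<phi> x)"
  using assms by (auto simp: is_weak_grad_def L2_on_def set_integral_L set_integrable_L intro: meas_L)

lemma weak_grad_inner_sq:
  assumes [measurable]: "g \<in> borel_measurable L" and "integrable L (\<lambda>x. (norm (g x))\<^sup>2)" "b \<in> Basis"
  shows "integrable L (\<lambda>x. (g x \<bullet> b)\<^sup>2)"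
proof (rule Bochner_Integration.integrable_bound[OF assms(2)])
  show "AE x in L. norm ((g x \<bullet> b)\<^sup>2) \<le> norm ((norm (g x))\<^sup>2)"
    by (intro AE_I2) (simp add: inner_Basis_sq_le[OF assms(3)])
qed simp

text \<open>\<open>wgrad\<close> is an arbitrary choice among weak gradients; almost everywhere
  uniqueness makes the energy independent of that choice.\<close>

lemma weak_grad_unique:
  assumes g: "is_weak_grad U u g" and g': "is_weak_grad U u g'"
  shows "AE x in L. g x = g' x"
proof -
  note [measurable] = weak_gradD(4)[OF g] weak_gradD(4)[OF g'] weak_gradD(5)[OF g] weak_gradD(5)[OF g']
  have "AE x in lebesgue. x \<in> U \<longrightarrow> (g x \<bullet> b - g' x \<bullet> b) = 0" if b: "b \<in> Basis" for b
  proof (rule fundamental_lemma[OF U_open])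
    note s = weak_grad_inner_sq[OF weak_gradD(5,6)[OF g] b] weak_grad_inner_sq[OF weak_gradD(5,6)[OF g'] b]
    note i = L2_imp_L1[OF _ s(1)] L2_imp_L1[OF _ s(2)]
    show "integrable L (\<lambda>x. g x \<bullet> b - g' x \<bullet> b)" using i by auto
    fix \<phi> assume \<phi>: "\<phi> \<in> test_funs U"
    have [measurable]: "\<phi> \<in> borel_measurable L" using test_fun_L[OF \<phi>] by simp
    have m: "integrable L (\<lambda>x. (g x \<bullet> b) * \<phi> x)" "integrable L (\<lambda>x. (g' x \<bullet> b) * \<phi> x)"
      by (intro L2_mult_integrable s test_fun_L[OF \<phi>]; measurable)+
    have "(LINT x|L. (g x \<bullet> b) * \<phi> x) = (LINT x|L. (g' x \<bullet> b) * \<phi> x)"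
      using weak_gradD(7)[OF g \<phi> b] weak_gradD(7)[OF g' \<phi> b] by simp
    then show "(LINT x:U|lebesgue. (g x \<bullet> b - g' x \<bullet> b) * \<phi> x) = 0"
      unfolding set_integral_L left_diff_distrib using m by simp
  qed measurable
  then have "AE x in lebesgue. \<forall>b\<in>Basis. x \<in> U \<longrightarrow> (g x \<bullet> b - g' x \<bullet> b) = 0"
    by (rule AE_finite_allI[OF finite_Basis])
  then show ?thesis unfolding AE_L by eventually_elim (auto intro: euclidean_eqI)
qed

lemma wgrad_norm_eq:
  assumes "is_weak_grad U u g"
  shows "(LINT x|L. (norm (wgrad U u x))\<^sup>2) = (LINT x|L. (norm (g x))\<^sup>2)"
proof -
  have w: "is_weak_grad U u (wgrad U u)" unfolding wgrad_def by (rule someI[of "is_weak_grad U u", OF assms])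
  note [measurable] = weak_gradD(5)[OF w] weak_gradD(5)[OF assms]
  show ?thesis by (rule integral_cong_AE) (use weak_grad_unique[OF w assms] in auto)
qed

text \<open>What an approximating sequence hands down to its limit, with the weak gradient entering
  only through its energy: inequalities for test functions are transported to \<open>u\<close> along
  these limits.\<close>

definition H1_approx :: "(nat \<Rightarrow> 'a \<Rightarrow> real) \<Rightarrow> ('a \<Rightarrow> real) \<Rightarrow> bool" where
  "H1_approx \<phi> u \<longleftrightarrow> (\<forall>k. \<phi> k \<in> test_funs U) \<and> u \<in> borel_measurable L \<and> integrable L (\<lambda>x. (u x)\<^sup>2)
     \<and> (\<forall>k. integrable L (\<lambda>x. (\<phi> k x - u x)\<^sup>2)) \<and> (\<lambda>k. LINT x|L. (\<phi> k x - u x)\<^sup>2) \<longlonglongrightarrow> 0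
     \<and> (\<lambda>k. dirichlet (\<phi> k)) \<longlonglongrightarrow> (LINT x|L. (norm (wgrad U u x))\<^sup>2)
     \<and> (\<forall>\<epsilon>>0. \<exists>n0. \<forall>m\<ge>n0. \<forall>n\<ge>n0. dirichlet (\<lambda>x. \<phi> m x - \<phi> n x) \<le> \<epsilon>)"

lemma weak_grad_approx:
  assumes g: "is_weak_grad U u g" and \<phi>: "\<And>k. \<phi> k \<in> test_funs U"
    and l1: "(\<lambda>k. LINT x|L. (\<phi> k x - u x)\<^sup>2) \<longlonglongrightarrow> 0" and l2: "(\<lambda>k. LINT x|L. (norm (cgrad (\<phi> k) x - g x))\<^sup>2) \<longlonglongrightarrow> 0"
  shows "H1_approx \<phi> u"
proof -
  note [measurable] = weak_gradD(2,5)[OF g] test_fun_L(5,6)[OF \<phi>]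
  have i1: "integrable L (\<lambda>x. (\<phi> k x - u x)\<^sup>2)" for k
    by (rule Bochner_Integration.integrable_bound[where f="\<lambda>x. 2 * (\<phi> k x)\<^sup>2 + 2 * (u x)\<^sup>2"])
       (use weak_gradD(3)[OF g] test_fun_L(1)[OF \<phi>] norm_sq_diff_le[of "\<phi> k x" "u x" for x] in auto)
  have i2: "integrable L (\<lambda>x. (norm (cgrad (\<phi> k) x - g x))\<^sup>2)" for k
    by (rule Bochner_Integration.integrable_bound[where f="\<lambda>x. 2 * (norm (cgrad (\<phi> k) x))\<^sup>2 + 2 * (norm (g x))\<^sup>2"])
       (use weak_gradD(6)[OF g] dirichlet_L(2)[OF \<phi>] norm_sq_diff_le[of "cgrad (\<phi> k) x" "g x" for x] in auto)
  have "(\<lambda>k. LINT x|L. (norm (cgrad (\<phi> k) x))\<^sup>2) \<longlonglongrightarrow> (LINT x|L. (norm (g x))\<^sup>2)"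
    by (rule L2_tendsto_norm[OF _ _ weak_gradD(6)[OF g] i2 l2]) measurable
  then have d: "(\<lambda>k. dirichlet (\<phi> k)) \<longlonglongrightarrow> (LINT x|L. (norm (wgrad U u x))\<^sup>2)"
    by (simp add: dirichlet_L(1)[OF \<phi>] wgrad_norm_eq[OF g])
  have le: "dirichlet (\<lambda>x. \<phi> m x - \<phi> n x) \<le> 2 * (LINT x|L. (norm (cgrad (\<phi> m) x - g x))\<^sup>2) + 2 * (LINT x|L. (norm (cgrad (\<phi> n) x - g x))\<^sup>2)" for m n
  proof -
    have "dirichlet (\<lambda>x. \<phi> m x - \<phi> n x) = (LINT x|L. (norm ((cgrad (\<phi> m) x - g x) - (cgrad (\<phi> n) x - g x)))\<^sup>2)"
      unfolding dirichlet_L(1)[OF test_fun_diff[OF \<phi> \<phi>], symmetric]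
      by (intro Bochner_Integration.integral_cong refl) (simp add: cgrad_diff test_fun_differentiable[OF \<phi>])
    also have "\<dots> \<le> (LINT x|L. 2 * (norm (cgrad (\<phi> m) x - g x))\<^sup>2 + 2 * (norm (cgrad (\<phi> n) x - g x))\<^sup>2)"
      by (intro integral_mono' norm_sq_diff_le) (use i2 in auto)
    also have "\<dots> = 2 * (LINT x|L. (norm (cgrad (\<phi> m) x - g x))\<^sup>2) + 2 * (LINT x|L. (norm (cgrad (\<phi> n) x - g x))\<^sup>2)"
      using i2 by simp
    finally show ?thesis .
  qed
  have "\<exists>n0. \<forall>m\<ge>n0. \<forall>n\<ge>n0. dirichlet (\<lambda>x. \<phi> m x - \<phi> n x) \<le> \<epsilon>" if e: "\<epsilon> > 0" for \<epsilon>
  proof -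
    have "\<epsilon>/4 > 0" using e by simp
    then obtain n0 where n0: "\<forall>k\<ge>n0. norm ((LINT x|L. (norm (cgrad (\<phi> k) x - g x))\<^sup>2) - 0) < \<epsilon>/4" using LIMSEQ_D[OF l2] by blast
    have "dirichlet (\<lambda>x. \<phi> m x - \<phi> n x) \<le> \<epsilon>" if "m \<ge> n0" "n \<ge> n0" for m n
      using n0[rule_format, OF that(1)] n0[rule_format, OF that(2)] le[of m n] by simp
    then show ?thesis by blast
  qed
  then show ?thesis unfolding H1_approx_def using \<phi> weak_gradD(2,3)[OF g] i1 l1 d by blast
qed

lemma H10_approx:
  assumes "u \<in> H10 U" obtains \<phi> where "H1_approx \<phi> u"
proof -
  obtain g \<phi> where g: "is_weak_grad U u g" and \<phi>: "\<And>k. \<phi> k \<in> test_funs U"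
    and l: "(\<lambda>k. (LINT x|L. (\<phi> k x - u x)\<^sup>2) + (LINT x|L. (norm (cgrad (\<phi> k) x - g x))\<^sup>2)) \<longlonglongrightarrow> 0"
    using assms unfolding H10_def set_integral_L by blast
  have nn: "0 \<le> (LINT x|L. (\<phi> k x - u x)\<^sup>2)" "0 \<le> (LINT x|L. (norm (cgrad (\<phi> k) x - g x))\<^sup>2)" for k by (intro integral_nonneg_AE; simp)+
  have "(\<lambda>k. LINT x|L. (\<phi> k x - u x)\<^sup>2) \<longlonglongrightarrow> 0" "(\<lambda>k. LINT x|L. (norm (cgrad (\<phi> k) x - g x))\<^sup>2) \<longlonglongrightarrow> 0"
    by (rule tendsto_sandwich[OF _ _ tendsto_const l]; use nn in simp)+
  then show thesis by (intro that[OF weak_grad_approx[OF g \<phi>]])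
qed

text \<open>By Poincare a Cauchy sequence in the Dirichlet norm is Cauchy in L2 too. Functions and
  gradients converge by completeness, and integration by parts passes to the limit, so the limit of
  the gradients is a weak gradient.\<close>

lemma H10_limit:
  assumes \<phi>: "\<And>k. \<phi> k \<in> test_funs U"
    and c: "\<And>\<epsilon>. \<epsilon> > 0 \<Longrightarrow> \<exists>n0. \<forall>m\<ge>n0. \<forall>n\<ge>n0. dirichlet (\<lambda>x. \<phi> m x - \<phi> n x) \<le> \<epsilon>"
  obtains u where "u \<in> H10 U" "H1_approx \<phi> u"
proof -
  have pc: "(LINT x|lborel. (\<phi> m x - \<phi> n x)\<^sup>2) \<le> 2 * \<rho>\<^sup>2 * dirichlet (\<lambda>x. \<phi> m x - \<phi> n x)" for m n
    by (rule poincare_inequality[OF test_fun_diff[OF \<phi> \<phi>] U_ball rho_pos])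
  have c1: "\<exists>n0. \<forall>m\<ge>n0. \<forall>n\<ge>n0. integrable lborel (\<lambda>x. (norm (\<phi> m x - \<phi> n x))\<^sup>2) \<and> (LINT x|lborel. (norm (\<phi> m x - \<phi> n x))\<^sup>2) \<le> \<epsilon>" if e: "\<epsilon> > 0" for \<epsilon>
  proof -
    have "\<epsilon> / (2 * \<rho>\<^sup>2) > 0" using e rho_pos by simp
    then obtain n0 where n0: "\<forall>m\<ge>n0. \<forall>n\<ge>n0. dirichlet (\<lambda>x. \<phi> m x - \<phi> n x) \<le> \<epsilon> / (2 * \<rho>\<^sup>2)" using c by blast
    have "(LINT x|lborel. (\<phi> m x - \<phi> n x)\<^sup>2) \<le> \<epsilon>" if "m \<ge> n0" "n \<ge> n0" for m n
    proof -
      have "2 * \<rho>\<^sup>2 * dirichlet (\<lambda>x. \<phi> m x - \<phi> n x) \<le> 2 * \<rho>\<^sup>2 * (\<epsilon> / (2 * \<rho>\<^sup>2))" using n0 that by (intro mult_left_mono) auto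
      then show ?thesis using pc[of m n] rho_pos by simp
    qed
    then show ?thesis using test_fun_integrable_sq[OF test_fun_diff[OF \<phi> \<phi>]] by (intro exI[of _ n0]) simp
  qed
  have c2: "\<exists>n0. \<forall>m\<ge>n0. \<forall>n\<ge>n0. integrable lborel (\<lambda>x. (norm (cgrad (\<phi> m) x - cgrad (\<phi> n) x))\<^sup>2) \<and> (LINT x|lborel. (norm (cgrad (\<phi> m) x - cgrad (\<phi> n) x))\<^sup>2) \<le> \<epsilon>" if e: "\<epsilon> > 0" for \<epsilon>
    using c[OF e] test_fun_integrable_cgrad[OF test_fun_diff[OF \<phi> \<phi>]] unfolding dirichlet_def
    by (simp add: cgrad_diff test_fun_differentiable[OF \<phi>])
  have mb: "\<phi> k \<in> borel_measurable lborel" "cgrad (\<phi> k) \<in> borel_measurable lborel" for k using test_fun_borel[OF \<phi>] test_fun_cgrad_borel[OF \<phi>] by auto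
  obtain u where um: "u \<in> borel_measurable lborel" and ui: "integrable lborel (\<lambda>x. (norm (u x))\<^sup>2)"
    and ud: "\<And>k. integrable lborel (\<lambda>x. (norm (\<phi> k x - u x))\<^sup>2)" and ul: "(\<lambda>k. LINT x|lborel. (norm (\<phi> k x - u x))\<^sup>2) \<longlonglongrightarrow> 0"
    by (rule L2_complete[OF mb(1) c1]) (use test_fun_integrable_sq[OF \<phi>] in auto)
  obtain g where gm: "g \<in> borel_measurable lborel" and gi: "integrable lborel (\<lambda>x. (norm (g x))\<^sup>2)"
    and gd: "\<And>k. integrable lborel (\<lambda>x. (norm (cgrad (\<phi> k) x - g x))\<^sup>2)" and gl: "(\<lambda>k. LINT x|lborel. (norm (cgrad (\<phi> k) x - g x))\<^sup>2) \<longlonglongrightarrow> 0"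
    by (rule L2_complete[OF mb(2) c2]) (use test_fun_integrable_cgrad[OF \<phi>] in auto)
  have umb[measurable]: "u \<in> borel_measurable borel" "g \<in> borel_measurable borel" using um gm by simp_all
  have L1: "(\<lambda>k. LINT x|L. (\<phi> k x - u x)\<^sup>2) \<longlonglongrightarrow> 0"
  proof (rule tendsto_sandwich[OF _ _ tendsto_const ul])
    show "\<forall>\<^sub>F k in sequentially. 0 \<le> (LINT x|L. (\<phi> k x - u x)\<^sup>2)" by (intro always_eventually allI integral_nonneg_AE) simp
    show "\<forall>\<^sub>F k in sequentially. (LINT x|L. (\<phi> k x - u x)\<^sup>2) \<le> (LINT x|lborel. (norm (\<phi> k x - u x))\<^sup>2)"
      using integral_L_mono(2)[OF ud] by simp
  qed
  have L2: "(\<lambda>k. LINT x|L. (norm (cgrad (\<phi> k) x - g x))\<^sup>2) \<longlonglongrightarrow> 0"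
  proof (rule tendsto_sandwich[OF _ _ tendsto_const gl])
    show "\<forall>\<^sub>F k in sequentially. 0 \<le> (LINT x|L. (norm (cgrad (\<phi> k) x - g x))\<^sup>2)" by (intro always_eventually allI integral_nonneg_AE) simp
    show "\<forall>\<^sub>F k in sequentially. (LINT x|L. (norm (cgrad (\<phi> k) x - g x))\<^sup>2) \<le> (LINT x|lborel. (norm (cgrad (\<phi> k) x - g x))\<^sup>2)"
      using integral_L_mono(2)[OF gd] by simp
  qed
  have wg: "is_weak_grad U u g" unfolding is_weak_grad_def L2_on_def set_integral_L set_integrable_L
  proof (intro conjI ballI)
    show "u \<in> borel_measurable lebesgue" "g \<in> borel_measurable lebesgue" by (intro meas_leb umb)+
    show "integrable L (\<lambda>x. (u x)\<^sup>2)" "integrable L (\<lambda>x. (norm (g x))\<^sup>2)"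
      using integral_L_mono(1)[OF ui] integral_L_mono(1)[OF gi] by simp_all
    fix \<psi> and b :: 'a assume \<psi>: "\<psi> \<in> test_funs U" and b: "b \<in> Basis"
    note \<psi>b = test_fun_pd[OF \<psi> b]
    have [measurable]: "\<psi> \<in> borel_measurable borel" "(\<lambda>x. pd b \<psi> x) \<in> borel_measurable borel" "\<phi> k \<in> borel_measurable borel" "cgrad (\<phi> k) \<in> borel_measurable borel" for k
      using test_fun_borel[OF \<psi>] test_fun_borel[OF \<psi>b] test_fun_borel[OF \<phi>] test_fun_cgrad_borel[OF \<phi>] by auto
    have A: "(\<lambda>k. LINT x|lborel. \<phi> k x * pd b \<psi> x) \<longlonglongrightarrow> (LINT x|lborel. u x * pd b \<psi> x)"
      by (rule L2_tendsto_weak) (use ui ud ul test_fun_integrable_sq[OF \<phi>] test_fun_integrable_sq[OF \<psi>b] in auto)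
    have sq: "integrable lborel (\<lambda>x. (v x \<bullet> b)\<^sup>2)" if "v \<in> borel_measurable borel" "integrable lborel (\<lambda>x. (norm (v x))\<^sup>2)" for v
      by (rule Bochner_Integration.integrable_bound[OF that(2)])
         (use that inner_Basis_sq_le[OF b] in \<open>auto intro!: AE_I2\<close>)
    have B: "(\<lambda>k. LINT x|lborel. (cgrad (\<phi> k) x \<bullet> b) * \<psi> x) \<longlonglongrightarrow> (LINT x|lborel. (g x \<bullet> b) * \<psi> x)"
    proof (rule L2_tendsto_weak)
      have d: "integrable lborel (\<lambda>x. ((cgrad (\<phi> k) x - g x) \<bullet> b)\<^sup>2)" for k by (rule sq[OF _ gd]) simp
      then show "integrable lborel (\<lambda>x. (cgrad (\<phi> k) x \<bullet> b - g x \<bullet> b)\<^sup>2)" for k by (simp add: inner_diff_left)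
      show "(\<lambda>k. LINT x|lborel. (cgrad (\<phi> k) x \<bullet> b - g x \<bullet> b)\<^sup>2) \<longlonglongrightarrow> 0"
      proof (rule tendsto_sandwich[OF _ _ tendsto_const gl])
        show "\<forall>\<^sub>F k in sequentially. 0 \<le> (LINT x|lborel. (cgrad (\<phi> k) x \<bullet> b - g x \<bullet> b)\<^sup>2)" by (intro always_eventually allI integral_nonneg_AE) simp
        have "(LINT x|lborel. (cgrad (\<phi> k) x \<bullet> b - g x \<bullet> b)\<^sup>2) \<le> (LINT x|lborel. (norm (cgrad (\<phi> k) x - g x))\<^sup>2)" for k
          by (rule integral_mono) (use d[of k] gd[of k] inner_Basis_sq_le[OF b, of "cgrad (\<phi> k) x - g x" for x] in \<open>auto simp: inner_diff_left\<close>)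
        then show "\<forall>\<^sub>F k in sequentially. (LINT x|lborel. (cgrad (\<phi> k) x \<bullet> b - g x \<bullet> b)\<^sup>2) \<le> (LINT x|lborel. (norm (cgrad (\<phi> k) x - g x))\<^sup>2)" by simp
      qed
    qed (use sq[OF _ gi] sq[OF _ test_fun_integrable_cgrad[OF \<phi>]] test_fun_integrable_sq[OF \<psi>] in auto)
    have "(LINT x|lborel. \<phi> k x * pd b \<psi> x) = - (LINT x|lborel. (cgrad (\<phi> k) x \<bullet> b) * \<psi> x)" for k
      using test_fun_integration_by_parts[OF \<phi> \<psi> b] by (simp add: cgrad_inner[OF b])
    then have "(\<lambda>k. LINT x|lborel. \<phi> k x * pd b \<psi> x) \<longlonglongrightarrow> - (LINT x|lborel. (g x \<bullet> b) * \<psi> x)"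
      using tendsto_minus[OF B] by simp
    then have "(LINT x|lborel. u x * pd b \<psi> x) = - (LINT x|lborel. (g x \<bullet> b) * \<psi> x)" using LIMSEQ_unique[OF A] by simp
    then show "(LINT x|L. u x * pd b \<psi> x) = - (LINT x|L. (g x \<bullet> b) * \<psi> x)"
      by (simp add: integral_L_lborel test_fun_vanishes[OF \<psi>] test_fun_vanishes[OF \<psi>b])
  qed
  have "(\<lambda>k. (LINT x|L. (\<phi> k x - u x)\<^sup>2) + (LINT x|L. (norm (cgrad (\<phi> k) x - g x))\<^sup>2)) \<longlonglongrightarrow> 0"
    using tendsto_add[OF L1 L2] by simp
  then have "u \<in> H10 U" unfolding H10_def set_integral_L using wg \<phi> by blast
  then show thesis using that weak_grad_approx[OF wg \<phi> L1 L2] by blast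
qed

text \<open>The neighbourhood in the definition of a local minimum is measured by
  \<open>wgrad\<close> of a difference, and energy estimates are available only for elements of
  \<open>H10\<close>.\<close>

lemma H10_diff:
  assumes "u \<in> H10 U" "v \<in> H10 U" shows "(\<lambda>x. v x - u x) \<in> H10 U"
proof -
  obtain g \<phi> where g: "is_weak_grad U u g" and \<phi>: "\<And>k. \<phi> k \<in> test_funs U"
    and l: "(\<lambda>k. (LINT x|L. (\<phi> k x - u x)\<^sup>2) + (LINT x|L. (norm (cgrad (\<phi> k) x - g x))\<^sup>2)) \<longlonglongrightarrow> 0"
    using assms(1) unfolding H10_def set_integral_L by blast
  obtain h \<psi> where h: "is_weak_grad U v h" and \<psi>: "\<And>k. \<psi> k \<in> test_funs U"
    and l': "(\<lambda>k. (LINT x|L. (\<psi> k x - v x)\<^sup>2) + (LINT x|L. (norm (cgrad (\<psi> k) x - h x))\<^sup>2)) \<longlonglongrightarrow> 0"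
    using assms(2) unfolding H10_def set_integral_L by blast
  note [measurable] = weak_gradD(1,2,4,5)[OF g] weak_gradD(1,2,4,5)[OF h] test_fun_L(5,6)[OF \<phi>] test_fun_L(5,6)[OF \<psi>]
  have diff: "integrable L (\<lambda>x. (norm (a x - b x))\<^sup>2)" "(LINT x|L. (norm (a x - b x))\<^sup>2) \<le> 2 * (LINT x|L. (norm (a x))\<^sup>2) + 2 * (LINT x|L. (norm (b x))\<^sup>2)"
    if [measurable]: "a \<in> borel_measurable L" "b \<in> borel_measurable L" and i: "integrable L (\<lambda>x. (norm (a x))\<^sup>2)" "integrable L (\<lambda>x. (norm (b x))\<^sup>2)"
    for a b :: "'a \<Rightarrow> 'c::euclidean_space"
  proof -
    show 1: "integrable L (\<lambda>x. (norm (a x - b x))\<^sup>2)"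
      by (rule Bochner_Integration.integrable_bound[where f="\<lambda>x. 2 * (norm (a x))\<^sup>2 + 2 * (norm (b x))\<^sup>2"])
         (use i norm_sq_diff_le[of "a x" "b x" for x] in auto)
    have "(LINT x|L. (norm (a x - b x))\<^sup>2) \<le> (LINT x|L. 2 * (norm (a x))\<^sup>2 + 2 * (norm (b x))\<^sup>2)"
      by (rule integral_mono[OF 1 _ norm_sq_diff_le]) (use i in auto)
    also have "\<dots> = 2 * (LINT x|L. (norm (a x))\<^sup>2) + 2 * (LINT x|L. (norm (b x))\<^sup>2)" using i by simp
    finally show "(LINT x|L. (norm (a x - b x))\<^sup>2) \<le> 2 * (LINT x|L. (norm (a x))\<^sup>2) + 2 * (LINT x|L. (norm (b x))\<^sup>2)" .
  qed
  have wg: "is_weak_grad U (\<lambda>x. v x - u x) (\<lambda>x. h x - g x)"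
    unfolding is_weak_grad_def L2_on_def set_integral_L set_integrable_L
  proof (intro conjI ballI)
    show "integrable L (\<lambda>x. (v x - u x)\<^sup>2)" using diff(1)[of v u] weak_gradD(3)[OF g] weak_gradD(3)[OF h] by simp
    show "integrable L (\<lambda>x. (norm (h x - g x))\<^sup>2)" using diff(1)[of h g] weak_gradD(6)[OF g] weak_gradD(6)[OF h] by simp
    fix \<theta> and b :: 'a assume \<theta>: "\<theta> \<in> test_funs U" and b: "b \<in> Basis"
    note [measurable] = test_fun_L(5)[OF \<theta>] test_fun_L(5)[OF test_fun_pd[OF \<theta> b]]
    have i: "integrable L (\<lambda>x. v x * pd b \<theta> x)" "integrable L (\<lambda>x. u x * pd b \<theta> x)"
      "integrable L (\<lambda>x. (h x \<bullet> b) * \<theta> x)" "integrable L (\<lambda>x. (g x \<bullet> b) * \<theta> x)"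
      by (intro L2_mult_integrable weak_gradD(3)[OF g] weak_gradD(3)[OF h] test_fun_L(1)[OF test_fun_pd[OF \<theta> b]] test_fun_L(1)[OF \<theta>]
          weak_grad_inner_sq[OF weak_gradD(5,6)[OF g] b] weak_grad_inner_sq[OF weak_gradD(5,6)[OF h] b]; measurable)+
    show "(LINT x|L. (v x - u x) * pd b \<theta> x) = - (LINT x|L. ((h x - g x) \<bullet> b) * \<theta> x)"
      unfolding left_diff_distrib inner_diff_left using i weak_gradD(7)[OF g \<theta> b] weak_gradD(7)[OF h \<theta> b] by simp
  qed measurable
  have A: "(LINT x|L. ((\<psi> k x - \<phi> k x) - (v x - u x))\<^sup>2) \<le> 2 * (LINT x|L. (\<psi> k x - v x)\<^sup>2) + 2 * (LINT x|L. (\<phi> k x - u x)\<^sup>2)" for k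
  proof -
    have e: "(\<psi> k x - \<phi> k x) - (v x - u x) = (\<psi> k x - v x) - (\<phi> k x - u x)" for x by simp
    show ?thesis unfolding e
      using diff(2)[of "\<lambda>x. \<psi> k x - v x" "\<lambda>x. \<phi> k x - u x"] diff(1)[of "\<psi> k" v] diff(1)[of "\<phi> k" u]
        test_fun_L(1)[OF \<phi>] test_fun_L(1)[OF \<psi>] weak_gradD(3)[OF g] weak_gradD(3)[OF h] by simp
  qed
  have B: "(LINT x|L. (norm (cgrad (\<lambda>x. \<psi> k x - \<phi> k x) x - (h x - g x)))\<^sup>2) \<le> 2 * (LINT x|L. (norm (cgrad (\<psi> k) x - h x))\<^sup>2) + 2 * (LINT x|L. (norm (cgrad (\<phi> k) x - g x))\<^sup>2)" for k
  proof -
    have e: "cgrad (\<lambda>x. \<psi> k x - \<phi> k x) x - (h x - g x) = (cgrad (\<psi> k) x - h x) - (cgrad (\<phi> k) x - g x)" for x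
      by (simp add: cgrad_diff test_fun_differentiable[OF \<phi>] test_fun_differentiable[OF \<psi>])
    show ?thesis unfolding e
      using diff(2)[of "\<lambda>x. cgrad (\<psi> k) x - h x" "\<lambda>x. cgrad (\<phi> k) x - g x"] diff(1)[of "cgrad (\<psi> k)" h] diff(1)[of "cgrad (\<phi> k)" g]
        dirichlet_L(2)[OF \<phi>] dirichlet_L(2)[OF \<psi>] weak_gradD(6)[OF g] weak_gradD(6)[OF h] by simp
  qed
  have "(\<lambda>k. 2 * ((LINT x|L. (\<psi> k x - v x)\<^sup>2) + (LINT x|L. (norm (cgrad (\<psi> k) x - h x))\<^sup>2)) + 2 * ((LINT x|L. (\<phi> k x - u x)\<^sup>2) + (LINT x|L. (norm (cgrad (\<phi> k) x - g x))\<^sup>2))) \<longlonglongrightarrow> 2 * 0 + 2 * 0"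
    by (intro tendsto_intros l l')
  then have lim: "(\<lambda>k. 2 * ((LINT x|L. (\<psi> k x - v x)\<^sup>2) + (LINT x|L. (norm (cgrad (\<psi> k) x - h x))\<^sup>2)) + 2 * ((LINT x|L. (\<phi> k x - u x)\<^sup>2) + (LINT x|L. (norm (cgrad (\<phi> k) x - g x))\<^sup>2))) \<longlonglongrightarrow> 0" by simp
  have "(\<lambda>k. (LINT x|L. ((\<psi> k x - \<phi> k x) - (v x - u x))\<^sup>2) + (LINT x|L. (norm (cgrad (\<lambda>x. \<psi> k x - \<phi> k x) x - (h x - g x)))\<^sup>2)) \<longlonglongrightarrow> 0"
  proof (rule tendsto_sandwich[OF _ _ tendsto_const lim]; intro always_eventually allI)
    fix k
    show "0 \<le> (LINT x|L. ((\<psi> k x - \<phi> k x) - (v x - u x))\<^sup>2) + (LINT x|L. (norm (cgrad (\<lambda>x. \<psi> k x - \<phi> k x) x - (h x - g x)))\<^sup>2)"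
      by (intro add_nonneg_nonneg integral_nonneg_AE) auto
    show "(LINT x|L. ((\<psi> k x - \<phi> k x) - (v x - u x))\<^sup>2) + (LINT x|L. (norm (cgrad (\<lambda>x. \<psi> k x - \<phi> k x) x - (h x - g x)))\<^sup>2) \<le> 2 * ((LINT x|L. (\<psi> k x - v x)\<^sup>2) + (LINT x|L. (norm (cgrad (\<psi> k) x - h x))\<^sup>2)) + 2 * ((LINT x|L. (\<phi> k x - u x)\<^sup>2) + (LINT x|L. (norm (cgrad (\<phi> k) x - g x))\<^sup>2))"
    proof -
      have "a + b \<le> 2 * (c + e) + 2 * (d + f)" if "a \<le> 2 * c + 2 * d" "b \<le> 2 * e + 2 * f" for a b c d e f :: real
        using add_mono[OF that] by (simp add: algebra_simps)
      from this[OF A[of k] B[of k]] show ?thesis .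
    qed
  qed
  then show ?thesis unfolding H10_def set_integral_L
    using wg test_fun_diff[OF \<psi> \<phi>] by (intro CollectI exI[of _ "\<lambda>x. h x - g x"] conjI exI[of _ "\<lambda>k x. \<psi> k x - \<phi> k x"]) auto
qed

end

section \<open>Subcritical embeddings of a bounded domain in dimension at least three\<close>

locale critical_domain = bounded_domain U \<rho> for U :: "'a::euclidean_space set" and \<rho> +
  assumes dim: "DIM('a) \<ge> 3"
begin

definition "q = 2 * real DIM('a) / (real DIM('a) - 2)"

lemma q_gt_2: "q > 2" using dim by (simp add: q_def field_simps)

lemma q_scaling: "real DIM('a) * (2 / q) = real DIM('a) - 2" using dim by (simp add: q_def field_simps)

text \<open>From t^p \<le> t^q + t^2: Sobolev controls the critical term and Poincare the quadratic
  one, and \<open>\<delta>\<close> gives each half of \<open>\<epsilon>\<close>.\<close>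

lemma subcritical_small:
  assumes p: "2 < p" "p < q" and e: "\<epsilon> > 0"
  obtains \<delta> where "\<delta> > 0" "\<And>\<phi>. \<phi> \<in> test_funs U \<Longrightarrow> dirichlet \<phi> \<le> \<delta> \<Longrightarrow> (LINT x|L. \<bar>\<phi> x\<bar> powr p) \<le> \<epsilon>"
proof -
  obtain C where C: "C > 0" "\<And>f. f \<in> test_funs (UNIV::'a set) \<Longrightarrow> (LINT x|lborel. \<bar>f x\<bar> powr q) powr (2 / q) \<le> C * dirichlet f"
    using sobolev_inequality[OF dim] unfolding q_def[symmetric] by blast
  define \<delta> where "\<delta> = min ((\<epsilon>/2) powr (2/q) / C) (\<epsilon> / (4 * \<rho>\<^sup>2))"
  have d0: "\<delta> > 0" using e C rho_pos by (simp add: \<delta>_def)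
  have d1: "C * \<delta> \<le> (\<epsilon>/2) powr (2/q)" using C by (simp add: \<delta>_def min_def field_simps)
  have d2: "2 * \<rho>\<^sup>2 * \<delta> \<le> \<epsilon>/2"
  proof -
    have "\<delta> \<le> \<epsilon> / (4 * \<rho>\<^sup>2)" by (simp add: \<delta>_def)
    then show ?thesis using rho_pos by (simp add: field_simps)
  qed
  have "(LINT x|L. \<bar>\<phi> x\<bar> powr p) \<le> \<epsilon>" if \<phi>: "\<phi> \<in> test_funs U" and d: "dirichlet \<phi> \<le> \<delta>" for \<phi>
  proof -
    let ?M = "LINT x|lborel. \<bar>\<phi> x\<bar> powr q"
    have M0: "?M \<ge> 0" by (intro integral_nonneg_AE) auto
    have iq: "integrable lborel (\<lambda>x. \<bar>\<phi> x\<bar> powr q)" using test_fun_integrable_powr[OF \<phi>] q_gt_2 by simp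
    have ip: "integrable lborel (\<lambda>x. \<bar>\<phi> x\<bar> powr p)" using test_fun_integrable_powr[OF \<phi>] p by simp
    have i2: "integrable lborel (\<lambda>x. (\<phi> x)\<^sup>2)" using test_fun_integrable_sq[OF \<phi>] .
    have "?M powr (2/q) \<le> C * dirichlet \<phi>" using C(2) test_fun_UNIV[OF \<phi>] by blast
    also have "\<dots> \<le> C * \<delta>" using d C by simp
    also have "\<dots> \<le> (\<epsilon>/2) powr (2/q)" by (rule d1)
    finally have "(?M powr (2/q)) powr (q/2) \<le> ((\<epsilon>/2) powr (2/q)) powr (q/2)"
      by (rule powr_mono2[rotated 2]) (use q_gt_2 in auto)
    then have 1: "?M \<le> \<epsilon>/2" using M0 e q_gt_2 by (simp add: powr_powr)
    have "(LINT x|lborel. (\<phi> x)\<^sup>2) \<le> 2 * \<rho>\<^sup>2 * dirichlet \<phi>" by (rule poincare_inequality[OF \<phi> U_ball rho_pos])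
    also have "\<dots> \<le> 2 * \<rho>\<^sup>2 * \<delta>" using d by (intro mult_left_mono) auto
    finally have 2: "(LINT x|lborel. (\<phi> x)\<^sup>2) \<le> \<epsilon>/2" using d2 by linarith
    have "(LINT x|lborel. \<bar>\<phi> x\<bar> powr p) \<le> (LINT x|lborel. \<bar>\<phi> x\<bar> powr q + (\<phi> x)\<^sup>2)"
      by (rule integral_mono[OF ip]) (use iq i2 powr_le_critical_plus_square[OF p, of "\<bar>\<phi> x\<bar>" for x] in auto)
    also have "\<dots> = ?M + (LINT x|lborel. (\<phi> x)\<^sup>2)" using iq i2 by simp
    finally show ?thesis using 1 2 test_fun_L(4)[OF \<phi>, of p] p by simp
  qed
  then show thesis using that d0 by blast
qed

text \<open>Differences of the sequence are small in \<open>L^p\<close> by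
  \<open>subcritical_small\<close>; Fatou along an almost everywhere convergent subsequence
  identifies the limit as \<open>u\<close>.\<close>

lemma H1_approx_Lp:
  assumes a: "H1_approx \<phi> u" and p: "2 < p" "p < q"
  shows "integrable L (\<lambda>x. \<bar>u x\<bar> powr p)" "integrable L (\<lambda>x. \<bar>\<phi> k x - u x\<bar> powr p)"
    "(\<lambda>k. LINT x|L. \<bar>\<phi> k x - u x\<bar> powr p) \<longlonglongrightarrow> 0"
proof -
  have \<phi>: "\<And>k. \<phi> k \<in> test_funs U" and u: "u \<in> borel_measurable L"
    and i2: "\<And>k. integrable L (\<lambda>x. (\<phi> k x - u x)\<^sup>2)" and l2: "(\<lambda>k. LINT x|L. (\<phi> k x - u x)\<^sup>2) \<longlonglongrightarrow> 0"
    and c: "\<And>\<epsilon>. \<epsilon> > 0 \<Longrightarrow> \<exists>n0. \<forall>m\<ge>n0. \<forall>n\<ge>n0. dirichlet (\<lambda>x. \<phi> m x - \<phi> n x) \<le> \<epsilon>"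
    using a unfolding H1_approx_def by auto
  note [measurable] = u test_fun_L(5)[OF \<phi>]
  have "(\<lambda>k. LINT x|L. norm ((\<phi> k x - u x)\<^sup>2)) \<longlonglongrightarrow> 0" using l2 by simp
  then obtain r where r: "strict_mono r" "AE x in L. (\<lambda>n. (\<phi> (r n) x - u x)\<^sup>2) \<longlonglongrightarrow> 0"
    using tendsto_L1_AE_subseq[of L "\<lambda>k x. (\<phi> k x - u x)\<^sup>2"] i2 by blast
  have ae: "AE x in L. (\<lambda>n. \<phi> (r n) x) \<longlonglongrightarrow> u x"
    using r(2)
  proof eventually_elim
    case (elim x)
    then have "(\<lambda>n. sqrt ((\<phi> (r n) x - u x)\<^sup>2)) \<longlonglongrightarrow> sqrt 0" by (intro tendsto_intros)
    then have "(\<lambda>n. \<phi> (r n) x - u x) \<longlonglongrightarrow> 0" by (simp add: tendsto_rabs_zero_iff)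
    then show ?case by (simp add: LIM_zero_iff)
  qed
  have cp: "\<exists>n0. \<forall>m\<ge>n0. \<forall>n\<ge>n0. (LINT x|L. \<bar>\<phi> m x - \<phi> n x\<bar> powr p) \<le> \<epsilon>" if e: "\<epsilon> > 0" for \<epsilon>
  proof -
    obtain \<delta> where d: "\<delta> > 0" "\<And>\<phi>. \<phi> \<in> test_funs U \<Longrightarrow> dirichlet \<phi> \<le> \<delta> \<Longrightarrow> (LINT x|L. \<bar>\<phi> x\<bar> powr p) \<le> \<epsilon>"
      using subcritical_small[OF p e] by blast
    obtain n0 where "\<forall>m\<ge>n0. \<forall>n\<ge>n0. dirichlet (\<lambda>x. \<phi> m x - \<phi> n x) \<le> \<delta>" using c[OF d(1)] by blast
    then show ?thesis using d(2)[OF test_fun_diff[OF \<phi> \<phi>]] by blast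
  qed
  have lim: "\<exists>n0. \<forall>n\<ge>n0. integrable L (\<lambda>x. \<bar>\<phi> n x - u x\<bar> powr p) \<and> (LINT x|L. \<bar>\<phi> n x - u x\<bar> powr p) \<le> \<epsilon>" if e: "\<epsilon> > 0" for \<epsilon>
  proof -
    obtain n0 where n0: "\<forall>m\<ge>n0. \<forall>n\<ge>n0. (LINT x|L. \<bar>\<phi> m x - \<phi> n x\<bar> powr p) \<le> \<epsilon>" using cp[OF e] by blast
    have i: "integrable L (\<lambda>x. \<bar>\<phi> m x - \<phi> n x\<bar> powr p)" for m n using test_fun_L(3)[OF test_fun_diff[OF \<phi> \<phi>], of p m n] p by simp
    have "integrable L (\<lambda>x. \<bar>\<phi> n x - u x\<bar> powr p)" "(LINT x|L. \<bar>\<phi> n x - u x\<bar> powr p) \<le> \<epsilon>" if n: "n \<ge> n0" for n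
      by (rule Fatou_cauchy_limit[where h="\<lambda>y. \<bar>y\<bar> powr p" and nz=n0 and \<epsilon>=\<epsilon> and f=\<phi> and F=u, OF _ u _ _ ae filterlim_subseq[OF r(1)] _ n];
          use n0 i p test_fun_L(5)[OF \<phi>] in \<open>auto intro: continuous_on_abs_powr\<close>)+
    then show ?thesis by blast
  qed
  obtain C where C: "C > 0" "\<And>a b::real. \<bar>\<bar>a\<bar> powr p - \<bar>b\<bar> powr p\<bar> \<le> 1 * \<bar>b\<bar> powr p + C * \<bar>a - b\<bar> powr p"
    using abs_powr_close[of p 1] p by auto
  obtain n0 where n0: "integrable L (\<lambda>x. \<bar>\<phi> n0 x - u x\<bar> powr p)" using lim[of 1] by auto
  have ip: "integrable L (\<lambda>x. \<bar>\<phi> k x\<bar> powr p)" for k using test_fun_L(3)[OF \<phi>] p by simp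
  have iu: "integrable L (\<lambda>x. \<bar>u x - \<phi> n0 x\<bar> powr p)" using n0 by (simp add: abs_minus_commute)
  \<comment> \<open>The zero weight turns the comparison lemma into a pure integrability
    criterion.\<close>
  show "integrable L (\<lambda>x. \<bar>u x\<bar> powr p)"
    by (rule weighted_powr_integral_close(1)[where f=u and g="\<phi> n0" and w="\<lambda>_. 0" and \<epsilon>=1 and C=C and p=p and M=L])
       (use ip iu C in auto)
  show "integrable L (\<lambda>x. \<bar>\<phi> k x - u x\<bar> powr p)"
  proof (rule weighted_powr_integral_close(1)[where f="\<lambda>x. \<phi> k x - u x" and g="\<lambda>x. \<phi> n0 x - u x" and w="\<lambda>_. 0" and \<epsilon>=1 and C=C and p=p and M=L])
    show "integrable L (\<lambda>x. \<bar>\<phi> k x - u x - (\<phi> n0 x - u x)\<bar> powr p)"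
      using test_fun_L(3)[OF test_fun_diff[OF \<phi> \<phi>], of p k n0] p by simp
  qed (use n0 C in auto)
  show "(\<lambda>k. LINT x|L. \<bar>\<phi> k x - u x\<bar> powr p) \<longlonglongrightarrow> 0"
  proof (rule LIMSEQ_I)
    fix e :: real assume "e > 0"
    then obtain n0 where n0: "\<forall>n\<ge>n0. (LINT x|L. \<bar>\<phi> n x - u x\<bar> powr p) \<le> e/2" using lim[of "e/2"] by auto
    have "(LINT x|L. \<bar>\<phi> n x - u x\<bar> powr p) \<ge> 0" for n by (intro integral_nonneg_AE) auto
    then show "\<exists>n0. \<forall>n\<ge>n0. norm ((LINT x|L. \<bar>\<phi> n x - u x\<bar> powr p) - 0) < e"
      using n0 \<open>e > 0\<close> by (intro exI[of _ n0]) (fastforce simp: abs_of_nonneg)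
  qed
qed

lemma H1_approx_weighted_limit:
  assumes a: "H1_approx \<phi> u" and p: "2 < p" "p < q"
    and w: "w \<in> borel_measurable L" "\<And>x. 0 \<le> w x" "\<And>x. x \<in> U \<Longrightarrow> w x \<le> 1"
  shows "(\<lambda>k. LINT x|L. w x * \<bar>\<phi> k x\<bar> powr p) \<longlonglongrightarrow> (LINT x|L. w x * \<bar>u x\<bar> powr p)" "integrable L (\<lambda>x. w x * \<bar>u x\<bar> powr p)"
proof -
  have \<phi>: "\<And>k. \<phi> k \<in> test_funs U" and u: "u \<in> borel_measurable L" using a unfolding H1_approx_def by auto
  note [measurable] = u w(1) test_fun_L(5)[OF \<phi>]
  note l = H1_approx_Lp[OF a p]
  show "(\<lambda>k. LINT x|L. w x * \<bar>\<phi> k x\<bar> powr p) \<longlonglongrightarrow> (LINT x|L. w x * \<bar>u x\<bar> powr p)"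
  proof (rule tendsto_by_eps_const[OF l(3), of "LINT x|L. \<bar>u x\<bar> powr p"])
    fix \<epsilon> :: real assume e: "\<epsilon> > 0"
    obtain C where C: "C > 0" "\<And>a b::real. \<bar>\<bar>a\<bar> powr p - \<bar>b\<bar> powr p\<bar> \<le> \<epsilon> * \<bar>b\<bar> powr p + C * \<bar>a - b\<bar> powr p"
      using abs_powr_close[of p \<epsilon>] p e by auto
    have "\<bar>(LINT x|L. w x * \<bar>\<phi> k x\<bar> powr p) - (LINT x|L. w x * \<bar>u x\<bar> powr p)\<bar>
       \<le> \<epsilon> * (LINT x|L. \<bar>u x\<bar> powr p) + C * (LINT x|L. \<bar>\<phi> k x - u x\<bar> powr p)" for k
      by (rule weighted_powr_integral_close(4)) (use w l C e in auto)
    then show "\<exists>C. \<forall>k. \<bar>(LINT x|L. w x * \<bar>\<phi> k x\<bar> powr p) - (LINT x|L. w x * \<bar>u x\<bar> powr p)\<bar>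
       \<le> \<epsilon> * (LINT x|L. \<bar>u x\<bar> powr p) + C * (LINT x|L. \<bar>\<phi> k x - u x\<bar> powr p)" by blast
  qed (auto intro!: integral_nonneg_AE)
  show "integrable L (\<lambda>x. w x * \<bar>u x\<bar> powr p)"
    by (rule Bochner_Integration.integrable_bound[OF l(1)])
       (use w mult_right_mono[of "w x" 1 "\<bar>u x\<bar> powr p" for x] in \<open>auto intro!: AE_I2\<close>)
qed

text \<open>Continuity at zero of the \<open>L^p\<close> mass with respect to the energy; it will
  determine the neighbourhood in which the minimisers are minimal.\<close>

lemma H10_small:
  assumes p: "2 < p" "p < q" and e: "\<epsilon> > 0"
  obtains \<delta> where "\<delta> > 0" "\<And>v. v \<in> H10 U \<Longrightarrow> (LINT x|L. (norm (wgrad U v x))\<^sup>2) < \<delta> \<Longrightarrow>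
    integrable L (\<lambda>x. \<bar>v x\<bar> powr p) \<and> (LINT x|L. \<bar>v x\<bar> powr p) \<le> \<epsilon>"
proof -
  obtain \<delta> where d: "\<delta> > 0" "\<And>\<phi>. \<phi> \<in> test_funs U \<Longrightarrow> dirichlet \<phi> \<le> \<delta> \<Longrightarrow> (LINT x|L. \<bar>\<phi> x\<bar> powr p) \<le> \<epsilon>"
    using subcritical_small[OF p e] by blast
  have "integrable L (\<lambda>x. \<bar>v x\<bar> powr p) \<and> (LINT x|L. \<bar>v x\<bar> powr p) \<le> \<epsilon>"
    if v: "v \<in> H10 U" "(LINT x|L. (norm (wgrad U v x))\<^sup>2) < \<delta>" for v
  proof -
    obtain \<phi> where a: "H1_approx \<phi> v" using H10_approx[OF v(1)] by blast
    have \<phi>: "\<And>k. \<phi> k \<in> test_funs U" and l: "(\<lambda>k. dirichlet (\<phi> k)) \<longlonglongrightarrow> (LINT x|L. (norm (wgrad U v x))\<^sup>2)"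
      using a unfolding H1_approx_def by auto
    have w: "(\<lambda>k. LINT x|L. 1 * \<bar>\<phi> k x\<bar> powr p) \<longlonglongrightarrow> (LINT x|L. 1 * \<bar>v x\<bar> powr p)"
      by (rule H1_approx_weighted_limit[OF a p]) auto
    have "\<forall>\<^sub>F k in sequentially. dirichlet (\<phi> k) < \<delta>" using order_tendstoD(2)[OF l v(2)] .
    then have "\<forall>\<^sub>F k in sequentially. (LINT x|L. 1 * \<bar>\<phi> k x\<bar> powr p) \<le> \<epsilon>" by eventually_elim (use d(2)[OF \<phi>] in auto)
    then have "(LINT x|L. 1 * \<bar>v x\<bar> powr p) \<le> \<epsilon>" by (rule tendsto_upperbound[OF w]) simp
    then show ?thesis using H1_approx_Lp(1)[OF a p] by simp
  qed
  then show thesis using that d(1) by blast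
qed

section \<open>The Sobolev constant\<close>

definition "Mq f = (LINT x|lborel. \<bar>f x\<bar> powr q)" for f :: "'a \<Rightarrow> real"

text \<open>The best Sobolev constant of the whole space. By scale invariance functions supported in
  any small ball come as close to it as functions on the whole space.\<close>

definition "S = Inf {dirichlet f / Mq f powr (2/q) | f. f \<in> test_funs (UNIV::'a set) \<and> Mq f > 0}"

lemma Mq_nonneg: "Mq f \<ge> 0" unfolding Mq_def by (intro integral_nonneg_AE) auto

lemma ex_test_fun_Mq_pos: "\<exists>f \<in> test_funs (UNIV::'a set). Mq f > 0"
proof -
  let ?B = "cbox (0::'a) One"
  obtain \<phi> :: "nat \<Rightarrow> 'a \<Rightarrow> real" where \<phi>: "\<And>n. \<phi> n \<in> test_funs ?B" "\<And>n x. \<bar>\<phi> n x\<bar> \<le> 1" "\<And>x. (\<lambda>n. \<phi> n x) \<longlonglongrightarrow> indicator (box 0 One) x"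
    using box_indicator_test_fun_limit[OF order_refl] by blast
  have [measurable]: "\<phi> n \<in> borel_measurable lborel" for n using test_fun_borel[OF \<phi>(1)] by simp
  have "(\<lambda>n. Mq (\<phi> n)) \<longlonglongrightarrow> (LINT x|lborel. \<bar>indicator (box (0::'a) One) x\<bar> powr q)"
    unfolding Mq_def
  proof (rule integral_dominated_convergence[where w="indicat_real ?B"])
    show "integrable lborel (indicat_real ?B)" by (rule integrable_real_indicator) (use emeasure_lborel_cbox_finite in auto)
    show "AE x in lborel. (\<lambda>n. \<bar>\<phi> n x\<bar> powr q) \<longlonglongrightarrow> \<bar>indicator (box 0 One) x\<bar> powr q"
    proof (rule AE_I2)
      fix x
      have c: "continuous_on UNIV (\<lambda>x::real. \<bar>x\<bar> powr q)" using continuous_on_abs_powr q_gt_2 by simp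
      show "(\<lambda>n. \<bar>\<phi> n x\<bar> powr q) \<longlonglongrightarrow> \<bar>indicator (box 0 One) x\<bar> powr q"
        by (rule continuous_on_tendsto_compose[OF c \<phi>(3)]) auto
    qed
    show "AE x in lborel. norm (\<bar>\<phi> n x\<bar> powr q) \<le> indicat_real ?B x" for n
    proof (rule AE_I2)
      fix x show "norm (\<bar>\<phi> n x\<bar> powr q) \<le> indicat_real ?B x"
        by (cases "x \<in> ?B") (use \<phi>(2)[of n x] test_fun_vanishes[OF \<phi>(1)] q_gt_2 in \<open>auto intro: powr_le1\<close>)
    qed
  qed (auto simp del: mem_box)
  moreover have "(LINT x|lborel. \<bar>indicator (box (0::'a) One) x\<bar> powr q) = (LINT x|lborel. indicator (box (0::'a) One) x)"
    by (intro Bochner_Integration.integral_cong) (auto simp: indicator_def)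
  moreover have "(LINT x|lborel. indicator (box (0::'a) One) x) = (1::real)"
    by (simp add: measure_lborel_box_eq inner_diff_left)
  ultimately have "(\<lambda>n. Mq (\<phi> n)) \<longlonglongrightarrow> 1" by simp
  then have "\<forall>\<^sub>F n in sequentially. Mq (\<phi> n) > 0" by (rule order_tendstoD) simp
  then obtain n where "Mq (\<phi> n) > 0" by (auto simp: eventually_sequentially)
  then show ?thesis using test_fun_UNIV[OF \<phi>(1)] by blast
qed

lemma S_props:
  shows S_pos: "S > 0" and S_le: "f \<in> test_funs (UNIV::'a set) \<Longrightarrow> S * Mq f powr (2/q) \<le> dirichlet f"
    and S_approx: "c > 1 \<Longrightarrow> \<exists>f \<in> test_funs (UNIV::'a set). Mq f > 0 \<and> dirichlet f < c * S * Mq f powr (2/q)"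
proof -
  let ?X = "{dirichlet f / Mq f powr (2/q) | f. f \<in> test_funs (UNIV::'a set) \<and> Mq f > 0}"
  obtain C where C: "C > 0" "\<And>f. f \<in> test_funs (UNIV::'a set) \<Longrightarrow> Mq f powr (2 / q) \<le> C * dirichlet f"
    using sobolev_inequality[OF dim] unfolding q_def[symmetric] Mq_def[symmetric] by blast
  have ne: "?X \<noteq> {}" using ex_test_fun_Mq_pos by blast
  have lb: "1/C \<le> y" if yX: "y \<in> ?X" for y
  proof -
    obtain f where f: "f \<in> test_funs (UNIV::'a set)" "Mq f > 0" "y = dirichlet f / Mq f powr (2/q)" using yX by blast
    show ?thesis using C(1) C(2)[OF f(1)] f(2) unfolding f(3) by (simp add: field_simps)
  qed
  have bb: "bdd_below ?X" using lb by (rule bdd_belowI)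
  have "1/C \<le> S" unfolding S_def by (rule cInf_greatest[OF ne lb])
  moreover have "1/C > 0" using C(1) by simp
  ultimately show S0: "S > 0" by linarith
  show "S * Mq f powr (2/q) \<le> dirichlet f" if f: "f \<in> test_funs (UNIV::'a set)"
  proof (cases "Mq f > 0")
    case True
    have "S \<le> dirichlet f / Mq f powr (2/q)" unfolding S_def by (rule cInf_lower[OF _ bb]) (use f True in blast)
    then show ?thesis using True by (simp add: field_simps)
  next
    case False
    then have "Mq f = 0" using Mq_nonneg[of f] by simp
    then show ?thesis using dirichlet_nonneg[of f] by simp
  qed
  show "\<exists>f \<in> test_funs (UNIV::'a set). Mq f > 0 \<and> dirichlet f < c * S * Mq f powr (2/q)" if "c > 1"
  proof -
    have "Inf ?X < c * S" using that S0 unfolding S_def[symmetric] by simp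
    then obtain y where y: "y \<in> ?X" "y < c * S" using cInf_lessD[OF ne] by blast
    then obtain f where f: "f \<in> test_funs (UNIV::'a set)" "Mq f > 0" "y = dirichlet f / Mq f powr (2/q)" by blast
    have "y * Mq f powr (2/q) < c * S * Mq f powr (2/q)" using y(2) f(2) by (intro mult_strict_right_mono) auto
    then show ?thesis using f by (intro bexI[of _ f]) auto
  qed
qed

text \<open>Hoelder's inequality on the finite measure space \<open>U\<close>, derived from Young's
  inequality with weights p/q and 1 - p/q after scaling by the level \<open>a\<close> for which a^q
  \<kappa> is the critical mass. The summand 1 keeps the base \<open>\<kappa>\<close>
  positive.\<close>

lemma subcritical_Holder:
  assumes \<phi>: "\<phi> \<in> test_funs U" and p: "2 < p" "p < q"
  shows "(LINT x|lborel. \<bar>\<phi> x\<bar> powr p) powr (2/p) \<le> Mq \<phi> powr (2/q) * (measure lborel U + 1) powr (2/p - 2/q)"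
proof -
  define \<kappa> where "\<kappa> = measure lborel U + 1"
  have \<kappa>: "\<kappa> > 0" "measure lborel U \<le> \<kappa>" by (auto simp: \<kappa>_def add_nonneg_pos)
  have ip: "integrable lborel (\<lambda>x. \<bar>\<phi> x\<bar> powr p)" "integrable lborel (\<lambda>x. \<bar>\<phi> x\<bar> powr q)" using test_fun_integrable_powr[OF \<phi>] p by auto
  have Uf: "emeasure lborel U < \<infinity>"
    by (rule emeasure_bounded_finite) (use U_ball bounded_subset[OF bounded_ball] in auto)
  have iU: "integrable lborel (indicat_real U)" by (rule integrable_real_indicator) (use Uf in auto)
  have q0: "q > 0" "p > 0" using p by auto
  show ?thesis
  proof (cases "Mq \<phi> > 0")
    case True
    define a where "a = (Mq \<phi> / \<kappa>) powr (1/q)"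
    have a: "a > 0" using True \<kappa> by (simp add: a_def)
    have aq: "a powr q = Mq \<phi> / \<kappa>" using True \<kappa> q0 by (simp add: a_def powr_powr)
    define \<theta> where "\<theta> = p / q"
    have \<theta>: "0 \<le> \<theta>" "\<theta> \<le> 1" using p by (auto simp: \<theta>_def)
    have pw: "\<bar>\<phi> x\<bar> powr p \<le> a powr p * (\<theta> / a powr q * \<bar>\<phi> x\<bar> powr q + (1 - \<theta>) * indicat_real U x)" for x
    proof (cases "\<phi> x = 0")
      case True
      then show ?thesis using \<theta> a by simp
    next
      case False
      then have xU: "x \<in> U" using test_fun_vanishes[OF \<phi>] by blast
      define s where "s = (\<bar>\<phi> x\<bar> / a) powr q"
      have s: "s > 0" using False a by (simp add: s_def)
      have "s powr \<theta> * 1 powr (1 - \<theta>) \<le> \<theta> * s + (1 - \<theta>) * 1"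
        by (rule Youngs_inequality_0) (use \<theta> s in auto)
      then have 1: "s powr \<theta> \<le> \<theta> * s + (1 - \<theta>)" by simp
      have 2: "s powr \<theta> = \<bar>\<phi> x\<bar> powr p / a powr p"
        using q0 a by (simp add: s_def powr_powr \<theta>_def powr_divide)
      have 3: "s = \<bar>\<phi> x\<bar> powr q / a powr q" using a by (simp add: s_def powr_divide)
      have "\<bar>\<phi> x\<bar> powr p / a powr p \<le> \<theta> * (\<bar>\<phi> x\<bar> powr q / a powr q) + (1 - \<theta>)" using 1 unfolding 2 unfolding 3 .
      then have "a powr p * (\<bar>\<phi> x\<bar> powr p / a powr p) \<le> a powr p * (\<theta> * (\<bar>\<phi> x\<bar> powr q / a powr q) + (1 - \<theta>))"
        by (rule mult_left_mono) simp
      then show ?thesis using xU a by simp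
    qed
    have "(LINT x|lborel. \<bar>\<phi> x\<bar> powr p) \<le> (LINT x|lborel. a powr p * (\<theta> / a powr q * \<bar>\<phi> x\<bar> powr q + (1 - \<theta>) * indicat_real U x))"
      by (rule integral_mono[OF ip(1)]) (use ip iU pw in auto)
    also have "\<dots> = a powr p * (\<theta> / a powr q * Mq \<phi> + (1 - \<theta>) * measure lborel U)"
      using ip iU by (simp add: Mq_def)
    also have "\<dots> \<le> a powr p * (\<theta> / a powr q * Mq \<phi> + (1 - \<theta>) * \<kappa>)" using \<kappa> \<theta> by (intro mult_left_mono add_left_mono) auto
    also have "\<theta> / a powr q * Mq \<phi> = \<theta> * \<kappa>" using True \<kappa> unfolding aq by simp
    also have "a powr p * (\<theta> * \<kappa> + (1 - \<theta>) * \<kappa>) = a powr p * \<kappa>" by (simp add: algebra_simps)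
    finally have "(LINT x|lborel. \<bar>\<phi> x\<bar> powr p) powr (2/p) \<le> (a powr p * \<kappa>) powr (2/p)"
      by (rule powr_mono2[rotated 2]) (use p in \<open>auto intro!: integral_nonneg_AE\<close>)
    also have "\<dots> = a powr 2 * \<kappa> powr (2/p)" using a \<kappa> q0 by (simp add: powr_mult powr_powr)
    also have "a powr 2 = Mq \<phi> powr (2/q) / \<kappa> powr (2/q)" using True \<kappa> by (simp add: a_def powr_powr powr_divide)
    also have "Mq \<phi> powr (2/q) / \<kappa> powr (2/q) * \<kappa> powr (2/p) = Mq \<phi> powr (2/q) * \<kappa> powr (2/p - 2/q)" using \<kappa> by (simp add: powr_diff)
    finally show ?thesis by (simp add: \<kappa>_def)
  next
    case False
    then have "Mq \<phi> = 0" using Mq_nonneg[of \<phi>] by simp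
    then have "AE x in lborel. \<bar>\<phi> x\<bar> powr q = 0" unfolding Mq_def using integral_nonneg_eq_0_iff_AE[OF ip(2)] by simp
    then have "AE x in lborel. \<bar>\<phi> x\<bar> powr p = 0" by eventually_elim simp
    then have "(LINT x|lborel. \<bar>\<phi> x\<bar> powr p) = 0" by (rule integral_eq_zero_AE)
    then show ?thesis by simp
  qed
qed

text \<open>The volume factor in Hoelder's inequality has exponent 2/p - 2/q and tends to 1, so the
  subcritical constants on \<open>U\<close> are asymptotically no worse than
  \<open>S\<close>.\<close>

lemma eventually_subcritical_Sobolev:
  assumes "c < 1"
  shows "\<forall>\<^sub>F p in at_left q. \<forall>\<phi> \<in> test_funs U. c * S * (LINT x|L. \<bar>\<phi> x\<bar> powr p) powr (2/p) \<le> dirichlet \<phi>"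
proof (cases "c \<le> 0")
  case True
  have "c * S * (LINT x|L. \<bar>\<phi> x\<bar> powr p) powr (2/p) \<le> dirichlet \<phi>" for p \<phi>
  proof -
    have "c * S \<le> 0" by (rule mult_nonpos_nonneg[OF True less_imp_le[OF S_pos]])
    then have "c * S * (LINT x|L. \<bar>\<phi> x\<bar> powr p) powr (2/p) \<le> 0" by (rule mult_nonpos_nonneg) simp
    then show ?thesis using dirichlet_nonneg[of \<phi>] by linarith
  qed
  then show ?thesis by (intro always_eventually) blast
next
  case False
  define \<kappa> where "\<kappa> = measure lborel U + 1"
  have \<kappa>: "\<kappa> > 0" by (auto simp: \<kappa>_def add_nonneg_pos)
  have "((\<lambda>p. \<kappa> powr (2/p - 2/q)) \<longlongrightarrow> \<kappa> powr (2/q - 2/q)) (at_left q)"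
    using \<kappa> q_gt_2 by (intro tendsto_intros) auto
  then have "((\<lambda>p. \<kappa> powr (2/p - 2/q)) \<longlongrightarrow> 1) (at_left q)" using \<kappa> by simp
  moreover have "1 < 1/c" using False assms by simp
  ultimately have "\<forall>\<^sub>F p in at_left q. \<kappa> powr (2/p - 2/q) < 1/c" by (rule order_tendstoD(2))
  moreover have "\<forall>\<^sub>F p in at_left q. 2 < p \<and> p < q"
    using eventually_at_left_real[OF q_gt_2] by simp
  ultimately show ?thesis
  proof eventually_elim
    case (elim p)
    show ?case
    proof
      fix \<phi> assume \<phi>: "\<phi> \<in> test_funs U"
      have "(LINT x|L. \<bar>\<phi> x\<bar> powr p) powr (2/p) \<le> Mq \<phi> powr (2/q) * \<kappa> powr (2/p - 2/q)"
        using subcritical_Holder[OF \<phi>] elim test_fun_L(4)[OF \<phi>, of p] by (simp add: \<kappa>_def)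
      also have "\<dots> \<le> Mq \<phi> powr (2/q) * (1/c)" using elim by (intro mult_left_mono) auto
      finally have "c * S * (LINT x|L. \<bar>\<phi> x\<bar> powr p) powr (2/p) \<le> c * S * (Mq \<phi> powr (2/q) * (1/c))"
        using False S_pos by (intro mult_left_mono) auto
      also have "\<dots> = S * Mq \<phi> powr (2/q)" using False by simp
      also have "\<dots> \<le> dirichlet \<phi>" by (rule S_le[OF test_fun_UNIV[OF \<phi>]])
      finally show "c * S * (LINT x|L. \<bar>\<phi> x\<bar> powr p) powr (2/p) \<le> dirichlet \<phi>" .
    qed
  qed
qed

text \<open>Composition with x to s(x - c) squeezes the support into the ball. It multiplies the
  critical mass by s^-N and the Dirichlet integral by s^(2-N), the power 2/q of the former, so the
  quotient is preserved.\<close>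

lemma concentrated_test_fun:
  assumes f: "f \<in> test_funs (UNIV::'a set)" and t: "t > 0"
  obtains g k where "g \<in> test_funs (ball c t)" "k > 0" "dirichlet g = k powr (2/q) * dirichlet f" "Mq g = k * Mq f"
proof -
  obtain K where K: "compact K" "\<And>x. x \<notin> K \<Longrightarrow> f x = 0" using test_fun_support[OF f] by metis
  obtain R where R: "R > 0" "\<And>x. x \<in> K \<Longrightarrow> norm x \<le> R" using compact_imp_bounded[OF K(1)] bounded_pos by metis
  define s where "s = 2 * R / t"
  have s: "s > 0" using R t by (simp add: s_def)
  define g where "g = (\<lambda>x. f (- (s *\<^sub>R c) + s *\<^sub>R x))"
  have fd: "\<forall>x. f differentiable (at x)" using test_fun_differentiable[OF f] by blast
  have "g \<in> test_funs (ball c t)"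
  proof (rule test_funsI[of _ "cball c (t/2)"])
    show "smooth_fun g" unfolding g_def by (rule smooth_fun_affine[OF test_fun_smooth[OF f]])
    show "g x = 0" if "x \<notin> cball c (t/2)" for x
    proof -
      have "norm (x - c) > t/2" using that by (simp add: dist_norm norm_minus_commute)
      then have "s * norm (x - c) > s * (t/2)" using s by simp
      also have "s * (t/2) = R" using t by (simp add: s_def)
      finally have "norm (s *\<^sub>R (x - c)) > R" using s by simp
      then have "s *\<^sub>R (x - c) \<notin> K" using R(2) by (meson not_less)
      moreover have "- (s *\<^sub>R c) + s *\<^sub>R x = s *\<^sub>R (x - c)" by (simp add: algebra_simps)
      ultimately show ?thesis using K(2) by (simp add: g_def)
    qed
  qed (use t in auto)
  moreover define k where "k = 1 / s ^ DIM('a)"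
  have k: "k > 0" using s by (simp add: k_def)
  have cg: "cgrad g x = s *\<^sub>R cgrad f (- (s *\<^sub>R c) + s *\<^sub>R x)" for x
    unfolding g_def by (rule cgrad_eqI) (simp only: pd_affine(1)[OF fd] inner_scaleR_left cgrad_inner)
  have [measurable]: "f \<in> borel_measurable borel" "cgrad f \<in> borel_measurable borel" using test_fun_borel[OF f] test_fun_cgrad_borel[OF f] by auto
  have "Mq f = s ^ DIM('a) * Mq g" unfolding Mq_def g_def by (rule lborel_integral_scale[OF _ s]) measurable
  then have "Mq g = k * Mq f" using s by (simp add: k_def)
  moreover have "dirichlet f = s ^ DIM('a) * (LINT x|lborel. (norm (cgrad f (- (s *\<^sub>R c) + s *\<^sub>R x)))\<^sup>2)"
    unfolding dirichlet_def by (rule lborel_integral_scale[OF _ s]) measurable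
  then have "dirichlet g = k * s\<^sup>2 * dirichlet f" unfolding dirichlet_def[of g] cg using s by (simp add: k_def power_mult_distrib)
  moreover have "k * s\<^sup>2 = k powr (2/q)"
  proof -
    have "k = s powr (- real DIM('a))" using s by (simp add: k_def powr_minus powr_realpow divide_inverse)
    then have "k powr (2/q) = s powr (- (real DIM('a) * (2/q)))" "k * s\<^sup>2 = s powr (- real DIM('a) + 2)"
      using s powr_add[of s "- real DIM('a)" 2] by (simp_all add: powr_powr)
    then show ?thesis unfolding q_scaling by simp
  qed
  ultimately show thesis using that k by simp
qed

end

section \<open>Orthogonal invariance\<close>

text \<open>Integrating \<open>f x * indicator (ball 0 1) (Q y + x)\<close> over \<open>x\<close> and \<open>y\<close> in both orders shows that
  \<open>f\<close> and \<open>f \<circ> (- Q)\<close> have the same integral.\<close>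

lemma nn_integral_neg_orthogonal:
  fixes Q :: "'a::euclidean_space \<Rightarrow> 'a"
  assumes Q: "orthogonal_transformation Q" and f[measurable]: "f \<in> borel_measurable borel"
  shows "(\<integral>\<^sup>+y. f (- Q y) \<partial>lborel) = (\<integral>\<^sup>+x. f x \<partial>lborel)"
proof -
  let ?B = "ball (0::'a) 1"
  have lin: "linear Q" by (rule orthogonal_transformation_linear[OF Q])
  have [measurable]: "Q \<in> borel_measurable borel"
    by (rule borel_measurable_continuous_onI) (rule linear_continuous_on_compose[OF continuous_on_id lin, simplified])
  have [measurable]: "?B \<in> sets borel" by simp
  have nQ: "norm (Q x) = norm x" for x by (rule orthogonal_transformation_norm[OF Q])
  have bij: "bij Q" by (rule orthogonal_transformation_bij[OF Q])
  define b where "b = emeasure lborel ?B"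
  have b: "b \<noteq> 0" "b \<noteq> top"
    using emeasure_lborel_ball_finite[of "0::'a" 1] content_ball_gt_0_iff[of "0::'a" 1] unfolding b_def
    by (auto simp: measure_def)
  have 1: "(\<integral>\<^sup>+y. f x * indicator ?B (Q y + x) \<partial>lborel) = f x * b" for x
  proof -
    obtain z where z: "Q z = x" using bij by (metis bij_pointE)
    have "(\<integral>\<^sup>+y. f x * indicator ?B (Q y + x) \<partial>lborel) = (\<integral>\<^sup>+y. f x * indicator ?B (y + z) \<partial>lborel)"
      using nQ linear_add[OF lin] by (intro nn_integral_cong) (auto simp: indicator_def z[symmetric], metis, metis)
    also have "\<dots> = (\<integral>\<^sup>+y. f x * indicator ?B y \<partial>lborel)" by (rule nn_integral_lborel_translate) measurable
    also have "\<dots> = f x * b" unfolding b_def by (rule nn_integral_cmult_indicator) simp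
    finally show ?thesis .
  qed
  have 2: "(\<integral>\<^sup>+y. f (x - Q y) \<partial>lborel) = (\<integral>\<^sup>+y. f (- Q y) \<partial>lborel)" for x
  proof -
    obtain z where z: "Q z = x" using bij by (metis bij_pointE)
    have "(\<integral>\<^sup>+y. f (- Q y) \<partial>lborel) = (\<integral>\<^sup>+y. (\<lambda>w. f (x - Q w)) (y + z) \<partial>lborel)"
      by (intro nn_integral_cong) (simp add: linear_add[OF lin] z)
    also have "\<dots> = (\<integral>\<^sup>+w. f (x - Q w) \<partial>lborel)" by (rule nn_integral_lborel_translate) measurable
    finally show ?thesis by simp
  qed
  have "(\<integral>\<^sup>+x. f x \<partial>lborel) * b = (\<integral>\<^sup>+x. \<integral>\<^sup>+y. f x * indicator ?B (Q y + x) \<partial>lborel \<partial>lborel)"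
    unfolding 1 by (rule nn_integral_multc[symmetric]) simp
  also have "\<dots> = (\<integral>\<^sup>+y. \<integral>\<^sup>+x. f x * indicator ?B (Q y + x) \<partial>lborel \<partial>lborel)"
    by (rule lborel_pair.Fubini') measurable
  also have "\<dots> = (\<integral>\<^sup>+y. \<integral>\<^sup>+x. f (x - Q y) * indicator ?B x \<partial>lborel \<partial>lborel)"
  proof (rule nn_integral_cong)
    fix y
    have "(\<integral>\<^sup>+x. (\<lambda>w. f w * indicator ?B (Q y + w)) (x + - Q y) \<partial>lborel) = (\<integral>\<^sup>+x. f x * indicator ?B (Q y + x) \<partial>lborel)"
      by (rule nn_integral_lborel_translate) measurable
    then show "(\<integral>\<^sup>+x. f x * indicator ?B (Q y + x) \<partial>lborel) = (\<integral>\<^sup>+x. f (x - Q y) * indicator ?B x \<partial>lborel)" by simp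
  qed
  also have "\<dots> = (\<integral>\<^sup>+x. \<integral>\<^sup>+y. f (x - Q y) * indicator ?B x \<partial>lborel \<partial>lborel)"
    by (rule lborel_pair.Fubini') measurable
  also have "\<dots> = (\<integral>\<^sup>+x. (\<integral>\<^sup>+y. f (- Q y) \<partial>lborel) * indicator ?B x \<partial>lborel)"
    by (intro nn_integral_cong, subst nn_integral_multc) (measurable, simp add: 2)
  also have "\<dots> = (\<integral>\<^sup>+y. f (- Q y) \<partial>lborel) * b" unfolding b_def by (rule nn_integral_cmult_indicator) simp
  finally have "b * (\<integral>\<^sup>+x. f x \<partial>lborel) = b * (\<integral>\<^sup>+y. f (- Q y) \<partial>lborel)" by (simp add: mult.commute)
  then show ?thesis using b by (simp add: ennreal_mult_cancel_left)
qed

text \<open>The preceding invariance concerns \<open>- Q\<close>, so it is applied to the negative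
  of \<open>Q\<close>; the identity on Borel sets then passes to the completion.\<close>

lemma lebesgue_orthogonal:
  fixes Q :: "'a::euclidean_space \<Rightarrow> 'a"
  assumes Q: "orthogonal_transformation Q"
  shows "distr lebesgue lebesgue Q = lebesgue" "Q \<in> lebesgue \<rightarrow>\<^sub>M lebesgue"
proof -
  have Q': "orthogonal_transformation (\<lambda>x. - Q x)" using Q by (simp add: orthogonal_transformation_neg)
  have lin: "linear Q" by (rule orthogonal_transformation_linear[OF Q])
  have Qm[measurable]: "Q \<in> borel_measurable borel"
    by (rule borel_measurable_continuous_onI) (rule linear_continuous_on_compose[OF continuous_on_id lin, simplified])
  have inv: "distr lborel lborel Q = lborel"
  proof (rule measure_eqI)
    fix A assume "A \<in> sets (distr lborel lborel Q)"
    then have A[measurable]: "A \<in> sets borel" by simp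
    have v: "Q -` A \<in> sets borel" using measurable_sets[OF Qm A] by simp
    have "emeasure (distr lborel lborel Q) A = emeasure lborel (Q -` A)" by (simp add: emeasure_distr)
    also have "\<dots> = (\<integral>\<^sup>+y. indicator (Q -` A) y \<partial>lborel)" using v by simp
    also have "\<dots> = (\<integral>\<^sup>+y. indicator A (- (- Q y)) \<partial>lborel)" by (simp add: indicator_vimage)
    also have "\<dots> = emeasure lborel A" using nn_integral_neg_orthogonal[OF Q', of "indicator A"] by simp
    finally show "emeasure (distr lborel lborel Q) A = emeasure lborel A" .
  qed simp
  have ml: "Q \<in> lebesgue \<rightarrow>\<^sub>M lborel" by (rule measurable_completion) simp
  have d: "distr lebesgue lborel Q = lborel" using distr_completion[of Q lborel lborel] inv by simp
  show "Q \<in> lebesgue \<rightarrow>\<^sub>M lebesgue" by (rule completion.measurable_completion2[OF ml]) (simp add: d)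
  show "distr lebesgue lebesgue Q = lebesgue"
    using completion.completion_distr_eq[OF ml] by (simp add: d)
qed

lemma lebesgue_integral_orthogonal:
  fixes F :: "'a::euclidean_space \<Rightarrow> real" and Q :: "'a \<Rightarrow> 'a"
  assumes "orthogonal_transformation Q" "F \<in> borel_measurable lebesgue"
  shows "(LINT x|lebesgue. F (Q x)) = (LINT x|lebesgue. F x)"
  using integral_distr[OF lebesgue_orthogonal(2)[OF assms(1)] assms(2)] lebesgue_orthogonal(1)[OF assms(1)] by simp

lemma AE_lebesgue_orthogonal:
  fixes P :: "'a::euclidean_space \<Rightarrow> bool" and Q :: "'a \<Rightarrow> 'a"
  assumes Q: "orthogonal_transformation Q" and P: "AE x in lebesgue. P x"
  shows "AE x in lebesgue. P (Q x)"
proof -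
  have "{x \<in> space lebesgue. \<not> P x} \<in> null_sets lebesgue" using P completion.AE_iff_null_sets by blast
  then have "AE x in lebesgue. x \<notin> {x \<in> space lebesgue. \<not> P x}" by (rule AE_not_in)
  moreover have m: "{x \<in> space lebesgue. \<not> P x} \<in> sets lebesgue" using \<open>_ \<in> null_sets _\<close> by auto
  have "space lebesgue - {x \<in> space lebesgue. \<not> P x} = {x. P x}" by auto
  then have mP: "{x. P x} \<in> sets lebesgue" using sets.compl_sets[OF m] by simp
  from calculation have "AE x in distr lebesgue lebesgue Q. x \<notin> {x \<in> space lebesgue. \<not> P x}" by (simp only: lebesgue_orthogonal(1)[OF Q])
  then have "AE x in lebesgue. Q x \<notin> {x \<in> space lebesgue. \<not> P x}"
    by (subst (asm) AE_distr_iff[OF lebesgue_orthogonal(2)[OF Q]]) (use mP in simp)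
  then show ?thesis by eventually_elim simp
qed

section \<open>Near-minimisers do not split\<close>

lemma smooth_cgrad_bound_ball:
  assumes "smooth_fun (h::'a::euclidean_space \<Rightarrow> real)"
  obtains K where "K \<ge> 0" "\<And>x. norm x \<le> r \<Longrightarrow> norm (cgrad h x) \<le> K"
proof -
  have "bounded (cgrad h ` cball 0 r)"
    by (intro compact_imp_bounded compact_continuous_image continuous_on_cgrad assms compact_cball)
  then obtain K where "K > 0" "\<forall>y\<in>cgrad h ` cball 0 r. norm y \<le> K" using bounded_pos by blast
  then show thesis by (intro that[of K]) auto
qed

lemma annulus_critical_domain: "DIM('a::euclidean_space) \<ge> 3 \<Longrightarrow> critical_domain (annulus::'a set) 3"
proof unfold_locales
  have "(annulus::'a set) = ball 0 3 - cball 0 1" by (auto simp: annulus_def)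
  moreover have "open (ball 0 3 - cball (0::'a) 1)" by (intro open_Diff) auto
  ultimately show "open (annulus::'a set)" by metis
qed (auto simp: annulus_def)

section \<open>The weighted quotient on the annulus\<close>

locale henon = critical_domain "annulus :: 'a::euclidean_space set" 3 +
  fixes \<alpha> :: real
  assumes alpha: "\<alpha> > 0"
begin

lemma finite_measure_L: "finite_measure L"
proof -
  have "emeasure lborel (annulus::'a set) < \<infinity>"
    by (rule emeasure_bounded_finite) (use U_ball bounded_subset[OF bounded_ball] in auto)
  then show ?thesis by (intro finite_measureI) (simp add: emeasure_restrict_space)
qed

text \<open>The bound by 1 is imposed inside the annulus only, because \<open>Psi\<close> exceeds 1
  beyond the outer sphere. \<open>Psi\<close>, its restrictions to the two halves and the powers of
  the cutoffs are all of this kind.\<close>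

definition weight :: "('a \<Rightarrow> real) \<Rightarrow> bool" where
  "weight w \<longleftrightarrow> w \<in> borel_measurable borel \<and> (\<forall>x. 0 \<le> w x) \<and> (\<forall>x\<in>annulus. w x \<le> 1)"

definition "mass p w u = (LINT x|L. w x * \<bar>u x\<bar> powr p)" for w u :: "'a \<Rightarrow> real"

abbreviation "W p u \<equiv> mass p (Psi \<alpha>) u"
abbreviation "M p u \<equiv> mass p (\<lambda>_. 1) u"

definition "energy u = (LINT x|L. (norm (wgrad annulus u x))\<^sup>2)"

lemma Psi_weight: "weight (Psi \<alpha>)" and Psi_less_1: "(x::'a) \<in> annulus \<Longrightarrow> Psi \<alpha> x < 1"
proof -
  have "\<bar>norm x - 2\<bar> powr \<alpha> < 1" if "x \<in> annulus" for x :: 'a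
  proof (cases "norm x = 2")
    case False
    have "\<bar>norm x - 2\<bar> < 1" using that by (auto simp: annulus_def)
    then have "\<bar>norm x - 2\<bar> powr \<alpha> < 1 powr \<alpha>" by (intro powr_less_mono2) (use alpha in auto)
    then show ?thesis by simp
  qed simp
  then show "weight (Psi \<alpha>)" "(x::'a) \<in> annulus \<Longrightarrow> Psi \<alpha> x < 1"
    unfolding weight_def Psi_def[abs_def] by (auto intro: less_imp_le)
qed

lemma one_weight: "weight (\<lambda>_. 1)" by (simp add: weight_def)

lemma weight_measurable_L: "weight w \<Longrightarrow> w \<in> borel_measurable L"
  by (simp add: weight_def meas_L meas_leb)

lemma mass_nonneg: "weight w \<Longrightarrow> mass p w u \<ge> 0"
  unfolding mass_def weight_def by (intro integral_nonneg_AE) auto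

lemma mass_limit:
  assumes "H1_approx \<phi> u" "2 < p" "p < q" "weight w"
  shows "(\<lambda>k. mass p w (\<phi> k)) \<longlonglongrightarrow> mass p w u" "integrable L (\<lambda>x. w x * \<bar>u x\<bar> powr p)"
  unfolding mass_def
  using H1_approx_weighted_limit[OF assms(1-3), of w] weight_measurable_L[OF assms(4)] assms(4) by (auto simp: weight_def)

lemma test_fun_weak_grad:
  assumes \<phi>: "\<phi> \<in> test_funs (annulus::'a set)" shows "is_weak_grad annulus \<phi> (cgrad \<phi>)"
  unfolding is_weak_grad_def L2_on_def set_integral_L set_integrable_L
proof (intro conjI ballI)
  show "\<phi> \<in> borel_measurable lebesgue" "cgrad \<phi> \<in> borel_measurable lebesgue"
    using test_fun_borel[OF \<phi>] test_fun_cgrad_borel[OF \<phi>] by (auto intro: meas_leb)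
  show "integrable L (\<lambda>x. (\<phi> x)\<^sup>2)" "integrable L (\<lambda>x. (norm (cgrad \<phi> x))\<^sup>2)" using test_fun_L(1)[OF \<phi>] dirichlet_L(2)[OF \<phi>] .
  fix \<psi> :: "'a \<Rightarrow> real" and b :: 'a assume \<psi>: "\<psi> \<in> test_funs annulus" and b: "b \<in> Basis"
  have [measurable]: "\<phi> \<in> borel_measurable borel" "\<psi> \<in> borel_measurable borel" "(\<lambda>x. pd b \<psi> x) \<in> borel_measurable borel" "(\<lambda>x. pd b \<phi> x) \<in> borel_measurable borel"
    using test_fun_borel[OF test_fun_pd[OF \<phi> b]] test_fun_borel[OF \<phi>] test_fun_borel[OF \<psi>] test_fun_borel[OF test_fun_pd[OF \<psi> b]] test_fun_cgrad_borel[OF \<phi>] by auto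
  show "(LINT x|L. \<phi> x * pd b \<psi> x) = - (LINT x|L. (cgrad \<phi> x \<bullet> b) * \<psi> x)"
    using test_fun_integration_by_parts[OF \<phi> \<psi> b]
    by (simp add: integral_L_lborel test_fun_vanishes[OF \<phi>] test_fun_vanishes[OF \<psi>] cgrad_inner[OF b])
qed

lemma test_fun_H1_approx:
  assumes \<phi>: "\<phi> \<in> test_funs annulus" shows "H1_approx (\<lambda>_. \<phi>) \<phi>" "energy \<phi> = dirichlet \<phi>"
  using weak_grad_approx[OF test_fun_weak_grad[OF \<phi>], of "\<lambda>_. \<phi>"] \<phi> wgrad_norm_eq[OF test_fun_weak_grad[OF \<phi>]]
  by (simp_all add: energy_def dirichlet_L(1))

lemma powr_tendsto:
  assumes "f \<longlonglongrightarrow> a" "\<And>k. f k \<ge> (0::real)" "p > 0"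
  shows "(\<lambda>k. f k powr p) \<longlonglongrightarrow> a powr p"
  using assms by (intro tendsto_powr') auto

text \<open>The IMS localisation formula. As cos^2 + sin^2 = 1 is a smooth quadratic partition of
  unity, the cross terms cancel and only \<phi>^2 |grad h|^2 remains as the cost.\<close>

lemma IMS:
  assumes \<phi>: "\<phi> \<in> test_funs annulus" and h: "smooth_fun h" and K: "\<And>x. x \<in> annulus \<Longrightarrow> norm (cgrad h x) \<le> K"
  shows "dirichlet (\<lambda>x. cos (h x) * \<phi> x) + dirichlet (\<lambda>x. sin (h x) * \<phi> x) \<le> dirichlet \<phi> + K\<^sup>2 * (LINT x|L. (\<phi> x)\<^sup>2)"
proof -
  have t: "(\<lambda>x. cos (h x) * \<phi> x) \<in> test_funs annulus" "(\<lambda>x. sin (h x) * \<phi> x) \<in> test_funs annulus"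
    by (intro test_fun_mult[OF smooth_fun_comp[OF smooth1_sin_cos(2) h] \<phi>] test_fun_mult[OF smooth_fun_comp[OF smooth1_sin_cos(1) h] \<phi>])+
  note i = dirichlet_L(2)[OF t(1)] dirichlet_L(2)[OF t(2)] dirichlet_L(2)[OF \<phi>] test_fun_L(1)[OF \<phi>]
  have dh: "h differentiable (at x)" "\<phi> differentiable (at x)" for x using smooth_fun_differentiable[OF h] test_fun_differentiable[OF \<phi>] by auto
  have c: "cgrad (\<lambda>x. cos (h x) * \<phi> x) x = cos (h x) *\<^sub>R cgrad \<phi> x - (\<phi> x * sin (h x)) *\<^sub>R cgrad h x" for x
  proof -
    have d: "(cos has_real_derivative - sin (h x)) (at (h x))" by (rule DERIV_cos)
    show ?thesis using cgrad_mult[OF pd_comp_real(2)[OF dh(1) d] dh(2)] cgrad_comp[OF dh(1) d] by simp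
  qed
  have s: "cgrad (\<lambda>x. sin (h x) * \<phi> x) x = sin (h x) *\<^sub>R cgrad \<phi> x + (\<phi> x * cos (h x)) *\<^sub>R cgrad h x" for x
  proof -
    have d: "(sin has_real_derivative cos (h x)) (at (h x))" by (rule DERIV_sin)
    show ?thesis using cgrad_mult[OF pd_comp_real(2)[OF dh(1) d] dh(2)] cgrad_comp[OF dh(1) d] by simp
  qed
  have pw: "(norm (cgrad (\<lambda>x. cos (h x) * \<phi> x) x))\<^sup>2 + (norm (cgrad (\<lambda>x. sin (h x) * \<phi> x) x))\<^sup>2 \<le> (norm (cgrad \<phi> x))\<^sup>2 + K\<^sup>2 * (\<phi> x)\<^sup>2" if x: "x \<in> annulus" for x
  proof -
    define C where "C = cos (h x)" define D where "D = sin (h x)"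
    have CD: "C\<^sup>2 + D\<^sup>2 = 1" by (simp add: C_def D_def)
    have "(norm (C *\<^sub>R a - (f * D) *\<^sub>R b))\<^sup>2 + (norm (D *\<^sub>R a + (f * C) *\<^sub>R b))\<^sup>2 = (C\<^sup>2 + D\<^sup>2) * (norm a)\<^sup>2 + f\<^sup>2 * ((C\<^sup>2 + D\<^sup>2) * (norm b)\<^sup>2)" for a b :: 'a and f
      unfolding power2_norm_eq_inner by (simp add: inner_simps inner_commute power2_eq_square algebra_simps)
    then have "(norm (cgrad (\<lambda>x. cos (h x) * \<phi> x) x))\<^sup>2 + (norm (cgrad (\<lambda>x. sin (h x) * \<phi> x) x))\<^sup>2 = (norm (cgrad \<phi> x))\<^sup>2 + (\<phi> x)\<^sup>2 * (norm (cgrad h x))\<^sup>2"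
      unfolding c s C_def[symmetric] D_def[symmetric] CD by simp
    also have "(\<phi> x)\<^sup>2 * (norm (cgrad h x))\<^sup>2 \<le> (\<phi> x)\<^sup>2 * K\<^sup>2" using K[OF x] by (intro mult_left_mono power_mono) auto
    finally show ?thesis by (simp add: mult.commute)
  qed
  have "dirichlet (\<lambda>x. cos (h x) * \<phi> x) + dirichlet (\<lambda>x. sin (h x) * \<phi> x) = (LINT x|L. (norm (cgrad (\<lambda>x. cos (h x) * \<phi> x) x))\<^sup>2 + (norm (cgrad (\<lambda>x. sin (h x) * \<phi> x) x))\<^sup>2)"
    unfolding dirichlet_L(1)[OF t(1), symmetric] dirichlet_L(1)[OF t(2), symmetric] using i by simp
  also have "\<dots> \<le> (LINT x|L. (norm (cgrad \<phi> x))\<^sup>2 + K\<^sup>2 * (\<phi> x)\<^sup>2)"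
    by (rule integral_mono) (use i pw in auto)
  also have "\<dots> = dirichlet \<phi> + K\<^sup>2 * (LINT x|L. (\<phi> x)\<^sup>2)" using i by (simp add: dirichlet_L(1)[OF \<phi>])
  finally show ?thesis .
qed

abbreviation "cosw p h \<equiv> (\<lambda>x::'a. \<bar>cos (h x)\<bar> powr p)"
abbreviation "sinw p h \<equiv> (\<lambda>x::'a. \<bar>sin (h x)\<bar> powr p)"

lemma trig_weights:
  assumes "smooth_fun h" "p > 0" shows "weight (cosw p h)" "weight (sinw p h)"
proof -
  have [measurable]: "h \<in> borel_measurable borel" by (rule borel_measurable_continuous_onI) (rule smooth_fun_continuous[OF assms(1)])
  show "weight (cosw p h)" "weight (sinw p h)" using assms(2) by (auto simp: weight_def intro!: powr_le1)
qed

lemma sobolev_H10: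
  assumes p: "2 < p" "p < q" and sob: "\<forall>\<phi> \<in> test_funs annulus. c * S * M p \<phi> powr (2/p) \<le> dirichlet \<phi>" and a: "H1_approx \<phi> u"
  shows "c * S * M p u powr (2/p) \<le> energy u"
proof (rule LIMSEQ_le)
  have \<phi>: "\<And>k. \<phi> k \<in> test_funs annulus" and l: "(\<lambda>k. dirichlet (\<phi> k)) \<longlonglongrightarrow> energy u" using a unfolding H1_approx_def energy_def by auto
  show "(\<lambda>k. dirichlet (\<phi> k)) \<longlonglongrightarrow> energy u" by (rule l)
  show "(\<lambda>k. c * S * M p (\<phi> k) powr (2/p)) \<longlonglongrightarrow> c * S * M p u powr (2/p)"
    by (intro tendsto_mult tendsto_const powr_tendsto mass_limit(1)[OF a p one_weight] mass_nonneg one_weight) (use p in auto)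
  show "\<exists>N. \<forall>n\<ge>N. c * S * M p (\<phi> n) powr (2/p) \<le> dirichlet (\<phi> n)" using sob \<phi> by blast
qed

text \<open>The Sobolev inequality is applied to the two localised pieces separately; their
  \<open>p\<close>-masses are masses of the uncut function with the weights |cos h|^p and |sin h|^p,
  a form that passes to the limit.\<close>

lemma splitting_inequality:
  assumes p: "2 < p" "p < q" and sob: "\<forall>\<phi> \<in> test_funs annulus. c * S * M p \<phi> powr (2/p) \<le> dirichlet \<phi>" and a: "H1_approx \<phi> u"
    and h: "smooth_fun h" and K: "\<And>x. x \<in> annulus \<Longrightarrow> norm (cgrad h x) \<le> K"
  shows "c * S * (mass p (cosw p h) u powr (2/p) + mass p (sinw p h) u powr (2/p)) \<le> energy u + K\<^sup>2 * (LINT x|L. (u x)\<^sup>2)"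
proof (rule LIMSEQ_le)
  have p0: "p > 0" using p by simp
  note w = trig_weights[OF h p0]
  have \<phi>: "\<And>k. \<phi> k \<in> test_funs annulus" and l: "(\<lambda>k. dirichlet (\<phi> k)) \<longlonglongrightarrow> energy u"
    and u: "u \<in> borel_measurable L" "integrable L (\<lambda>x. (u x)\<^sup>2)" "\<And>k. integrable L (\<lambda>x. (\<phi> k x - u x)\<^sup>2)" "(\<lambda>k. LINT x|L. (\<phi> k x - u x)\<^sup>2) \<longlonglongrightarrow> 0"
    using a unfolding H1_approx_def energy_def by auto
  have "(\<lambda>k. LINT x|L. (norm (\<phi> k x))\<^sup>2) \<longlonglongrightarrow> (LINT x|L. (norm (u x))\<^sup>2)"
    by (rule L2_tendsto_norm(2)[OF test_fun_L(5)[OF \<phi>] u(1)]) (use u in auto)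
  then show "(\<lambda>k. dirichlet (\<phi> k) + K\<^sup>2 * (LINT x|L. (\<phi> k x)\<^sup>2)) \<longlonglongrightarrow> energy u + K\<^sup>2 * (LINT x|L. (u x)\<^sup>2)"
    by (intro tendsto_intros l) simp
  show "(\<lambda>k. c * S * (mass p (cosw p h) (\<phi> k) powr (2/p) + mass p (sinw p h) (\<phi> k) powr (2/p))) \<longlonglongrightarrow> c * S * (mass p (cosw p h) u powr (2/p) + mass p (sinw p h) u powr (2/p))"
    by (intro tendsto_mult tendsto_const tendsto_add powr_tendsto mass_limit(1)[OF a p] mass_nonneg w) (use p in auto)
  have "c * S * (mass p (cosw p h) (\<phi> n) powr (2/p) + mass p (sinw p h) (\<phi> n) powr (2/p)) \<le> dirichlet (\<phi> n) + K\<^sup>2 * (LINT x|L. (\<phi> n x)\<^sup>2)" for n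
  proof -
    have t: "(\<lambda>x. cos (h x) * \<phi> n x) \<in> test_funs annulus" "(\<lambda>x. sin (h x) * \<phi> n x) \<in> test_funs annulus"
      by (intro test_fun_mult[OF smooth_fun_comp[OF smooth1_sin_cos(2) h] \<phi>] test_fun_mult[OF smooth_fun_comp[OF smooth1_sin_cos(1) h] \<phi>])+
    have e: "M p (\<lambda>x. cos (h x) * \<phi> n x) = mass p (cosw p h) (\<phi> n)" "M p (\<lambda>x. sin (h x) * \<phi> n x) = mass p (sinw p h) (\<phi> n)"
      by (simp_all add: mass_def abs_mult powr_mult)
    show ?thesis
      using sob[rule_format, OF t(1)] sob[rule_format, OF t(2)] IMS[OF \<phi>[of n] h K] unfolding e distrib_left by linarith
  qed
  then show "\<exists>N. \<forall>n\<ge>N. c * S * (mass p (cosw p h) (\<phi> n) powr (2/p) + mass p (sinw p h) (\<phi> n) powr (2/p)) \<le> dirichlet (\<phi> n) + K\<^sup>2 * (LINT x|L. (\<phi> n x)\<^sup>2)" by blast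
qed

text \<open>Because the weight is less than 1 inside the annulus, a function whose weighted and unweighted
  \<open>L\<^sup>p\<close> masses almost agree lives near the boundary, hence on a set of small measure.\<close>

lemma L2_small:
  assumes th: "\<theta> > 0" and p1: "2 < p1" "p1 < q"
  obtains \<kappa> where "\<kappa> > 0" "\<And>p u. p1 \<le> p \<Longrightarrow> p < q \<Longrightarrow> u \<in> borel_measurable L \<Longrightarrow> integrable L (\<lambda>x. (u x)\<^sup>2) \<Longrightarrow>
     integrable L (\<lambda>x. \<bar>u x\<bar> powr p) \<Longrightarrow> integrable L (\<lambda>x. Psi \<alpha> x * \<bar>u x\<bar> powr p) \<Longrightarrow> W p u = 1 \<Longrightarrow> M p u \<le> 1 + \<kappa> \<Longrightarrow> (LINT x|L. (u x)\<^sup>2) \<le> \<theta>"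
proof -
  interpret fm: finite_measure L by (rule finite_measure_L)
  define \<mu> where "\<mu> = measure L annulus"
  define \<tau> where "\<tau> = min 1 (\<theta> / (3 * (\<mu> + 2)))"
  have mu: "\<mu> \<ge> 0" by (simp add: \<mu>_def)
  have tau: "\<tau> > 0" "\<tau> \<le> 1" using th mu by (auto simp: \<tau>_def)
  have "\<tau> \<le> \<theta> / (3 * (\<mu> + 2))" by (simp add: \<tau>_def)
  then have tau3: "\<tau> * \<mu> + 2 * \<tau> \<le> \<theta>/3" using mu by (simp add: field_simps)
  \<comment> \<open>\<open>B\<close> bounds t^2 whenever \<tau> t^(p-2) < 1. The exponent is taken
    at \<open>p1\<close>, its worst case, so the bound is uniform in \<open>p\<close>.\<close>
  define B where "B = \<tau> powr (- (2 / (p1 - 2)))"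
  have B: "B > 0" using tau by (simp add: B_def)
  note [measurable] = weight_measurable_L[OF Psi_weight]
  \<comment> \<open>Where the weight is within 1/(n+1) of 1. These sets decrease to the empty set,
    as the weight is below 1 in the annulus, so one of them has small measure.\<close>
  define Z where "Z = (\<lambda>n::nat. {x \<in> space L. Psi \<alpha> x > 1 - 1 / real (Suc n)})"
  have Zm[measurable]: "Z n \<in> sets L" for n unfolding Z_def by measurable
  have "(\<lambda>n. measure L (Z n)) \<longlonglongrightarrow> measure L (\<Inter>n. Z n)"
  proof (rule fm.finite_Lim_measure_decseq)
    show "decseq Z"
    proof (rule decseq_SucI)
      fix n
      have "1 / real (Suc (Suc n)) \<le> 1 / real (Suc n)" by (intro divide_left_mono) auto
      then show "Z (Suc n) \<subseteq> Z n" unfolding Z_def by auto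
    qed
  qed auto
  moreover have "(\<Inter>n. Z n) = {}"
  proof (rule ccontr)
    assume "(\<Inter>n. Z n) \<noteq> {}"
    then obtain x where x: "\<And>n. x \<in> Z n" by auto
    then have xa: "x \<in> annulus" by (auto simp: Z_def)
    then have "1 - Psi \<alpha> x > 0" using Psi_less_1 by simp
    then obtain n where "1 / real (Suc n) < 1 - Psi \<alpha> x" using nat_approx_posE by metis
    then show False using x[of n] by (simp add: Z_def)
  qed
  ultimately have "(\<lambda>n. B * measure L (Z n)) \<longlonglongrightarrow> B * 0" by (intro tendsto_intros) simp
  then have "\<forall>\<^sub>F n in sequentially. B * measure L (Z n) < \<theta>/3" using th by (intro order_tendstoD) auto
  then obtain n where n: "B * measure L (Z n) < \<theta>/3" by (auto simp: eventually_sequentially)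
  have ZI: "Z n \<inter> annulus = Z n" by (auto simp: Z_def)
  define r where "r = 1 / real (Suc n)"
  have r: "r > 0" by (simp add: r_def)
  \<comment> \<open>Off \<open>Z n\<close> the defect 1 - \<open>Psi\<close> is at least
    \<open>r\<close>, and t^2 > \<tau> implies t^2 \<le> A t^p; the exponent \<open>q\<close> makes
    \<open>A\<close> serve every p < q because \<tau> \<le> 1.\<close>
  define A where "A = \<tau> powr (- ((q - 2) / 2))"
  have A: "A > 0" using tau by (simp add: A_def)
  define \<kappa> where "\<kappa> = min 1 (\<theta> * r / (3 * A))"
  have kap: "\<kappa> > 0" "\<kappa> \<le> 1" using th r A by (auto simp: \<kappa>_def)
  have "\<kappa> \<le> \<theta> * r / (3 * A)" by (simp add: \<kappa>_def)
  then have kap3: "A / r * \<kappa> \<le> \<theta>/3" using A r by (simp add: field_simps)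
  have "(LINT x|L. (u x)\<^sup>2) \<le> \<theta>"
    if p: "p1 \<le> p" "p < q" and u[measurable]: "u \<in> borel_measurable L" and i: "integrable L (\<lambda>x. (u x)\<^sup>2)"
      "integrable L (\<lambda>x. \<bar>u x\<bar> powr p)" "integrable L (\<lambda>x. Psi \<alpha> x * \<bar>u x\<bar> powr p)" and W: "W p u = 1" and Mk: "M p u \<le> 1 + \<kappa>" for p u
  proof -
    have pw: "(u x)\<^sup>2 \<le> \<tau> + A / r * (\<bar>u x\<bar> powr p - Psi \<alpha> x * \<bar>u x\<bar> powr p) + \<tau> * \<bar>u x\<bar> powr p + B * indicator (Z n) x" if x: "x \<in> space L" for x
    proof -
      define t where "t = \<bar>u x\<bar>"
      have t0: "t \<ge> 0" by (simp add: t_def)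
      have ps: "0 \<le> Psi \<alpha> x" "Psi \<alpha> x < 1" using Psi_weight Psi_less_1 x by (auto simp: weight_def)
      have nn: "0 \<le> A / r * ((1 - Psi \<alpha> x) * t powr p)" using A r ps by simp
      have "t\<^sup>2 \<le> \<tau> + A / r * ((1 - Psi \<alpha> x) * t powr p) + \<tau> * t powr p + B * indicator (Z n) x"
      proof (cases "x \<in> Z n")
        case True
        have "t\<^sup>2 \<le> \<tau> * t powr p + B"
        proof (cases "\<tau> * t powr (p - 2) \<ge> 1")
          case True
          have "t \<noteq> 0" using True by auto
          then have tp: "t powr p = t powr (p - 2) * t\<^sup>2" using t0 powr_add[of t "p - 2" 2] by simp
          have "1 * t\<^sup>2 \<le> \<tau> * t powr (p - 2) * t\<^sup>2" by (rule mult_right_mono[OF True]) simp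
          then show ?thesis using B tp by simp
        next
          case False
          have "t\<^sup>2 \<le> B"
          proof (cases "t = 0")
            case f: False
            then have t1: "t > 0" using t0 by simp
            have "t powr (p - 2) < 1 / \<tau>" using False tau by (simp add: field_simps)
            then have "(t powr (p - 2)) powr (2 / (p - 2)) \<le> (1 / \<tau>) powr (2 / (p - 2))" using p p1 by (intro powr_mono2) auto
            moreover have "(p - 2) * (2 / (p - 2)) = 2"
            proof -
              have "p - 2 \<noteq> 0" using p p1 by simp
              then show ?thesis by (metis nonzero_mult_div_cancel_left times_divide_eq_right)
            qed
            ultimately have "t\<^sup>2 \<le> (1 / \<tau>) powr (2 / (p - 2))" using t1 by (simp only: powr_powr) simp
            also have "\<dots> \<le> (1 / \<tau>) powr (2 / (p1 - 2))" using tau p p1 by (intro powr_mono divide_left_mono mult_pos_pos) auto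
            also have "\<dots> = B" using tau by (simp add: B_def powr_minus_divide powr_divide)
            finally show ?thesis .
          qed (use B in simp)
          then show ?thesis using tau by (simp add: add_increasing)
        qed
        then show ?thesis using True nn tau by simp
      next
        case False
        then have pr: "1 - Psi \<alpha> x \<ge> r" using x by (auto simp: Z_def r_def)
        have "t\<^sup>2 \<le> \<tau> + A * t powr p"
        proof (cases "t\<^sup>2 \<le> \<tau>")
          case True then show ?thesis using A by (simp add: add_increasing2)
        next
          case f: False
          then have t1: "t > 0" using t0 tau by (cases "t = 0") auto
          have "\<tau> powr ((p - 2) / 2) \<le> (t\<^sup>2) powr ((p - 2) / 2)" using f tau p p1 by (intro powr_mono2) auto
          also have "(t\<^sup>2) powr ((p - 2) / 2) = t powr (p - 2)" 
          proof -
            have "2 * ((p - 2) / 2) = p - 2" by (metis nonzero_mult_div_cancel_left times_divide_eq_right zero_neq_numeral)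
            then have "(t powr 2) powr ((p - 2) / 2) = t powr (p - 2)" by (simp only: powr_powr)
            then show ?thesis using t1 by simp
          qed
          finally have "\<tau> powr ((p - 2) / 2) \<le> t powr (p - 2)" .
          moreover have "\<tau> powr ((q - 2) / 2) \<le> \<tau> powr ((p - 2) / 2)" using tau p by (intro powr_mono') auto
          ultimately have "A * \<tau> powr ((q - 2) / 2) \<le> A * t powr (p - 2)" using A by simp
          moreover have "A * \<tau> powr ((q - 2) / 2) = 1" using tau by (simp add: A_def powr_add[symmetric])
          ultimately have f1: "1 * t\<^sup>2 \<le> A * t powr (p - 2) * t\<^sup>2" by (intro mult_right_mono) auto
          have "t powr p = t powr (p - 2) * t\<^sup>2" using t1 powr_add[of t "p - 2" 2] by simp
          then have "A * t powr p = A * t powr (p - 2) * t\<^sup>2" by (simp only: mult.assoc)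
          then show ?thesis using f1 tau by linarith
        qed
        moreover have "A * t powr p \<le> A / r * ((1 - Psi \<alpha> x) * t powr p)"
        proof -
          have "r * t powr p \<le> (1 - Psi \<alpha> x) * t powr p" using pr by (intro mult_right_mono) auto
          then have "A / r * (r * t powr p) \<le> A / r * ((1 - Psi \<alpha> x) * t powr p)" using A r by (intro mult_left_mono) auto
          then show ?thesis using r by simp
        qed
        moreover have "0 \<le> \<tau> * t powr p" using tau by simp
        ultimately show ?thesis using False by simp
      qed
      then show ?thesis by (simp add: t_def left_diff_distrib)
    qed
    have "(LINT x|L. (u x)\<^sup>2) \<le> (LINT x|L. \<tau> + A / r * (\<bar>u x\<bar> powr p - Psi \<alpha> x * \<bar>u x\<bar> powr p) + \<tau> * \<bar>u x\<bar> powr p + B * indicator (Z n) x)"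
      by (rule integral_mono[OF i(1)]) (use i pw in \<open>auto simp: fm.emeasure_finite less_top[symmetric]\<close>)
    also have "\<dots> = \<tau> * \<mu> + A / r * (M p u - W p u) + \<tau> * M p u + B * measure L (Z n)"
      using i ZI by (simp add: mass_def \<mu>_def fm.emeasure_finite less_top[symmetric])
    also have "\<dots> \<le> \<tau> * \<mu> + A / r * \<kappa> + \<tau> * 2 + B * measure L (Z n)"
      using W Mk kap A B r tau by (intro add_mono mult_left_mono) auto
    finally show ?thesis using tau3 kap3 n by linarith
  qed
  then show thesis using that[OF kap(1)] by blast
qed

text \<open>A fixed lower bound for the exponents: constants computed at \<open>p1\<close> serve all
  \<open>p\<close> between it and \<open>q\<close>.\<close>

definition "p1 = (2 + q) / 2"

lemma p1: "2 < p1" "p1 < q" using q_gt_2 by (auto simp: p1_def)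

text \<open>The source of contradictions: for any prescribed \<open>G > 1\<close>, a near-minimiser
  cannot be cut into two pieces whose powered masses sum to \<open>(1 - 2 * \<kappa>) * G\<close>.
  Its L2 norm is small by \<open>L2_small\<close>, so cutting costs little; the factor
  \<open>1 - 2 * \<kappa>\<close> leaves room for losing mass \<open>\<kappa>\<close> in each piece.
  The gradient bound \<open>K\<close> is fixed beforehand since the tolerances depend on it.\<close>

lemma near_minimiser_splitting:
  assumes G: "G > 1" and K: "K \<ge> 0"
  obtains c \<kappa> where "c > 1" "0 < \<kappa>" "\<kappa> < 1/20"
    "\<forall>\<^sub>F p in at_left q. p1 < p \<and> p < q \<and> (\<forall>u \<phi>. H1_approx \<phi> u \<and> W p u = 1 \<and> energy u \<le> c * S \<longrightarrow>
       M p u \<le> 1 + \<kappa> \<and> (\<forall>h. smooth_fun h \<and> (\<forall>x\<in>annulus. norm (cgrad h x) \<le> K) \<longrightarrow>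
         mass p (cosw p h) u powr (2/p) + mass p (sinw p h) u powr (2/p) < (1 - 2 * \<kappa>) * G))"
proof -
  have q0: "q > 0" using q_gt_2 by simp
  \<comment> \<open>Makes the localisation cost K^2 \<theta> at most S (G - 1) / 4.\<close>
  define \<theta> where "\<theta> = S * (G - 1) / (4 * (K\<^sup>2 + 1))"
  have K1: "K\<^sup>2 + 1 > 0" by (simp add: add_nonneg_pos)
  have th: "\<theta> > 0" using S_pos G K1 by (simp add: \<theta>_def)
  have "K\<^sup>2 * \<theta> \<le> (K\<^sup>2 + 1) * \<theta>" using th by (intro mult_right_mono) auto
  also have "\<dots> = S * (G - 1) / 4"
  proof -
    have "x * (S * (G - 1) / (4 * x)) = S * (G - 1) / 4" if "x > 0" for x :: real using that by simp
    from this[OF K1] show ?thesis unfolding \<theta>_def .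
  qed
  finally have Kth: "K\<^sup>2 * \<theta> \<le> S * (G - 1) / 4" .
  obtain \<kappa>0 where k0: "\<kappa>0 > 0" and k0s: "\<And>p u. p1 \<le> p \<Longrightarrow> p < q \<Longrightarrow> u \<in> borel_measurable L \<Longrightarrow> integrable L (\<lambda>x. (u x)\<^sup>2) \<Longrightarrow>
     integrable L (\<lambda>x. \<bar>u x\<bar> powr p) \<Longrightarrow> integrable L (\<lambda>x. Psi \<alpha> x * \<bar>u x\<bar> powr p) \<Longrightarrow> W p u = 1 \<Longrightarrow> M p u \<le> 1 + \<kappa>0 \<Longrightarrow> (LINT x|L. (u x)\<^sup>2) \<le> \<theta>"
    by (rule L2_small[OF th p1]) blast
  \<comment> \<open>The target is c + (G - 1)/4 < (1 - 2 \<kappa>) G / c with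
    \<open>c = (1 + \<kappa>) powr (1/q)\<close>; it holds for small \<open>\<kappa>\<close> because
    (1 - 2 \<kappa>) G / c - c tends to G - 1.\<close>
  have "((\<lambda>\<kappa>. (1 + \<kappa>) powr (-1/q) * (1 - 2 * \<kappa>) * G - (1 + \<kappa>) powr (1/q)) \<longlongrightarrow> (1 + 0) powr (-1/q) * (1 - 2 * 0) * G - (1 + 0) powr (1/q)) (at_right 0)"
    by (intro tendsto_intros) auto
  then have "((\<lambda>\<kappa>. (1 + \<kappa>) powr (-1/q) * (1 - 2 * \<kappa>) * G - (1 + \<kappa>) powr (1/q)) \<longlongrightarrow> G - 1) (at_right 0)" by simp
  moreover have "(G - 1) / 4 < G - 1" using G by simp
  ultimately have "\<forall>\<^sub>F \<kappa> in at_right 0. (G - 1) / 4 < (1 + \<kappa>) powr (-1/q) * (1 - 2 * \<kappa>) * G - (1 + \<kappa>) powr (1/q)" by (rule order_tendstoD(1))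
  moreover have "\<forall>\<^sub>F \<kappa> in at_right (0::real). \<kappa> \<in> {0<..<min \<kappa>0 (1/20)}" by (rule eventually_at_right_real) (use k0 in simp)
  ultimately have "\<forall>\<^sub>F \<kappa> in at_right (0::real). (G - 1) / 4 < (1 + \<kappa>) powr (-1/q) * (1 - 2 * \<kappa>) * G - (1 + \<kappa>) powr (1/q) \<and> \<kappa> \<in> {0<..<min \<kappa>0 (1/20)}"
    by (rule eventually_conj)
  then obtain \<kappa> where kf: "(G - 1) / 4 < (1 + \<kappa>) powr (-1/q) * (1 - 2 * \<kappa>) * G - (1 + \<kappa>) powr (1/q)" and k: "0 < \<kappa>" "\<kappa> < \<kappa>0" "\<kappa> < 1/20"
    using eventually_happens'[OF trivial_limit_at_right_real] by fastforce
  define c where "c = (1 + \<kappa>) powr (1/q)"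
  define c' where "c' = (1 + \<kappa>) powr (-1/q)"
  have c1: "c > 1" unfolding c_def using k q0 by (simp add: gr_one_powr)
  have cc: "c' = 1 / c" unfolding c_def c'_def using powr_minus[of "1 + \<kappa>" "1/q"] by (simp add: divide_inverse)
  have c'0: "c' > 0" "c' < 1" using c1 by (auto simp: cc)
  have "\<forall>\<^sub>F p in at_left q. \<forall>\<phi> \<in> test_funs annulus. c' * S * (LINT x|L. \<bar>\<phi> x\<bar> powr p) powr (2/p) \<le> dirichlet \<phi>"
    by (rule eventually_subcritical_Sobolev[OF c'0(2)])
  moreover have "\<forall>\<^sub>F p in at_left q. p \<in> {p1<..<q}" by (rule eventually_at_left_real[OF p1(2)])
  ultimately have "\<forall>\<^sub>F p in at_left q. p1 < p \<and> p < q \<and> (\<forall>u \<phi>. H1_approx \<phi> u \<and> W p u = 1 \<and> energy u \<le> c * S \<longrightarrow>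
       M p u \<le> 1 + \<kappa> \<and> (\<forall>h. smooth_fun h \<and> (\<forall>x\<in>annulus. norm (cgrad h x) \<le> K) \<longrightarrow>
         mass p (cosw p h) u powr (2/p) + mass p (sinw p h) u powr (2/p) < (1 - 2 * \<kappa>) * G))"
  proof eventually_elim
    case (elim p)
    have p: "2 < p" "p < q" "p1 \<le> p" "p1 < p" using elim p1 by auto
    have sob: "\<forall>\<phi> \<in> test_funs annulus. c' * S * M p \<phi> powr (2/p) \<le> dirichlet \<phi>" using elim by (simp add: mass_def)
    have "M p u \<le> 1 + \<kappa> \<and> (\<forall>h. smooth_fun h \<and> (\<forall>x\<in>annulus. norm (cgrad h x) \<le> K) \<longrightarrow>
         mass p (cosw p h) u powr (2/p) + mass p (sinw p h) u powr (2/p) < (1 - 2 * \<kappa>) * G)"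
      if a: "H1_approx \<phi> u" and Wu: "W p u = 1" and en: "energy u \<le> c * S" for u \<phi>
    proof (intro conjI allI impI)
      \<comment> \<open>The exponent 1/q in \<open>c\<close> is made for this: M^(2/p) \<le> c^2
        gives M \<le> (1 + \<kappa>)^(p/q) \<le> 1 + \<kappa>.\<close>
      have "c' * S * M p u powr (2/p) \<le> c * S" using sobolev_H10[OF p(1,2) sob a] en by linarith
      then have "S * (c' * M p u powr (2/p)) \<le> S * c" by (simp add: mult.assoc mult.left_commute mult.commute)
      then have "c' * M p u powr (2/p) \<le> c" using S_pos by simp
      then have "M p u powr (2/p) \<le> c * c" using c1 by (simp add: cc field_simps)
      then have "(M p u powr (2/p)) powr (p/2) \<le> (c * c) powr (p/2)" using p by (intro powr_mono2) auto
      then have "M p u \<le> (c * c) powr (p/2)" using p mass_nonneg[OF one_weight, of p u] by (simp add: powr_powr)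
      also have "c * c = (1 + \<kappa>) powr (2/q)" using k by (simp add: c_def powr_add[symmetric])
      also have "((1 + \<kappa>) powr (2/q)) powr (p/2) = (1 + \<kappa>) powr (p/q)" by (simp add: powr_powr)
      also have "\<dots> \<le> (1 + \<kappa>) powr 1" using k p by (intro powr_mono) auto
      finally show Mu: "M p u \<le> 1 + \<kappa>" using k by simp
      have um: "u \<in> borel_measurable L" "integrable L (\<lambda>x. (u x)\<^sup>2)" using a unfolding H1_approx_def by auto
      have u2: "(LINT x|L. (u x)\<^sup>2) \<le> \<theta>"
        by (rule k0s[OF p(3,2) um _ mass_limit(2)[OF a p(1,2) Psi_weight] Wu]) (use H1_approx_Lp(1)[OF a p(1,2)] Mu k in auto)
      fix h :: "'a \<Rightarrow> real" assume h: "smooth_fun h \<and> (\<forall>x\<in>annulus. norm (cgrad h x) \<le> K)"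
      define m where "m = mass p (cosw p h) u powr (2/p) + mass p (sinw p h) u powr (2/p)"
      have "c' * S * m \<le> energy u + K\<^sup>2 * (LINT x|L. (u x)\<^sup>2)"
        unfolding m_def by (rule splitting_inequality[OF p(1,2) sob a]) (use h in auto)
      also have "K\<^sup>2 * (LINT x|L. (u x)\<^sup>2) \<le> K\<^sup>2 * \<theta>" using u2 by (intro mult_left_mono) auto
      finally have "c' * S * m \<le> c * S + S * (G - 1) / 4" using en Kth by linarith
      also have "\<dots> = S * (c + (G - 1) / 4)" by (simp add: algebra_simps)
      also have "\<dots> < S * (c' * (1 - 2 * \<kappa>) * G)" using kf S_pos unfolding c_def[symmetric] c'_def[symmetric] by (intro mult_strict_left_mono; linarith)
      finally have "c' * S * m < c' * S * ((1 - 2 * \<kappa>) * G)" by (simp add: algebra_simps)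
      then show "mass p (cosw p h) u powr (2/p) + mass p (sinw p h) u powr (2/p) < (1 - 2 * \<kappa>) * G"
        using c'0 S_pos unfolding m_def by simp
    qed
    then show ?case using p by blast
  qed
  then show thesis using that[OF c1 k(1,3)] by blast
qed

end

text \<open>Strict subadditivity of \<open>t powr (2/p)\<close> in quantitative form: x^(2/p) = x
  (1/x)^(1 - 2/p), with 1/x at least 5/4 and an exponent bounded below uniformly in
  \<open>p\<close>.\<close>

lemma powr_ge_linear:
  fixes x p :: real
  assumes x: "0 < x" "x \<le> 4/5" and p: "2 < p'" "p' < p"
  shows "x * (5/4) powr (1 - 2/p') \<le> x powr (2/p)"
proof -
  have "1 - 2/p' \<le> 1 - 2/p" using p by (simp add: field_simps)
  then have "(5/4::real) powr (1 - 2/p') \<le> (5/4) powr (1 - 2/p)" by (intro powr_mono) auto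
  also have "(5/4::real) powr (1 - 2/p) \<le> (1/x) powr (1 - 2/p)" using x p by (intro powr_mono2) (auto simp: field_simps)
  finally have "x * (5/4) powr (1 - 2/p') \<le> x * (1/x) powr (1 - 2/p)" using x by simp
  also have "(1/x) powr (1 - 2/p) = x powr (- (1 - 2/p))" unfolding powr_minus_divide using x by (simp add: powr_divide)
  also have "x * x powr (- (1 - 2/p)) = x powr 1 * x powr (- (1 - 2/p))" using x by simp
  also have "\<dots> = x powr (2/p)" by (subst powr_add[symmetric]) simp
  finally show ?thesis .
qed

text \<open>Convexity of \<open>t powr r\<close>, used with a = cos^2, b = sin^2 and r =
  p/2.\<close>

lemma powr_mean:
  fixes a b r :: real
  assumes "0 \<le> a" "0 \<le> b" "a + b = 1" "r \<ge> 1"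
  shows "2 powr (1 - r) \<le> a powr r + b powr r"
proof (cases "a = 0 \<or> b = 0")
  case True
  have "(2::real) powr (1 - r) \<le> 2 powr 0" using assms by (intro powr_mono) auto
  then show ?thesis using True assms by auto
next
  case False
  have c1: "((1 - 1/2) *\<^sub>R a + (1/2) *\<^sub>R b) powr r \<le> (1 - 1/2) * a powr r + (1/2) * b powr r"
    by (rule convex_onD[OF powr_convex[OF assms(4)]]) (use False assms in auto)
  have c2: "(1 - 1/2) *\<^sub>R a + (1/2) *\<^sub>R b = 1/2" using assms by simp
  have "(1/2) powr r \<le> a powr r / 2 + b powr r / 2" using c1 unfolding c2 by simp
  then have "2 * (1/2) powr r \<le> a powr r + b powr r" by simp
  moreover have "2 powr (1 - r) = 2 * (1/2) powr r" by (simp add: powr_diff powr_divide)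
  ultimately show ?thesis by simp
qed

section \<open>The gap between the two sides and the failure of evenness\<close>

context henon
begin

text \<open>The sphere |x| = 2 may be left out of both halves since the weight vanishes there; thus
  the two side weights add up to \<open>Psi\<close>.\<close>

definition "win = (\<lambda>x::'a. indicator {x. norm x < 2} x * Psi \<alpha> x)"
definition "wout = (\<lambda>x::'a. indicator {x. norm x > 2} x * Psi \<alpha> x)"

lemma side_weights: "weight win" "weight wout"
  using Psi_weight unfolding weight_def win_def wout_def by (auto simp: indicator_def)

lemma sides_sum: "win x + wout x = Psi \<alpha> x"
  using alpha by (auto simp: win_def wout_def indicator_def Psi_def)

lemma mass_sides:
  assumes "H1_approx \<phi> u" "2 < p" "p < q"
  shows "mass p win u + mass p wout u = W p u"
  using mass_limit(2)[OF assms side_weights(1)] mass_limit(2)[OF assms side_weights(2)]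
  unfolding mass_def by (simp add: sides_sum flip: distrib_right Bochner_Integration.integral_add)

text \<open>Exceeding \<open>w'\<close> by at most 1 - \<open>Psi\<close> costs at most the defect
  \<open>M - W\<close>, which is small for near-minimisers. This pays for the layer in which a
  cutoff changes.\<close>

lemma mass_mono_defect:
  assumes a: "H1_approx \<phi> u" "2 < p" "p < q" and w: "weight w" "weight w'"
    and le: "\<And>x. x \<in> annulus \<Longrightarrow> w x \<le> w' x + (1 - Psi \<alpha> x)"
  shows "mass p w u \<le> mass p w' u + (M p u - W p u)"
proof -
  note i = mass_limit(2)[OF a w(1)] mass_limit(2)[OF a w(2)] mass_limit(2)[OF a one_weight] mass_limit(2)[OF a Psi_weight]
  have "mass p w u \<le> (LINT x|L. w' x * \<bar>u x\<bar> powr p + (1 * \<bar>u x\<bar> powr p - Psi \<alpha> x * \<bar>u x\<bar> powr p))"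
    unfolding mass_def
  proof (rule integral_mono[OF i(1)])
    fix x assume "x \<in> space L"
    then have "w x * \<bar>u x\<bar> powr p \<le> (w' x + (1 - Psi \<alpha> x)) * \<bar>u x\<bar> powr p" using le by (intro mult_right_mono) auto
    then show "w x * \<bar>u x\<bar> powr p \<le> w' x * \<bar>u x\<bar> powr p + (1 * \<bar>u x\<bar> powr p - Psi \<alpha> x * \<bar>u x\<bar> powr p)" by (simp add: algebra_simps)
  qed (use i in auto)
  also have "\<dots> = mass p w' u + (M p u - W p u)" unfolding mass_def using i by simp
  finally show ?thesis .
qed

text \<open>The cutoff angle rises from 0 to pi/2 across a shell around |x| = 2 where
  \<open>Psi\<close> \<le> 1/2. There either side weight is at most 1 - \<open>Psi\<close>, so up to
  the defect the inner mass is bounded by the cosine mass and the outer one by the sine mass. If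
  both sides had at least a quarter of the mass, strict subadditivity would contradict the splitting
  bound.\<close>

lemma gap:
  obtains c where "c > 1" "\<forall>\<^sub>F p in at_left q. \<forall>u \<phi>. H1_approx \<phi> u \<and> W p u = 1 \<and> energy u \<le> c * S \<longrightarrow>
     mass p win u < 1/4 \<or> mass p win u > 3/4"
proof -
  obtain \<sigma> where \<sigma>: "smooth1 \<sigma>" "\<And>t. t \<le> -1 \<Longrightarrow> \<sigma> t = (0::real)" "\<And>t. t \<ge> 1 \<Longrightarrow> \<sigma> t = 1"
    "\<And>t. 0 \<le> \<sigma> t" "\<And>t. \<sigma> t \<le> 1" "\<And>t. \<sigma> (- t) = 1 - \<sigma> t" by (rule smooth_step) blast
  \<comment> \<open>As |x| + 2 \<ge> 3 in the annulus, a value of |x|^2 - 4 smaller than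
    \<open>\<delta>\<close> in size forces |x| to within (1/2)^(1/\<alpha>) of 2, hence
    \<open>Psi\<close> \<le> 1/2.\<close>
  define \<delta> where "\<delta> = 3 * (1/2::real) powr (1/\<alpha>)"
  have d: "\<delta> > 0" by (simp add: \<delta>_def)
  define h where "h = (\<lambda>x::'a. (pi/2) * \<sigma> (-4/\<delta> + (1/\<delta>) * (x \<bullet> x)))"
  have h: "smooth_fun h" unfolding h_def
    by (rule smooth_fun_mult[OF smooth_fun_const smooth_fun_comp[OF smooth1_affine[OF \<sigma>(1)] smooth_fun_inner_self]])
  obtain K where K: "K \<ge> 0" "\<And>x. norm x \<le> 3 \<Longrightarrow> norm (cgrad h x) \<le> K" using smooth_cgrad_bound_ball[OF h, of 3] by blast
  \<comment> \<open>The lower bounds \<open>I - \<kappa>\<close> and \<open>1 - I - \<kappa>\<close>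
    for the two masses will lie in (0, 4/5], where \<open>powr_ge_linear\<close> gains exactly this
    factor; \<open>\<kappa> < 1/20\<close> keeps them positive.\<close>
  define G where "G = (5/4::real) powr (1 - 2/p1)"
  have G: "G > 1" unfolding G_def using p1 by (intro gr_one_powr) auto
  obtain c \<kappa> where c: "c > 1" "0 < \<kappa>" "\<kappa> < 1/20"
    and ev: "\<forall>\<^sub>F p in at_left q. p1 < p \<and> p < q \<and> (\<forall>u \<phi>. H1_approx \<phi> u \<and> W p u = 1 \<and> energy u \<le> c * S \<longrightarrow>
       M p u \<le> 1 + \<kappa> \<and> (\<forall>h. smooth_fun h \<and> (\<forall>x\<in>annulus. norm (cgrad h x) \<le> K) \<longrightarrow>
         mass p (cosw p h) u powr (2/p) + mass p (sinw p h) u powr (2/p) < (1 - 2 * \<kappa>) * G))"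
    by (rule near_minimiser_splitting[OF G K(1)]) blast
  have Psi_half: "Psi \<alpha> x \<le> 1/2" if "x \<in> annulus" "\<bar>x \<bullet> x - 4\<bar> < \<delta>" for x :: 'a
  proof -
    have "\<bar>norm x - 2\<bar> * 3 \<le> \<bar>norm x - 2\<bar> * (norm x + 2)" using that by (intro mult_left_mono) (auto simp: annulus_def)
    also have "\<dots> = \<bar>(norm x - 2) * (norm x + 2)\<bar>" using that by (simp add: abs_mult annulus_def)
    also have "(norm x - 2) * (norm x + 2) = x \<bullet> x - 4" by (simp add: algebra_simps dot_square_norm power2_eq_square)
    finally have "\<bar>norm x - 2\<bar> \<le> (1/2) powr (1/\<alpha>)" using that(2) by (simp add: \<delta>_def)
    then have "\<bar>norm x - 2\<bar> powr \<alpha> \<le> ((1/2) powr (1/\<alpha>)) powr \<alpha>" using alpha by (intro powr_mono2) auto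
    then show ?thesis using alpha by (simp add: Psi_def powr_powr)
  qed
  have Psi01: "0 \<le> Psi \<alpha> x" "x \<in> annulus \<Longrightarrow> Psi \<alpha> x \<le> 1" for x :: 'a using Psi_weight by (auto simp: weight_def)
  have "\<forall>\<^sub>F p in at_left q. \<forall>u \<phi>. H1_approx \<phi> u \<and> W p u = 1 \<and> energy u \<le> c * S \<longrightarrow> mass p win u < 1/4 \<or> mass p win u > 3/4"
    using ev
  proof eventually_elim
    case (elim p)
    have p: "p1 < p" "2 < p" "p < q" "p > 0" using elim p1 by auto
    have pa: "win x \<le> cosw p h x + (1 - Psi \<alpha> x)" if x: "x \<in> annulus" for x
    proof (cases "norm x < 2")
      case True
      have xx: "x \<bullet> x < 4" using power_strict_mono[OF True norm_ge_zero, of 2] by (simp add: dot_square_norm)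
      show ?thesis
      proof (cases "x \<bullet> x - 4 \<le> - \<delta>")
        case f: True
        then have "-4/\<delta> + (1/\<delta>) * (x \<bullet> x) \<le> -1" using d by (simp add: field_simps)
        then have "h x = 0" using \<sigma>(2) by (simp add: h_def)
        then show ?thesis using Psi01(2)[OF x] Psi01(1)[of x] True by (simp add: win_def)
      next
        case False
        then have "Psi \<alpha> x \<le> 1/2" using Psi_half[OF x] xx by simp
        moreover have "win x = Psi \<alpha> x" using True by (simp add: win_def)
        ultimately show ?thesis using powr_ge_zero[of "\<bar>cos (h x)\<bar>" p] by linarith
      qed
    next
      case False
      then show ?thesis using Psi01(2)[OF x] by (simp add: win_def add_nonneg_nonneg)
    qed
    have pb: "wout x \<le> sinw p h x + (1 - Psi \<alpha> x)" if x: "x \<in> annulus" for x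
    proof (cases "norm x > 2")
      case True
      have xx: "x \<bullet> x > 4" using power_strict_mono[OF True, of 2] by (simp add: dot_square_norm)
      show ?thesis
      proof (cases "x \<bullet> x - 4 \<ge> \<delta>")
        case f: True
        then have "-4/\<delta> + (1/\<delta>) * (x \<bullet> x) \<ge> 1" using d by (simp add: field_simps)
        then have hx: "h x = pi/2" using \<sigma>(3) by (simp add: h_def)
        have "sin (h x) = 1" unfolding hx by simp
        then show ?thesis using Psi01(2)[OF x] Psi01(1)[of x] True by (simp add: wout_def)
      next
        case False
        then have "Psi \<alpha> x \<le> 1/2" using Psi_half[OF x] xx by simp
        moreover have "wout x = Psi \<alpha> x" using True by (simp add: wout_def)
        ultimately show ?thesis using powr_ge_zero[of "\<bar>sin (h x)\<bar>" p] by linarith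
      qed
    next
      case False
      then show ?thesis using Psi01(2)[OF x] by (simp add: wout_def add_nonneg_nonneg)
    qed
    show ?case
    proof (intro allI impI, rule ccontr)
      fix u \<phi> assume A: "H1_approx \<phi> u \<and> W p u = 1 \<and> energy u \<le> c * S" and B: "\<not> (mass p win u < 1/4 \<or> mass p win u > 3/4)"
      define I where "I = mass p win u"
      have I: "1/4 \<le> I" "I \<le> 3/4" using B by (auto simp: I_def)
      have a: "H1_approx \<phi> u" and Wu: "W p u = 1" using A by auto
      have Mu: "M p u \<le> 1 + \<kappa>" using elim A by blast
      have "\<forall>x\<in>annulus. norm (cgrad h x) \<le> K" using K(2) by (simp add: annulus_def)
      then have sp: "mass p (cosw p h) u powr (2/p) + mass p (sinw p h) u powr (2/p) < (1 - 2 * \<kappa>) * G" using elim A h by blast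
      have O: "mass p wout u = 1 - I" using mass_sides[OF a p(2,3)] Wu by (simp add: I_def)
      have m1: "I - \<kappa> \<le> mass p (cosw p h) u"
        using mass_mono_defect[OF a p(2,3) side_weights(1) trig_weights(1)[OF h p(4)] pa] Mu Wu by (simp add: I_def)
      have m2: "1 - I - \<kappa> \<le> mass p (sinw p h) u"
        using mass_mono_defect[OF a p(2,3) side_weights(2) trig_weights(2)[OF h p(4)] pb] Mu Wu O by simp
      have "(I - \<kappa>) * G \<le> (I - \<kappa>) powr (2/p)" unfolding G_def by (rule powr_ge_linear) (use I c p p1 in auto)
      also have "\<dots> \<le> mass p (cosw p h) u powr (2/p)" using m1 I c p by (intro powr_mono2) auto
      finally have 1: "(I - \<kappa>) * G \<le> mass p (cosw p h) u powr (2/p)" .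
      have "(1 - I - \<kappa>) * G \<le> (1 - I - \<kappa>) powr (2/p)" unfolding G_def by (rule powr_ge_linear) (use I c p p1 in auto)
      also have "\<dots> \<le> mass p (sinw p h) u powr (2/p)" using m2 I c p by (intro powr_mono2) auto
      finally have 2: "(1 - I - \<kappa>) * G \<le> mass p (sinw p h) u powr (2/p)" .
      have "(1 - 2 * \<kappa>) * G = (I - \<kappa>) * G + (1 - I - \<kappa>) * G" by (simp add: algebra_simps)
      then show False using 1 2 sp by linarith
    qed
  qed
  then show thesis using that c(1) by blast
qed

lemma mass_orthogonal:
  fixes Q :: "'a \<Rightarrow> 'a"
  assumes Q: "orthogonal_transformation Q" and u: "u \<in> borel_measurable L" and w: "w \<in> borel_measurable borel"
  shows "mass p (\<lambda>x. w (Q x)) (\<lambda>x. u (Q x)) = mass p w u" "(\<lambda>x. u (Q x)) \<in> borel_measurable L"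
proof -
  have ind: "indicator annulus (Q x) = (indicator annulus x :: real)" for x
    using orthogonal_transformation_norm[OF Q, of x] by (simp add: indicator_def annulus_def)
  have rm: "(\<lambda>x. g x * indicator annulus x) \<in> borel_measurable lebesgue \<longleftrightarrow> g \<in> borel_measurable L" for g :: "'a \<Rightarrow> real"
    by (subst borel_measurable_restrict_space_iff) (auto simp: mult.commute)
  have wL: "w \<in> borel_measurable L" using w by (intro meas_L meas_leb)
  have "(\<lambda>x. w x * \<bar>u x\<bar> powr p) \<in> borel_measurable L" using u wL by measurable
  then have F: "(\<lambda>x. (w x * \<bar>u x\<bar> powr p) * indicator annulus x) \<in> borel_measurable lebesgue" by (rule rm[THEN iffD2])
  have "mass p (\<lambda>x. w (Q x)) (\<lambda>x. u (Q x)) = (LINT x|lebesgue. (\<lambda>x. (w x * \<bar>u x\<bar> powr p) * indicator annulus x) (Q x))"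
    unfolding mass_def by (subst integral_restrict_space) (simp_all add: ind mult.commute)
  also have "\<dots> = (LINT x|lebesgue. (w x * \<bar>u x\<bar> powr p) * indicator annulus x)"
    by (rule lebesgue_integral_orthogonal[OF Q F])
  also have "\<dots> = mass p w u" unfolding mass_def by (subst integral_restrict_space) (simp_all add: mult.commute)
  finally show "mass p (\<lambda>x. w (Q x)) (\<lambda>x. u (Q x)) = mass p w u" .
  have "(\<lambda>x. u x * indicator annulus x) \<in> borel_measurable lebesgue" by (rule rm[THEN iffD2, OF u])
  then have "(\<lambda>x. (\<lambda>x. u x * indicator annulus x) (Q x)) \<in> borel_measurable lebesgue"
    by (rule measurable_compose[OF lebesgue_orthogonal(2)[OF Q]])
  then show "(\<lambda>x. u (Q x)) \<in> borel_measurable L" unfolding ind by (rule rm[THEN iffD1])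
qed

text \<open>Since |x| > 1, some coordinate satisfies |\<open>x \<bullet> b\<close>| \<ge> 1/sqrt N,
  so for one \<open>b\<close> the region where this holds carries at least 1/N of the mass. The
  cutoffs for \<open>b\<close> are exchanged by x to -x, so an even function has equal masses
  \<open>A\<close>. Their weights add up to 1 on that region and to at least s = 2^(1 - p/2)
  elsewhere, which lifts 2A above \<open>s\<close> by the factor 1 + e and the sum 2 A^(2/p) above
  1.\<close>

lemma even_not_near_minimal:
  obtains c where "c > 1" "\<forall>\<^sub>F p in at_left q. \<forall>u \<phi>. H1_approx \<phi> u \<and> W p u = 1 \<and> energy u \<le> c * S \<longrightarrow>
     \<not> (AE x in L. u (- x) = u x)"
proof -
  obtain \<sigma> where \<sigma>: "smooth1 \<sigma>" "\<And>t. t \<le> -1 \<Longrightarrow> \<sigma> t = (0::real)" "\<And>t. t \<ge> 1 \<Longrightarrow> \<sigma> t = 1"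
    "\<And>t. 0 \<le> \<sigma> t" "\<And>t. \<sigma> t \<le> 1" "\<And>t. \<sigma> (- t) = 1 - \<sigma> t" by (rule smooth_step) blast
  define N where "N = real DIM('a)"
  have N: "N \<ge> 3" using dim by (simp add: N_def)
  define h where "h = (\<lambda>b x::'a. (pi/2) * \<sigma> (0 + sqrt N * (x \<bullet> b)))"
  have h: "smooth_fun (h b)" for b unfolding h_def
    by (rule smooth_fun_mult[OF smooth_fun_const smooth_fun_comp[OF smooth1_affine[OF \<sigma>(1)] smooth_fun_inner]])
  have "\<forall>b. \<exists>k. k \<ge> 0 \<and> (\<forall>x. norm x \<le> 3 \<longrightarrow> norm (cgrad (h b) x) \<le> k)" using smooth_cgrad_bound_ball[OF h] by metis
  then obtain k where k: "\<And>b. k b \<ge> 0" "\<And>b x. norm x \<le> 3 \<Longrightarrow> norm (cgrad (h b) x) \<le> k b" by metis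
  \<comment> \<open>The coordinate \<open>b\<close> will depend on \<open>u\<close>, so one gradient
    bound has to serve all of them.\<close>
  define K where "K = (\<Sum>b\<in>Basis. k b)"
  have K0: "K \<ge> 0" unfolding K_def by (intro sum_nonneg k)
  have K: "norm (cgrad (h b) x) \<le> K" if "b \<in> Basis" "x \<in> annulus" for b x
  proof -
    have "norm (cgrad (h b) x) \<le> k b" using that k(2) by (simp add: annulus_def)
    also have "\<dots> \<le> K" unfolding K_def by (rule member_le_sum) (use that k in auto)
    finally show ?thesis .
  qed
  \<comment> \<open>The largest value with s (1 + e) \<le> s + (1 - s)/N, where 1/s = 2^(p/2 - 1),
    evaluated at the smallest exponent \<open>p1\<close>.\<close>
  define e where "e = (2 powr (p1/2 - 1) - 1) / N"
  have "(2::real) powr (p1/2 - 1) > 1" using p1 by (intro gr_one_powr) auto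
  then have e: "e > 0" using N by (simp add: e_def)
  define G where "G = (1 + e) powr (2/q)"
  have G: "G > 1" unfolding G_def using e q_gt_2 by (intro gr_one_powr) auto
  obtain c \<kappa> where c: "c > 1" "0 < \<kappa>" "\<kappa> < 1/20"
    and ev: "\<forall>\<^sub>F p in at_left q. p1 < p \<and> p < q \<and> (\<forall>u \<phi>. H1_approx \<phi> u \<and> W p u = 1 \<and> energy u \<le> c * S \<longrightarrow>
       M p u \<le> 1 + \<kappa> \<and> (\<forall>h. smooth_fun h \<and> (\<forall>x\<in>annulus. norm (cgrad h x) \<le> K) \<longrightarrow>
         mass p (cosw p h) u powr (2/p) + mass p (sinw p h) u powr (2/p) < (1 - 2 * \<kappa>) * G))"
    by (rule near_minimiser_splitting[OF G K0]) blast
  have "\<forall>\<^sub>F p in at_left q. \<forall>u \<phi>. H1_approx \<phi> u \<and> W p u = 1 \<and> energy u \<le> c * S \<longrightarrow> \<not> (AE x in L. u (- x) = u x)"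
    using ev
  proof eventually_elim
    case (elim p)
    have p: "p1 < p" "2 < p" "p < q" "p > 0" using elim p1 by auto
    show ?case
    proof (intro allI impI notI)
      fix u \<phi> assume A: "H1_approx \<phi> u \<and> W p u = 1 \<and> energy u \<le> c * S" and even: "AE x in L. u (- x) = u x"
      have a: "H1_approx \<phi> u" and Wu: "W p u = 1" using A by auto
      have u: "u \<in> borel_measurable L" using a by (simp add: H1_approx_def)
      note lim = mass_limit(2)[OF a p(2,3)]
      have M1: "M p u \<ge> 1"
      proof -
        have "W p u \<le> M p u" unfolding mass_def
          by (rule integral_mono[OF lim[OF Psi_weight] lim[OF one_weight]])
             (use Psi_weight mult_right_mono[of "Psi \<alpha> x" 1 "\<bar>u x\<bar> powr p" for x] in \<open>auto simp: weight_def\<close>)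
        then show ?thesis using Wu by simp
      qed
      define z where "z = (\<lambda>b x::'a. indicat_real {x. 1 \<le> sqrt N * \<bar>x \<bullet> b\<bar>} x)"
      have zw: "weight (z b)" for b unfolding weight_def z_def by (auto simp: indicator_def)
      have "M p u \<le> (LINT x|L. (\<Sum>b\<in>Basis. z b x * \<bar>u x\<bar> powr p))" unfolding mass_def
      proof (rule integral_mono[OF lim[OF one_weight]])
        fix x assume "x \<in> space L"
        then have nx: "norm x > 1" by (simp add: annulus_def)
        have "\<exists>b\<in>Basis. 1 \<le> sqrt N * \<bar>x \<bullet> b\<bar>"
        proof (rule ccontr)
          assume "\<not> ?thesis"
          then have lt: "sqrt N * \<bar>x \<bullet> b\<bar> < 1" if "b \<in> Basis" for b using that by auto
          have "(x \<bullet> b)\<^sup>2 \<le> 1 / N" if "b \<in> Basis" for b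
          proof -
            have "(sqrt N * \<bar>x \<bullet> b\<bar>)\<^sup>2 \<le> 1" using lt[OF that] N by (intro power_le_one) auto
            then show ?thesis using N by (simp add: power_mult_distrib field_simps)
          qed
          then have "(\<Sum>b\<in>Basis. (x \<bullet> b)\<^sup>2) \<le> (\<Sum>b\<in>(Basis::'a set). 1 / N)" by (rule sum_mono)
          also have "\<dots> = 1" using N by (simp add: N_def)
          finally have "(norm x)\<^sup>2 \<le> 1" by (simp add: norm_eq_sqrt_inner euclidean_inner[of x x] power2_eq_square[symmetric] sum_nonneg)
          then show False using nx by (simp add: power2_le_iff_abs_le abs_square_le_1)
        qed
        then obtain b where b: "b \<in> Basis" "z b x = 1" by (auto simp: z_def)
        have "1 * \<bar>u x\<bar> powr p = z b x * \<bar>u x\<bar> powr p" using b by simp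
        also have "\<dots> \<le> (\<Sum>b\<in>Basis. z b x * \<bar>u x\<bar> powr p)" by (rule member_le_sum) (use b in \<open>auto simp: z_def\<close>)
        finally show "1 * \<bar>u x\<bar> powr p \<le> (\<Sum>b\<in>Basis. z b x * \<bar>u x\<bar> powr p)" .
      qed (use lim[OF zw] in auto)
      also have "\<dots> = (\<Sum>b\<in>Basis. mass p (z b) u)" unfolding mass_def using lim[OF zw] by simp
      finally have sumb: "M p u \<le> (\<Sum>b\<in>Basis. mass p (z b) u)" .
      have "\<exists>b\<in>Basis. M p u / N \<le> mass p (z b) u"
      proof (rule ccontr)
        assume "\<not> ?thesis"
        then have "(\<Sum>b\<in>Basis. mass p (z b) u) < (\<Sum>b\<in>(Basis::'a set). M p u / N)" by (intro sum_strict_mono) auto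
        also have "\<dots> = M p u" using N by (simp add: N_def)
        finally show False using sumb by simp
      qed
      then obtain b where b: "b \<in> Basis" "M p u / N \<le> mass p (z b) u" by blast
      note tw = trig_weights[OF h[of b] p(4)]
      \<comment> \<open>By the symmetry of the step function the angle at -x is complementary to
        that at x, turning cosine into sine.\<close>
      have hm: "h b (- x) = pi/2 - h b x" for x
      proof -
        have e: "0 + sqrt N * ((- x) \<bullet> b) = - (0 + sqrt N * (x \<bullet> b))" by simp
        show ?thesis unfolding h_def e \<sigma>(6) by (simp add: right_diff_distrib)
      qed
      have refl: "mass p (cosw p (h b)) u = mass p (sinw p (h b)) u"
      proof -
        have Q: "orthogonal_transformation (\<lambda>x::'a. - x)" using orthogonal_transformation_neg[of "\<lambda>x::'a. x"] orthogonal_transformation_id by (simp add: id_def)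
        have cm: "cosw p (h b) \<in> borel_measurable borel" using tw(1) by (simp add: weight_def)
        have "mass p (cosw p (h b)) u = mass p (\<lambda>x. cosw p (h b) (- x)) (\<lambda>x. u (- x))" by (rule mass_orthogonal(1)[OF Q u cm, symmetric])
        also have "\<dots> = mass p (sinw p (h b)) u" unfolding mass_def hm cos_diff
        proof (rule integral_cong_AE)
          note [measurable] = u mass_orthogonal(2)[OF Q u] weight_measurable_L[OF tw(2)]
          show "(\<lambda>x. \<bar>cos (pi/2) * cos (h b x) + sin (pi/2) * sin (h b x)\<bar> powr p * \<bar>u (- x)\<bar> powr p) \<in> borel_measurable L"
            by simp measurable
          show "(\<lambda>x. sinw p (h b) x * \<bar>u x\<bar> powr p) \<in> borel_measurable L" by measurable
          show "AE x in L. \<bar>cos (pi/2) * cos (h b x) + sin (pi/2) * sin (h b x)\<bar> powr p * \<bar>u (- x)\<bar> powr p = \<bar>sin (h b x)\<bar> powr p * \<bar>u x\<bar> powr p"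
            using even by eventually_elim simp
        qed
        finally show ?thesis .
      qed
      define A where "A = mass p (cosw p (h b)) u"
      define s where "s = (2::real) powr (1 - p/2)"
      have s: "0 < s" "s \<le> 1" using p powr_mono[of "1 - p/2" 0 2] by (auto simp: s_def)
      have pw: "s + (1 - s) * z b x \<le> cosw p (h b) x + sinw p (h b) x" for x
      proof (cases "1 \<le> sqrt N * \<bar>x \<bullet> b\<bar>")
        case True
        then have "sqrt N * (x \<bullet> b) \<ge> 1 \<or> sqrt N * (x \<bullet> b) \<le> -1" by (auto simp: abs_if split: if_splits)
        then consider "h b x = 0" | "h b x = pi/2" using \<sigma>(2,3) by (auto simp: h_def)
        then show ?thesis
        proof cases
          case 1 then show ?thesis using True by (simp add: z_def)
        next
          case 2
          have "cos (h b x) = 0" "sin (h b x) = 1" unfolding 2 by simp_all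
          then show ?thesis using True by (simp add: z_def)
        qed
      next
        case False
        have "s \<le> ((cos (h b x))\<^sup>2) powr (p/2) + ((sin (h b x))\<^sup>2) powr (p/2)"
          unfolding s_def by (rule powr_mean) (use p in auto)
        moreover have sq: "(t\<^sup>2) powr (p/2) = \<bar>t\<bar> powr p" for t :: real
        proof -
          have "(t\<^sup>2) powr (p/2) = (\<bar>t\<bar> powr 2) powr (p/2)" by simp
          also have "\<dots> = \<bar>t\<bar> powr p" by (simp only: powr_powr) simp
          finally show ?thesis .
        qed
        ultimately show ?thesis using False by (simp add: z_def)
      qed
      have "s * M p u + (1 - s) * mass p (z b) u = (LINT x|L. s * (1 * \<bar>u x\<bar> powr p) + (1 - s) * (z b x * \<bar>u x\<bar> powr p))"
        unfolding mass_def using lim[OF one_weight] lim[OF zw] by simp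
      also have "\<dots> \<le> (LINT x|L. cosw p (h b) x * \<bar>u x\<bar> powr p + sinw p (h b) x * \<bar>u x\<bar> powr p)"
      proof (rule integral_mono)
        fix x
        have "(s + (1 - s) * z b x) * \<bar>u x\<bar> powr p \<le> (cosw p (h b) x + sinw p (h b) x) * \<bar>u x\<bar> powr p" by (rule mult_right_mono[OF pw]) simp
        then show "s * (1 * \<bar>u x\<bar> powr p) + (1 - s) * (z b x * \<bar>u x\<bar> powr p) \<le> cosw p (h b) x * \<bar>u x\<bar> powr p + sinw p (h b) x * \<bar>u x\<bar> powr p"
          by (simp add: algebra_simps)
      qed (use lim[OF one_weight] lim[OF zw] lim[OF tw(1)] lim[OF tw(2)] in auto)
      also have "\<dots> = 2 * A" unfolding A_def using refl lim[OF tw(1)] lim[OF tw(2)] by (simp add: mass_def)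
      finally have "s * M p u + (1 - s) * mass p (z b) u \<le> 2 * A" .
      moreover have "(1 - s) * (M p u / N) \<le> (1 - s) * mass p (z b) u" using b s by (intro mult_left_mono) auto
      moreover have "s + (1 - s) / N \<le> (s + (1 - s) / N) * M p u"
      proof -
        have "0 \<le> s + (1 - s) / N" using s N by (intro add_nonneg_nonneg) auto
        then show ?thesis using mult_left_mono[OF M1] by fastforce
      qed
      ultimately have A2: "s + (1 - s) / N \<le> 2 * A" by (simp add: algebra_simps)
      have "s * (1 + e) \<le> s + (1 - s) / N"
      proof -
        have "(2::real) powr (p1/2 - 1) \<le> 2 powr (p/2 - 1)" using p by (intro powr_mono) auto
        then have "s * 2 powr (p1/2 - 1) \<le> s * 2 powr (p/2 - 1)" using s by simp
        also have "\<dots> = 1" by (simp add: s_def powr_add[symmetric])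
        finally have "s * (2 powr (p1/2 - 1) - 1) / N \<le> (1 - s) / N" using N by (intro divide_right_mono) (auto simp: algebra_simps)
        then show ?thesis by (simp add: e_def algebra_simps)
      qed
      then have A3: "s * (1 + e) / 2 \<le> A" using A2 by simp
      have "G \<le> (1 + e) powr (2/p)" unfolding G_def using e p by (intro powr_mono divide_left_mono) auto
      \<comment> \<open>Here s/2 = 2^(-p/2), so (s/2)^(2/p) = 1/2: equal splitting alone would give
        exactly 1, and the factor 1 + e is the whole gain.\<close>
      also have "\<dots> = 2 * (s/2 * (1 + e)) powr (2/p)"
      proof -
        have "s = 2 powr 1 * 2 powr (- (p/2))" unfolding s_def powr_add[symmetric] by simp
        then have s2: "s / 2 = 2 powr (- (p/2))" by simp
        have "- (p/2) * (2/p) = - 1" using p by simp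
        then have "(s/2) powr (2/p) = 2 powr (- 1)" unfolding s2 powr_powr by simp
        then have "(s/2) powr (2/p) = 1/2" by (simp add: powr_minus_divide)
        then show ?thesis unfolding powr_mult by simp
      qed
      also have "\<dots> \<le> 2 * A powr (2/p)" using A3 s e p by (intro mult_left_mono powr_mono2) auto
      finally have "G \<le> mass p (cosw p (h b)) u powr (2/p) + mass p (sinw p (h b)) u powr (2/p)" using refl by (simp add: A_def)
      moreover have "mass p (cosw p (h b)) u powr (2/p) + mass p (sinw p (h b)) u powr (2/p) < (1 - 2 * \<kappa>) * G" using elim A h K[OF b(1)] by blast
      moreover have "(1 - 2 * \<kappa>) * G \<le> 1 * G" using c G by (intro mult_right_mono) auto
      ultimately show False by linarith
    qed
  qed
  then show thesis using that c(1) by blast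
qed

end

section \<open>Minimisers on either side\<close>

context henon
begin

lemma mass_test_fun_continuous_exponent:
  assumes g: "g \<in> test_funs (annulus::'a set)" and w: "weight w"
  shows "((\<lambda>p. mass p w g) \<longlongrightarrow> mass q w g) (at_left q)"
proof (rule tendsto_at_left_sequentially[OF q_gt_2])
  interpret fm: finite_measure L by (rule finite_measure_L)
  obtain b where b: "b > 0" "\<And>x. \<bar>g x\<bar> \<le> b" using test_fun_bounded[OF g] by metis
  note [measurable] = test_fun_L(5)[OF g] weight_measurable_L[OF w]
  fix T :: "nat \<Rightarrow> real" assume T: "\<And>n. T n < q" "\<And>n. 2 < T n" "T \<longlonglongrightarrow> q"
  show "(\<lambda>n. mass (T n) w g) \<longlonglongrightarrow> mass q w g"
    unfolding mass_def
  \<comment> \<open>Raising the bound \<open>b\<close> to \<open>b + 1\<close> makes the base at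
    least 1, so the powers increase with the exponent.\<close>
  proof (rule integral_dominated_convergence[where w="\<lambda>_. (b + 1) powr q"])
    show "AE x in L. (\<lambda>n. w x * \<bar>g x\<bar> powr T n) \<longlonglongrightarrow> w x * \<bar>g x\<bar> powr q"
    proof (rule AE_I2)
      fix x show "(\<lambda>n. w x * \<bar>g x\<bar> powr T n) \<longlonglongrightarrow> w x * \<bar>g x\<bar> powr q"
        by (cases "g x = 0") (auto intro!: tendsto_intros T)
    qed
    show "AE x in L. norm (w x * \<bar>g x\<bar> powr T n) \<le> (b + 1) powr q" for n
    proof (rule AE_I2)
      fix x assume "x \<in> space L"
      then have wx: "0 \<le> w x" "w x \<le> 1" using w by (auto simp: weight_def)
      have "\<bar>g x\<bar> powr T n \<le> (b + 1) powr T n" using b(2)[of x] T(2)[of n] by (intro powr_mono2) auto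
      also have "\<dots> \<le> (b + 1) powr q" using b T(1)[of n] by (intro powr_mono) auto
      finally have "w x * \<bar>g x\<bar> powr T n \<le> 1 * (b + 1) powr q" using wx by (intro mult_mono) auto
      then show "norm (w x * \<bar>g x\<bar> powr T n) \<le> (b + 1) powr q" using wx by simp
    qed
  qed auto
qed

text \<open>An almost optimal function for \<open>S\<close> is squeezed into a ball next to the
  boundary, where the weight is at least (1 - 2t)^\<alpha>. The function is fixed at the critical
  exponent; the strict inequality then persists for \<open>p\<close> near \<open>q\<close> by
  continuity of the mass in the exponent.\<close>

lemma concentrated_competitor:
  assumes c: "c > 1" and w: "weight w"
    and A: "\<And>t. 0 < t \<Longrightarrow> t < 1/2 \<Longrightarrow> \<exists>z. \<forall>x\<in>ball z t. x \<in> annulus \<and> 1 - 2 * t < \<bar>norm x - 2\<bar> \<and> w x = Psi \<alpha> x"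
  shows "\<forall>\<^sub>F p in at_left q. \<exists>\<phi>\<in>test_funs annulus. W p \<phi> > 0 \<and> mass p w \<phi> = W p \<phi> \<and> dirichlet \<phi> < c * S * W p \<phi> powr (2/p)"
proof -
  \<comment> \<open>One factor \<open>l\<close> pays for \<open>f\<close> being only almost optimal,
    the other for the loss of weight in the ball.\<close>
  define l where "l = sqrt c"
  have l: "l > 1" "l * l = c" using c by (auto simp: l_def)
  obtain f where f: "f \<in> test_funs (UNIV::'a set)" "Mq f > 0" "dirichlet f < l * S * Mq f powr (2/q)" using S_approx[OF l(1)] by blast
  have "((\<lambda>t. ((1 - 2 * t) powr \<alpha>) powr (2/q)) \<longlongrightarrow> ((1 - 2 * 0) powr \<alpha>) powr (2/q)) (at_right (0::real))"
    by (intro tendsto_intros) auto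
  then have "((\<lambda>t. ((1 - 2 * t) powr \<alpha>) powr (2/q)) \<longlongrightarrow> 1) (at_right (0::real))" by simp
  moreover have "1/l < 1" using l by simp
  ultimately have "\<forall>\<^sub>F t in at_right (0::real). 1/l < ((1 - 2 * t) powr \<alpha>) powr (2/q)" by (rule order_tendstoD(1))
  moreover have "\<forall>\<^sub>F t in at_right (0::real). t \<in> {0<..<1/2}" by (rule eventually_at_right_real) simp
  ultimately have "\<forall>\<^sub>F t in at_right (0::real). 1/l < ((1 - 2 * t) powr \<alpha>) powr (2/q) \<and> t \<in> {0<..<1/2}" by (rule eventually_conj)
  then obtain t where t: "1/l < ((1 - 2 * t) powr \<alpha>) powr (2/q)" "0 < t" "t < 1/2"
    using eventually_happens'[OF trivial_limit_at_right_real] by fastforce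
  obtain z where z: "\<And>x. x \<in> ball z t \<Longrightarrow> x \<in> annulus \<and> 1 - 2 * t < \<bar>norm x - 2\<bar> \<and> w x = Psi \<alpha> x" using A[OF t(2,3)] by blast
  obtain g k where g0: "g \<in> test_funs (ball z t)" and gk: "k > 0" "dirichlet g = k powr (2/q) * dirichlet f" "Mq g = k * Mq f"
    by (rule concentrated_test_fun[OF f(1) t(2), of z]) blast
  have "ball z t \<subseteq> annulus" using z by blast
  then have g: "g \<in> test_funs annulus" using g0 test_funs_mono by blast
  have wg: "w x * \<bar>g x\<bar> powr p = Psi \<alpha> x * \<bar>g x\<bar> powr p" for x p
    by (cases "x \<in> ball z t") (use z test_fun_vanishes[OF g0] in auto)
  have mw: "mass p w g = W p g" for p unfolding mass_def wg ..
  have Mg: "Mq g > 0" using gk f by simp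
  have Dg: "dirichlet g < l * S * Mq g powr (2/q)"
  proof -
    have "k powr (2/q) * dirichlet f < k powr (2/q) * (l * S * Mq f powr (2/q))" using f(3) gk(1) by (intro mult_strict_left_mono) auto
    then show ?thesis using gk f(2) by (simp add: powr_mult mult.left_commute mult.assoc)
  qed
  define a where "a = (1 - 2 * t) powr \<alpha>"
  have a: "a > 0" using t by (simp add: a_def)
  have "a * \<bar>g x\<bar> powr q \<le> Psi \<alpha> x * \<bar>g x\<bar> powr q" for x
  proof (cases "x \<in> ball z t")
    case True
    have "(1 - 2 * t) powr \<alpha> \<le> \<bar>norm x - 2\<bar> powr \<alpha>" using z[OF True] t alpha by (intro powr_mono2) auto
    then show ?thesis by (intro mult_right_mono) (auto simp: a_def Psi_def)
  qed (use test_fun_vanishes[OF g0] in simp)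
  moreover have iq: "integrable L (\<lambda>x. \<bar>g x\<bar> powr q)" using test_fun_L(3)[OF g] q_gt_2 by simp
  moreover have "integrable L (\<lambda>x. Psi \<alpha> x * \<bar>g x\<bar> powr q)"
    by (rule Bochner_Integration.integrable_bound[OF iq])
       (use weight_measurable_L[OF Psi_weight] test_fun_L(5)[OF g] Psi_weight mult_right_mono[of "Psi \<alpha> x" 1 "\<bar>g x\<bar> powr q" for x] in \<open>auto simp: weight_def intro!: AE_I2\<close>)
  ultimately have "(LINT x|L. a * \<bar>g x\<bar> powr q) \<le> W q g" unfolding mass_def by (intro integral_mono) auto
  then have Wg: "a * Mq g \<le> W q g" using test_fun_L(4)[OF g, of q] q_gt_2 iq by (simp add: Mq_def)
  then have Wpos: "W q g > 0" using mult_pos_pos[OF a Mg] by linarith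
  have "1/l * Mq g powr (2/q) < a powr (2/q) * Mq g powr (2/q)" using t(1) Mg by (intro mult_strict_right_mono) (auto simp: a_def)
  also have "\<dots> = (a * Mq g) powr (2/q)" by (simp add: powr_mult)
  also have "\<dots> \<le> W q g powr (2/q)" using Wg a Mg q_gt_2 by (intro powr_mono2) auto
  finally have "l * S * (l * (1/l * Mq g powr (2/q))) < l * S * (l * W q g powr (2/q))" using l S_pos by (intro mult_strict_left_mono) auto
  then have "l * S * Mq g powr (2/q) < c * S * W q g powr (2/q)" using l by (simp add: l(2)[symmetric] mult.assoc mult.left_commute)
  then have D: "dirichlet g < c * S * W q g powr (2/q)" using Dg by linarith
  note lim = mass_test_fun_continuous_exponent[OF g Psi_weight]
  have "((\<lambda>p. c * S * W p g powr (2/p)) \<longlongrightarrow> c * S * W q g powr (2/q)) (at_left q)"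
    using lim Wpos q_gt_2 by (intro tendsto_intros) auto
  then have "\<forall>\<^sub>F p in at_left q. dirichlet g < c * S * W p g powr (2/p)" using D by (rule order_tendstoD(1))
  moreover have "\<forall>\<^sub>F p in at_left q. W p g > 0" using order_tendstoD(1)[OF lim Wpos] .
  ultimately show ?thesis by eventually_elim (use g mw in blast)
qed

text \<open>Balls of radius \<open>t\<close> touching the inner or the outer sphere from inside the
  annulus; \<open>t < 1/2\<close> keeps them in the corresponding half.\<close>

lemma competitors:
  assumes c: "c > 1" and w: "w = win \<or> w = wout"
  shows "\<forall>\<^sub>F p in at_left q. \<exists>\<phi>\<in>test_funs annulus. W p \<phi> > 0 \<and> mass p w \<phi> = W p \<phi> \<and> dirichlet \<phi> < c * S * W p \<phi> powr (2/p)"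
proof (rule concentrated_competitor[OF c])
  show "weight w" using w side_weights by blast
  obtain b :: 'a where b: "b \<in> Basis" using nonempty_Basis by blast
  fix t :: real assume t: "0 < t" "t < 1/2"
  show "\<exists>z. \<forall>x\<in>ball z t. x \<in> annulus \<and> 1 - 2 * t < \<bar>norm x - 2\<bar> \<and> w x = Psi \<alpha> x"
    using w
  proof
    assume w: "w = win"
    show ?thesis
    proof (intro exI ballI)
      fix x assume x: "x \<in> ball ((1 + t) *\<^sub>R b) t"
      have nb: "norm ((1 + t) *\<^sub>R b) = 1 + t" using b t by simp
      have "norm x < 1 + 2 * t" "norm x > 1"
        using norm_triangle_ineq2[of x "(1 + t) *\<^sub>R b"] norm_triangle_ineq2[of "(1 + t) *\<^sub>R b" x] x nb by (auto simp: dist_norm norm_minus_commute)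
      then show "x \<in> annulus \<and> 1 - 2 * t < \<bar>norm x - 2\<bar> \<and> w x = Psi \<alpha> x" using t by (auto simp: annulus_def w win_def)
    qed
  next
    assume w: "w = wout"
    show ?thesis
    proof (intro exI ballI)
      fix x assume x: "x \<in> ball ((3 - t) *\<^sub>R b) t"
      have nb: "norm ((3 - t) *\<^sub>R b) = 3 - t" using b t by simp
      have "norm x < 3" "norm x > 3 - 2 * t"
        using norm_triangle_ineq2[of x "(3 - t) *\<^sub>R b"] norm_triangle_ineq2[of "(3 - t) *\<^sub>R b" x] x nb by (auto simp: dist_norm norm_minus_commute)
      then show "x \<in> annulus \<and> 1 - 2 * t < \<bar>norm x - 2\<bar> \<and> w x = Psi \<alpha> x" using t by (auto simp: annulus_def w wout_def)
    qed
  qed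
qed

lemma mass_cmult: "mass p w (\<lambda>x. c * u x) = \<bar>c\<bar> powr p * mass p w u"
proof -
  have "(\<lambda>x. w x * \<bar>c * u x\<bar> powr p) = (\<lambda>x. \<bar>c\<bar> powr p * (w x * \<bar>u x\<bar> powr p))" by (auto simp: abs_mult powr_mult)
  then show ?thesis unfolding mass_def by simp
qed

lemma R_eq: "R \<alpha> p u = energy u / W p u powr (2/p)" for u :: "'a \<Rightarrow> real"
  by (simp add: R_def energy_def mass_def set_integral_L)

lemma mass_close:
  assumes a: "H1_approx \<phi> u" "2 < p" "p < q" and v: "v \<in> borel_measurable L" "integrable L (\<lambda>x. \<bar>v x - u x\<bar> powr p)"
    and w: "weight w" and C: "C > 0" "\<epsilon> > 0" "\<And>a b::real. \<bar>\<bar>a\<bar> powr p - \<bar>b\<bar> powr p\<bar> \<le> \<epsilon> * \<bar>b\<bar> powr p + C * \<bar>a - b\<bar> powr p"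
  shows "\<bar>mass p w v - mass p w u\<bar> \<le> \<epsilon> * M p u + C * M p (\<lambda>x. v x - u x)"
proof -
  have "u \<in> borel_measurable L" using a by (simp add: H1_approx_def)
  then have "\<bar>(LINT x|L. w x * \<bar>v x\<bar> powr p) - (LINT x|L. w x * \<bar>u x\<bar> powr p)\<bar> \<le> \<epsilon> * (LINT x|L. \<bar>u x\<bar> powr p) + C * (LINT x|L. \<bar>v x - u x\<bar> powr p)"
    by (intro weighted_powr_integral_close(4)) (use v w C H1_approx_Lp(1)[OF a] weight_measurable_L[OF w] in \<open>auto simp: weight_def\<close>)
  then show ?thesis by (simp add: mass_def)
qed

text \<open>The \<open>L^q\<close> masses of differences are bounded by Sobolev, so interpolation
  upgrades L2 smallness to \<open>L^p\<close> smallness; this is where subcriticality provides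
  compactness.\<close>

lemma Lp_cauchy_of_L2_cauchy:
  assumes p: "2 < p" "p < q" and \<phi>: "\<And>n::nat. \<phi> n \<in> test_funs annulus" and K: "\<And>n. dirichlet (\<phi> n) \<le> K"
    and c2: "\<And>\<epsilon>. \<epsilon> > 0 \<Longrightarrow> \<exists>n0. \<forall>m\<ge>n0. \<forall>n\<ge>n0. (LINT x|lborel. (\<phi> m x - \<phi> n x)\<^sup>2) < \<epsilon>" and e: "\<epsilon> > 0"
  shows "\<exists>n0. \<forall>m\<ge>n0. \<forall>n\<ge>n0. M p (\<lambda>x. \<phi> m x - \<phi> n x) \<le> \<epsilon>"
proof -
  have K0: "K \<ge> 0" using K[of 0] dirichlet_nonneg[of "\<phi> (0::nat)"] by linarith
  define B where "B = (4 * K / S) powr (q/2)"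
  have B: "B \<ge> 0" by (simp add: B_def)
  have Mb: "Mq f \<le> B" if f: "f \<in> test_funs annulus" "dirichlet f \<le> 4 * K" for f
  proof -
    have "S * Mq f powr (2/q) \<le> 4 * K" using S_le[OF test_fun_UNIV[OF f(1)]] f(2) by linarith
    then have "Mq f powr (2/q) \<le> 4 * K / S" using S_pos by (simp add: field_simps)
    then have "(Mq f powr (2/q)) powr (q/2) \<le> B" unfolding B_def using q_gt_2 by (intro powr_mono2) auto
    then show ?thesis using Mq_nonneg[of f] q_gt_2 by (simp add: powr_powr)
  qed
  define \<epsilon>1 where "\<epsilon>1 = \<epsilon> / (2 * (B + 1))"
  have e1: "\<epsilon>1 > 0" "\<epsilon>1 * B \<le> \<epsilon>/2" using e B by (auto simp: \<epsilon>1_def field_simps)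
  obtain C where C: "C > 0" "\<And>t. t \<ge> 0 \<Longrightarrow> t powr p \<le> \<epsilon>1 * t powr q + C * t\<^sup>2" using powr_interpolation[OF p e1(1)] by blast
  have "\<epsilon> / (2 * C) > 0" using e C by simp
  then obtain n0 where n0: "\<forall>m\<ge>n0. \<forall>n\<ge>n0. (LINT x|lborel. (\<phi> m x - \<phi> n x)\<^sup>2) < \<epsilon> / (2 * C)" using c2 by blast
  have "M p (\<lambda>x. \<phi> m x - \<phi> n x) \<le> \<epsilon>" if mn: "m \<ge> n0" "n \<ge> n0" for m n
  proof -
    define f where "f = (\<lambda>x. \<phi> m x - \<phi> n x)"
    have f: "f \<in> test_funs annulus" unfolding f_def by (rule test_fun_diff[OF \<phi> \<phi>])
    have Df: "dirichlet f \<le> 4 * K"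
      using dirichlet_parallelogram[OF \<phi>[of m] \<phi>[of n]] K[of m] K[of n]
        dirichlet_nonneg[of "\<lambda>x. \<phi> m x + \<phi> n x"] unfolding f_def by linarith
    have i: "integrable lborel (\<lambda>x. \<bar>f x\<bar> powr p)" "integrable lborel (\<lambda>x. \<bar>f x\<bar> powr q)" "integrable lborel (\<lambda>x. (f x)\<^sup>2)"
      using test_fun_integrable_powr[OF f] test_fun_integrable_sq[OF f] p by auto
    have "M p f = (LINT x|lborel. \<bar>f x\<bar> powr p)" using test_fun_L(4)[OF f, of p] p by (simp add: mass_def)
    also have "\<dots> \<le> (LINT x|lborel. \<epsilon>1 * \<bar>f x\<bar> powr q + C * (f x)\<^sup>2)"
    proof (rule integral_mono[OF i(1)])
      show "\<bar>f x\<bar> powr p \<le> \<epsilon>1 * \<bar>f x\<bar> powr q + C * (f x)\<^sup>2" for x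
        using C(2)[of "\<bar>f x\<bar>"] by simp
    qed (use i in simp)
    also have "\<dots> = \<epsilon>1 * Mq f + C * (LINT x|lborel. (f x)\<^sup>2)" using i by (simp add: Mq_def)
    also have "\<dots> \<le> \<epsilon>1 * B + C * (\<epsilon> / (2 * C))"
      using n0[rule_format, OF mn] Mb[OF f Df] e1 C unfolding f_def by (intro add_mono mult_left_mono) auto
    also have "\<dots> \<le> \<epsilon>" using e1 C by simp
    finally show ?thesis by (simp add: f_def)
  qed
  then show ?thesis by blast
qed

lemma M_bounded:
  assumes p: "2 < p" "p < q" and \<phi>: "\<phi> \<in> test_funs annulus" and K: "dirichlet \<phi> \<le> K"
  shows "M p \<phi> \<le> (K / S) powr (q/2) + 18 * K"
proof -
  have "S * Mq \<phi> powr (2/q) \<le> K" using S_le[OF test_fun_UNIV[OF \<phi>]] K by linarith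
  then have "Mq \<phi> powr (2/q) \<le> K / S" using S_pos by (simp add: field_simps)
  then have "(Mq \<phi> powr (2/q)) powr (q/2) \<le> (K / S) powr (q/2)" using q_gt_2 by (intro powr_mono2) auto
  then have 1: "Mq \<phi> \<le> (K / S) powr (q/2)" using Mq_nonneg[of \<phi>] q_gt_2 by (simp add: powr_powr)
  have "(LINT x|lborel. (\<phi> x)\<^sup>2) \<le> 2 * 3\<^sup>2 * dirichlet \<phi>" by (rule poincare_inequality[OF \<phi> U_ball]) simp
  then have 2: "(LINT x|lborel. (\<phi> x)\<^sup>2) \<le> 18 * K" using K by simp
  have i: "integrable lborel (\<lambda>x. \<bar>\<phi> x\<bar> powr p)" "integrable lborel (\<lambda>x. \<bar>\<phi> x\<bar> powr q)" "integrable lborel (\<lambda>x. (\<phi> x)\<^sup>2)"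
    using test_fun_integrable_powr[OF \<phi>] test_fun_integrable_sq[OF \<phi>] p by auto
  have "M p \<phi> = (LINT x|lborel. \<bar>\<phi> x\<bar> powr p)" using test_fun_L(4)[OF \<phi>, of p] p by (simp add: mass_def)
  also have "\<dots> \<le> (LINT x|lborel. \<bar>\<phi> x\<bar> powr q + (\<phi> x)\<^sup>2)"
  proof (rule integral_mono[OF i(1)])
    show "\<bar>\<phi> x\<bar> powr p \<le> \<bar>\<phi> x\<bar> powr q + (\<phi> x)\<^sup>2" for x
      using powr_le_critical_plus_square[OF p, of "\<bar>\<phi> x\<bar>"] by simp
  qed (use i in simp)
  also have "\<dots> = Mq \<phi> + (LINT x|lborel. (\<phi> x)\<^sup>2)" using i by (simp add: Mq_def)
  finally show ?thesis using 1 2 by linarith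
qed

text \<open>A minimising sequence is Cauchy in the Dirichlet norm by the parallelogram law: by the gap
  the midpoints stay in the admissible class.\<close>

lemma side_minimiser:
  assumes p: "2 < p" "p < q" and w: "weight w" "\<And>x. w x \<le> Psi \<alpha> x"
    and gap: "\<And>\<phi>. \<phi> \<in> test_funs annulus \<Longrightarrow> W p \<phi> = 1 \<Longrightarrow> dirichlet \<phi> \<le> c * S \<Longrightarrow> mass p w \<phi> < 1/4 \<or> mass p w \<phi> > 3/4"
    and comp: "\<exists>\<phi>\<in>test_funs annulus. W p \<phi> > 0 \<and> mass p w \<phi> = W p \<phi> \<and> dirichlet \<phi> < c * S * W p \<phi> powr (2/p)"
  obtains u \<phi> where "is_local_min_R \<alpha> p u" "H1_approx \<phi> u" "W p u = 1" "mass p w u \<ge> 3/4" "energy u \<le> c * S"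
proof -
  have p0: "p > 0" using p by simp
  define X where "X = {dirichlet \<phi> | \<phi>. \<phi> \<in> test_funs annulus \<and> W p \<phi> = 1 \<and> mass p w \<phi> > 1/2}"
  define m where "m = Inf X"
  have bb: "bdd_below X" by (rule bdd_belowI[of _ 0]) (auto simp: X_def dirichlet_nonneg)
  have normalise: "\<exists>\<psi>\<in>test_funs annulus. W p \<psi> = 1 \<and> mass p w \<psi> = mass p w \<phi> / W p \<phi> \<and> dirichlet \<psi> = dirichlet \<phi> / W p \<phi> powr (2/p)"
    if \<phi>: "\<phi> \<in> test_funs annulus" and pos: "W p \<phi> > 0" for \<phi>
  proof (intro bexI[of _ "\<lambda>x. (W p \<phi> powr (- 1/p)) * \<phi> x"] conjI)
    let ?s = "W p \<phi> powr (- 1/p)"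
    have s: "\<bar>?s\<bar> powr p = 1 / W p \<phi>" 
    proof -
      have "(- 1/p) * p = - 1" using p0 by simp
      then have "?s powr p = W p \<phi> powr (- 1)" unfolding powr_powr by simp
      then show ?thesis using pos by (simp add: powr_minus_divide)
    qed
    show "W p (\<lambda>x. ?s * \<phi> x) = 1" "mass p w (\<lambda>x. ?s * \<phi> x) = mass p w \<phi> / W p \<phi>"
      unfolding mass_cmult s using pos by auto
    have "?s\<^sup>2 = ?s powr 2" using pos by simp
    also have "\<dots> = W p \<phi> powr (- (2/p))" by (simp add: powr_powr)
    finally have "?s\<^sup>2 = 1 / W p \<phi> powr (2/p)" by (simp add: powr_minus_divide)
    then show "dirichlet (\<lambda>x. ?s * \<phi> x) = dirichlet \<phi> / W p \<phi> powr (2/p)" unfolding dirichlet_cmult[OF \<phi>] by simp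
  qed (rule test_fun_cmult[OF \<phi>])
  have mass_le: "mass p w \<phi> \<le> W p \<phi>" if \<phi>: "\<phi> \<in> test_funs annulus" for \<phi>
    unfolding mass_def
    by (rule integral_mono[OF mass_limit(2)[OF test_fun_H1_approx(1)[OF \<phi>] p w(1)] mass_limit(2)[OF test_fun_H1_approx(1)[OF \<phi>] p Psi_weight]])
       (use w(2) in \<open>auto intro: mult_right_mono\<close>)
  obtain \<phi>0 where c0: "\<phi>0 \<in> test_funs annulus" "W p \<phi>0 > 0" "mass p w \<phi>0 = W p \<phi>0" "dirichlet \<phi>0 < c * S * W p \<phi>0 powr (2/p)"
    using comp by blast
  obtain \<psi>0 where p0': "\<psi>0 \<in> test_funs annulus" "W p \<psi>0 = 1" "mass p w \<psi>0 = 1" "dirichlet \<psi>0 = dirichlet \<phi>0 / W p \<phi>0 powr (2/p)"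
    using normalise[OF c0(1,2)] c0 by auto
  have "W p \<phi>0 powr (2/p) > 0" using c0(2) by simp
  then have D0: "dirichlet \<psi>0 < c * S" using c0(4) unfolding p0'(4) by (simp only: pos_divide_less_eq)
  have X0: "dirichlet \<psi>0 \<in> X" unfolding X_def using p0' by force
  have Xne: "X \<noteq> {}" using X0 by blast
  have m_le: "m \<le> dirichlet \<psi>0" unfolding m_def by (rule cInf_lower[OF X0 bb])
  have m_lt: "m < c * S" using m_le D0 by linarith
  have m0: "m \<ge> 0" unfolding m_def by (rule cInf_greatest[OF Xne]) (auto simp: X_def dirichlet_nonneg)
  \<comment> \<open>The scale-invariant form of minimality, free of any normalisation of
    \<open>\<phi>\<close>; it applies to midpoints and to approximations of nearby
    functions.\<close>
  have hom: "m * W p \<phi> powr (2/p) \<le> dirichlet \<phi>" if \<phi>: "\<phi> \<in> test_funs annulus" and ms: "mass p w \<phi> > W p \<phi> / 2" for \<phi>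
  proof -
    have "W p \<phi> > 0" using mass_le[OF \<phi>] ms mass_nonneg[OF Psi_weight, of p \<phi>] by linarith
    then obtain \<psi> where ps: "\<psi> \<in> test_funs annulus" "W p \<psi> = 1" "mass p w \<psi> = mass p w \<phi> / W p \<phi>" "dirichlet \<psi> = dirichlet \<phi> / W p \<phi> powr (2/p)"
      using normalise[OF \<phi>] by blast
    have "mass p w \<psi> > 1/2" unfolding ps(3) pos_less_divide_eq[OF \<open>W p \<phi> > 0\<close>] using ms by simp
    then have "dirichlet \<psi> \<in> X" unfolding X_def using ps by blast
    then have "m \<le> dirichlet \<psi>" unfolding m_def by (rule cInf_lower[OF _ bb])
    moreover have "W p \<phi> powr (2/p) > 0" using \<open>W p \<phi> > 0\<close> by simp
    ultimately show ?thesis unfolding ps(4) by (simp only: pos_le_divide_eq)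
  qed
  have "\<exists>\<phi>. \<phi> \<in> test_funs annulus \<and> W p \<phi> = 1 \<and> mass p w \<phi> > 1/2 \<and> dirichlet \<phi> < min (m + 1 / real (Suc n)) (c * S)" for n
  proof -
    have "Inf X < min (m + 1 / real (Suc n)) (c * S)" using m_lt unfolding m_def[symmetric] by simp
    then obtain y where "y \<in> X" "y < min (m + 1 / real (Suc n)) (c * S)" using cInf_lessD[OF Xne] by blast
    then show ?thesis unfolding X_def by blast
  qed
  then obtain f where f: "\<And>n. f n \<in> test_funs annulus" "\<And>n. W p (f n) = 1" "\<And>n. mass p w (f n) > 1/2"
    "\<And>n. dirichlet (f n) < min (m + 1 / real (Suc n)) (c * S)" by metis
  have fK: "dirichlet (f n) \<le> c * S" for n using f(4)[of n] by simp
  \<comment> \<open>The gap lifts the threshold from 1/2 to 3/4 along the sequence, which leaves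
    room for midpoints and for the limit.\<close>
  have f34: "mass p w (f n) > 3/4" for n using gap[OF f(1,2) fK, of n] f(3)[of n] by auto
  have fm: "m \<le> dirichlet (f n)" for n using hom[OF f(1), of n] f(2,3)[of n] by simp
  obtain s :: "nat \<Rightarrow> nat" where s: "strict_mono s" "\<And>\<epsilon>. \<epsilon> > 0 \<Longrightarrow> \<exists>n0. \<forall>m\<ge>n0. \<forall>n\<ge>n0. (LINT x|lborel. (f (s m) x - f (s n) x)\<^sup>2) < \<epsilon>"
    by (rule rellich_compactness[of f, OF f(1) U_sets(2) U_ball zero_less_numeral fK]) blast
  define g where "g = (\<lambda>n. f (s n))"
  have g: "\<And>n. g n \<in> test_funs annulus" "\<And>n. W p (g n) = 1" "\<And>n. mass p w (g n) > 3/4" "\<And>n. dirichlet (g n) \<le> c * S" "\<And>n. m \<le> dirichlet (g n)"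
    using f(1,2) f34 fK fm by (auto simp: g_def)
  have gD: "dirichlet (g n) \<le> m + 1 / real (Suc n)" for n
  proof -
    have "dirichlet (g n) \<le> m + 1 / real (Suc (s n))" using f(4)[of "s n"] by (simp add: g_def)
    also have "1 / real (Suc (s n)) \<le> 1 / real (Suc n)" using seq_suble[OF s(1), of n] by (intro divide_left_mono) auto
    finally show ?thesis by simp
  qed
  have gc: "\<exists>n0. \<forall>m\<ge>n0. \<forall>n\<ge>n0. (LINT x|lborel. (g m x - g n x)\<^sup>2) < \<epsilon>" if "\<epsilon> > 0" for \<epsilon>
    using s(2)[OF that] by (simp add: g_def)
  define Mb where "Mb = (c * S / S) powr (q/2) + 18 * (c * S)"
  have Mb: "M p (g n) \<le> Mb" for n unfolding Mb_def by (rule M_bounded[OF p g(1) g(4)])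
  have Mb0: "Mb \<ge> 0" using Mb[of 0] mass_nonneg[OF one_weight, of p "g 0"] by linarith
  have cauchy: "\<exists>n0. \<forall>i\<ge>n0. \<forall>j\<ge>n0. dirichlet (\<lambda>x. g i x - g j x) \<le> \<epsilon>" if e: "\<epsilon> > 0" for \<epsilon>
  proof -
    \<comment> \<open>The first bound keeps midpoints in the class, as 3/4 - 1/16 > (1 + 1/16)/2;
      the second makes the loss 4 m \<eta> in the parallelogram law at most \<epsilon>/2.\<close>
    define \<eta> where "\<eta> = min (1/16) (\<epsilon> / (8 * (m + 1)))"
    have et: "\<eta> > 0" "\<eta> \<le> 1/16" unfolding \<eta>_def using e m0 by simp (rule min.cobounded1)
    have "\<eta> \<le> \<epsilon> / (8 * (m + 1))" unfolding \<eta>_def by (rule min.cobounded2)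
    moreover have "8 * (m + 1) > 0" using m0 by simp
    ultimately have "\<eta> * (8 * (m + 1)) \<le> \<epsilon>" by (simp only: pos_le_divide_eq)
    then have "8 * (\<eta> * m) + 8 * \<eta> \<le> \<epsilon>" by (simp add: algebra_simps)
    then have etm: "4 * (m * \<eta>) \<le> \<epsilon>/2" using et by (simp add: mult.commute)
    define \<epsilon>1 where "\<epsilon>1 = \<eta> / (2 * (Mb + 1))"
    have e1: "\<epsilon>1 > 0" "\<epsilon>1 * Mb \<le> \<eta>/2" using et Mb0 by (auto simp: \<epsilon>1_def field_simps)
    obtain C where C: "C > 0" "\<And>a b::real. \<bar>\<bar>a\<bar> powr p - \<bar>b\<bar> powr p\<bar> \<le> \<epsilon>1 * \<bar>b\<bar> powr p + C * \<bar>a - b\<bar> powr p"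
      using abs_powr_close[OF p0 e1(1)] by blast
    have "\<eta> / (2 * C) > 0" using et C by simp
    then obtain n1 where n1: "\<forall>i\<ge>n1. \<forall>j\<ge>n1. M p (\<lambda>x. g i x - g j x) \<le> \<eta> / (2 * C)"
      using Lp_cauchy_of_L2_cauchy[OF p g(1) g(4) gc] by blast
    obtain n2 :: nat where n2: "1 / real (Suc n2) < \<epsilon>/8" using nat_approx_posE[of "\<epsilon>/8"] e by auto
    have "dirichlet (\<lambda>x. g i x - g j x) \<le> \<epsilon>" if ij: "i \<ge> max n1 n2" "j \<ge> max n1 n2" for i j
    proof -
      \<comment> \<open>The midpoint differs from \<open>g j\<close> by half of the difference of
        the two functions, so it is \<open>L^p\<close>-close to \<open>g j\<close> before anything
        is known about convergence of gradients.\<close>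
      define h where "h = (\<lambda>x. (1/2) * (g i x + g j x))"
      have h: "h \<in> test_funs annulus" unfolding h_def by (intro test_fun_cmult test_fun_add g)
      have hd: "(\<lambda>x. h x - g j x) = (\<lambda>x. (1/2) * (g i x - g j x))" by (auto simp: h_def field_simps)
      have Mh: "M p (\<lambda>x. h x - g j x) \<le> \<eta> / (2 * C)"
      proof -
        have "M p (\<lambda>x. h x - g j x) = \<bar>1/2\<bar> powr p * M p (\<lambda>x. g i x - g j x)" unfolding hd by (rule mass_cmult)
        also have "\<dots> \<le> 1 * M p (\<lambda>x. g i x - g j x)" using p0 mass_nonneg[OF one_weight] by (intro mult_right_mono) (auto intro: powr_le1)
        also have "\<dots> \<le> \<eta> / (2 * C)" using n1 ij by simp
        finally show ?thesis .
      qed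
      have close: "\<bar>mass p w' h - mass p w' (g j)\<bar> \<le> \<eta>" if w': "weight w'" for w'
      proof -
        have "integrable L (\<lambda>x. \<bar>h x - g j x\<bar> powr p)" using test_fun_L(3)[OF test_fun_diff[OF h g(1)]] p0 by simp
        then have "\<bar>mass p w' h - mass p w' (g j)\<bar> \<le> \<epsilon>1 * M p (g j) + C * M p (\<lambda>x. h x - g j x)"
          by (intro mass_close[OF test_fun_H1_approx(1)[OF g(1)] p test_fun_L(5)[OF h] _ w' C(1) e1(1) C(2)])
        also have "\<dots> \<le> \<epsilon>1 * Mb + C * (\<eta> / (2 * C))" using Mb[of j] Mh e1 C by (intro add_mono mult_left_mono) auto
        also have "\<dots> \<le> \<eta>" using e1 C by simp
        finally show ?thesis .
      qed
      have Wh: "1 - \<eta> \<le> W p h" "W p h \<le> 1 + \<eta>" using close[OF Psi_weight] g(2)[of j] by (auto simp: abs_le_iff)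
      have "mass p w h > W p h / 2" using close[OF w(1)] g(3)[of j] Wh et by (auto simp: abs_le_iff)
      then have "m * W p h powr (2/p) \<le> dirichlet h" by (rule hom[OF h])
      moreover have "m * (1 - \<eta>) \<le> m * W p h powr (2/p)"
      proof -
        have "1 - \<eta> = (1 - \<eta>) powr 1" using et by simp
        also have "\<dots> \<le> (1 - \<eta>) powr (2/p)" using et p by (intro powr_mono') auto
        also have "\<dots> \<le> W p h powr (2/p)" using Wh et p by (intro powr_mono2) auto
        finally show ?thesis using m0 by (intro mult_left_mono) auto
      qed
      moreover have "dirichlet h = dirichlet (\<lambda>x. g i x + g j x) / 4"
        unfolding h_def dirichlet_cmult[OF test_fun_add[OF g(1) g(1)]] by (simp add: power2_eq_square)
      ultimately have "dirichlet (\<lambda>x. g i x + g j x) \<ge> 4 * m - 4 * (m * \<eta>)" by (simp add: algebra_simps)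
      moreover have "1 / real (Suc i) \<le> 1 / real (Suc n2)" "1 / real (Suc j) \<le> 1 / real (Suc n2)" using ij by (auto intro!: divide_left_mono)
      then have "dirichlet (g i) \<le> m + \<epsilon>/8" "dirichlet (g j) \<le> m + \<epsilon>/8" using gD[of i] gD[of j] n2 by linarith+
      \<comment> \<open>The midpoint bounds the energy of the sum from below by 4m - 4 m \<eta>, and
        the two energies exceed \<open>m\<close> by at most \<epsilon>/8, so the parallelogram law
        leaves at most \<epsilon> for the difference.\<close>
      ultimately show ?thesis using dirichlet_parallelogram[OF g(1)[of i] g(1)[of j]] etm by linarith
    qed
    then show ?thesis by blast
  qed
  obtain u where u: "u \<in> H10 annulus" "H1_approx g u" using H10_limit[OF g(1) cauchy] by blast
  have um: "u \<in> borel_measurable L" using u(2) by (simp add: H1_approx_def)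
  have Wu: "W p u = 1" using LIMSEQ_unique[OF mass_limit(1)[OF u(2) p Psi_weight]] g(2) by simp
  have mu: "mass p w u \<ge> 3/4"
    by (rule LIMSEQ_le_const[OF mass_limit(1)[OF u(2) p w(1)]]) (use g(3) in \<open>auto intro: less_imp_le\<close>)
  have Du: "(\<lambda>n. dirichlet (g n)) \<longlonglongrightarrow> energy u" using u(2) by (simp add: H1_approx_def energy_def)
  have Eu: "energy u = m"
  proof -
    have "(\<lambda>n. m + 1 / real (Suc n)) \<longlonglongrightarrow> m + 0" by (intro tendsto_intros LIMSEQ_Suc[OF lim_1_over_n])
    then have l: "(\<lambda>n. m + 1 / real (Suc n)) \<longlonglongrightarrow> m" by simp
    have "(\<lambda>n. dirichlet (g n)) \<longlonglongrightarrow> m"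
      by (rule tendsto_sandwich[OF _ _ tendsto_const l]) (intro always_eventually allI g(5) gD)+
    then show ?thesis using LIMSEQ_unique[OF Du] by simp
  qed
  have Ru: "R \<alpha> p u = m" using Wu Eu by (simp add: R_eq)
  have nz: "\<not> ae_zero_on annulus u"
  proof
    assume "ae_zero_on annulus u"
    then have "AE x in L. u x = 0" by (simp add: ae_zero_on_def AE_L)
    then have "AE x in L. Psi \<alpha> x * \<bar>u x\<bar> powr p = 0" by eventually_elim simp
    then have "W p u = 0" unfolding mass_def by (rule integral_eq_zero_AE)
    then show False using Wu by simp
  qed
  have "\<exists>\<epsilon>>0. \<forall>v. v \<in> H10 annulus \<and> \<not> ae_zero_on annulus v \<and> H1norm annulus (\<lambda>x. v x - u x) < \<epsilon> \<longrightarrow> R \<alpha> p u \<le> R \<alpha> p v"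
  proof -
    \<comment> \<open>Together with the choice of \<open>\<delta>\<close> this keeps every mass
      within 1/16 of that of \<open>u\<close>, so a nearby \<open>v\<close> still has more than half
      of its weighted mass on the side of \<open>w\<close>.\<close>
    define \<epsilon>1 where "\<epsilon>1 = 1 / (32 * (M p u + 1))"
    have Mu0: "M p u \<ge> 0" by (rule mass_nonneg[OF one_weight])
    have e1: "\<epsilon>1 > 0" "\<epsilon>1 * M p u \<le> 1/32" using Mu0 by (auto simp: \<epsilon>1_def field_simps)
    obtain C where C: "C > 0" "\<And>a b::real. \<bar>\<bar>a\<bar> powr p - \<bar>b\<bar> powr p\<bar> \<le> \<epsilon>1 * \<bar>b\<bar> powr p + C * \<bar>a - b\<bar> powr p"
      using abs_powr_close[OF p0 e1(1)] by blast
    have "1 / (32 * C) > 0" using C by simp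
    then obtain \<delta> where d: "\<delta> > 0" "\<And>v. v \<in> H10 annulus \<Longrightarrow> (LINT x|L. (norm (wgrad annulus v x))\<^sup>2) < \<delta> \<Longrightarrow>
      integrable L (\<lambda>x. \<bar>v x\<bar> powr p) \<and> (LINT x|L. \<bar>v x\<bar> powr p) \<le> 1 / (32 * C)" using H10_small[OF p] by blast
    have "R \<alpha> p u \<le> R \<alpha> p v" if v: "v \<in> H10 annulus" and H: "H1norm annulus (\<lambda>x. v x - u x) < sqrt \<delta>" for v
    proof -
      define d0 where "d0 = (\<lambda>x. v x - u x)"
      have "d0 \<in> H10 annulus" unfolding d0_def by (rule H10_diff[OF u(1) v])
      moreover have "(LINT x|L. (norm (wgrad annulus d0 x))\<^sup>2) < \<delta>"
      proof -
        have "(LINT x|L. (d0 x)\<^sup>2) + (LINT x|L. (norm (wgrad annulus d0 x))\<^sup>2) < \<delta>" using H by (simp add: H1norm_def set_integral_L d0_def)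
        moreover have "0 \<le> (LINT x|L. (d0 x)\<^sup>2)" by (intro integral_nonneg_AE) auto
        ultimately show ?thesis by linarith
      qed
      ultimately have id: "integrable L (\<lambda>x. \<bar>d0 x\<bar> powr p)" "M p d0 \<le> 1 / (32 * C)" using d(2)[of d0] by (auto simp: mass_def)
      obtain \<psi> where a: "H1_approx \<psi> v" using H10_approx[OF v] by blast
      have vm: "v \<in> borel_measurable L" and ps: "\<And>k. \<psi> k \<in> test_funs annulus" and Dv: "(\<lambda>k. dirichlet (\<psi> k)) \<longlonglongrightarrow> energy v"
        using a by (auto simp: H1_approx_def energy_def)
      have close: "\<bar>mass p w' v - mass p w' u\<bar> \<le> 1/16" if w': "weight w'" for w'
      proof -
        have "\<bar>mass p w' v - mass p w' u\<bar> \<le> \<epsilon>1 * M p u + C * M p (\<lambda>x. v x - u x)"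
          by (rule mass_close[OF u(2) p vm _ w' C(1) e1(1) C(2)]) (use id in \<open>simp add: d0_def\<close>)
        also have "C * M p (\<lambda>x. v x - u x) \<le> C * (1 / (32 * C))" using id C by (intro mult_left_mono) (auto simp: d0_def)
        finally show ?thesis using e1 C by simp
      qed
      have Wv: "W p v \<ge> 15/16" "mass p w v - W p v / 2 > 0" using close[OF Psi_weight] close[OF w(1)] Wu mu unfolding abs_le_iff by linarith+
      note lw = mass_limit(1)[OF a p w(1)] and lW = mass_limit(1)[OF a p Psi_weight]
      \<comment> \<open>The strict inequality for \<open>v\<close> is inherited by its approximating
        test functions from some index on, and there \<open>hom\<close> applies.\<close>
      have "(\<lambda>k. mass p w (\<psi> k) - W p (\<psi> k) / 2) \<longlonglongrightarrow> mass p w v - W p v / 2" by (intro tendsto_intros lw lW) simp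
      then have "\<forall>\<^sub>F k in sequentially. mass p w (\<psi> k) - W p (\<psi> k) / 2 > 0" using Wv(2) by (rule order_tendstoD(1))
      then have ev: "\<forall>\<^sub>F k in sequentially. m * W p (\<psi> k) powr (2/p) \<le> dirichlet (\<psi> k)" by eventually_elim (use hom[OF ps] in simp)
      have "(\<lambda>k. m * W p (\<psi> k) powr (2/p)) \<longlonglongrightarrow> m * W p v powr (2/p)"
        by (intro tendsto_mult tendsto_const powr_tendsto lW mass_nonneg Psi_weight) (use p in auto)
      then have "m * W p v powr (2/p) \<le> energy v" using Dv ev by (intro tendsto_le[OF _ Dv]) auto
      moreover have "W p v powr (2/p) > 0" using Wv(1) by simp
      ultimately show ?thesis unfolding Ru unfolding R_eq by (simp only: pos_le_divide_eq)
    qed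
    then show ?thesis using d(1) by (intro exI[of _ "sqrt \<delta>"]) auto
  qed
  then have "is_local_min_R \<alpha> p u" unfolding is_local_min_R_def using u(1) nz by blast
  then show thesis using that u(2) Wu mu Eu m_lt by simp
qed

end

section \<open>Two inequivalent non-radial minima\<close>

context henon
begin

text \<open>Weights invariant under \<open>Q\<close> see only the factor |k|^p, so the ratio of two
  such masses is unchanged.\<close>

lemma mass_equivalent:
  fixes Q :: "'a \<Rightarrow> 'a"
  assumes Q: "orthogonal_transformation Q" and u: "u \<in> borel_measurable L" and v: "v \<in> borel_measurable L"
    and ae: "AE x in lebesgue. x \<in> annulus \<longrightarrow> v x = k * u (Q x)" and w: "weight w" "\<And>x. w (Q x) = w x"
  shows "mass p w v = \<bar>k\<bar> powr p * mass p w u"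
proof -
  note [measurable] = v mass_orthogonal(2)[OF Q u] weight_measurable_L[OF w(1)]
  have "mass p w v = mass p w (\<lambda>x. k * u (Q x))" unfolding mass_def
  proof (rule integral_cong_AE)
    have "AE x in L. v x = k * u (Q x)" using ae by (simp add: AE_L)
    then show "AE x in L. w x * \<bar>v x\<bar> powr p = w x * \<bar>k * u (Q x)\<bar> powr p" by eventually_elim simp
  qed measurable
  also have "\<dots> = \<bar>k\<bar> powr p * mass p w (\<lambda>x. u (Q x))" by (rule mass_cmult)
  also have "mass p w (\<lambda>x. u (Q x)) = mass p w u"
    using mass_orthogonal(1)[OF Q u, of w p] w by (simp add: weight_def)
  finally show ?thesis .
qed

text \<open>The reflection preserves null sets, so the radial representation holds at almost every x
  for both x and -x.\<close>

lemma radial_imp_even: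
  assumes "radial_on annulus (u::'a \<Rightarrow> real)" shows "AE x in L. u (- x) = u x"
proof -
  obtain f where f: "AE x in lebesgue. x \<in> annulus \<longrightarrow> u x = f (norm x)" using assms by (auto simp: radial_on_def)
  have "orthogonal_transformation (\<lambda>x::'a. - x)"
    using orthogonal_transformation_neg[of "\<lambda>x::'a. x"] orthogonal_transformation_id by (simp add: id_def)
  from AE_lebesgue_orthogonal[OF this f] f show ?thesis
    unfolding AE_L by eventually_elim (auto simp: annulus_def)
qed

text \<open>The side holding at least three quarters of the mass is preserved by orthogonal maps and
  nonzero multiples, and it differs for \<open>u\<close> and \<open>v\<close>; in particular the two
  minima are distinct.\<close>

lemma two_nonradial_minima:
  "\<exists>p0. 2 < p0 \<and> p0 < q \<and> (\<forall>p. p0 < p \<and> p < q \<longrightarrow>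
     (\<exists>(u::'a \<Rightarrow> real) (v::'a \<Rightarrow> real). is_local_min_R \<alpha> p u \<and> is_local_min_R \<alpha> p v \<and>
        \<not> radial_on annulus u \<and> \<not> radial_on annulus v \<and>
        \<not> (\<exists>c Q. orthogonal_transformation Q \<and> (AE x in lebesgue. x \<in> annulus \<longrightarrow> v x = c * u (Q x)))))"
proof -
  obtain c1 where c1: "c1 > 1" and e1: "\<forall>\<^sub>F p in at_left q. \<forall>u \<phi>. H1_approx \<phi> u \<and> W p u = 1 \<and> energy u \<le> c1 * S \<longrightarrow>
     mass p win u < 1/4 \<or> mass p win u > 3/4" by (rule gap) blast
  obtain c2 where c2: "c2 > 1" and e2: "\<forall>\<^sub>F p in at_left q. \<forall>u \<phi>. H1_approx \<phi> u \<and> W p u = 1 \<and> energy u \<le> c2 * S \<longrightarrow>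
     \<not> (AE x in L. u (- x) = u x)" by (rule even_not_near_minimal) blast
  define c where "c = min c1 c2"
  have c: "c > 1" using c1 c2 by (simp add: c_def)
  have cS: "c * S \<le> c1 * S" "c * S \<le> c2 * S" using S_pos by (auto simp: c_def intro!: mult_right_mono)
  note ev = eventually_conj[OF e1 eventually_conj[OF e2 eventually_conj[OF competitors[OF c, of win] competitors[OF c, of wout]]]]
  then obtain b where b: "b < q" and P: "\<And>p. b < p \<Longrightarrow> p < q \<Longrightarrow>
     (\<forall>u \<phi>. H1_approx \<phi> u \<and> W p u = 1 \<and> energy u \<le> c1 * S \<longrightarrow> mass p win u < 1/4 \<or> mass p win u > 3/4) \<and>
     (\<forall>u \<phi>. H1_approx \<phi> u \<and> W p u = 1 \<and> energy u \<le> c2 * S \<longrightarrow> \<not> (AE x in L. u (- x) = u x)) \<and>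
     (\<exists>\<phi>\<in>test_funs annulus. W p \<phi> > 0 \<and> mass p win \<phi> = W p \<phi> \<and> dirichlet \<phi> < c * S * W p \<phi> powr (2/p)) \<and>
     (\<exists>\<phi>\<in>test_funs annulus. W p \<phi> > 0 \<and> mass p wout \<phi> = W p \<phi> \<and> dirichlet \<phi> < c * S * W p \<phi> powr (2/p))"
    unfolding eventually_at_left[OF q_gt_2] by auto
  have le: "win x \<le> Psi \<alpha> x" "wout x \<le> Psi \<alpha> x" for x using Psi_weight by (auto simp: win_def wout_def indicator_def weight_def)
  show ?thesis
  proof (intro exI[of _ "max b p1"] conjI allI impI)
    show "2 < max b p1" "max b p1 < q" using p1 b by auto
    fix p assume pp: "max b p1 < p \<and> p < q"
    then have p: "2 < p" "p < q" using p1 by auto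
    have bp: "b < p" using pp by simp
    note Pp = P[OF bp p(2)]
    have g1: "mass p win \<phi> < 1/4 \<or> mass p win \<phi> > 3/4" if "\<phi> \<in> test_funs annulus" "W p \<phi> = 1" "dirichlet \<phi> \<le> c * S" for \<phi>
      using Pp test_fun_H1_approx[OF that(1)] that(2,3) cS(1) by (metis order_trans)
    \<comment> \<open>The side masses add up to 1, so the gap for the inner side is at once the gap
      for the outer side.\<close>
    have g2: "mass p wout \<phi> < 1/4 \<or> mass p wout \<phi> > 3/4" if \<phi>: "\<phi> \<in> test_funs annulus" "W p \<phi> = 1" "dirichlet \<phi> \<le> c * S" for \<phi>
      using g1[OF \<phi>] mass_sides[OF test_fun_H1_approx(1)[OF \<phi>(1)] p] \<phi>(2) by auto
    obtain u \<phi> where u: "is_local_min_R \<alpha> p u" "H1_approx \<phi> u" "W p u = 1" "mass p win u \<ge> 3/4" "energy u \<le> c * S"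
      by (rule side_minimiser[OF p side_weights(1) le(1) g1]) (use Pp in blast)+
    obtain v \<psi> where v: "is_local_min_R \<alpha> p v" "H1_approx \<psi> v" "W p v = 1" "mass p wout v \<ge> 3/4" "energy v \<le> c * S"
      by (rule side_minimiser[OF p side_weights(2) le(2) g2]) (use Pp in blast)+
    have "\<not> radial_on annulus u" using Pp u(2,3,5) cS(2) radial_imp_even[of u] by (meson order_trans)
    moreover have "\<not> radial_on annulus v" using Pp v(2,3,5) cS(2) radial_imp_even[of v] by (meson order_trans)
    moreover have "\<not> (\<exists>c Q. orthogonal_transformation Q \<and> (AE x in lebesgue. x \<in> annulus \<longrightarrow> v x = c * u (Q x)))"
    proof (rule notI, elim exE conjE)
      fix k and Q :: "'a \<Rightarrow> 'a"
      assume Q: "orthogonal_transformation Q" and ae: "AE x in lebesgue. x \<in> annulus \<longrightarrow> v x = k * u (Q x)"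
      have um: "u \<in> borel_measurable L" "v \<in> borel_measurable L" using u(2) v(2) by (auto simp: H1_approx_def)
      have rad: "win (Q x) = win x" "wout (Q x) = wout x" for x
        using orthogonal_transformation_norm[OF Q, of x] by (simp_all add: win_def wout_def Psi_def indicator_def)
      define s where "s = \<bar>k\<bar> powr p"
      have s: "s \<ge> 0" by (simp add: s_def)
      have 1: "mass p win v = s * mass p win u" "mass p wout v = s * mass p wout u"
        unfolding s_def by (intro mass_equivalent[OF Q um ae] side_weights rad)+
      have "s * (3/4) \<le> s * mass p win u" using u(4) s by (intro mult_left_mono) auto
      moreover have "s * mass p wout u \<le> s * (1/4)" using mass_sides[OF u(2) p] u(3,4) s by (intro mult_left_mono) auto
      ultimately show False using 1 mass_sides[OF v(2) p] v(3,4) by linarith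
    qed
    ultimately show "\<exists>(u::'a \<Rightarrow> real) (v::'a \<Rightarrow> real). is_local_min_R \<alpha> p u \<and> is_local_min_R \<alpha> p v \<and>
        \<not> radial_on annulus u \<and> \<not> radial_on annulus v \<and>
        \<not> (\<exists>c Q. orthogonal_transformation Q \<and> (AE x in lebesgue. x \<in> annulus \<longrightarrow> v x = c * u (Q x)))"
      using u(1) v(1) by blast
  qed
qed

end

theorem theorem3p1:
  fixes \<alpha> :: real
  assumes "CARD('n::finite) \<ge> 3" and "\<alpha> > 0"
  shows "\<exists>p0. 2 < p0 \<and> p0 < 2 * real CARD('n) / (real CARD('n) - 2) \<and>
           (\<forall>p. p0 < p \<and> p < 2 * real CARD('n) / (real CARD('n) - 2) \<longrightarrow>
              (\<exists>(u::real^'n \<Rightarrow> real) (v::real^'n \<Rightarrow> real).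
                 is_local_min_R \<alpha> p u \<and> is_local_min_R \<alpha> p v \<and>
                 \<not> radial_on annulus u \<and> \<not> radial_on annulus v \<and>
                 \<not> (\<exists>c Q. orthogonal_transformation Q \<and>
                        (AE x in lebesgue. x \<in> annulus \<longrightarrow> v x = c * u (Q x)))))"
proof -
  have dim: "DIM(real^'n) = CARD('n)" by simp
  have cd: "critical_domain (annulus::(real^'n) set) 3" by (rule annulus_critical_domain) (use assms dim in simp)
  have h: "henon TYPE(real^'n) \<alpha>" by (intro henon.intro henon_axioms.intro cd assms)
  show ?thesis using henon.two_nonradial_minima[OF h] unfolding critical_domain.q_def[OF cd] dim .
qed

end
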